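(* Let $d\in\mathbb{N}$. (a) Let $1\le p\le\infty$. There exists a constant $C=C_{p,d}$ such that for every $N\in\mathbb{N}$ $$\|S_Nf\|_{M^p(\mathbb{R}^d)}\le C\|f\|_{M^p(\mathbb{R}^d)}\qquad\text{for all } f\in M^p(\mathbb{R}^d)$$ if and only if $1<p<\infty$. (b) For $p=1$, there exist a constant $c>1$ and a constant $\kappa_d>0$ depending only on $d$ such that for every $N\in\mathbb{N}$ $$\|S_N\|_{M^1(\mathbb{R}^d)\to M^1(\mathbb{R}^d)}\ge\kappa_d\,\big(\log(cN)\big)^d.$$ In particular, for every $1<p<\infty$ and every $f\in M^p(\mathbb{R}^d)$, $\lim_{N\to\infty}S_Nf=f$ in $M^p(\mathbb{R}^d)$, and there exists $f\in M^1(\mathbb{R}^d)$ such that $S_Nf$ does not converge to $f$ in $M^1(\mathbb{R}^d)$.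
   Context: $\mathbb{N}=\{1,2,\dots\}$, $\mathbb{N}_0=\mathbb{N}\cup\{0\}$. One-dimensional Hermite functions: for $n\in\mathbb{N}_0$, $h_n(t)=C_n e^{\pi t^2}\frac{d^n}{dt^n}\big(e^{-2\pi t^2}\big)$, $t\in\mathbb{R}$, where the real constant $C_n$ has sign $(-1)^n$ and is chosen so that $\|h_n\|_{L^2(\mathbb{R})}=1$. Tensor product Hermite functions: for $n=(n_1,\dots,n_d)\in\mathbb{N}_0^d$ and $t=(t_1,\dots,t_d)\in\mathbb{R}^d$, $h_n(t)=\prod_{j=1}^d h_{n_j}(t_j)$. Time-frequency shifts: for $z=(x,\omega)\in\mathbb{R}^{2d}$, $\pi(z)f(t)=e^{2\pi i\omega\cdot t}f(t-x)$. Pairing: $\langle f,g\rangle=\int f\overline{g}$ on $L^2(\mathbb{R}^d)$, extended to $f\in\mathcal{S}'(\mathbb{R}^d)$ (tempered distributions), $g\in\mathcal{S}(\mathbb{R}^d)$ (linear in $f$, antilinear in $g$). Modulation spaces: with $\varphi(t)=2^{d/4}e^{-\pi|t|^2}$, $t\in\mathbb{R}^d$, and $1\le p<\infty$, $$M^p(\mathbb{R}^d)=\Big\{f\in\mathcal{S}'(\mathbb{R}^d):\ \|f\|_{M^p(\mathbb{R}^d)}^p:=\int_{\mathbb{R}^{2d}}|\langle f,\pi(z)\varphi\rangle|^p\,dz<\infty\Big\},$$ and $M^\infty(\mathbb{R}^d)$ is defined in the same way with $\|f\|_{M^\infty(\mathbb{R}^d)}:=\sup_{z\in\mathbb{R}^{2d}}|\langle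 f,\pi(z)\varphi\rangle|$. Partial Hermite expansion operator: $S_Nf:=\sum_{0\le n_1,\dots,n_d\le N}\langle f,h_n\rangle h_n$. $\|S_N\|_{M^1(\mathbb{R}^d)\to M^1(\mathbb{R}^d)}$ denotes its operator norm on $M^1(\mathbb{R}^d)$. *)

theory Defs
  imports "HOL-Analysis.Analysis"
begin

subsection \<open>Schwartz functions and tempered distributions\<close>

definition partial_deriv :: "'d::finite \<Rightarrow> (real^'d \<Rightarrow> complex) \<Rightarrow> real^'d \<Rightarrow> complex" where
  "partial_deriv i f x = vector_derivative (\<lambda>s. f (x + s *\<^sub>R axis i 1)) (at 0)"

text \<open>A list of coordinates, rather than a multi-index, says which partial derivatives are taken.\<close>

primrec iter_deriv :: "'d::finite list \<Rightarrow> (real^'d \<Rightarrow> complex) \<Rightarrow> real^'d \<Rightarrow> complex" where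
  "iter_deriv [] f = f"
| "iter_deriv (i # is) f = partial_deriv i (iter_deriv is f)"

definition smooth :: "(real^'d::finite \<Rightarrow> complex) \<Rightarrow> bool" where
  "smooth f \<longleftrightarrow> (\<forall>is x. iter_deriv is f differentiable (at x))"

definition schwartz_space :: "(real^'d::finite \<Rightarrow> complex) set" where
  "schwartz_space = {f. smooth f \<and>
     (\<forall>k is. bounded (range (\<lambda>x. norm x ^ k * norm (iter_deriv is f x))))}"

definition schwartz_seminorm :: "nat \<Rightarrow> 'd::finite list \<Rightarrow> (real^'d \<Rightarrow> complex) \<Rightarrow> real" where
  "schwartz_seminorm k is f = (SUP x. norm x ^ k * norm (iter_deriv is f x))"

text \<open>
  A tempered distribution is a complex-linear functional on the Schwartz space that is
  continuous for the topology of the seminorms above, i.e. bounded by finitely many of them.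
  HOL functions being total, its value outside the Schwartz space is fixed to be 0.
\<close>

type_synonym 'd functional = "(real^'d \<Rightarrow> complex) \<Rightarrow> complex"

definition tempered_distributions :: "'d::finite functional set" where
  "tempered_distributions = {u.
     (\<forall>a b. \<forall>g\<in>schwartz_space. \<forall>h\<in>schwartz_space.
        u (\<lambda>t. a * g t + b * h t) = a * u g + b * u h) \<and>
     (\<exists>C m. \<forall>g\<in>schwartz_space.
        norm (u g) \<le> C * (\<Sum>k\<le>m. \<Sum>is | length is \<le> m. schwartz_seminorm k is g)) \<and>
     (\<forall>g. g \<notin> schwartz_space \<longrightarrow> u g = 0)}"

definition distribution_of :: "(real^'d::finite \<Rightarrow> complex) \<Rightarrow> 'd functional" where
  "distribution_of F g = (if g \<in> schwartz_space then LINT t|lborel. F t * g t else 0)"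

text \<open>
  The sesquilinear pairing: for integrable F * cnj g it gives the integral of F * cnj g when
  applied to \<open>distribution_of F\<close>, so it is linear in the distribution and antilinear in the
  Schwartz function.
\<close>

definition pairing :: "'d::finite functional \<Rightarrow> (real^'d \<Rightarrow> complex) \<Rightarrow> complex" where
  "pairing f g = f (\<lambda>t. cnj (g t))"

subsection \<open>Modulation spaces\<close>

definition tf_shift ::
  "(real^'d::finite) \<times> (real^'d) \<Rightarrow> (real^'d \<Rightarrow> complex) \<Rightarrow> real^'d \<Rightarrow> complex" where
  "tf_shift z f = (\<lambda>t. exp (2 * complex_of_real pi * \<i> * complex_of_real (snd z \<bullet> t)) * f (t - fst z))"

definition gauss_window :: "real^'d::finite \<Rightarrow> complex" where
  "gauss_window t = complex_of_real (2 powr (real CARD('d) / 4) * exp (- pi * (norm t)\<^sup>2))"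

definition mod_norm :: "ennreal \<Rightarrow> 'd::finite functional \<Rightarrow> ennreal" where
  "mod_norm p f =
    (if p = \<infinity> then (SUP z. ennreal (norm (pairing f (tf_shift z gauss_window))))
     else let I = (\<integral>\<^sup>+ z. ennreal (norm (pairing f (tf_shift z gauss_window)) powr enn2real p) \<partial>lborel)
          in if I = \<infinity> then \<infinity> else ennreal (enn2real I powr (1 / enn2real p)))"

definition mod_space :: "ennreal \<Rightarrow> 'd::finite functional set" where
  "mod_space p = {f \<in> tempered_distributions. mod_norm p f < \<infinity>}"

definition mod_opnorm :: "ennreal \<Rightarrow> ('d::finite functional \<Rightarrow> 'd functional) \<Rightarrow> ennreal" where
  "mod_opnorm p T = (SUP f\<in>{f \<in> mod_space p. mod_norm p f \<le> 1}. mod_norm p (T f))"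

definition converges_in_mod ::
  "ennreal \<Rightarrow> (nat \<Rightarrow> 'd::finite functional) \<Rightarrow> 'd functional \<Rightarrow> bool" where
  "converges_in_mod p u f \<longleftrightarrow> (\<lambda>N. mod_norm p (\<lambda>g. u N g - f g)) \<longlonglongrightarrow> 0"

subsection \<open>Hermite expansions\<close>

definition hermite_unnorm :: "nat \<Rightarrow> real \<Rightarrow> real" where
  "hermite_unnorm n t = exp (pi * t\<^sup>2) * (deriv ^^ n) (\<lambda>s. exp (- 2 * pi * s\<^sup>2)) t"

definition hermite_const :: "nat \<Rightarrow> real" where
  "hermite_const n = (-1) ^ n / sqrt (LINT t|lborel. (hermite_unnorm n t)\<^sup>2)"

definition hermite1 :: "nat \<Rightarrow> real \<Rightarrow> real" where
  "hermite1 n t = hermite_const n * hermite_unnorm n t"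

definition hermite :: "nat^'d::finite \<Rightarrow> real^'d \<Rightarrow> complex" where
  "hermite n t = complex_of_real (\<Prod>j\<in>UNIV. hermite1 (n $ j) (t $ j))"

definition hermite_sum :: "nat \<Rightarrow> 'd::finite functional \<Rightarrow> real^'d \<Rightarrow> complex" where
  "hermite_sum N f t = (\<Sum>n | \<forall>j. n $ j \<le> N. pairing f (hermite n) * hermite n t)"

text \<open>The partial expansion operator S_N, viewed as an operator on tempered distributions.\<close>

definition hermite_partial :: "nat \<Rightarrow> 'd::finite functional \<Rightarrow> 'd functional" where
  "hermite_partial N f = distribution_of (hermite_sum N f)"

end

theory Submission
  imports Defs "HOL-Complex_Analysis.Complex_Analysis" "HOL-Probability.Probability"
begin

text \<open>
  Write \<open>V f Z\<close> for the pairing of \<open>f\<close> with the time-frequency shift of the Gaussian window by \<open>Z\<close>,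
  so that the modulation norm is the \<open>L\<^sup>p\<close> norm of \<open>V f\<close> over phase space. Up to a scalar the conjugate of
  the shifted Gaussian is the generating function of the Hermite functions, evaluated at the complex numbers
  \<open>z\<^sub>j = x\<^sub>j - i \<omega>\<^sub>j\<close>. Hence \<open>\<bar>V f Z\<bar> = exp (- \<pi> \<bar>z\<bar>\<^sup>2 / 2) * \<bar>F z\<bar>\<close>, where \<open>F\<close> is an entire power series
  whose coefficients are the Hermite coefficients of \<open>f\<close> up to normalisation, and the partial sum
  operator \<open>S\<^sub>N\<close> truncates this series to the exponents \<open>n\<close> with all \<open>n\<^sub>j \<le> N\<close>
  (\<open>stft_eq_pseries\<close>, \<open>stft_hermite_partial\<close>). The theorem thus is a statement about Taylor
  truncation in a weighted \<open>L\<^sup>p\<close> space of entire functions.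

  Rotating one \<open>z\<^sub>k\<close> preserves Lebesgue measure and the weight. Averaging over these rotations
  reduces truncation in the \<open>k\<close>-th exponent to truncation of a one-variable power series on circles,
  which for \<open>1 < p < \<infinity>\<close> is bounded by the theorem of M. Riesz. Treating the coordinates one after the
  other gives the uniform bound (\<open>hermite_partial_bounded\<close>), and dominated convergence on the circles
  gives the convergence (\<open>hermite_partial_converges\<close>). The theorem of M. Riesz is proved for
  \<open>1 < p \<le> 2\<close> by Stein's comparison of two Laplacians (\<open>stein_inequality_regularized\<close>), and the
  exponents above 2 are reached by repeated doubling (\<open>riesz_bound_double\<close>).

  For \<open>p = 1\<close> the operator is tested on coherent states, that is, on shifted Gaussians, all of which have norm
  \<open>2\<^sup>d\<close>. For them everything factorises over the coordinates, and in one coordinate truncation produces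
  a truncated exponential series. If the coherent state sits at distance \<open>\<rho> = sqrt (N / \<pi>)\<close> from the
  origin, then on circles of radius close to \<open>\<rho>\<close> the coefficients of this series are Poisson weights of mean close to
  \<open>N\<close>, cut off at \<open>N\<close>: about \<open>sqrt N\<close> coefficients below the cut-off are of size \<open>1 / sqrt N\<close>. Hardy's
  inequality, read from the top coefficient downwards, turns the sharp cut-off into a factor
  \<open>log N\<close> (\<open>ker1_circle_lower_bound\<close>). Integrating over an annulus and multiplying over the
  coordinates gives the lower bound of order \<open>(log N)\<^sup>d\<close> (\<open>opnorm_lower\<close>).

  The modulus of \<open>V (S\<^sub>N (coherent state at W)) Z\<close> is symmetric in \<open>W\<close> and \<open>Z\<close>. A superposition of coherent states whose
  coefficients are the conjugate signs of this kernel therefore is bounded in \<open>M\<^sup>\<infinity>\<close>, while its image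
  under \<open>S\<^sub>N\<close> recovers the norms in \<open>M\<^sup>1\<close>; so boundedness fails for \<open>p = \<infinity>\<close> as well
  (\<open>unbounded_pinf\<close>). Finally a gliding hump of coherent states yields one element of \<open>M\<^sup>1\<close> whose
  partial sums are unbounded, hence divergent (\<open>exists_divergent\<close>).
\<close>

(* The dollar sign denotes vector components only. *)
no_notation fps_nth (infixl \<open>$\<close> 75)

section \<open>M. Riesz: truncation of power series on the circle\<close>

text \<open>
  A negative slope at some point would, by convexity, make the function grow linearly towards \<open>-\<infinity>\<close>.
\<close>

lemma convex_bounded_left_imp_mono:
  fixes M M1 M2 :: "real \<Rightarrow> real"
  assumes d1: "\<And>x. (M has_real_derivative M1 x) (at x)"
    and d2: "\<And>x. (M1 has_real_derivative M2 x) (at x)"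
    and pos: "\<And>x. M2 x \<ge> 0" and bdd: "\<And>x. x \<le> 0 \<Longrightarrow> M x \<le> B" and "x \<le> y"
  shows "M x \<le> M y"
proof -
  have mono1: "M1 a \<le> M1 b" if "a \<le> b" for a b
    by (rule DERIV_nonneg_imp_nondecreasing[OF that]) (use d2 pos in blast)
  have "M1 c \<ge> 0" for c
  proof (rule ccontr)
    assume neg: "\<not> M1 c \<ge> 0"
    define a where "a = min (c - 1) (min (c + (B - M c + 1) / M1 c) 0)"
    have a: "a < c" "a \<le> 0" "a \<le> c + (B - M c + 1) / M1 c" by (auto simp: a_def)
    obtain z where z: "a < z" "z < c" "M c - M a = (c - a) * M1 z"
      using MVT2[OF a(1), of M M1] d1 by blast
    have "(c - a) * M1 z \<le> (c - a) * M1 c"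
      by (intro mult_left_mono mono1) (use z a in auto)
    moreover have "(a - c) * M1 c \<ge> B - M c + 1"
      using a(3) neg by (simp add: field_simps)
    moreover have "M a \<le> B" using bdd a by blast
    ultimately show False using z(3) by (simp add: algebra_simps)
  qed
  then show ?thesis
    using DERIV_nonneg_imp_nondecreasing[OF \<open>x \<le> y\<close>, of M] d1 by blast
qed

text \<open>
  In the coordinates \<open>w = exp (r + i t)\<close> the sum of the second derivatives in \<open>r\<close> and \<open>t\<close> is \<open>\<bar>w\<bar>\<^sup>2\<close> times
  the Laplacian. The angular part integrates to 0 by periodicity, so the circle means of a
  subharmonic function are convex in \<open>r\<close>; being bounded as \<open>r \<rightarrow> -\<infinity>\<close>, they increase.
\<close>

lemma circle_integral_mono_log_radius:
  fixes f f1 f2 g1 g2 :: "real \<Rightarrow> real \<Rightarrow> real"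
  assumes df: "\<And>r t. ((\<lambda>r. f r t) has_real_derivative f1 r t) (at r)"
    and df1: "\<And>r t. ((\<lambda>r. f1 r t) has_real_derivative f2 r t) (at r)"
    and dg: "\<And>r t. (f r has_real_derivative g1 r t) (at t)"
    and dg1: "\<And>r t. (g1 r has_real_derivative g2 r t) (at t)"
    and c: "continuous_on UNIV (\<lambda>(r,t). f r t)" "continuous_on UNIV (\<lambda>(r,t). f1 r t)"
       "continuous_on UNIV (\<lambda>(r,t). f2 r t)"
    and per: "\<And>r. g1 r (2*pi) = g1 r 0"
    and pos: "\<And>r t. f2 r t + g2 r t \<ge> 0"
    and bdd: "\<And>r t. r \<le> 0 \<Longrightarrow> f r t \<le> B"
    and "x \<le> y"
  shows "integral {0..2*pi} (f x) \<le> integral {0..2*pi} (f y)"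
proof -
  have pr: "continuous_on UNIV (\<lambda>t. (r,t))" for r :: real by (intro continuous_intros)
  have sl: "continuous_on UNIV (f r)" "continuous_on UNIV (f1 r)" "continuous_on UNIV (f2 r)" for r
    using continuous_on_compose2[OF c(1) pr] continuous_on_compose2[OF c(2) pr]
       continuous_on_compose2[OF c(3) pr] by auto
  have io: "f r integrable_on {0..2*pi}" "f1 r integrable_on {0..2*pi}" "f2 r integrable_on {0..2*pi}" for r
    using sl by (auto intro!: integrable_continuous_real intro: continuous_on_subset)
  have d1: "((\<lambda>r. integral {0..2*pi} (f r)) has_real_derivative integral {0..2*pi} (f1 r)) (at r)" for r
    using leibniz_rule_field_derivative[of UNIV 0 "2*pi" f f1 r] df io(1) c(2)
    by (auto intro: continuous_on_subset)
  have d2: "((\<lambda>r. integral {0..2*pi} (f1 r)) has_real_derivative integral {0..2*pi} (f2 r)) (at r)" for r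
    using leibniz_rule_field_derivative[of UNIV 0 "2*pi" f1 f2 r] df1 io(2) c(3)
    by (auto intro: continuous_on_subset)
  have p: "integral {0..2*pi} (f2 r) \<ge> 0" for r
  proof -
    have "(g2 r has_integral (g1 r (2*pi) - g1 r 0)) {0..2*pi}"
      by (rule fundamental_theorem_of_calculus)
        (use dg1 in \<open>auto simp: has_real_derivative_iff_has_vector_derivative[symmetric] intro: has_field_derivative_at_within\<close>)
    then have g: "(g2 r has_integral 0) {0..2*pi}" using per by simp
    have "((\<lambda>t. f2 r t + g2 r t) has_integral (integral {0..2*pi} (f2 r) + 0)) {0..2*pi}"
      by (intro has_integral_add g integrable_integral io)
    from has_integral_nonneg[OF this] pos show ?thesis by auto
  qed
  have b: "integral {0..2*pi} (f r) \<le> 2*pi * B" if "r \<le> 0" for r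
  proof -
    have "integral {0..2*pi} (f r) \<le> integral {0..2*pi} (\<lambda>_. B)"
      by (intro integral_le io) (use bdd that in auto)
    then show ?thesis by simp
  qed
  show ?thesis by (rule convex_bounded_left_imp_mono[OF d1 d2 p b \<open>x \<le> y\<close>])
qed

text \<open>
  The summand \<open>e > 0\<close> keeps the base away from 0, so that powers with exponent below 1 are smooth also at
  the zeros of \<open>H\<close>. For a harmonic \<open>H\<close> these second derivatives are taken in \<open>r\<close> and in \<open>t\<close>, and the
  terms with \<open>H2\<close> cancel in the sum.
\<close>

lemma regularized_power_derivs:
  fixes H H1 H2 :: "real \<Rightarrow> 'e::real_inner"
  assumes "(H has_vector_derivative H1 x) (at x)" "(H1 has_vector_derivative H2 x) (at x)" "e > 0"
  shows "((\<lambda>x. (e + H x \<bullet> H x) powr s) has_real_derivative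
            s * (e + H x \<bullet> H x) powr (s - 1) * (2 * (H x \<bullet> H1 x))) (at x)" (is ?A)
    and "((\<lambda>x. s * (e + H x \<bullet> H x) powr (s - 1) * (2 * (H x \<bullet> H1 x))) has_real_derivative
            s * (s - 1) * (e + H x \<bullet> H x) powr (s - 2) * (2 * (H x \<bullet> H1 x))\<^sup>2
            + s * (e + H x \<bullet> H x) powr (s - 1) * (2 * (H1 x \<bullet> H1 x) + 2 * (H x \<bullet> H2 x))) (at x)" (is ?B)
proof -
  have q: "((\<lambda>x. e + H x \<bullet> H x) has_real_derivative 2 * (H x \<bullet> H1 x)) (at x)"
    using assms unfolding has_real_derivative_iff_has_vector_derivative has_vector_derivative_def
    by (auto intro!: derivative_eq_intros simp: inner_commute algebra_simps)
  have q1: "((\<lambda>x. 2 * (H x \<bullet> H1 x)) has_real_derivative (2 * (H1 x \<bullet> H1 x) + 2 * (H x \<bullet> H2 x))) (at x)"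
    using assms unfolding has_real_derivative_iff_has_vector_derivative has_vector_derivative_def
    by (auto intro!: derivative_eq_intros simp: inner_commute algebra_simps)
  have p: "e + H x \<bullet> H x > 0" using assms(3) by (simp add: add_pos_nonneg)
  show ?A using DERIV_fun_powr[OF q p, of s] by simp
  have "((\<lambda>x. (e + H x \<bullet> H x) powr (s-1)) has_real_derivative
            (s-1) * (e + H x \<bullet> H x) powr (s - 2) * (2 * (H x \<bullet> H1 x))) (at x)"
    using DERIV_fun_powr[OF q p, of "s-1"] by (simp add: algebra_simps)
  from DERIV_mult[OF DERIV_cmult[OF this, of s] q1]
  show ?B by (simp add: algebra_simps power2_eq_square)
qed

lemma cnj_has_vector_derivative:
  "(f has_vector_derivative d) F \<Longrightarrow> ((\<lambda>x. cnj (f x)) has_vector_derivative cnj d) F"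
  by (rule bounded_linear.has_vector_derivative[OF bounded_linear_cnj])

text \<open>
  In the coordinates \<open>w = exp (r + i t)\<close> the derivative in \<open>r\<close> acts on polynomials as the Euler operator
  \<open>w d/dw\<close>, and the derivative in \<open>t\<close> as \<open>\<i>\<close> times this operator.
\<close>

abbreviation euler :: "complex poly \<Rightarrow> complex poly" where "euler Q \<equiv> pCons 0 (pderiv Q)"

abbreviation polexp :: "real \<Rightarrow> real \<Rightarrow> complex" where "polexp r t \<equiv> exp (Complex r t)"

lemma polexp_derivs:
  "((\<lambda>r. poly Q (polexp r t)) has_vector_derivative poly (euler Q) (polexp r t)) (at r)"
  "((\<lambda>t. poly Q (polexp r t)) has_vector_derivative \<i> * poly (euler Q) (polexp r t)) (at t)"
proof -
  have 1: "((\<lambda>z. poly Q (exp z)) has_field_derivative poly (euler Q) (exp z)) (at z)" for z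
    by (auto intro!: derivative_eq_intros poly_DERIV[THEN DERIV_chain2] simp: mult.commute)
  have 2: "((\<lambda>r. Complex r t) has_vector_derivative 1) (at r)"
    unfolding Complex_eq by (auto intro!: derivative_eq_intros)
  have 3: "((\<lambda>t. Complex r t) has_vector_derivative \<i>) (at t)"
    unfolding Complex_eq by (auto intro!: derivative_eq_intros)
  show "((\<lambda>r. poly Q (polexp r t)) has_vector_derivative poly (euler Q) (polexp r t)) (at r)"
    using field_vector_diff_chain_at[OF 2 1] by (simp add: o_def)
  show "((\<lambda>t. poly Q (polexp r t)) has_vector_derivative \<i> * poly (euler Q) (polexp r t)) (at t)"
    using field_vector_diff_chain_at[OF 3 1] by (simp add: o_def mult.commute)
qed

lemma polexp_second_derivs:
  "((\<lambda>t. \<i> * poly (euler Q) (polexp r t)) has_vector_derivative - poly (euler (euler Q)) (polexp r t)) (at t)"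
  using has_vector_derivative_mult_right[OF polexp_derivs(2)[of "euler Q" r t], of \<i>] by simp

lemma polexp_periodic: "polexp r (2 * pi) = polexp r 0"
  by (simp add: exp_eq_polar complex_eq_iff)

text \<open>
  The pointwise core of Stein's inequality. Here \<open>U\<close> and \<open>V\<close> stand for \<open>e + \<bar>cnj A + B\<bar>\<^sup>2\<close> and
  \<open>e + \<bar>A\<bar>\<^sup>2 + \<bar>B\<bar>\<^sup>2\<close>, the numbers \<open>GU\<close> and \<open>GV\<close> for their squared gradients, and \<open>4 * S\<close> for the
  Laplacian that they share. By Cauchy--Schwarz the negative gradient term of \<open>U powr s\<close> is at most
  \<open>2 * (1 - s)\<close> times its Laplacian term, so a positive fraction \<open>2 * s - 1\<close> survives; this is where
  \<open>p = 2 * s > 1\<close> enters. The gradient term of \<open>V\<close> has the right sign, and passing from \<open>V\<close> to \<open>U\<close>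
  costs \<open>2 powr (1 - s)\<close>.
\<close>

lemma stein_laplacian_arith:
  fixes U V S GU GV s K :: real
  assumes "1/2 < s" "s \<le> 1" "U > 0" "V > 0" "U \<le> 2 * V" "S \<ge> 0"
    "GU \<le> 8 * U * S" "GV \<ge> 0" "K = 2 powr (1 - s) / (s * 2 - 1)"
  shows "0 \<le> K * (s * (s-1) * U powr (s-2) * GU + s * U powr (s-1) * (4 * S))
              - (s * (s-1) * V powr (s-2) * GV + s * V powr (s-1) * (4 * S))"
proof -
  have u: "U powr (s-1) = U powr (s-2) * U"
    using powr_mult_base[of U "s-2"] assms by (simp add: mult.commute)
  have "(1-s) * U powr (s-2) * GU \<le> (1-s) * U powr (s-2) * (8 * U * S)"
    by (intro mult_left_mono) (use assms in auto)
  also have "\<dots> = (1 - s) * 8 * S * U powr (s-1)" using u by (simp add: algebra_simps)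
  finally have "4 * S * (s*2-1) * U powr (s-1) \<le> (s-1) * U powr (s-2) * GU + U powr (s-1) * (4 * S)"
    by (simp add: algebra_simps)
  then have "K * (4 * S * (s*2-1) * U powr (s-1)) \<le> K * ((s-1) * U powr (s-2) * GU + U powr (s-1) * (4 * S))"
    by (intro mult_left_mono) (use assms in auto)
  moreover have "K * (4 * S * (s*2-1) * U powr (s-1)) = 4 * S * (2 powr (1-s) * U powr (s-1))"
  proof -
    have "K * (s * 2 - 1) = 2 powr (1 - s)" using assms by simp
    then show ?thesis by (metis (no_types, opaque_lifting) mult.assoc mult.left_commute)
  qed
  moreover have "2 powr (1-s) * U powr (s-1) = (U/2) powr (s-1)"
    using assms by (simp add: powr_divide powr_diff powr_minus field_simps)
  moreover have "V powr (s-1) \<le> (U/2) powr (s-1)"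
    using assms by (intro powr_mono2') auto
  ultimately have "4 * S * V powr (s-1) \<le> K * ((s-1) * U powr (s-2) * GU + U powr (s-1) * (4 * S))"
    using assms(6) by (smt (verit) mult_left_mono)
  moreover have "(s-1) * V powr (s-2) * GV \<le> 0" using assms
    by (simp add: mult_nonpos_nonneg)
  ultimately have "0 \<le> K * ((s-1) * U powr (s-2) * GU + U powr (s-1) * (4 * S))
      - ((s-1) * V powr (s-2) * GV + V powr (s-1) * (4 * S))" by (simp add: algebra_simps)
  then have "0 \<le> s * (K * ((s-1) * U powr (s-2) * GU + U powr (s-1) * (4 * S))
      - ((s-1) * V powr (s-2) * GV + V powr (s-1) * (4 * S)))" using assms(1) by simp
  then show ?thesis by (simp add: algebra_simps)
qed

lemma poly_bounded_unit_disc: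
  fixes A :: "complex poly"
  obtains C where "C \<ge> 0" "\<And>z. norm z \<le> 1 \<Longrightarrow> norm (poly A z) \<le> C"
proof -
  have "compact ((\<lambda>z. poly A z) ` cball 0 1)"
    by (intro compact_continuous_image continuous_intros) auto
  then obtain C where "\<forall>x\<in>(\<lambda>z. poly A z) ` cball 0 1. norm x \<le> C"
    using compact_imp_bounded bounded_iff by metis
  then show thesis using that[of "max C 0"] by (force simp: le_max_iff_disj)
qed

text \<open>
  The function \<open>K * U powr s - V powr s\<close> is subharmonic on the disc, and it is nonnegative at the origin,
  where \<open>B\<close> vanishes and \<open>U = V\<close>, because \<open>K \<ge> 1\<close>. Hence its mean over the unit circle is nonnegative.
\<close>

lemma stein_inequality_regularized:
  fixes A B :: "complex poly" and s e K :: real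
  assumes s: "1/2 < s" "s \<le> 1" and B0: "poly B 0 = 0" and e: "e > 0"
    and K: "K = 2 powr (1 - s) / (s * 2 - 1)"
  shows "integral {0..2*pi} (\<lambda>t. (e + (norm (poly A (cis t)))\<^sup>2 + (norm (poly B (cis t)))\<^sup>2) powr s)
     \<le> K * integral {0..2*pi} (\<lambda>t. (e + (norm (cnj (poly A (cis t)) + poly B (cis t)))\<^sup>2) powr s)"
proof -
  \<comment> \<open>h is the harmonic function and v the vector-valued analytic function to be compared; h1, h2, v1, v2 are
    their derivatives in the logarithmic radius, k1 and w1 those in the angle.\<close>
  define h h1 h2 k1 where "h = (\<lambda>r t. cnj (poly A (polexp r t)) + poly B (polexp r t))"
    and "h1 = (\<lambda>r t. cnj (poly (euler A) (polexp r t)) + poly (euler B) (polexp r t))"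
    and "h2 = (\<lambda>r t. cnj (poly (euler (euler A)) (polexp r t)) + poly (euler (euler B)) (polexp r t))"
    and "k1 = (\<lambda>r t. cnj (\<i> * poly (euler A) (polexp r t)) + \<i> * poly (euler B) (polexp r t))"
  define v v1 v2 w1 where "v = (\<lambda>r t. (poly A (polexp r t), poly B (polexp r t)))"
    and "v1 = (\<lambda>r t. (poly (euler A) (polexp r t), poly (euler B) (polexp r t)))"
    and "v2 = (\<lambda>r t. (poly (euler (euler A)) (polexp r t), poly (euler (euler B)) (polexp r t)))"
    and "w1 = (\<lambda>r t. (\<i> * poly (euler A) (polexp r t), \<i> * poly (euler B) (polexp r t)))"
  have dh: "((\<lambda>r. h r t) has_vector_derivative h1 r t) (at r)"
     "((\<lambda>r. h1 r t) has_vector_derivative h2 r t) (at r)"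
     "(h r has_vector_derivative k1 r t) (at t)"
     "(k1 r has_vector_derivative - h2 r t) (at t)" for r t
    unfolding h_def h1_def h2_def k1_def
    by (rule has_vector_derivative_add cnj_has_vector_derivative polexp_derivs polexp_second_derivs
       has_vector_derivative_eq_rhs[OF has_vector_derivative_add[OF cnj_has_vector_derivative[OF polexp_second_derivs] polexp_second_derivs]] | simp)+
  have dv: "((\<lambda>r. v r t) has_vector_derivative v1 r t) (at r)"
     "((\<lambda>r. v1 r t) has_vector_derivative v2 r t) (at r)"
     "(v r has_vector_derivative w1 r t) (at t)"
     "(w1 r has_vector_derivative - v2 r t) (at t)" for r t
    unfolding v_def v1_def v2_def w1_def
    by (rule has_vector_derivative_Pair polexp_derivs polexp_second_derivs
       has_vector_derivative_eq_rhs[OF has_vector_derivative_Pair[OF polexp_second_derivs polexp_second_derivs]] | simp)+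
  define U V where "U = (\<lambda>r t. e + h r t \<bullet> h r t)" and "V = (\<lambda>r t. e + v r t \<bullet> v r t)"
  have UV: "U r t > 0" "V r t > 0" for r t by (auto simp: U_def V_def e add_pos_nonneg)
  define f f1 f2 g1 g2 where "f = (\<lambda>r t. K * U r t powr s - V r t powr s)"
   and "f1 = (\<lambda>r t. K * (s * U r t powr (s - 1) * (2 * (h r t \<bullet> h1 r t))) - s * V r t powr (s - 1) * (2 * (v r t \<bullet> v1 r t)))"
   and "f2 = (\<lambda>r t. K * (s * (s - 1) * U r t powr (s - 2) * (2 * (h r t \<bullet> h1 r t))\<^sup>2
            + s * U r t powr (s - 1) * (2 * (h1 r t \<bullet> h1 r t) + 2 * (h r t \<bullet> h2 r t)))
          - (s * (s - 1) * V r t powr (s - 2) * (2 * (v r t \<bullet> v1 r t))\<^sup>2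
            + s * V r t powr (s - 1) * (2 * (v1 r t \<bullet> v1 r t) + 2 * (v r t \<bullet> v2 r t))))"
   and "g1 = (\<lambda>r t. K * (s * U r t powr (s - 1) * (2 * (h r t \<bullet> k1 r t))) - s * V r t powr (s - 1) * (2 * (v r t \<bullet> w1 r t)))"
   and "g2 = (\<lambda>r t. K * (s * (s - 1) * U r t powr (s - 2) * (2 * (h r t \<bullet> k1 r t))\<^sup>2
            + s * U r t powr (s - 1) * (2 * (k1 r t \<bullet> k1 r t) + 2 * (h r t \<bullet> - h2 r t)))
          - (s * (s - 1) * V r t powr (s - 2) * (2 * (v r t \<bullet> w1 r t))\<^sup>2
            + s * V r t powr (s - 1) * (2 * (w1 r t \<bullet> w1 r t) + 2 * (v r t \<bullet> - v2 r t))))"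
  have Kpos: "K \<ge> 1"
  proof -
    have "(1::real) \<le> 2 powr (1 - s)" using s by (intro ge_one_powr_ge_zero) auto
    then show ?thesis using s unfolding K by (subst pos_le_divide_eq) auto
  qed
  have ch: "continuous_on UNIV (\<lambda>(r,t). h r t)" "continuous_on UNIV (\<lambda>(r,t). h1 r t)" "continuous_on UNIV (\<lambda>(r,t). h2 r t)"
     "continuous_on UNIV (\<lambda>(r,t). v r t)" "continuous_on UNIV (\<lambda>(r,t). v1 r t)" "continuous_on UNIV (\<lambda>(r,t). v2 r t)"
    unfolding h_def h1_def h2_def v_def v1_def v2_def case_prod_beta by (intro continuous_intros)+
  have UV0: "U r t \<noteq> 0" "V r t \<noteq> 0" for r t using UV[of r t] by auto
  have cUV: "continuous_on UNIV (\<lambda>(r,t). U r t)" "continuous_on UNIV (\<lambda>(r,t). V r t)"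
    using ch unfolding U_def V_def case_prod_beta by (intro continuous_intros; simp)+
  have cf: "continuous_on UNIV (\<lambda>(r,t). f r t)" "continuous_on UNIV (\<lambda>(r,t). f1 r t)" "continuous_on UNIV (\<lambda>(r,t). f2 r t)"
    using ch cUV UV0 unfolding f_def f1_def f2_def case_prod_beta by (intro continuous_intros; simp)+
  obtain CA CB where C: "CA \<ge> 0" "\<And>z. norm z \<le> 1 \<Longrightarrow> norm (poly A z) \<le> CA"
       "CB \<ge> 0" "\<And>z. norm z \<le> 1 \<Longrightarrow> norm (poly B z) \<le> CB"
    using poly_bounded_unit_disc[of A] poly_bounded_unit_disc[of B] by metis
  have pos: "f2 r t + g2 r t \<ge> 0" for r t
  proof -
    define a b where "a = poly (euler A) (polexp r t)" and "b = poly (euler B) (polexp r t)"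
    define S where "S = (norm a)\<^sup>2 + (norm b)\<^sup>2"
    define GU where "GU = (2 * (h r t \<bullet> h1 r t))\<^sup>2 + (2 * (h r t \<bullet> k1 r t))\<^sup>2"
    define GV where "GV = (2 * (v r t \<bullet> v1 r t))\<^sup>2 + (2 * (v r t \<bullet> w1 r t))\<^sup>2"
    have h1: "h1 r t \<bullet> h1 r t + k1 r t \<bullet> k1 r t = 2 * S"
      unfolding h1_def k1_def S_def a_def[symmetric] b_def[symmetric] cmod_power2 inner_complex_def
      by (simp add: algebra_simps power2_eq_square)
    have v1: "v1 r t \<bullet> v1 r t + w1 r t \<bullet> w1 r t = 2 * S"
      unfolding v1_def w1_def S_def a_def[symmetric] b_def[symmetric] cmod_power2 inner_complex_def inner_prod_def
      by (simp add: algebra_simps power2_eq_square)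
    have "GU \<le> 4 * (h r t \<bullet> h r t) * (h1 r t \<bullet> h1 r t + k1 r t \<bullet> k1 r t)"
      using Cauchy_Schwarz_ineq[of "h r t" "h1 r t"] Cauchy_Schwarz_ineq[of "h r t" "k1 r t"]
      unfolding GU_def by (simp add: algebra_simps power_mult_distrib)
    also have "\<dots> = 8 * (h r t \<bullet> h r t) * S" unfolding h1 by simp
    also have "\<dots> \<le> 8 * U r t * S" unfolding U_def using e by (intro mult_right_mono) (auto simp: S_def)
    finally have GU: "GU \<le> 8 * U r t * S" .
    have "(norm (h r t))\<^sup>2 \<le> (norm (poly A (polexp r t)) + norm (poly B (polexp r t)))\<^sup>2"
      unfolding h_def by (intro power_mono) (use norm_triangle_ineq[of "cnj (poly A (polexp r t))"] in auto)
    also have "\<dots> \<le> 2 * ((norm (poly A (polexp r t)))\<^sup>2 + (norm (poly B (polexp r t)))\<^sup>2)"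
      using sum_squares_bound[of "norm (poly A (polexp r t))" "norm (poly B (polexp r t))"]
      by (simp add: power2_sum)
    finally have UV2: "U r t \<le> 2 * V r t"
      unfolding U_def V_def v_def using e by (simp add: power2_norm_eq_inner)
    have "f2 r t + g2 r t = K * (s * (s-1) * U r t powr (s-2) * GU + s * U r t powr (s-1) * (2 * (h1 r t \<bullet> h1 r t + k1 r t \<bullet> k1 r t)))
              - (s * (s-1) * V r t powr (s-2) * GV + s * V r t powr (s-1) * (2 * (v1 r t \<bullet> v1 r t + w1 r t \<bullet> w1 r t)))"
      unfolding f2_def g2_def GU_def GV_def by (simp add: algebra_simps)
    also have "\<dots> \<ge> 0"
      using stein_laplacian_arith[OF s UV UV2 _ GU _ K, of GV] unfolding h1 v1 by (simp add: S_def GV_def)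
    finally show ?thesis .
  qed
  have bdd: "f r t \<le> K * (e + (CA + CB)\<^sup>2) powr s" if "r \<le> 0" for r t
  proof -
    have "norm (h r t) \<le> norm (poly A (polexp r t)) + norm (poly B (polexp r t))"
      unfolding h_def by (metis norm_triangle_ineq complex_mod_cnj)
    also have "\<dots> \<le> CA + CB" using that by (intro add_mono C) auto
    finally have "(norm (h r t))\<^sup>2 \<le> (CA + CB)\<^sup>2" by (intro power_mono) auto
    then have "U r t powr s \<le> (e + (CA + CB)\<^sup>2) powr s"
      using s e unfolding U_def by (intro powr_mono2) (auto simp: power2_norm_eq_inner)
    then have "K * U r t powr s \<le> K * (e + (CA + CB)\<^sup>2) powr s" using Kpos by simp
    moreover have "V r t powr s \<ge> 0" by simp
    ultimately show ?thesis unfolding f_def by linarith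
  qed
  have mono: "integral {0..2*pi} (f x) \<le> integral {0..2*pi} (f 0)" if "x \<le> 0" for x
  proof (rule circle_integral_mono_log_radius[OF _ _ _ _ cf(1) cf(2) cf(3) _ _ bdd that])
    show "((\<lambda>r. f r t) has_real_derivative f1 r t) (at r)" for r t
      unfolding f_def f1_def U_def V_def
      by (intro DERIV_diff DERIV_cmult regularized_power_derivs(1)[OF dh(1) dh(2) e] regularized_power_derivs(1)[OF dv(1) dv(2) e])
    show "((\<lambda>r. f1 r t) has_real_derivative f2 r t) (at r)" for r t
      unfolding f1_def f2_def U_def V_def
      by (intro DERIV_diff DERIV_cmult regularized_power_derivs(2)[OF dh(1) dh(2) e] regularized_power_derivs(2)[OF dv(1) dv(2) e])
    show "(f r has_real_derivative g1 r t) (at t)" for r t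
      unfolding f_def g1_def U_def V_def
      by (intro DERIV_diff DERIV_cmult regularized_power_derivs(1)[OF dh(3) dh(4) e] regularized_power_derivs(1)[OF dv(3) dv(4) e])
    show "(g1 r has_real_derivative g2 r t) (at t)" for r t
      unfolding g1_def g2_def U_def V_def
      by (intro DERIV_diff DERIV_cmult regularized_power_derivs(2)[OF dh(3) dh(4) e] regularized_power_derivs(2)[OF dv(3) dv(4) e])
    show "g1 r (2*pi) = g1 r 0" for r
      unfolding g1_def U_def V_def h_def h1_def k1_def v_def v1_def w1_def polexp_periodic ..
  qed (use pos in auto)
  define F where "F = (\<lambda>z. K * (e + (norm (cnj (poly A z) + poly B z))\<^sup>2) powr s
       - (e + (norm (poly A z))\<^sup>2 + (norm (poly B z))\<^sup>2) powr s)"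
  have fF: "f r t = F (polexp r t)" for r t
    unfolding f_def F_def U_def V_def h_def v_def by (simp add: power2_norm_eq_inner add.assoc)
  have F0: "F 0 \<ge> 0" using Kpos B0 unfolding F_def by (simp add: mult_le_cancel_right1)
  have ee: "e + (norm (x::complex))\<^sup>2 \<noteq> 0" "e + (norm x)\<^sup>2 + (norm (y::complex))\<^sup>2 \<noteq> 0" for x y
    using e by (smt (verit) zero_le_power2)+
  have "isCont F 0" unfolding F_def by (intro continuous_intros; simp add: ee)
  \<comment> \<open>On a circle of small radius f is close to its value F 0 at the origin, which is nonnegative.\<close>
  have "integral {0..2*pi} (f 0) \<ge> 0 - d" if "d > 0" for d
  proof -
    define d' where "d' = d / (2*pi)"
    have "d' > 0" using that by (simp add: d'_def)
    with \<open>isCont F 0\<close> obtain \<delta> where del: "\<delta> > 0" "\<And>z. dist z 0 < \<delta> \<Longrightarrow> dist (F z) (F 0) < d'"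
      unfolding continuous_at_eps_delta by blast
    define r where "r = min 0 (ln (\<delta> / 2))"
    have "exp r \<le> exp (ln (\<delta>/2))" unfolding r_def exp_le_cancel_iff by simp
    then have "exp r < \<delta>" using del(1) by simp
    then have "f r t \<ge> - d'" for t
      using del(2)[of "polexp r t"] F0 by (simp add: fF dist_real_def)
    moreover have "continuous_on {0..2*pi} (\<lambda>t. (r,t))" by (intro continuous_intros)
    then have "continuous_on {0..2*pi} (f r)"
      using continuous_on_compose2[OF cf(1), of "{0..2*pi}" "\<lambda>t. (r,t)"] by simp
    then have "f r integrable_on {0..2*pi}" by (rule integrable_continuous_real)
    ultimately have "integral {0..2*pi} (\<lambda>_. - d') \<le> integral {0..2*pi} (f r)"
      by (intro integral_le) auto
    also have "\<dots> \<le> integral {0..2*pi} (f 0)" by (rule mono) (simp add: r_def)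
    finally show ?thesis by (simp add: d'_def)
  qed
  then have "0 \<le> integral {0..2*pi} (f 0) + d" if "d > 0" for d using that by (metis diff_le_eq)
  then have "integral {0..2*pi} (f 0) \<ge> 0" by (rule field_le_epsilon)
  moreover have pc: "polexp 0 t = cis t" for t by (simp add: exp_eq_polar)
  have "integral {0..2*pi} (f 0) =
     K * integral {0..2*pi} (\<lambda>t. (e + (norm (cnj (poly A (cis t)) + poly B (cis t)))\<^sup>2) powr s)
     - integral {0..2*pi} (\<lambda>t. (e + (norm (poly A (cis t)))\<^sup>2 + (norm (poly B (cis t)))\<^sup>2) powr s)"
    unfolding fF F_def pc
    by (subst integral_diff)
      (auto intro!: integrable_continuous_real continuous_intros simp: ee)
  ultimately show ?thesis by simp
qed

lemma powr_add_le_add_powr: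
  fixes a b s :: real
  assumes "a \<ge> 0" "b \<ge> 0" "0 < s" "s \<le> 1"
  shows "(a + b) powr s \<le> a powr s + b powr s"
proof (cases "a + b = 0")
  case False
  then have ab: "a + b > 0" using assms by simp
  have *: "x / (a + b) \<le> (x / (a + b)) powr s" if "0 \<le> x" "x \<le> a + b" for x
    using powr_mono'[of s 1 "x / (a+b)"] that ab assms by simp
  have "1 = a / (a+b) + b / (a+b)" using ab by (simp add: add_divide_distrib[symmetric])
  also have "\<dots> \<le> (a / (a+b)) powr s + (b / (a+b)) powr s" by (intro add_mono *) (use assms in auto)
  also have "\<dots> = (a powr s + b powr s) / (a + b) powr s"
    using assms ab by (simp add: powr_divide add_divide_distrib)
  finally show ?thesis using ab by (simp add: le_divide_eq)
qed (use assms in auto)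

lemma norm_power2_powr: "((norm (x::complex))\<^sup>2) powr s = norm x powr (2 * s)"
  by (metis norm_ge_zero powr_numeral powr_powr)

text \<open>
  On the circle \<open>cnj A + B\<close> is an arbitrary trigonometric polynomial, split into its frequencies \<open>\<le> 0\<close> and
  \<open>> 0\<close>. So this is the boundedness of the Riesz projection on \<open>L\<^sup>p\<close> of the circle, with \<open>C\<close> in the role
  of the \<open>p\<close>-th power of its norm.
\<close>

definition riesz_bound :: "real \<Rightarrow> real \<Rightarrow> bool" where
  "riesz_bound p C \<longleftrightarrow> (\<forall>A B :: complex poly. poly B 0 = 0 \<longrightarrow>
     integral {0..2*pi} (\<lambda>t. norm (poly A (cis t)) powr p)
      \<le> C * integral {0..2*pi} (\<lambda>t. norm (cnj (poly A (cis t)) + poly B (cis t)) powr p))"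

lemma continuous_on_norm_powr [continuous_intros]:
  fixes f :: "'a::topological_space \<Rightarrow> complex"
  assumes "continuous_on X f" "p > 0"
  shows "continuous_on X (\<lambda>x. norm (f x) powr p)"
  using assms by (intro continuous_on_powr' continuous_intros) auto

text \<open>
  Stein's inequality with \<open>s = p / 2\<close>, as the regularisation tends to 0.
\<close>

lemma riesz_bound_le_2:
  assumes p: "1 < p" "p \<le> 2"
  shows "riesz_bound p (2 powr (1 - p/2) / (p - 1))"
  unfolding riesz_bound_def
proof (intro allI impI)
  fix A B :: "complex poly" assume B: "poly B 0 = 0"
  define s where "s = p / 2"
  define K where "K = 2 powr (1 - s) / (s * 2 - 1)"
  have s: "1/2 < s" "s \<le> 1" using p by (auto simp: s_def)
  have K: "K \<ge> 0" using s by (simp add: K_def)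
  let ?a = "\<lambda>t. norm (poly A (cis t))" and ?b = "\<lambda>t. norm (poly B (cis t))"
  let ?h = "\<lambda>t. norm (cnj (poly A (cis t)) + poly B (cis t))"
  have n0: "e + (norm (x::complex))\<^sup>2 \<noteq> 0" "e + (norm x)\<^sup>2 + (norm (y::complex))\<^sup>2 \<noteq> 0" if "e > 0" for e x y
    using that by (smt (verit) zero_le_power2)+
  have "integral {0..2*pi} (\<lambda>t. ?a t powr p) \<le> K * integral {0..2*pi} (\<lambda>t. ?h t powr p) + d" if "d > 0" for d
  proof -
    \<comment> \<open>Chosen such that the regularisation contributes K * 2 * pi * e powr s < d.\<close>
    define e where "e = (d / (2*pi*(K+1))) powr (1/s)"
    have e: "e > 0" "e powr s = d / (2*pi*(K+1))" using that K s by (auto simp: e_def powr_powr)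
    have "integral {0..2*pi} (\<lambda>t. ?a t powr p) \<le> integral {0..2*pi} (\<lambda>t. (e + (?a t)\<^sup>2 + (?b t)\<^sup>2) powr s)"
    proof (rule integral_le)
      show "?a t powr p \<le> (e + (?a t)\<^sup>2 + (?b t)\<^sup>2) powr s" for t
        using powr_mono2[of s "(?a t)\<^sup>2" "e + (?a t)\<^sup>2 + (?b t)\<^sup>2"] s e by (simp add: norm_power2_powr s_def)
    qed (use p n0[OF e(1)] in \<open>auto intro!: integrable_continuous_real continuous_intros\<close>)
    also have "\<dots> \<le> K * integral {0..2*pi} (\<lambda>t. (e + (?h t)\<^sup>2) powr s)"
      by (rule stein_inequality_regularized[OF s B e(1) K_def])
    also have "\<dots> \<le> K * integral {0..2*pi} (\<lambda>t. e powr s + ?h t powr p)"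
    proof (intro mult_left_mono integral_le K)
      show "(e + (?h t)\<^sup>2) powr s \<le> e powr s + ?h t powr p" for t
        using powr_add_le_add_powr[of e "(?h t)\<^sup>2" s] s e by (simp add: norm_power2_powr s_def)
    qed (use p n0[OF e(1)] e(1) in \<open>auto intro!: integrable_continuous_real continuous_intros\<close>)
    also have "integral {0..2*pi} (\<lambda>t. e powr s + ?h t powr p) = 2*pi * e powr s + integral {0..2*pi} (\<lambda>t. ?h t powr p)"
      by (subst integral_add) (use p in \<open>auto intro!: integrable_continuous_real continuous_intros\<close>)
    also have "K * \<dots> \<le> K * integral {0..2*pi} (\<lambda>t. ?h t powr p) + d"
    proof -
      have "K * (2*pi*e powr s) = d * (K / (K+1))" unfolding e(2) using K by simp
      also have "\<dots> \<le> d * 1" using that K by (intro mult_left_mono) auto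
      finally show ?thesis by (simp add: algebra_simps)
    qed
    finally show ?thesis .
  qed
  from field_le_epsilon[OF this]
  show "integral {0..2*pi} (\<lambda>t. ?a t powr p) \<le> 2 powr (1 - p/2) / (p - 1) * integral {0..2*pi} (\<lambda>t. ?h t powr p)"
    unfolding K_def s_def by simp
qed

lemma has_integral_cis_power:
  "((\<lambda>t. cis t ^ n) has_integral (if n = 0 then 2 * pi else 0)) {0..2*pi}"
proof (cases "n = 0")
  case True then show ?thesis using has_integral_const_real[of "1::complex" 0 "2*pi"] by (simp add: scaleR_conv_of_real)
next
  case False
  have "((\<lambda>t. cis t ^ n) has_integral (cis (2*pi) ^ n / (\<i> * of_nat n) - cis 0 ^ n / (\<i> * of_nat n))) {0..2*pi}"
  proof (rule fundamental_theorem_of_calculus)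
    fix t
    have "((\<lambda>z. exp (\<i> * of_nat n * z) / (\<i> * of_nat n)) has_field_derivative exp (\<i> * of_nat n * of_real t)) (at (of_real t))"
      using False by (auto intro!: derivative_eq_intros simp: field_simps)
    from has_vector_derivative_real_field[OF this]
    have "((\<lambda>t. exp (\<i> * of_nat n * of_real t) / (\<i> * of_nat n)) has_vector_derivative exp (\<i> * of_nat n * of_real t)) (at t within {0..2*pi})"
      by (simp add: o_def)
    moreover have "exp (\<i> * of_nat n * of_real t) = cis t ^ n" for t
      by (simp add: cis_conv_exp exp_of_nat_mult[symmetric] mult_ac)
    ultimately show "((\<lambda>t. cis t ^ n / (\<i> * of_nat n)) has_vector_derivative cis t ^ n) (at t within {0..2*pi})" by simp
  qed simp
  then show ?thesis using False by simp
qed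

lemma has_integral_poly_cis:
  fixes Q :: "complex poly"
  shows "((\<lambda>t. poly Q (cis t)) has_integral 2 * pi * poly Q 0) {0..2*pi}"
proof -
  have "((\<lambda>t. \<Sum>i\<le>degree Q. coeff Q i * cis t ^ i) has_integral (\<Sum>i\<le>degree Q. coeff Q i * (if i = 0 then 2 * pi else 0))) {0..2*pi}"
    by (intro has_integral_sum has_integral_mult_right has_integral_cis_power) auto
  also have "(\<Sum>i\<le>degree Q. coeff Q i * (if i = 0 then 2 * pi else 0)) = 2 * pi * poly Q 0"
    by (simp add: if_distrib sum.delta poly_0_coeff_0 cong: if_cong)
  finally show ?thesis by (simp add: poly_altdef)
qed

lemma powr_above_tangent:
  fixes x y p :: real
  assumes "p > 1" "x \<ge> 0" "y > 0"
  shows "y powr p + p * y powr (p - 1) * (x - y) \<le> x powr p"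
proof (cases "x = 0")
  case True
  have "y powr p = y powr (p-1) * y" using powr_mult_base[of y "p-1"] assms by (simp add: mult.commute)
  then have "y powr p + p * y powr (p - 1) * (x - y) = (1 - p) * (y powr (p - 1) * y)"
    using True by (simp add: algebra_simps)
  also have "\<dots> \<le> 0" using assms by (intro mult_nonpos_nonneg) auto
  finally show ?thesis by (smt (verit) powr_ge_zero)
next
  case False
  have "convex_on {0<..} (\<lambda>x::real. x powr p)"
    using assms by (intro powr_convex) auto
  moreover have "((\<lambda>x::real. x powr p) has_field_derivative p * y powr (p - 1)) (at y within {0<..})"
    using assms by (intro has_field_derivative_at_within[OF has_real_derivative_powr]) auto
  ultimately show ?thesis
    using convex_on_imp_above_tangent[of "{0<..}" "\<lambda>x. x powr p" y x "p * y powr (p - 1)"] assms False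
      interior_open[of "{0::real<..}"] by simp
qed

text \<open>
  Jensen's inequality for the convex function \<open>x powr p\<close>, applied to the mean value property;
  convexity enters through the tangent at \<open>\<bar>Q 0\<bar>\<close>.
\<close>

lemma powr_mean_value_poly:
  fixes Q :: "complex poly"
  assumes p: "p > 1"
  shows "2 * pi * norm (poly Q 0) powr p \<le> integral {0..2*pi} (\<lambda>t. norm (poly Q (cis t)) powr p)"
proof (cases "poly Q 0 = 0")
  case True
  have "0 \<le> integral {0..2*pi} (\<lambda>t. norm (poly Q (cis t)) powr p)"
    using p by (intro integral_nonneg integrable_continuous_real continuous_intros) auto
  then show ?thesis using True by simp
next
  case False
  define y where "y = norm (poly Q 0)"
  have y: "y > 0" using False by (simp add: y_def)
  define k where "k = p * y powr (p - 1)"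
  have "norm (2 * pi * poly Q 0) \<le> integral {0..2*pi} (\<lambda>t. norm (poly Q (cis t)))"
    unfolding integral_unique[OF has_integral_poly_cis, symmetric]
    by (rule integral_norm_bound_integral) (auto intro!: integrable_continuous_real continuous_intros)
  then have "2 * pi * y \<le> integral {0..2*pi} (\<lambda>t. norm (poly Q (cis t)))"
    by (simp add: norm_mult y_def)
  then have "k * (2 * pi * y) \<le> k * integral {0..2*pi} (\<lambda>t. norm (poly Q (cis t)))"
    using p unfolding k_def by (intro mult_left_mono) auto
  then have "2 * pi * y powr p \<le> 2 * pi * (y powr p - k * y) + k * integral {0..2*pi} (\<lambda>t. norm (poly Q (cis t)))"
    by (simp add: right_diff_distrib mult.commute mult.left_commute)
  also have "\<dots> = integral {0..2*pi} (\<lambda>t. (y powr p - k * y) + k * norm (poly Q (cis t)))"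
  proof (subst integral_add)
    show "(\<lambda>t. k * norm (poly Q (cis t))) integrable_on {0..2*pi}"
      by (intro integrable_continuous_real continuous_intros)
  qed (simp_all add: integrable_const_ivl)
  also have "\<dots> \<le> integral {0..2*pi} (\<lambda>t. norm (poly Q (cis t)) powr p)"
  proof (rule integral_le)
    show "(y powr p - k * y) + k * norm (poly Q (cis t)) \<le> norm (poly Q (cis t)) powr p" for t
      using powr_above_tangent[OF p norm_ge_zero y, of "poly Q (cis t)"]
      unfolding k_def right_diff_distrib by linarith
    show "(\<lambda>t. (y powr p - k * y) + k * norm (poly Q (cis t))) integrable_on {0..2*pi}"
      by (intro integrable_continuous_real continuous_intros)
    show "(\<lambda>t. norm (poly Q (cis t)) powr p) integrable_on {0..2*pi}"
      using p by (intro integrable_continuous_real continuous_intros) auto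
  qed
  finally show ?thesis unfolding y_def .
qed

lemma cis_mult_cnj [simp]: "cis t * cnj (cis t) = 1"
  using complex_norm_square[of "cis t"] by (simp only: norm_cis) simp

text \<open>
  On the unit circle \<open>\<bar>A\<bar>\<^sup>2\<close> is a real trigonometric polynomial, and \<open>Q\<close> collects its frequencies \<open>\<ge> 0\<close>.
  The induction expands \<open>\<bar>a + w * A\<bar>\<^sup>2 = \<bar>a\<bar>\<^sup>2 + 2 * Re (cnj a * w * A) + \<bar>A\<bar>\<^sup>2\<close>.
\<close>

lemma norm_square_eq_real_part_poly:
  fixes A :: "complex poly"
  shows "\<exists>Q. (\<forall>t. poly A (cis t) * cnj (poly A (cis t)) = poly Q (cis t) + cnj (poly Q (cis t)) - poly Q 0)
     \<and> cnj (poly Q 0) = poly Q 0"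
proof (induction A)
  case 0 show ?case by (rule exI[of _ 0]) simp
next
  case (pCons a A)
  then obtain Q where Q: "\<And>t. poly A (cis t) * cnj (poly A (cis t)) = poly Q (cis t) + cnj (poly Q (cis t)) - poly Q 0"
     "cnj (poly Q 0) = poly Q 0" by blast
  let ?Q = "Q + smult (cnj a) (pCons 0 A) + [:a * cnj a:]"
  have "poly (pCons a A) (cis t) * cnj (poly (pCons a A) (cis t)) = poly ?Q (cis t) + cnj (poly ?Q (cis t)) - poly ?Q 0" for t
  proof -
    have "poly (pCons a A) (cis t) * cnj (poly (pCons a A) (cis t)) =
       a * cnj a + cnj a * (cis t * poly A (cis t)) + a * cnj (cis t * poly A (cis t)) + (cis t * cnj (cis t)) * (poly A (cis t) * cnj (poly A (cis t)))"
      by (simp add: algebra_simps)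
    then show ?thesis unfolding cis_mult_cnj Q(1) by (simp add: algebra_simps)
  qed
  moreover have "cnj (poly ?Q 0) = poly ?Q 0" using Q(2) by simp
  ultimately show ?case by blast
qed

lemma powr_add_le_max:
  fixes a b p :: real
  assumes "a \<ge> 0" "b \<ge> 0" "p \<ge> 0"
  shows "(a + b) powr p \<le> 2 powr p * (a powr p + b powr p)"
proof -
  have "(a + b) powr p \<le> (2 * max a b) powr p" using assms by (intro powr_mono2) auto
  also have "\<dots> = 2 powr p * (max a b) powr p" using assms by (simp add: powr_mult)
  also have "\<dots> \<le> 2 powr p * (a powr p + b powr p)" by (intro mult_left_mono) (auto simp: max_def)
  finally show ?thesis .
qed

text \<open>
  With \<open>\<bar>A\<bar>\<^sup>2 = Q + cnj Q - Q 0\<close> on the circle, the product \<open>A * (cnj A + B) = \<bar>A\<bar>\<^sup>2 + A * B\<close> has the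
  form \<open>cnj Q + (Q - Q 0 + A * B)\<close>, whose second summand vanishes at 0. The inequality for \<open>p\<close> bounds
  \<open>Q\<close>, and with it \<open>\<bar>A\<bar>\<^sup>2\<close>, in \<open>L\<^sup>p\<close> by the product; the factor \<open>A\<close> of the product is absorbed into the
  left-hand side by the inequality of arithmetic and geometric means.
\<close>

lemma riesz_bound_double:
  assumes p: "p > 1" and C: "riesz_bound p C" "C \<ge> 0"
  shows "riesz_bound (2 * p) ((2 powr p * (2 powr p + 1) * C)\<^sup>2)"
  unfolding riesz_bound_def
proof (intro allI impI)
  fix A B :: "complex poly" assume B: "poly B 0 = 0"
  obtain Q where Q: "\<And>t. poly A (cis t) * cnj (poly A (cis t)) = poly Q (cis t) + cnj (poly Q (cis t)) - poly Q 0"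
    using norm_square_eq_real_part_poly by blast
  let ?I = "\<lambda>f. integral {0..2*pi} f :: real"
  define a h q where "a = (\<lambda>t. norm (poly A (cis t)))" and "h = (\<lambda>t. norm (cnj (poly A (cis t)) + poly B (cis t)))"
    and "q = (\<lambda>t. norm (poly Q (cis t)))"
  define K where "K = 2 powr p * (2 powr p + 1) * C"
  have K: "K \<ge> 0" using C by (simp add: K_def)
  note ci = integrable_continuous_real continuous_intros
  have ah: "norm (cnj (poly Q (cis t)) + poly (Q - [:poly Q 0:] + A * B) (cis t)) = a t * h t" for t
  proof -
    have "cnj (poly Q (cis t)) + poly (Q - [:poly Q 0:] + A * B) (cis t) = poly A (cis t) * (cnj (poly A (cis t)) + poly B (cis t))"
      using Q[of t] by (simp add: algebra_simps)
    then show ?thesis by (simp add: norm_mult a_def h_def)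
  qed
  have sq: "a t powr (2 * p) \<le> 2 powr p * (2 powr p * q t powr p + norm (poly Q 0) powr p)" for t
  proof -
    have "(a t)\<^sup>2 = norm (poly A (cis t) * cnj (poly A (cis t)))" by (simp add: a_def norm_mult power2_eq_square)
    also have "\<dots> \<le> 2 * q t + norm (poly Q 0)" unfolding Q q_def
      by (smt (verit) complex_mod_cnj norm_triangle_ineq norm_triangle_ineq4)
    finally have "((a t)\<^sup>2) powr p \<le> (2 * q t + norm (poly Q 0)) powr p" using p by (intro powr_mono2) auto
    also have "\<dots> \<le> 2 powr p * ((2 * q t) powr p + norm (poly Q 0) powr p)"
      using p by (intro powr_add_le_max) (auto simp: q_def)
    finally show ?thesis by (simp add: a_def q_def norm_power2_powr powr_mult)
  qed
  have "?I (\<lambda>t. a t powr (2*p)) \<le> ?I (\<lambda>t. 2 powr p * (2 powr p * q t powr p + norm (poly Q 0) powr p))"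
    using p sq by (intro integral_le) (auto intro!: ci simp: a_def q_def)
  also have "\<dots> = 2 powr p * (2 powr p * ?I (\<lambda>t. q t powr p) + 2 * pi * norm (poly Q 0) powr p)"
    using p by (simp, subst integral_add) (auto intro!: ci simp: a_def q_def)
  also have "\<dots> \<le> 2 powr p * (2 powr p * ?I (\<lambda>t. q t powr p) + ?I (\<lambda>t. q t powr p))"
    using powr_mean_value_poly[OF p, of Q] by (intro mult_left_mono add_left_mono) (auto simp: q_def)
  also have "\<dots> = 2 powr p * (2 powr p + 1) * ?I (\<lambda>t. q t powr p)" by (simp add: algebra_simps)
  also have "\<dots> \<le> 2 powr p * (2 powr p + 1) * (C * ?I (\<lambda>t. (a t * h t) powr p))"
  proof (intro mult_left_mono)
    have "poly (Q - [:poly Q 0:] + A * B) 0 = 0" using B by simp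
    with C(1) show "?I (\<lambda>t. q t powr p) \<le> C * ?I (\<lambda>t. (a t * h t) powr p)"
      unfolding riesz_bound_def q_def ah[symmetric] by blast
  qed simp
  finally have main: "?I (\<lambda>t. a t powr (2*p)) \<le> K * ?I (\<lambda>t. (a t * h t) powr p)" by (simp add: K_def)
  have amgm: "K * (a t * h t) powr p \<le> (a t powr (2*p) + K\<^sup>2 * h t powr (2*p)) / 2" for t
  proof -
    have "x powr (2 * p) = (x powr p)\<^sup>2" for x :: real
      unfolding power2_eq_square powr_add[symmetric] by simp
    then have "a t powr (2*p) = (a t powr p)\<^sup>2" "h t powr (2*p) = (h t powr p)\<^sup>2" by blast+
    moreover have "0 \<le> (a t powr p - K * h t powr p)\<^sup>2" by simp
    moreover have "(a t * h t) powr p = a t powr p * h t powr p" by (simp add: a_def h_def powr_mult)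
    ultimately show ?thesis by (simp add: power2_diff power_mult_distrib algebra_simps)
  qed
  have "K * ?I (\<lambda>t. (a t * h t) powr p) = ?I (\<lambda>t. K * (a t * h t) powr p)" by simp
  also have "\<dots> \<le> ?I (\<lambda>t. (a t powr (2*p) + K\<^sup>2 * h t powr (2*p)) / 2)"
  proof (rule integral_le)
    show "(\<lambda>t. K * (a t * h t) powr p) integrable_on {0..2*pi}"
      using p unfolding a_def h_def norm_mult[symmetric] by (intro ci) auto
  qed (use p amgm in \<open>auto intro!: ci simp: a_def h_def\<close>)
  also have "\<dots> = (?I (\<lambda>t. a t powr (2*p)) + K\<^sup>2 * ?I (\<lambda>t. h t powr (2*p))) / 2"
    using p by (simp, subst integral_add) (auto intro!: ci simp: a_def h_def)
  finally have "?I (\<lambda>t. a t powr (2*p)) \<le> K\<^sup>2 * ?I (\<lambda>t. h t powr (2*p))" using main by simp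
  then show "?I (\<lambda>t. norm (poly A (cis t)) powr (2 * p)) \<le> (2 powr p * (2 powr p + 1) * C)\<^sup>2 *
     ?I (\<lambda>t. norm (cnj (poly A (cis t)) + poly B (cis t)) powr (2 * p))"
    unfolding a_def h_def K_def .
qed

text \<open>
  Doubling extends the interval \<open>1 < p \<le> 2\<close> to \<open>1 < p \<le> 2 ^ Suc n\<close> for every \<open>n\<close>.
\<close>

lemma riesz_bound_exists:
  assumes "p > 1"
  obtains C where "riesz_bound p C" "C \<ge> 0"
proof -
  have "\<exists>C\<ge>0. riesz_bound p C" if "p > 1" "p \<le> 2 ^ Suc n" for n p
    using that
  proof (induction n arbitrary: p)
    case 0
    then show ?case using riesz_bound_le_2[of p] by (intro exI[of _ "2 powr (1 - p/2) / (p - 1)"]) auto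
  next
    case (Suc n)
    show ?case
    proof (cases "p \<le> 2")
      case True
      then show ?thesis using Suc.prems riesz_bound_le_2[of p] by (intro exI[of _ "2 powr (1 - p/2) / (p - 1)"]) auto
    next
      case False
      then obtain C where "C \<ge> 0" "riesz_bound (p/2) C" using Suc.IH[of "p/2"] Suc.prems by auto
      then show ?thesis using riesz_bound_double[of "p/2" C] False
        by (intro exI[of _ "(2 powr (p/2) * (2 powr (p/2) + 1) * C)\<^sup>2"]) auto
    qed
  qed
  moreover obtain n where "p \<le> 2 ^ Suc n"
  proof -
    obtain n where "p < 2 ^ n" using real_arch_pow[of 2 p] by auto
    also have "(2::real) ^ n \<le> 2 ^ Suc n" by simp
    finally show thesis using that[of n] by simp
  qed
  ultimately show thesis using that assms by blast
qed

text \<open>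
  Multiplication by \<open>exp (- i N t)\<close> moves the frequencies \<open>0, \<dots>, N\<close> to \<open>-N, \<dots>, 0\<close> and those above \<open>N\<close> to positive ones.
  So truncation at \<open>N\<close> is the Riesz projection, up to a factor of modulus 1.
\<close>

lemma truncation_bound_finite:
  fixes c :: "nat \<Rightarrow> complex"
  assumes C: "riesz_bound p C" and N: "N \<le> M"
  shows "integral {0..2*pi} (\<lambda>t. norm (\<Sum>n\<le>N. c n * cis t ^ n) powr p)
     \<le> C * integral {0..2*pi} (\<lambda>t. norm (\<Sum>n\<le>M. c n * cis t ^ n) powr p)"
proof -
  define A where "A = (\<Sum>n\<le>N. monom (cnj (c n)) (N - n))"
  define B where "B = (\<Sum>n\<in>{N<..M}. monom (c n) (n - N))"
  have B0: "poly B 0 = 0" by (auto simp: B_def poly_sum poly_monom intro!: sum.neutral)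
  have nrm: "norm (cis t ^ N * x) = norm x" for t x by (simp add: norm_mult norm_power)
  have "cis t ^ N * cnj (poly A (cis t)) = (\<Sum>n\<le>N. c n * cis t ^ n)" for t
    unfolding A_def poly_sum poly_monom cnj_sum sum_distrib_left
  proof (rule sum.cong)
    fix n assume "n \<in> {..N}"
    then have "cis t ^ N = cis t ^ n * cis t ^ (N - n)" by (simp flip: power_add)
    moreover have "cis t ^ (N - n) * cnj (cis t) ^ (N - n) = 1" by (simp flip: power_mult_distrib)
    ultimately show "cis t ^ N * cnj (cnj (c n) * cis t ^ (N - n)) = c n * cis t ^ n"
      by (simp add: mult_ac)
  qed simp
  moreover have "cis t ^ N * poly B (cis t) = (\<Sum>n\<in>{N<..M}. c n * cis t ^ n)" for t
    unfolding B_def poly_sum poly_monom sum_distrib_left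
    by (rule sum.cong) (auto simp flip: power_add simp: mult_ac)
  moreover have "(\<Sum>n\<le>M. c n * cis t ^ n) = (\<Sum>n\<le>N. c n * cis t ^ n) + (\<Sum>n\<in>{N<..M}. c n * cis t ^ n)" for t
    using N by (subst sum.union_disjoint[symmetric]) (auto intro!: sum.cong)
  ultimately have "norm (\<Sum>n\<le>N. c n * cis t ^ n) = norm (poly A (cis t))"
     "norm (\<Sum>n\<le>M. c n * cis t ^ n) = norm (cnj (poly A (cis t)) + poly B (cis t))" for t
    using nrm[of t "cnj (poly A (cis t))"] nrm[of t "cnj (poly A (cis t)) + poly B (cis t)"]
    by (simp_all add: distrib_left del: complex_cnj_add)
  then show ?thesis using C B0 unfolding riesz_bound_def by simp
qed

theorem truncation_bound_circle:
  fixes c :: "nat \<Rightarrow> complex"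
  assumes C: "riesz_bound p C" "p > 0" and sm: "summable (\<lambda>n. norm (c n))"
  shows "integral {0..2*pi} (\<lambda>t. norm (\<Sum>n\<le>N. c n * cis t ^ n) powr p)
     \<le> C * integral {0..2*pi} (\<lambda>t. norm (\<Sum>n. c n * cis t ^ n) powr p)"
proof -
  have s: "summable (\<lambda>n. c n * cis t ^ n)" for t
    by (rule summable_norm_cancel) (simp add: norm_mult norm_power sm)
  have "(\<lambda>M. integral {0..2*pi} (\<lambda>t. norm (\<Sum>n\<le>M. c n * cis t ^ n) powr p))
     \<longlonglongrightarrow> integral {0..2*pi} (\<lambda>t. norm (\<Sum>n. c n * cis t ^ n) powr p)"
  proof (rule dominated_convergence(2)[where h = "\<lambda>t. (\<Sum>n. norm (c n)) powr p"])
    show "(\<lambda>t. norm (\<Sum>n\<le>M. c n * cis t ^ n) powr p) integrable_on {0..2*pi}" for M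
      using C by (intro integrable_continuous_real continuous_intros) auto
    show "(\<lambda>t. (\<Sum>n. norm (c n)) powr p) integrable_on {0..2*pi}" by (rule integrable_const_ivl)
    show "norm (norm (\<Sum>n\<le>M. c n * cis t ^ n) powr p) \<le> (\<Sum>n. norm (c n)) powr p" for M t
    proof -
      have "norm (\<Sum>n\<le>M. c n * cis t ^ n) \<le> (\<Sum>n\<le>M. norm (c n))"
        by (rule order_trans[OF norm_sum]) (simp add: norm_mult norm_power)
      also have "\<dots> \<le> (\<Sum>n. norm (c n))" by (rule sum_le_suminf[OF sm]) auto
      finally show ?thesis using C by (auto intro!: powr_mono2)
    qed
    show "(\<lambda>M. norm (\<Sum>n\<le>M. c n * cis t ^ n) powr p) \<longlonglongrightarrow> norm (\<Sum>n. c n * cis t ^ n) powr p" for t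
      using C summable_LIMSEQ'[OF s] by (intro tendsto_powr' tendsto_intros) auto
  qed
  then have "(\<lambda>M. C * integral {0..2*pi} (\<lambda>t. norm (\<Sum>n\<le>M. c n * cis t ^ n) powr p))
     \<longlonglongrightarrow> C * integral {0..2*pi} (\<lambda>t. norm (\<Sum>n. c n * cis t ^ n) powr p)"
    by (intro tendsto_intros)
  then show ?thesis
    by (rule LIMSEQ_le_const) (use truncation_bound_finite[OF C(1), of N _ c] in blast)
qed

section \<open>Hermite functions and their generating function\<close>

text \<open>
  The Hermite polynomials, scaled such that \<open>exp (2 * \<pi> * t * z - \<pi> * z\<^sup>2 / 2)\<close> generates them. The
  generating function is differentiated in \<open>z\<close> at complex arguments, hence the general field.
\<close>

fun hpoly :: "nat \<Rightarrow> 'a::{real_normed_field} \<Rightarrow> 'a" where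
  "hpoly 0 t = 1"
| "hpoly (Suc 0) t = 2 * of_real pi * t"
| "hpoly (Suc (Suc n)) t = 2 * of_real pi * t * hpoly (Suc n) t - of_real pi * of_nat (Suc n) * hpoly n t"

lemma hpoly_Suc: "hpoly (Suc n) t = 2 * of_real pi * t * hpoly n t - of_real pi * of_nat n * hpoly (n - 1) t"
  by (cases n) auto

lemma hpoly_of_real: "hpoly n (of_real t :: 'a::real_normed_field) = of_real (hpoly n t)"
  by (induction n t rule: hpoly.induct) auto

lemma hpoly_has_derivative:
  fixes t :: "'a::real_normed_field"
  shows "(hpoly n has_field_derivative 2 * of_real pi * of_nat n * hpoly (n - 1) t) (at t)"
proof (induction n "t" rule: hpoly.induct)
  case (1 t)
  have "hpoly 0 = (\<lambda>t::'a. 1)" by (rule ext) simp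
  then show ?case by simp
next
  case (2 t)
  have "hpoly (Suc 0) = (\<lambda>t::'a. 2 * of_real pi * t)" by (rule ext) simp
  then show ?case by (auto intro!: derivative_eq_intros)
next
  case (3 n t)
  have h: "hpoly (Suc n) t = 2 * of_real pi * t * hpoly n t - of_real pi * of_nat n * hpoly (n - 1) t"
    by (rule hpoly_Suc)
  have e: "hpoly (Suc (Suc n)) = (\<lambda>t::'a. 2 * of_real pi * t * hpoly (Suc n) t - of_real pi * of_nat (Suc n) * hpoly n t)"
    by (rule ext) simp
  show ?case unfolding e
    by (rule derivative_eq_intros 3 refl)+ (simp add: h algebra_simps)
qed

lemma hermite_rodrigues:
  "(deriv ^^ n) (\<lambda>s. exp (- 2 * pi * s\<^sup>2)) t = (-2) ^ n * hpoly n t * exp (- 2 * pi * t\<^sup>2)"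
proof (induction n arbitrary: t)
  case (Suc n)
  have "((\<lambda>t. (-2) ^ n * hpoly n t * exp (- 2 * pi * t\<^sup>2)) has_real_derivative
        (-2) ^ Suc n * hpoly (Suc n) t * exp (- 2 * pi * t\<^sup>2)) (at t)"
    unfolding hpoly_Suc
    by (rule derivative_eq_intros hpoly_has_derivative refl)+ (simp add: algebra_simps)
  moreover have "(deriv ^^ n) (\<lambda>s. exp (- 2 * pi * s\<^sup>2)) = (\<lambda>t. (-2) ^ n * hpoly n t * exp (- 2 * pi * t\<^sup>2))"
    using Suc.IH by (rule ext)
  ultimately show ?case by (simp add: DERIV_imp_deriv)
qed simp

abbreviation hgen :: "complex \<Rightarrow> complex \<Rightarrow> complex" where
  "hgen t z \<equiv> exp (2 * of_real pi * t * z - of_real pi * z\<^sup>2 / 2)"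

lemma hpoly_generating_deriv:
  fixes t z :: complex
  shows "(deriv ^^ n) (hgen t) z
     = hpoly n (t - z / 2) * hgen t z"
proof (induction n arbitrary: z)
  case (Suc n)
  have d: "((\<lambda>z. hpoly n (t - z / 2)) has_field_derivative 2 * of_real pi * of_nat n * hpoly (n - 1) (t - z / 2) * (- 1 / 2)) (at z)"
    by (rule DERIV_chain2[OF hpoly_has_derivative]) (auto intro!: derivative_eq_intros)
  have "((\<lambda>z. hpoly n (t - z / 2) * hgen t z) has_field_derivative
        hpoly (Suc n) (t - z / 2) * hgen t z) (at z)"
    unfolding hpoly_Suc
    by (rule derivative_eq_intros d refl | simp)+ (simp add: algebra_simps)
  moreover have "(deriv ^^ n) (hgen t) =
      (\<lambda>z. hpoly n (t - z / 2) * hgen t z)"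
    by (rule ext) (rule Suc.IH)
  ultimately show ?case by (simp add: DERIV_imp_deriv)
qed simp

lemma hpoly_generating_sums:
  fixes t z :: complex
  shows "(\<lambda>n. hpoly n t / fact n * z ^ n) sums hgen t z"
proof -
  have "(hgen t) holomorphic_on ball 0 (norm z + 1)"
    by (intro holomorphic_intros) auto
  from holomorphic_power_series[OF this, of z] show ?thesis
    by (simp add: hpoly_generating_deriv)
qed

text \<open>
  Cauchy's estimate for the generating function. That the radius \<open>R\<close> is free is what makes the series
  of Hermite functions below converge at every rate.
\<close>

lemma hpoly_bound:
  fixes t R :: real
  assumes "R > 0"
  shows "\<bar>hpoly n t\<bar> \<le> fact n * exp (2 * pi * \<bar>t\<bar> * R + pi * R\<^sup>2 / 2) / R ^ n"
proof -
  have "norm ((deriv ^^ n) (hgen (of_real t)) 0)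
      \<le> fact n * exp (2 * pi * \<bar>t\<bar> * R + pi * R\<^sup>2 / 2) / R ^ n"
  proof (rule Cauchy_inequality)
    fix z :: complex assume z: "norm (0 - z) = R"
    have "Re (2 * pi * complex_of_real t * z - pi * z\<^sup>2 / 2) \<le> norm (2 * pi * complex_of_real t * z - pi * z\<^sup>2 / 2)"
      by (rule complex_Re_le_cmod)
    also have "\<dots> \<le> norm (2 * pi * complex_of_real t * z) + norm (pi * z\<^sup>2 / 2)" by (rule norm_triangle_ineq4)
    also have "\<dots> = 2 * pi * \<bar>t\<bar> * R + pi * R\<^sup>2 / 2" using z by (simp add: norm_mult norm_power norm_divide)
    finally show "norm (hgen (of_real t) z) \<le> exp (2 * pi * \<bar>t\<bar> * R + pi * R\<^sup>2 / 2)"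
      by simp
  qed (use assms in \<open>auto intro!: holomorphic_intros continuous_intros\<close>)
  then show ?thesis by (simp add: hpoly_generating_deriv hpoly_of_real)
qed

text \<open>
  The multiple of the \<open>n\<close>-th Hermite function whose ladder relations have no square roots; the square
  of its \<open>L\<^sup>2\<close> norm is \<open>\<pi> ^ n * fact n\<close>.
\<close>

definition hfun :: "nat \<Rightarrow> real \<Rightarrow> real" where
  "hfun n t = 2 powr (1/4) * exp (- pi * t\<^sup>2) * hpoly n t"

lemma hfun_raise: "2 * pi * t * hfun n t = hfun (Suc n) t + pi * n * hfun (n - 1) t"
  unfolding hfun_def hpoly_Suc by (simp add: algebra_simps)

lemma hfun_has_derivative:
  "(hfun n has_real_derivative pi * n * hfun (n - 1) t - hfun (Suc n) t) (at t)"
  unfolding hfun_def [abs_def] hpoly_Suc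
  by (rule derivative_eq_intros hpoly_has_derivative refl)+ (simp add: algebra_simps)

definition hfun_scale :: "real \<Rightarrow> real" where
  "hfun_scale R = 2 powr (1/4) * exp (5 * pi * R\<^sup>2 / 2)"

lemma hfun_scale_pos: "hfun_scale R > 0" by (simp add: hfun_scale_def)

text \<open>
  Half of the Gaussian factor absorbs the growth \<open>exp (2 * \<pi> * \<bar>t\<bar> * R)\<close> of the polynomial factor.
\<close>

lemma hfun_bound:
  assumes R: "R > 0"
  shows "\<bar>hfun n t\<bar> \<le> hfun_scale R * fact n / R ^ n * exp (- pi * t\<^sup>2 / 2)"
proof -
  have "0 \<le> pi/2 * (\<bar>t\<bar> - 2 * R)\<^sup>2" by simp
  then have e: "- pi * t\<^sup>2 + (2 * pi * \<bar>t\<bar> * R + pi * R\<^sup>2 / 2) \<le> 5 * pi * R\<^sup>2 / 2 + - pi * t\<^sup>2 / 2"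
    by (simp add: power2_eq_square algebra_simps)
  have "\<bar>hfun n t\<bar> = 2 powr (1/4) * exp (- pi * t\<^sup>2) * \<bar>hpoly n t\<bar>" by (simp add: hfun_def abs_mult)
  also have "\<dots> \<le> 2 powr (1/4) * exp (- pi * t\<^sup>2) * (fact n * exp (2 * pi * \<bar>t\<bar> * R + pi * R\<^sup>2 / 2) / R ^ n)"
    by (intro mult_left_mono hpoly_bound R) auto
  also have "\<dots> = 2 powr (1/4) * fact n / R ^ n * exp (- pi * t\<^sup>2 + (2 * pi * \<bar>t\<bar> * R + pi * R\<^sup>2 / 2))"
    by (simp only: exp_add) simp
  also have "\<dots> \<le> 2 powr (1/4) * fact n / R ^ n * exp (5 * pi * R\<^sup>2 / 2 + - pi * t\<^sup>2 / 2)"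
    using R e by (intro mult_left_mono) auto
  also have "\<dots> = hfun_scale R * fact n / R ^ n * exp (- pi * t\<^sup>2 / 2)"
    by (simp only: exp_add hfun_scale_def) simp
  finally show ?thesis .
qed

text \<open>
  By \<open>hfun_bound\<close> with radius \<open>2 * R\<close>, a Hermite series with such coefficients converges geometrically.
  The class is stable under the ladder operators at the price of doubling \<open>R\<close>. It contains the coefficients
  \<open>z ^ n / fact n\<close> of the coherent states.
\<close>

definition coeff_bound :: "real \<Rightarrow> real \<Rightarrow> (nat \<Rightarrow> complex) \<Rightarrow> bool" where
  "coeff_bound C R \<alpha> \<longleftrightarrow> (\<forall>n. norm (\<alpha> n) * fact n \<le> C * R ^ n)"

definition hseries :: "(nat \<Rightarrow> complex) \<Rightarrow> real \<Rightarrow> complex" where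
  "hseries \<alpha> t = (\<Sum>n. \<alpha> n * of_real (hfun n t))"

text \<open>
  What differentiation, and multiplication by \<open>2 * \<pi> * t\<close>, of a Hermite series do to its coefficients.
\<close>

definition shift_deriv :: "(nat \<Rightarrow> complex) \<Rightarrow> nat \<Rightarrow> complex" where
  "shift_deriv \<alpha> n = of_real pi * of_nat (Suc n) * \<alpha> (Suc n) - (if n = 0 then 0 else \<alpha> (n - 1))"

definition shift_mult :: "(nat \<Rightarrow> complex) \<Rightarrow> nat \<Rightarrow> complex" where
  "shift_mult \<alpha> n = of_real pi * of_nat (Suc n) * \<alpha> (Suc n) + (if n = 0 then 0 else \<alpha> (n - 1))"

lemma coeff_bound_nonneg: "coeff_bound C R \<alpha> \<Longrightarrow> C \<ge> 0"
  unfolding coeff_bound_def by (drule spec[of _ 0]) (auto intro: order_trans[OF norm_ge_zero])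

lemma coeff_bound_shift_aux:
  assumes C: "coeff_bound C R \<alpha>" and R: "R \<ge> 1"
    and b: "norm \<beta> \<le> norm (of_real pi * of_nat (Suc n) * \<alpha> (Suc n)) + norm (if n = 0 then 0 else \<alpha> (n - 1))"
  shows "norm \<beta> * fact n \<le> (C * (pi * R + 1)) * (2 * R) ^ n"
proof -
  have a: "norm (\<alpha> k) * fact k \<le> C * R ^ k" for k using C by (auto simp: coeff_bound_def)
  have C0: "C \<ge> 0" using coeff_bound_nonneg[OF C] .
  have "norm \<beta> * fact n \<le> (norm (of_real pi * of_nat (Suc n) * \<alpha> (Suc n)) + norm (if n = 0 then 0 else \<alpha> (n - 1))) * fact n"
    using b by (intro mult_right_mono) auto
  also have "\<dots> = pi * (norm (\<alpha> (Suc n)) * fact (Suc n)) + n * (norm (\<alpha> (n-1)) * fact (n-1))"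
    by (cases n) (auto simp: norm_mult algebra_simps simp del: of_nat_Suc)
  also have "\<dots> \<le> pi * (C * R ^ Suc n) + n * (C * R ^ (n-1))"
    by (intro add_mono mult_left_mono a) auto
  also have "\<dots> \<le> pi * (C * R * (2*R) ^ n) + (C * (2*R) ^ n)"
  proof (intro add_mono mult_left_mono)
    have "R ^ n \<le> (2*R) ^ n" using R by (intro power_mono) auto
    then show "C * R ^ Suc n \<le> C * R * (2*R) ^ n"
      using C0 R mult_left_mono[of "R ^ n" "(2*R) ^ n" "C * R"] by (simp only: power_Suc mult.assoc) simp
    have "real n \<le> 2 ^ n" by simp
    then have "real n * R ^ (n-1) \<le> 2 ^ n * R ^ n" using R by (intro mult_mono power_increasing) auto
    then show "n * (C * R ^ (n-1)) \<le> C * (2*R) ^ n" using C0 by (simp add: power_mult_distrib mult_left_mono mult.left_commute)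
  qed auto
  also have "\<dots> = (C * (pi * R + 1)) * (2 * R) ^ n" by (simp add: algebra_simps)
  finally show ?thesis .
qed

lemma coeff_bound_shift:
  assumes "coeff_bound C R \<alpha>" "R \<ge> 1"
  shows "coeff_bound (C * (pi * R + 1)) (2 * R) (shift_deriv \<alpha>)"
    "coeff_bound (C * (pi * R + 1)) (2 * R) (shift_mult \<alpha>)"
  unfolding coeff_bound_def shift_deriv_def shift_mult_def
  by (intro allI coeff_bound_shift_aux[OF assms] norm_triangle_ineq4 norm_triangle_ineq)+

lemma hseries_term_bound:
  assumes C: "coeff_bound C R \<alpha>" and R: "R \<ge> 1"
  shows "norm (\<alpha> n * of_real (hfun n t)) \<le> C * hfun_scale (2 * R) * (1/2) ^ n"
proof -
  have "norm (\<alpha> n * of_real (hfun n t)) \<le> norm (\<alpha> n) * (hfun_scale (2*R) * fact n / (2*R) ^ n * exp (- pi * t\<^sup>2 / 2))"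
    unfolding norm_mult norm_of_real by (intro mult_left_mono hfun_bound) (use R in auto)
  also have "\<dots> = (norm (\<alpha> n) * fact n) * (hfun_scale (2*R) / (2*R) ^ n * exp (- pi * t\<^sup>2 / 2))" by simp
  also have "\<dots> \<le> (C * R ^ n) * (hfun_scale (2*R) / (2*R) ^ n * 1)"
  proof (rule mult_mono)
    show "norm (\<alpha> n) * fact n \<le> C * R ^ n" using C by (simp add: coeff_bound_def)
    show "hfun_scale (2*R) / (2*R) ^ n * exp (- pi * t\<^sup>2 / 2) \<le> hfun_scale (2*R) / (2*R) ^ n * 1"
      using R hfun_scale_pos[of "2*R"] by (intro mult_left_mono) auto
  qed (use coeff_bound_nonneg[OF C] R hfun_scale_pos[of "2*R"] in \<open>auto simp: less_imp_le\<close>)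
  also have "\<dots> = C * hfun_scale (2 * R) * (1/2) ^ n" using R by (simp add: power_mult_distrib power_divide)
  finally show ?thesis .
qed

lemma summable_geometric_half: "summable (\<lambda>n. c * (1/2) ^ n :: real)"
  by (intro summable_mult summable_geometric) auto

lemma hseries_summable:
  assumes C: "coeff_bound C R \<alpha>" and R: "R \<ge> 1"
  shows "summable (\<lambda>n. \<alpha> n * of_real (hfun n t))"
  by (rule summable_comparison_test[OF _ summable_geometric_half]) (use hseries_term_bound[OF assms] in blast)

lemma hseries_bound:
  assumes C: "coeff_bound C R \<alpha>" and R: "R \<ge> 1"
  shows "norm (hseries \<alpha> t) \<le> 2 * hfun_scale (2 * R) * C"
proof -
  have "norm (hseries \<alpha> t) \<le> (\<Sum>n. C * hfun_scale (2 * R) * (1/2) ^ n)"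
    unfolding hseries_def by (rule suminf_le_const norm_suminf_le[OF hseries_term_bound[OF assms] summable_geometric_half])
  also have "\<dots> = C * hfun_scale (2 * R) * 2"
    by (subst suminf_mult) (auto simp: suminf_geometric)
  finally show ?thesis by (simp add: algebra_simps)
qed

lemma hseries_shift:
  assumes C: "coeff_bound C R \<alpha>" and R: "R \<ge> 1" and s: "s = 1 \<or> s = -1"
  shows "(\<lambda>n. \<alpha> n * (of_real pi * of_nat n * of_real (hfun (n - 1) t) + s * of_real (hfun (Suc n) t)))
     sums (hseries (\<lambda>n. of_real pi * of_nat (Suc n) * \<alpha> (Suc n) + s * (if n = 0 then 0 else \<alpha> (n - 1))) t)"
proof -
  have b1: "coeff_bound (C * (pi * R + 1)) (2 * R) (\<lambda>n. of_real pi * of_nat (Suc n) * \<alpha> (Suc n))"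
    unfolding coeff_bound_def by (intro allI coeff_bound_shift_aux[OF C R]) simp
  have b2: "coeff_bound (C * (pi * R + 1)) (2 * R) (\<lambda>n. s * (if n = 0 then 0 else \<alpha> (n - 1)))"
    unfolding coeff_bound_def using s by (intro allI coeff_bound_shift_aux[OF C R]) (auto simp: norm_mult)
  have R2: "2 * R \<ge> 1" using R by simp
  have 1: "(\<lambda>n. of_real pi * of_nat (Suc n) * \<alpha> (Suc n) * of_real (hfun n t)) sums hseries (\<lambda>n. of_real pi * of_nat (Suc n) * \<alpha> (Suc n)) t"
    unfolding hseries_def by (intro summable_sums hseries_summable[OF b1 R2])
  have 1: "(\<lambda>n. \<alpha> n * (of_real pi * of_nat n * of_real (hfun (n - 1) t))) sums hseries (\<lambda>n. of_real pi * of_nat (Suc n) * \<alpha> (Suc n)) t"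
    using 1 sums_Suc_iff[of "\<lambda>n. \<alpha> n * (of_real pi * of_nat n * of_real (hfun (n - 1) t))"
      "hseries (\<lambda>n. of_real pi * of_nat (Suc n) * \<alpha> (Suc n)) t"] by (simp add: mult_ac)
  have "(\<lambda>n. s * (if n = 0 then 0 else \<alpha> (n - 1)) * of_real (hfun n t)) sums hseries (\<lambda>n. s * (if n = 0 then 0 else \<alpha> (n - 1))) t"
    unfolding hseries_def by (intro summable_sums hseries_summable[OF b2 R2])
  then have 2: "(\<lambda>n. \<alpha> n * (s * of_real (hfun (Suc n) t))) sums hseries (\<lambda>n. s * (if n = 0 then 0 else \<alpha> (n - 1))) t"
    using sums_Suc_iff[of "\<lambda>n. s * (if n = 0 then 0 else \<alpha> (n - 1)) * of_real (hfun n t)"] by (simp add: mult_ac)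
  have "hseries (\<lambda>n. of_real pi * of_nat (Suc n) * \<alpha> (Suc n)) t + hseries (\<lambda>n. s * (if n = 0 then 0 else \<alpha> (n - 1))) t
    = hseries (\<lambda>n. of_real pi * of_nat (Suc n) * \<alpha> (Suc n) + s * (if n = 0 then 0 else \<alpha> (n - 1))) t"
    unfolding hseries_def
    by (subst suminf_add[OF hseries_summable[OF b1 R2] hseries_summable[OF b2 R2]]) (simp add: algebra_simps)
  with sums_add[OF 1 2] show ?thesis by (simp add: distrib_left)
qed

lemma hseries_mult:
  assumes C: "coeff_bound C R \<alpha>" and R: "R \<ge> 1"
  shows "of_real (2 * pi * t) * hseries \<alpha> t = hseries (shift_mult \<alpha>) t"
proof -
  have "(\<lambda>n. of_real (2 * pi * t) * (\<alpha> n * of_real (hfun n t))) sums (of_real (2 * pi * t) * hseries \<alpha> t)"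
    unfolding hseries_def by (intro sums_mult summable_sums hseries_summable[OF C R])
  moreover have "of_real (2 * pi * t) * (\<alpha> n * of_real (hfun n t)) =
     \<alpha> n * (of_real pi * of_nat n * of_real (hfun (n - 1) t) + 1 * of_real (hfun (Suc n) t))" for n

    using arg_cong[OF hfun_raise[of t n], of complex_of_real] by (simp add: mult.left_commute add.commute)
  ultimately have "(\<lambda>n. \<alpha> n * (of_real pi * of_nat n * of_real (hfun (n - 1) t) + 1 * of_real (hfun (Suc n) t)))
     sums (of_real (2 * pi * t) * hseries \<alpha> t)" by (simp only:)
  from sums_unique2[OF this hseries_shift[OF C R, of 1 t]] show ?thesis
    by (simp only: shift_mult_def [abs_def] mult_1_left) simp
qed

lemma hseries_has_derivative:
  assumes C: "coeff_bound C R \<alpha>" and R: "R \<ge> 1"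
  shows "(hseries \<alpha> has_vector_derivative hseries (shift_deriv \<alpha>) t) (at t)"
proof -
  define g' where "g' = (\<lambda>t. hseries (shift_deriv \<alpha>) t)"
  define d where "d = (\<lambda>n t. \<alpha> n * (of_real pi * of_nat n * of_real (hfun (n - 1) t) + (-1) * of_real (hfun (Suc n) t)))"
  have sd: "(\<lambda>n. d n t) sums g' t" for t
    using hseries_shift[OF C R, of "-1" t] unfolding d_def g'_def shift_deriv_def[abs_def] by simp
  define M where "M = (\<lambda>n. (C * (pi * R + 1)) * hfun_scale (4 * R) * ((1/2)^(n-1) + (1/2) ^ Suc n))"
  have b1: "coeff_bound (C * (pi * R + 1)) (2 * R) (\<lambda>n. of_real pi * of_nat (Suc n) * \<alpha> (Suc n))"
    unfolding coeff_bound_def by (intro allI coeff_bound_shift_aux[OF C R]) simp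
  have b2: "coeff_bound (C * (pi * R + 1)) (2 * R) (\<lambda>n. (if n = 0 then 0 else \<alpha> (n - 1)))"
    unfolding coeff_bound_def by (intro allI coeff_bound_shift_aux[OF C R]) auto
  have R2: "2 * R \<ge> 1" using R by simp
  have C0: "C * (pi * R + 1) * hfun_scale (4*R) \<ge> 0"
    using coeff_bound_nonneg[OF C] R hfun_scale_pos[of "4*R"] by (intro mult_nonneg_nonneg) auto
  have dM: "norm (d n t) \<le> M n" for n t
  proof -
    have "norm (\<alpha> n * (of_real pi * of_nat n * of_real (hfun (n - 1) t))) \<le> C * (pi * R + 1) * hfun_scale (4 * R) * (1/2)^(n-1)"
      using hseries_term_bound[OF b1 R2, of "n-1" t] C0 by (cases n) (auto simp: mult_ac)
    moreover have "norm (\<alpha> n * ((-1) * of_real (hfun (Suc n) t))) \<le> C * (pi * R + 1) * hfun_scale (4 * R) * (1/2)^Suc n"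
      using hseries_term_bound[OF b2 R2, of "Suc n" t] by (auto simp: norm_mult)
    ultimately show ?thesis unfolding d_def M_def distrib_left by (intro norm_triangle_le add_mono)
  qed
  have sM: "summable M"
  proof -
    have "summable (\<lambda>n. (1/2::real)^(n-1))" by (subst summable_Suc_iff[symmetric]) simp
    then show ?thesis unfolding M_def by (intro summable_mult summable_add) auto
  qed
  have "\<exists>g. \<forall>x\<in>UNIV. (\<lambda>n. \<alpha> n * of_real (hfun n x)) sums g x \<and> (g has_derivative (\<lambda>h. h *\<^sub>R g' x)) (at x within UNIV)"
  proof (rule has_derivative_series)
    show "((\<lambda>x. \<alpha> n * of_real (hfun n x)) has_derivative (\<lambda>h. h *\<^sub>R d n x)) (at x within UNIV)" for n x
    proof -
      have "((\<lambda>x. complex_of_real (hfun n x)) has_vector_derivative of_real (pi * n * hfun (n - 1) x - hfun (Suc n) x)) (at x)"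
        using hfun_has_derivative[of n x] by (intro has_vector_derivative_of_real) (simp add: has_real_derivative_iff_has_vector_derivative)
      from has_vector_derivative_mult_right[OF this, of "\<alpha> n"]
      show ?thesis by (simp add: has_vector_derivative_def d_def)
    qed
    show "\<forall>\<^sub>F n in sequentially. \<forall>x\<in>UNIV. \<forall>h. norm ((\<Sum>i<n. h *\<^sub>R d i x) - h *\<^sub>R g' x) \<le> e * norm h" if "e > 0" for e
    proof -
      have "uniform_limit UNIV (\<lambda>n x. \<Sum>i<n. d i x) (\<lambda>x. \<Sum>i. d i x) sequentially"
        by (rule Weierstrass_m_test[OF dM sM])
      moreover have "(\<Sum>i. d i x) = g' x" for x using sd[of x] by (simp add: sums_iff)
      ultimately have "\<forall>\<^sub>F n in sequentially. \<forall>x\<in>UNIV. dist (\<Sum>i<n. d i x) (g' x) < e"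
        using that uniform_limitD by fastforce
      then show ?thesis
      proof eventually_elim
        case (elim n)
        show ?case
        proof (intro ballI allI)
          fix x h
          have "(\<Sum>i<n. h *\<^sub>R d i x) - h *\<^sub>R g' x = h *\<^sub>R ((\<Sum>i<n. d i x) - g' x)"
            by (simp add: scaleR_right_diff_distrib scaleR_sum_right)
          then have "norm ((\<Sum>i<n. h *\<^sub>R d i x) - h *\<^sub>R g' x) = norm h * norm ((\<Sum>i<n. d i x) - g' x)" by simp
          also have "\<dots> \<le> norm h * e" using elim by (intro mult_left_mono) (auto simp: dist_norm less_imp_le)
          finally show "norm ((\<Sum>i<n. h *\<^sub>R d i x) - h *\<^sub>R g' x) \<le> e * norm h" by (simp add: mult.commute)
        qed
      qed
    qed
    show "(\<lambda>n. \<alpha> n * of_real (hfun n 0)) sums hseries \<alpha> 0"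
      unfolding hseries_def by (intro summable_sums hseries_summable[OF C R])
  qed auto
  then obtain g where g: "\<And>x. (\<lambda>n. \<alpha> n * of_real (hfun n x)) sums g x" "\<And>x. (g has_derivative (\<lambda>h. h *\<^sub>R g' x)) (at x)" by auto
  have "g = hseries \<alpha>" unfolding hseries_def using g(1) by (auto simp: sums_iff fun_eq_iff)
  then show ?thesis using g(2)[of t] by (simp add: has_vector_derivative_def g'_def)
qed

text \<open>
  Derivatives and powers of \<open>t\<close> act on the coefficients only. So all Schwartz seminorms of a Hermite
  series are bounded by the constant \<open>C\<close> of its coefficients, with a factor that depends on \<open>R\<close> and
  the seminorm but not on the series.
\<close>

lemma hseries_weighted_bound:
  assumes "R \<ge> 1"
  obtains Q where "Q \<ge> 0" "\<And>C \<alpha> t. coeff_bound C R \<alpha> \<Longrightarrow> (1 + \<bar>t\<bar>) ^ k * norm (hseries ((shift_deriv ^^ m) \<alpha>) t) \<le> Q * C"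
proof -
  have D: "\<exists>c r. c \<ge> 0 \<and> r \<ge> 1 \<and> (\<forall>C \<alpha>. coeff_bound C R \<alpha> \<longrightarrow> coeff_bound (c * C) r ((shift_deriv ^^ m) \<alpha>))"
  proof (induction m)
    case 0 then show ?case by (intro exI[of _ 1] exI[of _ R]) (use assms in auto)
  next
    case (Suc m)
    then obtain c r where c: "c \<ge> 0" "r \<ge> 1" "\<And>C \<alpha>. coeff_bound C R \<alpha> \<Longrightarrow> coeff_bound (c * C) r ((shift_deriv ^^ m) \<alpha>)" by blast
    then show ?case using coeff_bound_shift(1)[OF c(3)]
      by (intro exI[of _ "c * (pi * r + 1)"] exI[of _ "2 * r"]) (auto simp: mult_ac)
  qed
  have T: "\<exists>q\<ge>0. \<forall>C \<alpha> t. coeff_bound C r \<alpha> \<longrightarrow> \<bar>2 * pi * t\<bar> ^ k * norm (hseries \<alpha> t) \<le> q * C" if "r \<ge> 1" for r k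
    using that
  proof (induction k arbitrary: r)
    case 0
    then show ?case using hseries_bound[where R=r] hfun_scale_pos[of "2*r"]
      by (intro exI[of _ "2 * hfun_scale (2*r)"]) auto
  next
    case (Suc k)
    from Suc.IH[of "2*r"] Suc.prems obtain q where q: "q \<ge> 0"
      "\<And>C \<alpha> t. coeff_bound C (2*r) \<alpha> \<Longrightarrow> \<bar>2 * pi * t\<bar> ^ k * norm (hseries \<alpha> t) \<le> q * C" by auto
    show ?case
    proof (intro exI[of _ "q * (pi * r + 1)"] conjI allI impI)
      fix C \<alpha> t assume C: "coeff_bound C r \<alpha>"
      have "\<bar>2 * pi * t\<bar> ^ Suc k * norm (hseries \<alpha> t) = \<bar>2 * pi * t\<bar> ^ k * norm (of_real (2 * pi * t) * hseries \<alpha> t)"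
        by (simp only: norm_mult norm_of_real power_Suc mult_ac)
      also have "\<dots> \<le> q * (C * (pi * r + 1))" unfolding hseries_mult[OF C Suc.prems]
        by (intro q(2) coeff_bound_shift C Suc.prems)
      finally show "\<bar>2 * pi * t\<bar> ^ Suc k * norm (hseries \<alpha> t) \<le> q * (pi * r + 1) * C" by (simp add: mult_ac)
    qed (use q(1) Suc.prems in auto)
  qed
  from D obtain c r where c: "c \<ge> 0" "r \<ge> 1" "\<And>C \<alpha>. coeff_bound C R \<alpha> \<Longrightarrow> coeff_bound (c * C) r ((shift_deriv ^^ m) \<alpha>)" by blast
  from T[OF c(2), of k] T[OF c(2), of 0] obtain q q0 where q: "q \<ge> 0" "q0 \<ge> 0"
    "\<And>C \<alpha> t. coeff_bound C r \<alpha> \<Longrightarrow> \<bar>2 * pi * t\<bar> ^ k * norm (hseries \<alpha> t) \<le> q * C"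
    "\<And>C \<alpha> t. coeff_bound C r \<alpha> \<Longrightarrow> norm (hseries \<alpha> t) \<le> q0 * C" by auto
  show thesis
  proof (rule that[of "2 ^ k * (q0 + q) * c"])
    fix C \<alpha> t assume "coeff_bound C R \<alpha>"
    from c(3)[OF this] have b: "coeff_bound (c * C) r ((shift_deriv ^^ m) \<alpha>)" .
    let ?e = "norm (hseries ((shift_deriv ^^ m) \<alpha>) t)"
    have "(1 + \<bar>t\<bar>) ^ k \<le> (2 * max 1 \<bar>2 * pi * t\<bar>) ^ k"
    proof (rule power_mono)
      have "\<bar>t\<bar> \<le> \<bar>2 * pi * t\<bar>" using pi_ge_two by (simp add: abs_mult mult_le_cancel_right1)
      then show "1 + \<bar>t\<bar> \<le> 2 * max 1 \<bar>2 * pi * t\<bar>" by linarith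
    qed auto
    also have "\<dots> \<le> 2 ^ k * (1 + \<bar>2 * pi * t\<bar> ^ k)"
      unfolding power_mult_distrib by (intro mult_left_mono) (auto simp: max_def)
    finally have "(1 + \<bar>t\<bar>) ^ k * ?e \<le> 2 ^ k * (1 + \<bar>2 * pi * t\<bar> ^ k) * ?e"
      by (intro mult_right_mono) auto
    also have "\<dots> = 2 ^ k * (?e + \<bar>2 * pi * t\<bar> ^ k * ?e)" by (simp add: algebra_simps)
    also have "\<dots> \<le> 2 ^ k * (q0 * (c * C) + q * (c * C))" by (intro mult_left_mono add_mono q b) auto
    finally show "(1 + \<bar>t\<bar>) ^ k * ?e \<le> 2 ^ k * (q0 + q) * c * C" by (simp add: algebra_simps)
  qed (use c q in auto)
qed

text \<open>
  For \<open>z = x - i \<omega>\<close> the conjugate of the Gaussian shifted by \<open>(x, \<omega>)\<close>, up to a scalar: a coherent state.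
\<close>

definition gen :: "complex \<Rightarrow> real \<Rightarrow> complex" where
  "gen z t = of_real (2 powr (1/4)) * exp (2 * of_real pi * of_real t * z - of_real (pi * t\<^sup>2) - of_real pi * z\<^sup>2 / 2)"

abbreviation expcoeff :: "complex \<Rightarrow> nat \<Rightarrow> complex" where "expcoeff z n \<equiv> z ^ n / fact n"

abbreviation unit_seq :: "nat \<Rightarrow> nat \<Rightarrow> complex" where "unit_seq n k \<equiv> (if k = n then 1 else 0)"

lemma gen_eq_hseries: "gen z = hseries (expcoeff z)"
proof
  fix t
  have "(\<lambda>n. of_real (2 powr (1/4) * exp (- pi * t\<^sup>2)) * (hpoly n (of_real t) / fact n * z ^ n)) sums
     (of_real (2 powr (1/4) * exp (- pi * t\<^sup>2)) * hgen (of_real t) z)"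
    by (intro sums_mult hpoly_generating_sums)
  moreover have "of_real (2 powr (1/4) * exp (- pi * t\<^sup>2)) * (hpoly n (of_real t) / fact n * z ^ n) = expcoeff z n * of_real (hfun n t)" for n
    by (simp add: hfun_def hpoly_of_real)
  moreover have "of_real (2 powr (1/4) * exp (- pi * t\<^sup>2)) * hgen (of_real t) z = gen z t"
  proof -
    have "exp (of_real (- pi * t\<^sup>2)) * hgen (of_real t) z = exp (2 * of_real pi * of_real t * z - of_real (pi * t\<^sup>2) - of_real pi * z\<^sup>2 / 2)"
      unfolding mult_exp_exp by (rule arg_cong[of _ _ exp]) simp
    then show ?thesis unfolding gen_def of_real_mult exp_of_real[symmetric] by (simp only: mult.assoc)
  qed
  ultimately have "(\<lambda>n. expcoeff z n * of_real (hfun n t)) sums gen z t" by (simp only:)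
  then show "gen z t = hseries (expcoeff z) t" unfolding hseries_def by (simp add: sums_iff)
qed

lemma hfun_eq_hseries: "hseries (unit_seq n) t = of_real (hfun n t)"
proof -
  have "(\<lambda>k. unit_seq n k * of_real (hfun k t)) sums (unit_seq n n * of_real (hfun n t))"
    by (rule sums_single[of n "\<lambda>k. unit_seq n k * of_real (hfun k t)", THEN sums_cong[THEN iffD1, rotated]]) auto
  then show ?thesis by (simp add: hseries_def sums_iff)
qed

lemma coeff_bound_expcoeff: "norm z \<le> R \<Longrightarrow> coeff_bound 1 R (expcoeff z)"
  by (auto simp: coeff_bound_def norm_divide norm_power intro: power_mono)

lemma coeff_bound_unit_seq: "R > 0 \<Longrightarrow> coeff_bound (fact n / R ^ n) R (unit_seq n)"
  by (auto simp: coeff_bound_def)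

text \<open>
  The radius is at least twice \<open>\<bar>z\<bar>\<close>, so the tail of the exponential series is smaller by \<open>(1/2) ^ M\<close>.
\<close>

lemma coeff_bound_expcoeff_tail:
  assumes "2 * norm z \<le> R"
  shows "coeff_bound ((1/2) ^ M) R (\<lambda>n. if n \<le> M then 0 else expcoeff z n)"
  unfolding coeff_bound_def
proof
  fix n
  show "norm (if n \<le> M then 0 else expcoeff z n) * fact n \<le> (1/2) ^ M * R ^ n"
  proof (cases "n \<le> M")
    case True then show ?thesis using assms norm_ge_zero[of z] by (auto simp del: norm_ge_zero)
  next
    case False
    have "norm z ^ n \<le> (R/2) ^ n" using assms by (intro power_mono) auto
    also have "\<dots> = (1/2) ^ n * R ^ n" by (simp add: power_divide)
    also have "\<dots> \<le> (1/2) ^ M * R ^ n"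
      using False assms norm_ge_zero[of z] by (intro mult_right_mono power_decreasing) (auto simp del: norm_ge_zero)
    finally show ?thesis using False by (simp add: norm_divide norm_power)
  qed
qed

definition gen_deriv :: "nat \<Rightarrow> complex \<Rightarrow> real \<Rightarrow> complex" where
  "gen_deriv m z = hseries ((shift_deriv ^^ m) (expcoeff z))"

definition hfun_deriv :: "nat \<Rightarrow> nat \<Rightarrow> real \<Rightarrow> complex" where
  "hfun_deriv m n = hseries ((shift_deriv ^^ m) (unit_seq n))"

lemma coeff_bound_iterate:
  assumes "coeff_bound C R \<alpha>" "R \<ge> 1"
  shows "\<exists>C' R'. R' \<ge> 1 \<and> coeff_bound C' R' ((shift_deriv ^^ m) \<alpha>)"
proof (induction m)
  case 0 then show ?case using assms by auto
next
  case (Suc m)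
  then obtain C' R' where "R' \<ge> 1" "coeff_bound C' R' ((shift_deriv ^^ m) \<alpha>)" by blast
  then show ?case using coeff_bound_shift(1)[of C' R'] by (intro exI[of _ "C' * (pi * R' + 1)"] exI[of _ "2 * R'"]) auto
qed

lemma hseries_iterate_has_derivative:
  assumes "coeff_bound C R \<alpha>" "R \<ge> 1"
  shows "(hseries ((shift_deriv ^^ m) \<alpha>) has_vector_derivative hseries ((shift_deriv ^^ Suc m) \<alpha>) t) (at t)"
  using coeff_bound_iterate[OF assms, of m] hseries_has_derivative by auto

lemma gen_deriv_0: "gen_deriv 0 z = gen z" by (simp add: gen_deriv_def gen_eq_hseries)

lemma hfun_deriv_0: "hfun_deriv 0 n = (\<lambda>t. of_real (hfun n t))"
  by (simp add: hfun_deriv_def hfun_eq_hseries fun_eq_iff)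

lemma gen_deriv_has_derivative: "(gen_deriv m z has_vector_derivative gen_deriv (Suc m) z t) (at t)"
  unfolding gen_deriv_def
  by (rule hseries_iterate_has_derivative[OF coeff_bound_expcoeff[of z "norm z + 1"]]) auto

lemma hfun_deriv_has_derivative: "(hfun_deriv m n has_vector_derivative hfun_deriv (Suc m) n t) (at t)"
  unfolding hfun_deriv_def
  by (rule hseries_iterate_has_derivative[OF coeff_bound_unit_seq[of 1]]) auto

lemma gen_deriv_bounded:
  obtains Q where "\<And>t. (1 + \<bar>t\<bar>) ^ k * norm (gen_deriv m z t) \<le> Q"
proof -
  have "norm z + 1 \<ge> 1" by simp
  from hseries_weighted_bound[OF this, of k m]
  obtain Q where "Q \<ge> 0" and Q: "\<And>C \<alpha> t. coeff_bound C (norm z + 1) \<alpha> \<Longrightarrow> (1 + \<bar>t\<bar>) ^ k * norm (hseries ((shift_deriv ^^ m) \<alpha>) t) \<le> Q * C"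
    by blast
  from Q[OF coeff_bound_expcoeff[of z]] show thesis using that[of Q] unfolding gen_deriv_def by simp
qed

lemma hfun_deriv_bounded:
  assumes "R \<ge> 1"
  obtains Q where "Q \<ge> 0" "\<And>n t. (1 + \<bar>t\<bar>) ^ k * norm (hfun_deriv m n t) \<le> Q * fact n / R ^ n"
proof -
  obtain Q where Q: "Q \<ge> 0" "\<And>C \<alpha> t. coeff_bound C R \<alpha> \<Longrightarrow> (1 + \<bar>t\<bar>) ^ k * norm (hseries ((shift_deriv ^^ m) \<alpha>) t) \<le> Q * C"
    using hseries_weighted_bound[OF assms, of k m] by auto
  show thesis using that[of Q] Q(1) Q(2)[OF coeff_bound_unit_seq] assms unfolding hfun_deriv_def by simp
qed

lemma shift_deriv_linear_step:
  "shift_deriv (\<lambda>n. a * \<alpha> n + \<beta> n) = (\<lambda>n. a * shift_deriv \<alpha> n + shift_deriv \<beta> n)"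
  by (rule ext) (simp add: shift_deriv_def algebra_simps)

lemma shift_deriv_linear:
  "(shift_deriv ^^ m) (\<lambda>n. a * \<alpha> n + \<beta> n) = (\<lambda>n. a * (shift_deriv ^^ m) \<alpha> n + (shift_deriv ^^ m) \<beta> n)"
proof (induction m)
  case (Suc m)
  show ?case by (simp only: funpow.simps o_apply Suc.IH shift_deriv_linear_step)
qed simp

lemma hseries_iterate_linear:
  assumes "coeff_bound C R \<alpha>" "R \<ge> 1" "coeff_bound C' R' \<beta>" "R' \<ge> 1"
  shows "hseries ((shift_deriv ^^ m) (\<lambda>n. a * \<alpha> n + \<beta> n)) t =
     a * hseries ((shift_deriv ^^ m) \<alpha>) t + hseries ((shift_deriv ^^ m) \<beta>) t"
proof -
  obtain D S D' S' where b: "S \<ge> 1" "coeff_bound D S ((shift_deriv ^^ m) \<alpha>)"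
     "S' \<ge> 1" "coeff_bound D' S' ((shift_deriv ^^ m) \<beta>)"
    using coeff_bound_iterate[OF assms(1,2), of m] coeff_bound_iterate[OF assms(3,4), of m] by blast
  show ?thesis unfolding shift_deriv_linear hseries_def
    using hseries_summable[OF b(2,1), of t] hseries_summable[OF b(4,3), of t]
    by (simp add: suminf_mult suminf_add summable_mult algebra_simps flip: suminf_mult)
qed

lemma gen_deriv_minus_partial:
  "gen_deriv m z t - (\<Sum>n\<le>M. expcoeff z n * hfun_deriv m n t) =
     hseries ((shift_deriv ^^ m) (\<lambda>n. if n \<le> M then 0 else expcoeff z n)) t"
proof (induction M)
  case 0
  have b: "coeff_bound ((1/2) ^ 0) (2 * (norm z + 1)) (\<lambda>n. if n \<le> 0 then 0 else expcoeff z n)"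
    by (rule coeff_bound_expcoeff_tail) auto
  have "expcoeff z = (\<lambda>n. 1 * unit_seq 0 n + (if n \<le> 0 then 0 else expcoeff z n))" by auto
  then show ?case unfolding gen_deriv_def hfun_deriv_def
    using hseries_iterate_linear[OF coeff_bound_unit_seq[of 1 0] _ b, of m 1 t] by simp
next
  case (Suc M)
  have b: "coeff_bound ((1/2) ^ Suc M) (2 * (norm z + 1)) (\<lambda>n. if n \<le> Suc M then 0 else expcoeff z n)"
    by (rule coeff_bound_expcoeff_tail) auto
  have "(\<lambda>n. if n \<le> M then 0 else expcoeff z n) =
     (\<lambda>n. expcoeff z (Suc M) * unit_seq (Suc M) n + (if n \<le> Suc M then 0 else expcoeff z n))"
    by (rule ext) (auto simp only: le_Suc_eq mult_1_right mult_zero_right add_0_right add_0_left split: if_splits)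
  then have "hseries ((shift_deriv ^^ m) (\<lambda>n. if n \<le> M then 0 else expcoeff z n)) t
     = expcoeff z (Suc M) * hfun_deriv m (Suc M) t + hseries ((shift_deriv ^^ m) (\<lambda>n. if n \<le> Suc M then 0 else expcoeff z n)) t"
    unfolding hfun_deriv_def
    using hseries_iterate_linear[OF coeff_bound_unit_seq[of 1 "Suc M"] _ b, of m "expcoeff z (Suc M)" t] by simp
  then show ?case using Suc.IH by (simp add: algebra_simps)
qed

text \<open>
  The Hermite expansion of a coherent state converges geometrically in every Schwartz seminorm.
\<close>

lemma gen_deriv_tail_bound:
  obtains Q where "Q \<ge> 0"
   "\<And>M t. (1 + \<bar>t\<bar>) ^ k * norm (gen_deriv m z t - (\<Sum>n\<le>M. expcoeff z n * hfun_deriv m n t)) \<le> Q * (1/2) ^ M"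
proof -
  obtain Q where Q: "Q \<ge> 0" "\<And>C \<alpha> t. coeff_bound C (2 * norm z + 1) \<alpha> \<Longrightarrow> (1 + \<bar>t\<bar>) ^ k * norm (hseries ((shift_deriv ^^ m) \<alpha>) t) \<le> Q * C"
    using hseries_weighted_bound[of "2 * norm z + 1" k m] norm_ge_zero[of z] by (smt (verit, best))
  show thesis by (rule that[OF Q(1)]) (unfold gen_deriv_minus_partial, intro Q(2) coeff_bound_expcoeff_tail, simp)
qed

text \<open>
  Just enough decay for integrability, and for integration by parts without boundary terms.
\<close>

definition schwartz_decay :: "(real \<Rightarrow> complex) \<Rightarrow> bool" where
  "schwartz_decay f \<longleftrightarrow> continuous_on UNIV f \<and> (\<exists>Q. \<forall>t. (1 + \<bar>t\<bar>) ^ 2 * norm (f t) \<le> Q)"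

lemma integrable_inverse_square: "integrable lborel (\<lambda>t::real. 1 / (1 + \<bar>t\<bar>) ^ 2)"
proof -
  have I: "integrable lborel (\<lambda>x::real. inverse (1 + x^2))"
    using integrable_inverse_1_plus_square by (simp add: set_integrable_def einterval_def)
  have *: "norm (1 / (1 + \<bar>t\<bar>) ^ 2) \<le> norm (inverse (1 + t^2))" for t :: real
  proof -
    have "0 < 1 + t^2" by (simp add: add_pos_nonneg)
    then show ?thesis by (simp add: power2_eq_square field_simps)
  qed
  show ?thesis by (rule Bochner_Integration.integrable_bound[OF I]) (use * in auto)
qed

lemma schwartz_decay_integrable:
  assumes "schwartz_decay f" shows "integrable lborel f"
proof -
  obtain Q where Q: "\<And>t. (1 + \<bar>t\<bar>) ^ 2 * norm (f t) \<le> Q" using assms unfolding schwartz_decay_def by blast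
  have "f \<in> borel_measurable borel" using assms by (auto simp: schwartz_decay_def intro: borel_measurable_continuous_onI)
  then have m: "f \<in> borel_measurable lborel" by simp
  have "norm (f t) \<le> norm (Q * (1 / (1 + \<bar>t\<bar>) ^ 2))" for t
  proof -
    have "norm (f t) \<le> Q * (1 / (1 + \<bar>t\<bar>) ^ 2)" using Q[of t] by (simp add: field_simps pos_le_divide_eq)
    then show ?thesis by (smt (verit) norm_ge_zero real_norm_def)
  qed
  then show ?thesis
    by (intro Bochner_Integration.integrable_bound[OF integrable_mult_right[OF integrable_inverse_square, of Q] m]) auto
qed

lemma schwartz_decay_lim:
  assumes "schwartz_decay f"
  shows "(f \<longlongrightarrow> 0) at_top" "(f \<longlongrightarrow> 0) at_bot"
proof -
  obtain Q where Q: "\<And>t. (1 + \<bar>t\<bar>) ^ 2 * norm (f t) \<le> Q" using assms unfolding schwartz_decay_def by blast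
  have Q0: "Q \<ge> 0" using Q[of 0] by (simp add: order_trans[OF norm_ge_zero])
  have b: "norm (f t) \<le> Q * inverse \<bar>t\<bar>" if "t \<noteq> 0" for t
  proof -
    have "\<bar>t\<bar> * norm (f t) \<le> (1 + \<bar>t\<bar>) ^ 2 * norm (f t)"
      by (intro mult_right_mono) (auto simp: power2_eq_square algebra_simps)
    also have "\<dots> \<le> Q" by (rule Q)
    finally show ?thesis using that by (simp add: field_simps)
  qed
  have 1: "((\<lambda>t. Q * inverse \<bar>t\<bar>) \<longlongrightarrow> Q * 0) at_top"
    by (intro tendsto_mult tendsto_const tendsto_inverse_0_at_top filterlim_abs_real)
  have 2: "((\<lambda>t. Q * inverse \<bar>t\<bar>) \<longlongrightarrow> Q * 0) at_bot"
    using 1 unfolding filterlim_at_bot_mirror by simp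
  show "(f \<longlongrightarrow> 0) at_top"
    by (rule Lim_null_comparison[OF _ 1[simplified]], rule eventually_mono[OF eventually_gt_at_top[of 0]], rule b) auto
  show "(f \<longlongrightarrow> 0) at_bot"
    by (rule Lim_null_comparison[OF _ 2[simplified]], rule eventually_mono[OF eventually_gt_at_bot[of 0]], rule b) auto
qed

lemma integral_deriv_eq_0:
  assumes "schwartz_decay f" "schwartz_decay f'" "\<And>t. (f has_vector_derivative f' t) (at t)"
  shows "(LINT t|lborel. f' t) = 0"
proof -
  have i: "set_integrable lborel (einterval (-\<infinity>) \<infinity>) f'"
    using schwartz_decay_integrable[OF assms(2)] by (simp add: set_integrable_def einterval_def)
  have c: "isCont f' x" for x using assms(2) by (simp add: schwartz_decay_def continuous_on_eq_continuous_at)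
  have "(LBINT x=-\<infinity>..\<infinity>. f' x) = 0 - 0"
    by (rule interval_integral_FTC_integrable[OF _ assms(3) c i])
      (use schwartz_decay_lim[OF assms(1)] in \<open>auto simp: at_left_PInf at_right_MInf filterlim_filtermap o_def\<close>)
  then show ?thesis by (simp add: interval_lebesgue_integral_def einterval_def set_lebesgue_integral_def)
qed

lemma schwartz_decay_hfun: "schwartz_decay (hfun_deriv m n)"
proof -
  obtain Q where "\<And>n t. (1 + \<bar>t\<bar>) ^ 2 * norm (hfun_deriv m n t) \<le> Q * fact n / 1 ^ n"
    using hfun_deriv_bounded[of 1 2 m] by (metis order_refl)
  moreover have "continuous_on UNIV (hfun_deriv m n)"
    using hfun_deriv_has_derivative[of m n] has_vector_derivative_continuous continuous_at_imp_continuous_on by blast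
  ultimately show ?thesis unfolding schwartz_decay_def by blast
qed

lemma schwartz_decay_gen: "schwartz_decay (gen_deriv m z)"
proof -
  obtain Q where "\<And>t. (1 + \<bar>t\<bar>) ^ 2 * norm (gen_deriv m z t) \<le> Q"
    using gen_deriv_bounded[of 2 m z] by auto
  moreover have "continuous_on UNIV (gen_deriv m z)"
    using gen_deriv_has_derivative[of m z] has_vector_derivative_continuous continuous_at_imp_continuous_on by blast
  ultimately show ?thesis unfolding schwartz_decay_def by blast
qed

lemma schwartz_decay_mult:
  assumes "schwartz_decay f" "schwartz_decay g" shows "schwartz_decay (\<lambda>t. f t * g t)"
proof -
  obtain Q where Q: "\<And>t. (1 + \<bar>t\<bar>) ^ 2 * norm (f t) \<le> Q" using assms unfolding schwartz_decay_def by blast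
  obtain Q' where Q': "\<And>t. (1 + \<bar>t\<bar>) ^ 2 * norm (g t) \<le> Q'" using assms unfolding schwartz_decay_def by blast
  have "norm (g t) \<le> Q'" for t
  proof -
    have "1 * norm (g t) \<le> (1 + \<bar>t\<bar>) ^ 2 * norm (g t)" by (intro mult_right_mono) auto
    then show ?thesis using Q'[of t] by linarith
  qed
  then have "(1 + \<bar>t\<bar>) ^ 2 * norm (f t) * norm (g t) \<le> Q * Q'" for t
    using Q[of t] by (intro mult_mono) (auto intro: order_trans[OF _ Q[of t]])
  then show ?thesis using assms unfolding schwartz_decay_def norm_mult
    by (auto intro!: continuous_intros exI[of _ "Q * Q'"] simp: mult.assoc)
qed

lemma schwartz_decay_add:
  assumes "schwartz_decay f" "schwartz_decay g" shows "schwartz_decay (\<lambda>t. f t + g t)"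
proof -
  obtain Q where Q: "\<And>t. (1 + \<bar>t\<bar>) ^ 2 * norm (f t) \<le> Q" using assms unfolding schwartz_decay_def by blast
  obtain Q' where Q': "\<And>t. (1 + \<bar>t\<bar>) ^ 2 * norm (g t) \<le> Q'" using assms unfolding schwartz_decay_def by blast
  have "(1 + \<bar>t\<bar>) ^ 2 * norm (f t + g t) \<le> Q + Q'" for t
  proof -
    have "(1 + \<bar>t\<bar>) ^ 2 * norm (f t + g t) \<le> (1 + \<bar>t\<bar>) ^ 2 * (norm (f t) + norm (g t))"
      by (intro mult_left_mono norm_triangle_ineq) auto
    also have "\<dots> \<le> Q + Q'" using Q[of t] Q'[of t] by (simp add: distrib_left)
    finally show ?thesis .
  qed
  then show ?thesis using assms unfolding schwartz_decay_def by (auto intro!: continuous_intros)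
qed

text \<open>
  The raising relation \<open>e\<^sub>n\<^sub>+\<^sub>1 = \<pi> * t * e\<^sub>n - e\<^sub>n' / 2\<close> for \<open>e\<^sub>n = hfun n\<close>, with the derivative moved onto \<open>g\<close>
  by integration by parts.
\<close>

lemma integral_raise:
  assumes g: "schwartz_decay g" "schwartz_decay g'" "\<And>t. (g has_vector_derivative g' t) (at t)"
    and rel: "\<And>t. g' t / 2 + of_real (pi * t) * g t = G t" and G: "integrable lborel (\<lambda>t. of_real (hfun n t) * G t)"
  shows "(LINT t|lborel. of_real (hfun (Suc n) t) * g t) = (LINT t|lborel. of_real (hfun n t) * G t)"
proof -
  define f where "f = hfun_deriv 0 n"
  define f' where "f' = hfun_deriv 1 n"
  have f: "schwartz_decay f" "schwartz_decay f'" "\<And>t. (f has_vector_derivative f' t) (at t)" "\<And>t. f t = of_real (hfun n t)"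
    using hfun_deriv_has_derivative[of 0 n] unfolding f_def f'_def
    by (simp_all add: schwartz_decay_hfun) (simp add: hfun_deriv_0)
  have f'eq: "f' t = of_real (pi * n * hfun (n - 1) t - hfun (Suc n) t)" for t
  proof -
    have "(f has_vector_derivative of_real (pi * n * hfun (n - 1) t - hfun (Suc n) t)) (at t)"
      using hfun_has_derivative[of n t] unfolding f_def hfun_deriv_0
      by (intro has_vector_derivative_of_real) (simp add: has_real_derivative_iff_has_vector_derivative)
    from vector_derivative_unique_at[OF f(3) this] show ?thesis .
  qed
  define d where "d = (\<lambda>t. f t * g' t + f' t * g t)"
  have d: "schwartz_decay d" unfolding d_def by (intro schwartz_decay_add schwartz_decay_mult f g)
  have "(LINT t|lborel. d t) = 0"
    by (rule integral_deriv_eq_0[OF schwartz_decay_mult[OF f(1) g(1)] d])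
      (unfold d_def, intro has_vector_derivative_mult f g)
  moreover have "of_real (hfun (Suc n) t) * g t = of_real (hfun n t) * G t - d t / 2" for t
  proof -
    have "hfun (Suc n) t = pi * t * hfun n t - (pi * n * hfun (n - 1) t - hfun (Suc n) t) / 2"
      using hfun_raise[of t n] by (simp add: field_simps)
    then have "of_real (hfun (Suc n) t) = of_real (pi * t) * f t - f' t / 2"
      unfolding f(4) f'eq by (metis of_real_diff of_real_mult of_real_divide of_real_numeral)
    then have e: "of_real (hfun (Suc n) t) * g t = (of_real (pi * t) * f t - f' t / 2) * g t" by (simp only:)
    show ?thesis unfolding e rel[symmetric] d_def f(4)[symmetric] by (simp add: field_simps)
  qed
  ultimately show ?thesis using G schwartz_decay_integrable[OF d] by simp
qed

lemma integrable_hfun_gen: "integrable lborel (\<lambda>t. of_real (hfun n t) * gen z t)"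
  using schwartz_decay_integrable[OF schwartz_decay_mult[OF schwartz_decay_hfun[of 0 n] schwartz_decay_gen[of 0 z]]]
  by (simp add: hfun_deriv_0 gen_deriv_0)

lemma integrable_hfun_hfun: "integrable lborel (\<lambda>t. complex_of_real (hfun n t) * of_real (hfun m t))"
  using schwartz_decay_integrable[OF schwartz_decay_mult[OF schwartz_decay_hfun[of 0 n] schwartz_decay_hfun[of 0 m]]]
  by (simp add: hfun_deriv_0)

lemma gen_deriv_1: "gen_deriv 1 z t = 2 * of_real pi * (z - of_real t) * gen z t"
proof -
  have "((\<lambda>w. of_real (2 powr (1/4)) * exp (2 * of_real pi * w * z - of_real pi * w\<^sup>2 - of_real pi * z\<^sup>2 / 2)) has_field_derivative
      2 * of_real pi * (z - of_real t) * gen z t) (at (of_real t))"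
    unfolding gen_def by (auto intro!: derivative_eq_intros) (simp add: algebra_simps)
  from has_vector_derivative_real_field[OF this]
  have "(gen z has_vector_derivative 2 * of_real pi * (z - of_real t) * gen z t) (at t)"
    by (simp add: gen_def [abs_def] o_def)
  from vector_derivative_unique_at[OF _ this] gen_deriv_has_derivative[of 0 z t] show ?thesis
    by (simp add: gen_deriv_0)
qed

text \<open>
  After an affine substitution the integral is the characteristic function of the standard normal
  distribution, at a point proportional to the imaginary part of \<open>w + z\<close>.
\<close>

lemma complex_gaussian_integral:
  "(LINT t|lborel. gen w t * gen z t) = exp (of_real pi * w * z)"
proof -
  define a b where "a = Re (w + z)" and "b = Im (w + z)"
  \<comment> \<open>The substitution t = a / 2 + c * x centres the Gaussian at a real point and gives it variance 1.\<close>
  define c where "c = 1 / (2 * sqrt pi)"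
  have c: "c \<noteq> 0" "c > 0" by (auto simp: c_def)
  have zeta: "w + z = of_real a + \<i> * of_real b" by (simp add: a_def b_def complex_eq_iff)
  have cc: "pi * c\<^sup>2 = 1 / 4" "2 * pi * c = sqrt pi"
    by (auto simp: c_def power_divide field_simps real_div_sqrt power2_eq_square)
  have key: "\<bar>c\<bar> *\<^sub>R (gen w (a/2 + c * x) * gen z (a/2 + c * x)) =
      (exp (of_real pi * w * z) * exp (of_real (pi * b\<^sup>2 / 2))) * (std_normal_density x *\<^sub>R iexp (sqrt pi * b * x))" for x
  proof -
    let ?t = "a/2 + c * x"
    let ?E = "\<lambda>u. 2 * of_real pi * of_real ?t * u - of_real (pi * ?t\<^sup>2) - of_real pi * u\<^sup>2 / 2"
    have "?E w + ?E z = of_real pi * w * z + (2 * of_real pi * of_real ?t * (w + z) - 2 * of_real pi * of_real (?t\<^sup>2) - of_real pi * (w + z)\<^sup>2 / 2)"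
      by (simp add: power2_eq_square field_simps)
    also have "2 * of_real pi * of_real ?t * (w + z) - 2 * of_real pi * of_real (?t\<^sup>2) - of_real pi * (w + z)\<^sup>2 / 2
       = of_real (pi * b\<^sup>2 / 2) + of_real (- 2 * (pi * c\<^sup>2) * x\<^sup>2) + \<i> * of_real ((2 * pi * c) * b * x)"
      unfolding zeta by (simp add: power2_eq_square field_simps)
    also have "\<dots> = of_real (pi * b\<^sup>2 / 2) + of_real (- (x\<^sup>2) / 2) + \<i> * of_real (sqrt pi * b * x)"
      unfolding cc by simp
    finally have E: "?E w + ?E z = of_real pi * w * z + of_real (pi * b\<^sup>2 / 2) + of_real (- (x\<^sup>2) / 2) + \<i> * of_real (sqrt pi * b * x)"
      by (simp only: add.assoc)
    have s: "(2 powr (1/4)) * (2 powr (1/4)) = sqrt (2::real)" by (simp add: powr_half_sqrt flip: powr_add)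
    have "gen w ?t * gen z ?t = of_real ((2 powr (1/4)) * (2 powr (1/4))) * (exp (?E w) * exp (?E z))"
      by (simp only: gen_def mult_ac of_real_mult)
    then have g: "gen w ?t * gen z ?t = of_real (sqrt 2) * exp (?E w + ?E z)" by (simp only: s exp_add)
    have s2: "\<bar>c\<bar> * sqrt 2 = 1 / sqrt (2 * pi)" using c by (simp add: c_def real_sqrt_mult field_simps)
    have "\<bar>c\<bar> *\<^sub>R (gen w ?t * gen z ?t) = of_real (\<bar>c\<bar> * sqrt 2) * exp (?E w + ?E z)"
      by (simp only: g scaleR_conv_of_real of_real_mult mult.assoc)
    also have "of_real (\<bar>c\<bar> * sqrt 2) = complex_of_real (1 / sqrt (2 * pi))" by (simp only: s2)
    also have "exp (?E w + ?E z) = exp (of_real pi * w * z) * exp (of_real (pi * b\<^sup>2 / 2)) * of_real (exp (- (x\<^sup>2) / 2)) * iexp (sqrt pi * b * x)"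
      unfolding E exp_add exp_of_real[symmetric] by simp
    finally show ?thesis unfolding std_normal_density_def scaleR_conv_of_real by simp
  qed
  have "(LINT t|lborel. gen w t * gen z t) = \<bar>c\<bar> *\<^sub>R (LINT x|lborel. gen w (a/2 + c * x) * gen z (a/2 + c * x))"
    by (rule lborel_integral_real_affine[OF c(1)])
  also have "\<dots> = (LINT x|lborel. (exp (of_real pi * w * z) * exp (of_real (pi * b\<^sup>2 / 2))) * (std_normal_density x *\<^sub>R iexp (sqrt pi * b * x)))"
    by (simp only: key flip: integral_scaleR_right)
  also have "\<dots> = (exp (of_real pi * w * z) * exp (of_real (pi * b\<^sup>2 / 2))) * (LINT x|lborel. std_normal_density x *\<^sub>R iexp (sqrt pi * b * x))"
    by (rule integral_mult_right_zero)
  also have "(LINT x|lborel. std_normal_density x *\<^sub>R iexp (sqrt pi * b * x)) = char std_normal_distribution (sqrt pi * b)"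
    unfolding char_def by (subst integral_density) (auto simp: normal_density_nonneg)
  also have "\<dots> = of_real (exp (- (pi * b\<^sup>2 / 2)))"
    unfolding char_std_normal_distribution by (simp add: power_mult_distrib)
  finally show ?thesis by (simp add: mult.assoc exp_of_real[symmetric] mult_exp_exp)
qed

text \<open>
  Coherent states are eigenfunctions of the lowering operator \<open>g \<mapsto> g' / 2 + \<pi> * t * g\<close>, with eigenvalue \<open>\<pi> * z\<close>.
\<close>

lemma integral_hfun_gen: "(LINT t|lborel. of_real (hfun n t) * gen z t) = (of_real pi * z) ^ n"
proof (induction n)
  case 0
  have "of_real (hfun 0 t) = gen 0 t" for t by (simp add: hfun_def gen_def flip: exp_of_real)
  then show ?case using complex_gaussian_integral[of 0 z] by simp
next
  case (Suc n)
  have "(LINT t|lborel. of_real (hfun (Suc n) t) * gen z t) = (LINT t|lborel. of_real (hfun n t) * (of_real pi * z * gen z t))"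
  proof (rule integral_raise)
    show "schwartz_decay (gen z)" using schwartz_decay_gen[of 0 z] by (simp add: gen_deriv_0)
    show "(gen z has_vector_derivative gen_deriv 1 z t) (at t)" for t
      using gen_deriv_has_derivative[of 0 z t] by (simp add: gen_deriv_0)
    show "gen_deriv 1 z t / 2 + of_real (pi * t) * gen z t = of_real pi * z * gen z t" for t
      unfolding gen_deriv_1 by (simp add: field_simps)
    show "integrable lborel (\<lambda>t. of_real (hfun n t) * (of_real pi * z * gen z t))"
      using integrable_mult_right[OF integrable_hfun_gen[of n z], of "of_real pi * z"] by (simp add: mult_ac)
  qed (rule schwartz_decay_gen)
  also have "\<dots> = of_real pi * z * (LINT t|lborel. of_real (hfun n t) * gen z t)"
    by (subst integral_mult_right_zero[symmetric]) (simp add: mult_ac)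
  finally show ?case using Suc.IH by simp
qed

text \<open>
  The lowering operator maps \<open>hfun (Suc n)\<close> to \<open>\<pi> * Suc n\<close> times \<open>hfun n\<close>.
\<close>

lemma integral_hfun_square: "(LINT t|lborel. complex_of_real (hfun n t) * of_real (hfun n t)) = of_real (pi ^ n * fact n)"
proof (induction n)
  case 0
  have "of_real (hfun 0 t) = gen 0 t" for t by (simp add: hfun_def gen_def flip: exp_of_real)
  then show ?case using complex_gaussian_integral[of 0 0] by simp
next
  case (Suc n)
  have e: "hfun_deriv 1 n t = of_real (pi * n * hfun (n - 1) t - hfun (Suc n) t)" for t n
  proof -
    have "(hfun_deriv 0 n has_vector_derivative of_real (pi * n * hfun (n - 1) t - hfun (Suc n) t)) (at t)"
      using hfun_has_derivative[of n t] unfolding hfun_deriv_0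
      by (intro has_vector_derivative_of_real) (simp add: has_real_derivative_iff_has_vector_derivative)
    from vector_derivative_unique_at[OF hfun_deriv_has_derivative[of 0 n t, simplified] this] show ?thesis by simp
  qed
  have "(LINT t|lborel. complex_of_real (hfun (Suc n) t) * of_real (hfun (Suc n) t)) =
     (LINT t|lborel. of_real (hfun n t) * (of_real (pi * Suc n) * of_real (hfun n t)))"
  proof (rule integral_raise)
    show "schwartz_decay (\<lambda>t. complex_of_real (hfun (Suc n) t))" using schwartz_decay_hfun[of 0 "Suc n"] by (simp add: hfun_deriv_0)
    show "((\<lambda>t. complex_of_real (hfun (Suc n) t)) has_vector_derivative hfun_deriv 1 (Suc n) t) (at t)" for t
      using hfun_deriv_has_derivative[of 0 "Suc n" t] by (simp add: hfun_deriv_0)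
    show "hfun_deriv 1 (Suc n) t / 2 + of_real (pi * t) * of_real (hfun (Suc n) t) = of_real (pi * Suc n) * of_real (hfun n t)" for t
    proof -
      have "(pi * Suc n * hfun (Suc n - 1) t - hfun (Suc (Suc n)) t) / 2 + pi * t * hfun (Suc n) t = pi * Suc n * hfun n t"
        using hfun_raise[of t "Suc n"] by (simp add: field_simps)
      from arg_cong[OF this, of complex_of_real] show ?thesis unfolding e by simp
    qed
    show "integrable lborel (\<lambda>t. complex_of_real (hfun n t) * (of_real (pi * Suc n) * of_real (hfun n t)))"
      using integrable_mult_right[OF integrable_hfun_hfun[of n n], of "of_real (pi * Suc n)"] by (simp add: mult_ac)
  qed (rule schwartz_decay_hfun)
  also have "\<dots> = of_real (pi * Suc n) * (LINT t|lborel. complex_of_real (hfun n t) * of_real (hfun n t))"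
    by (subst integral_mult_right_zero[symmetric]) (simp add: mult_ac)
  finally show ?case using Suc.IH by (simp add: mult_ac)
qed

text \<open>
  The sign of the normalising constant cancels the factor \<open>(-1) ^ n\<close> of Rodrigues' formula.
\<close>

lemma hermite1_eq_hfun: "hermite1 n t = hfun n t / sqrt (pi ^ n * fact n)"
proof -
  have u: "hermite_unnorm n t = (-2) ^ n / 2 powr (1/4) * hfun n t" for t
  proof -
    have "exp (pi * t\<^sup>2) * exp (- 2 * pi * t\<^sup>2) = exp (- pi * t\<^sup>2)" by (simp add: mult_exp_exp)
    then have "hermite_unnorm n t = (-2) ^ n * hpoly n t * exp (- pi * t\<^sup>2)"
      unfolding hermite_unnorm_def hermite_rodrigues by (metis mult.assoc mult.commute)
    then show ?thesis by (simp add: hfun_def)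
  qed
  have h2: "(LINT t|lborel. (hfun n t)\<^sup>2) = pi ^ n * fact n"
  proof -
    have "complex_of_real (LINT t|lborel. (hfun n t)\<^sup>2) = (LINT t|lborel. complex_of_real ((hfun n t)\<^sup>2))"
      by (rule integral_complex_of_real[symmetric])
    also have "\<dots> = of_real (pi ^ n * fact n)"
      unfolding integral_hfun_square[symmetric] by (simp add: power2_eq_square)
    finally show ?thesis by (simp only: of_real_eq_iff)
  qed
  have s: "((2::real) powr (1/4))\<^sup>2 = sqrt 2" by (simp add: powr_power powr_half_sqrt)
  have "(LINT t|lborel. (hermite_unnorm n t)\<^sup>2) = (LINT t|lborel. (4 ^ n / sqrt 2) * (hfun n t)\<^sup>2)"
    unfolding u power_mult_distrib power_divide s by (simp add: power2_eq_square flip: power_mult_distrib)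
  also have "\<dots> = (4 ^ n / sqrt 2) * (pi ^ n * fact n)" by (simp only: integral_mult_right_zero h2)
  finally have "sqrt (LINT t|lborel. (hermite_unnorm n t)\<^sup>2) = sqrt (4 ^ n / sqrt 2) * sqrt (pi ^ n * fact n)"
    by (simp only: real_sqrt_mult)
  also have "sqrt (4 ^ n / sqrt 2) = 2 ^ n / 2 powr (1/4)"
  proof (rule real_sqrt_unique)
    show "(2 ^ n / 2 powr (1/4))\<^sup>2 = 4 ^ n / sqrt (2::real)" unfolding power_divide s
      by (simp add: power2_eq_square flip: power_mult_distrib)
  qed simp
  finally have c: "hermite_const n = (-1) ^ n / (2 ^ n / 2 powr (1/4) * sqrt (pi ^ n * fact n))"
    by (simp add: hermite_const_def)
  have "(-1) ^ n * (-2) ^ n = (2::real) ^ n" by (simp flip: power_mult_distrib)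
  then show ?thesis unfolding hermite1_def c u by (simp add: field_simps)
qed

section \<open>Tempered distributions on tensor products\<close>

lemma partial_deriv_prod:
  fixes E E' :: "'d::finite \<Rightarrow> real \<Rightarrow> complex"
  assumes "(E i has_vector_derivative E' i (x $ i)) (at (x $ i))"
  shows "partial_deriv i (\<lambda>t. \<Prod>j\<in>UNIV. E j (t $ j)) x = E' i (x $ i) * (\<Prod>j\<in>UNIV-{i}. E j (x $ j))"
proof -
  have "(\<Prod>j\<in>UNIV. E j ((x + s *\<^sub>R axis i 1) $ j)) = E i (x $ i + s) * (\<Prod>j\<in>UNIV-{i}. E j (x $ j))" for s
    by (subst prod.remove[of UNIV i]) (auto simp: axis_def intro!: prod.cong)
  moreover have "((\<lambda>s. E i (x $ i + s)) has_vector_derivative E' i (x $ i)) (at 0)"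
  proof -
    have "((\<lambda>s. x $ i + s) has_vector_derivative (0 + 1)) (at 0)"
      by (intro has_vector_derivative_add has_vector_derivative_const has_vector_derivative_id)
    from vector_diff_chain_at[OF this, of "E i" "E' i (x $ i)"] assms show ?thesis by (simp add: o_def)
  qed
  then have "((\<lambda>s. E i (x $ i + s) * (\<Prod>j\<in>UNIV-{i}. E j (x $ j))) has_vector_derivative
      E' i (x $ i) * (\<Prod>j\<in>UNIV-{i}. E j (x $ j))) (at 0)"
    by (rule has_vector_derivative_mult_left)
  ultimately show ?thesis unfolding partial_deriv_def by (simp add: vector_derivative_at)
qed

definition deriv_family :: "(nat \<Rightarrow> real \<Rightarrow> complex) \<Rightarrow> bool" where
  "deriv_family D \<longleftrightarrow> (\<forall>m t. (D m has_vector_derivative D (Suc m) t) (at t))"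

text \<open>
  Each partial derivative acts on one factor only, so just the number of occurrences of each coordinate in
  the list matters.
\<close>

lemma iter_deriv_prod:
  fixes D :: "'d::finite \<Rightarrow> nat \<Rightarrow> real \<Rightarrow> complex"
  assumes "\<And>j. deriv_family (D j)"
  shows "iter_deriv is (\<lambda>t. \<Prod>j\<in>UNIV. D j 0 (t $ j)) = (\<lambda>t. \<Prod>j\<in>UNIV. D j (count_list is j) (t $ j))"
proof (induction "is")
  case (Cons i "is")
  show ?case
  proof
    fix x
    have "iter_deriv (i # is) (\<lambda>t. \<Prod>j\<in>UNIV. D j 0 (t $ j)) x =
      D i (Suc (count_list is i)) (x $ i) * (\<Prod>j\<in>UNIV-{i}. D j (count_list is j) (x $ j))"
      unfolding iter_deriv.simps Cons.IH
      by (rule partial_deriv_prod[of "\<lambda>j. D j (count_list is j)" i "\<lambda>j. D j (Suc (count_list is j))"])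
        (use assms in \<open>simp add: deriv_family_def\<close>)
    also have "\<dots> = (\<Prod>j\<in>UNIV. D j (count_list (i # is) j) (x $ j))"
      using prod.remove[of UNIV i "\<lambda>j. D j (count_list (i # is) j) (x $ j)"] by (auto intro!: prod.cong)
    finally show "iter_deriv (i # is) (\<lambda>t. \<Prod>j\<in>UNIV. D j 0 (t $ j)) x = (\<Prod>j\<in>UNIV. D j (count_list (i # is) j) (x $ j))" .
  qed
qed simp

lemma differentiable_prod_coords:
  fixes E :: "'d::finite \<Rightarrow> real \<Rightarrow> complex"
  assumes "\<And>j t. E j differentiable (at t)"
  shows "(\<lambda>t. \<Prod>j\<in>UNIV. E j (t $ j)) differentiable (at x)"
proof -
  have "(\<lambda>t. \<Prod>j\<in>J. E j (t $ j)) differentiable (at x)" if "finite J" for J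
    using that
  proof (induction J)
    case (insert i J)
    have "(\<lambda>t. E i (t $ i)) differentiable (at x)"
      using differentiable_chain_at[of "\<lambda>t. t $ i" x "E i"] assms
      by (simp add: o_def bounded_linear_imp_differentiable bounded_linear_vec_nth)
    then show ?case using insert by (simp add: differentiable_mult)
  qed simp
  then show ?thesis by simp
qed

lemma one_plus_sum_le_prod:
  fixes a :: "'i \<Rightarrow> real"
  assumes "finite J" "\<And>j. a j \<ge> 0"
  shows "1 + (\<Sum>j\<in>J. a j) \<le> (\<Prod>j\<in>J. 1 + a j)"
  using assms(1)
proof (induction J)
  case (insert i J)
  have "1 \<le> (\<Prod>j\<in>J. 1 + a j)" by (rule prod_ge_1) (use assms in auto)
  then have "a i * 1 \<le> a i * (\<Prod>j\<in>J. 1 + a j)" using assms(2) by (intro mult_left_mono) auto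
  then show ?case using insert by (simp add: algebra_simps)
qed simp

lemma norm_power_le_prod:
  fixes t :: "real^'d::finite"
  shows "norm t ^ k \<le> (\<Prod>j\<in>UNIV. (1 + \<bar>t $ j\<bar>) ^ k)"
proof -
  have "norm t \<le> (\<Prod>j\<in>UNIV. 1 + \<bar>t $ j\<bar>)"
    using norm_le_l1_cart[of t] one_plus_sum_le_prod[of UNIV "\<lambda>j. \<bar>t $ j\<bar>"] by simp
  then have "norm t ^ k \<le> (\<Prod>j\<in>UNIV. 1 + \<bar>t $ j\<bar>) ^ k" by (intro power_mono) auto
  then show ?thesis by (simp add: prod_power_distrib)
qed

lemma norm_prod_weighted:
  fixes t :: "real^'d::finite" and a b :: "'d \<Rightarrow> complex"
  shows "norm t ^ k * norm (\<Prod>j\<in>UNIV. a j) \<le> (\<Prod>j\<in>UNIV. (1 + \<bar>t $ j\<bar>) ^ k * norm (a j))"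
  unfolding prod.distrib prod_norm[symmetric] by (intro mult_right_mono norm_power_le_prod prod_nonneg) auto

definition rapid_family :: "(nat \<Rightarrow> real \<Rightarrow> complex) \<Rightarrow> bool" where
  "rapid_family D \<longleftrightarrow> deriv_family D \<and> (\<forall>k m. \<exists>Q. \<forall>t. (1 + \<bar>t\<bar>) ^ k * norm (D m t) \<le> Q)"

lemma prod_in_schwartz_space:
  fixes D :: "'d::finite \<Rightarrow> nat \<Rightarrow> real \<Rightarrow> complex"
  assumes D: "\<And>j. rapid_family (D j)"
  shows "(\<lambda>t. \<Prod>j\<in>UNIV. D j 0 (t $ j)) \<in> schwartz_space"
proof -
  have d: "\<And>j. deriv_family (D j)" using D by (simp add: rapid_family_def)
  have dd: "D j m differentiable (at t)" for j m t
    using d[of j] unfolding deriv_family_def differentiable_def has_vector_derivative_def by blast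
  have "bounded (range (\<lambda>x. norm x ^ k * norm (iter_deriv is (\<lambda>t. \<Prod>j\<in>UNIV. D j 0 (t $ j)) x)))" for k "is"
  proof -
    have "\<forall>j. \<exists>Q. \<forall>t. (1 + \<bar>t\<bar>) ^ k * norm (D j (count_list is j) t) \<le> Q" using D by (simp add: rapid_family_def)
    then obtain Q where Q: "\<And>j t. (1 + \<bar>t\<bar>) ^ k * norm (D j (count_list is j) t) \<le> Q j" by metis
    have "norm x ^ k * norm (iter_deriv is (\<lambda>t. \<Prod>j\<in>UNIV. D j 0 (t $ j)) x) \<le> (\<Prod>j\<in>UNIV. Q j)" for x
      unfolding iter_deriv_prod[OF d] by (rule order_trans[OF norm_prod_weighted]) (intro prod_mono conjI Q mult_nonneg_nonneg; simp)
    then show ?thesis by (intro boundedI[of _ "\<Prod>j\<in>UNIV. Q j"]) auto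
  qed
  moreover have "smooth (\<lambda>t. \<Prod>j\<in>UNIV. D j 0 (t $ j))"
    unfolding smooth_def iter_deriv_prod[OF d] by (intro allI differentiable_prod_coords dd)
  ultimately show ?thesis by (simp add: schwartz_space_def)
qed

lemma partial_deriv_linear:
  assumes "f differentiable (at x)" "g differentiable (at x)"
  shows "partial_deriv i (\<lambda>t. a * f t + b * g t) x = a * partial_deriv i f x + b * partial_deriv i g x"
proof -
  have l: "((\<lambda>s. x + s *\<^sub>R axis i 1) has_derivative (\<lambda>s. s *\<^sub>R axis i 1)) (at 0)"
    by (auto intro!: derivative_eq_intros)
  have "(\<lambda>s. h (x + s *\<^sub>R axis i 1)) differentiable (at 0)" if "h differentiable (at x)" for h :: "real^'a \<Rightarrow> complex"
  proof -
    have "(\<lambda>s. x + s *\<^sub>R axis i 1) differentiable (at 0)" using l by (auto simp: differentiable_def)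
    from differentiable_chain_at[OF this, of h] that show ?thesis by (simp add: o_def)
  qed
  then show ?thesis unfolding partial_deriv_def using assms
    by (simp add: vector_derivative_works has_vector_derivative_mult_right has_vector_derivative_add vector_derivative_at)
qed

lemma iter_deriv_linear:
  assumes "smooth f" "smooth g"
  shows "iter_deriv is (\<lambda>t. a * f t + b * g t) = (\<lambda>t. a * iter_deriv is f t + b * iter_deriv is g t)"
proof (induction "is")
  case (Cons i "is")
  show ?case unfolding iter_deriv.simps Cons.IH
    by (rule ext, rule partial_deriv_linear) (use assms in \<open>auto simp: smooth_def\<close>)
qed simp

lemma schwartz_space_linear:
  assumes "f \<in> schwartz_space" "g \<in> schwartz_space"
  shows "(\<lambda>t. a * f t + b * g t) \<in> schwartz_space"
proof -
  have s: "smooth f" "smooth g" using assms by (auto simp: schwartz_space_def)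
  have "smooth (\<lambda>t. a * f t + b * g t)"
    unfolding smooth_def iter_deriv_linear[OF s]
    using s by (auto simp: smooth_def intro!: differentiable_add differentiable_mult)
  moreover have "bounded (range (\<lambda>x. norm x ^ k * norm (iter_deriv is (\<lambda>t. a * f t + b * g t) x)))" for k "is"
  proof -
    obtain A B where A: "\<And>x. norm x ^ k * norm (iter_deriv is f x) \<le> A" and B: "\<And>x. norm x ^ k * norm (iter_deriv is g x) \<le> B"
      using assms unfolding schwartz_space_def bounded_iff by (auto simp: abs_mult) metis
    have "norm x ^ k * norm (a * iter_deriv is f x + b * iter_deriv is g x) \<le> norm a * A + norm b * B" for x
    proof -
      have "norm x ^ k * norm (a * iter_deriv is f x + b * iter_deriv is g x) \<le> norm x ^ k * (norm a * norm (iter_deriv is f x) + norm b * norm (iter_deriv is g x))"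
        by (intro mult_left_mono norm_triangle_le) (auto simp: norm_mult)
      also have "\<dots> = norm a * (norm x ^ k * norm (iter_deriv is f x)) + norm b * (norm x ^ k * norm (iter_deriv is g x))"
        by (simp add: algebra_simps)
      also have "\<dots> \<le> norm a * A + norm b * B" by (intro add_mono mult_left_mono A B) auto
      finally show ?thesis .
    qed
    then show ?thesis unfolding iter_deriv_linear[OF s]
      by (intro boundedI[of _ "norm a * A + norm b * B"]) auto
  qed
  ultimately show ?thesis by (simp add: schwartz_space_def)
qed

lemma tempered_linear:
  assumes "u \<in> tempered_distributions" "g \<in> schwartz_space" "h \<in> schwartz_space"
  shows "u (\<lambda>t. a * g t + b * h t) = a * u g + b * u h"
  using assms by (simp add: tempered_distributions_def)

lemma schwartz_zero:
  fixes g :: "real^'d::finite \<Rightarrow> complex"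
  shows "g \<in> schwartz_space \<Longrightarrow> (\<lambda>t::real^'d. 0) \<in> schwartz_space"
  using schwartz_space_linear[of g g 0 0] by simp

lemma tempered_sum:
  assumes u: "u \<in> tempered_distributions" and "finite S" and g: "\<And>n. g n \<in> schwartz_space"
  shows "(\<lambda>t. \<Sum>n\<in>S. c n * g n t) \<in> schwartz_space \<and> u (\<lambda>t. \<Sum>n\<in>S. c n * g n t) = (\<Sum>n\<in>S. c n * u (g n))"
  using assms(2)
proof (induction S)
  case empty
  show ?case using schwartz_zero[OF g] tempered_linear[OF u g g, of 0 _ 0] by simp
next
  case (insert i S)
  then show ?case using schwartz_space_linear[OF g[of i], of _ "c i" 1] tempered_linear[OF u g[of i], of _ "c i" 1] by simp
qed

lemma seminorm_le:
  assumes "\<And>x. norm x ^ k * norm (iter_deriv is f x) \<le> B"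
  shows "schwartz_seminorm k is f \<le> B"
  unfolding schwartz_seminorm_def by (rule cSUP_least) (use assms in auto)

lemma seminorm_upper:
  assumes "f \<in> schwartz_space"
  shows "norm x ^ k * norm (iter_deriv is f x) \<le> schwartz_seminorm k is f"
proof -
  have "bounded (range (\<lambda>x. norm x ^ k * norm (iter_deriv is f x)))" using assms by (simp add: schwartz_space_def)
  then have "bdd_above (range (\<lambda>x. norm x ^ k * norm (iter_deriv is f x)))" by (rule bounded_imp_bdd_above)
  then show ?thesis unfolding schwartz_seminorm_def by (rule cSUP_upper2) auto
qed

lemma seminorm_nonneg: "f \<in> schwartz_space \<Longrightarrow> schwartz_seminorm k is f \<ge> 0"
  by (rule order_trans[OF _ seminorm_upper[where x=0]]) auto

lemma tempered_bound:
  fixes u :: "'d::finite functional"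
  assumes "u \<in> tempered_distributions"
  obtains C m where "C \<ge> 0" "\<And>g. g \<in> schwartz_space \<Longrightarrow> norm (u g) \<le> C * (\<Sum>k\<le>m. \<Sum>is | length is \<le> m. schwartz_seminorm k is g)"
proof -
  obtain C m where *: "\<And>g. g \<in> schwartz_space \<Longrightarrow> norm (u g) \<le> C * (\<Sum>k\<le>m. \<Sum>is | length is \<le> m. schwartz_seminorm k is g)"
    using assms unfolding tempered_distributions_def by blast
  show thesis
  proof (rule that[of "max C 0" m])
    fix g :: "real^'d \<Rightarrow> complex" assume g: "g \<in> schwartz_space"
    have "C * (\<Sum>k\<le>m. \<Sum>is | length is \<le> m. schwartz_seminorm k is g) \<le> max C 0 * (\<Sum>k\<le>m. \<Sum>is | length is \<le> m. schwartz_seminorm k is g)"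
      by (intro mult_right_mono sum_nonneg seminorm_nonneg g) auto
    with *[OF g] show "norm (u g) \<le> max C 0 * (\<Sum>k\<le>m. \<Sum>is | length is \<le> m. schwartz_seminorm k is g)" by linarith
  qed auto
qed

lemma tempered_tendsto:
  assumes u: "u \<in> tempered_distributions" and g: "g \<in> schwartz_space" "\<And>M. gs M \<in> schwartz_space"
    and lim: "\<And>k is. (\<lambda>M::nat. schwartz_seminorm k is (\<lambda>t. gs M t - g t)) \<longlonglongrightarrow> 0"
  shows "(\<lambda>M. u (gs M)) \<longlonglongrightarrow> u g"
proof -
  obtain C m where C: "C \<ge> 0" "\<And>g. g \<in> schwartz_space \<Longrightarrow> norm (u g) \<le> C * (\<Sum>k\<le>m. \<Sum>is | length is \<le> m. schwartz_seminorm k is g)"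
    using tempered_bound[OF u] by blast
  have l: "(\<lambda>M. C * (\<Sum>k\<le>m. \<Sum>is | length is \<le> m. schwartz_seminorm k is (\<lambda>t. gs M t - g t))) \<longlonglongrightarrow> 0"
    by (intro tendsto_mult_right_zero tendsto_null_sum lim)
  have "norm (u (gs M) - u g) \<le> C * (\<Sum>k\<le>m. \<Sum>is | length is \<le> m. schwartz_seminorm k is (\<lambda>t. gs M t - g t))" for M
    using C(2)[OF schwartz_space_linear[OF g(2)[of M] g(1), of 1 "-1"]] tempered_linear[OF u g(2)[of M] g(1), of 1 "-1"] by simp
  then have "(\<lambda>M. u (gs M) - u g) \<longlonglongrightarrow> 0" by (intro Lim_null_comparison[OF _ l]) auto
  then show ?thesis by (simp add: LIM_zero_iff)
qed

definition hprod :: "nat^'d::finite \<Rightarrow> real^'d \<Rightarrow> complex" where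
  "hprod n t = (\<Prod>j\<in>UNIV. of_real (hfun (n $ j) (t $ j)))"

definition genprod :: "('d::finite \<Rightarrow> complex) \<Rightarrow> real^'d \<Rightarrow> complex" where
  "genprod z t = (\<Prod>j\<in>UNIV. gen (z j) (t $ j))"

text \<open>
  The coefficients of the entire power series that represents \<open>u\<close>; see \<open>functional_genprod_expansion\<close>.
\<close>

definition hcoeff :: "'d::finite functional \<Rightarrow> nat^'d \<Rightarrow> complex" where
  "hcoeff u n = u (hprod n) / (\<Prod>j\<in>UNIV. fact (n $ j))"

definition box_upto :: "nat \<Rightarrow> (nat^'d::finite) set" where
  "box_upto M = {n. \<forall>j. n $ j \<le> M}"

abbreviation zpow :: "('d::finite \<Rightarrow> complex) \<Rightarrow> nat^'d \<Rightarrow> complex" where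
  "zpow z n \<equiv> (\<Prod>j\<in>UNIV. z j ^ (n $ j))"

lemma rapid_hfun: "rapid_family (\<lambda>m. hfun_deriv m n)"
proof -
  have "\<exists>Q. \<forall>t. (1 + \<bar>t\<bar>) ^ k * norm (hfun_deriv m n t) \<le> Q" for k m
    using hfun_deriv_bounded[of 1 k m] by (metis order_refl)
  then show ?thesis using hfun_deriv_has_derivative by (simp add: rapid_family_def deriv_family_def)
qed

lemma rapid_gen: "rapid_family (\<lambda>m. gen_deriv m z)"
proof -
  have "\<exists>Q. \<forall>t. (1 + \<bar>t\<bar>) ^ k * norm (gen_deriv m z t) \<le> Q" for k m
    using gen_deriv_bounded[of k m z] by metis
  then show ?thesis using gen_deriv_has_derivative by (simp add: rapid_family_def deriv_family_def)
qed

lemma genprod_alt: "genprod z = (\<lambda>t. \<Prod>j\<in>UNIV. gen_deriv 0 (z j) (t $ j))"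
  by (simp add: genprod_def gen_deriv_0 fun_eq_iff)

lemma hprod_alt: "hprod n = (\<lambda>t. \<Prod>j\<in>UNIV. hfun_deriv 0 (n $ j) (t $ j))"
  by (simp add: hprod_def hfun_deriv_0 fun_eq_iff)

lemma hprod_schwartz: "hprod n \<in> schwartz_space"
  unfolding hprod_alt by (rule prod_in_schwartz_space[of "\<lambda>j m. hfun_deriv m (n $ j)"]) (rule rapid_hfun)

lemma genprod_schwartz: "genprod z \<in> schwartz_space"
  unfolding genprod_alt by (rule prod_in_schwartz_space[of "\<lambda>j m. gen_deriv m (z j)"]) (rule rapid_gen)

lemma finite_box_upto: "finite (box_upto M :: (nat^'d::finite) set)"
proof -
  have "box_upto M \<subseteq> vec_lambda ` (PiE (UNIV :: 'd set) (\<lambda>_. {..M}))"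
  proof
    fix n :: "nat^'d" assume "n \<in> box_upto M"
    then have "(\<lambda>j. n $ j) \<in> PiE UNIV (\<lambda>_. {..M})" by (auto simp: box_upto_def)
    then show "n \<in> vec_lambda ` (PiE (UNIV :: 'd set) (\<lambda>_. {..M}))" by (metis image_eqI vec_nth_inverse)
  qed
  then show ?thesis by (rule finite_subset) (intro finite_imageI finite_PiE, auto)
qed

lemma prod_sum_box:
  fixes f :: "'d::finite \<Rightarrow> nat \<Rightarrow> 'b::comm_semiring_1"
  shows "(\<Prod>j\<in>UNIV. \<Sum>n\<le>M. f j n) = (\<Sum>n\<in>box_upto M. \<Prod>j\<in>UNIV. f j (n $ j))"
proof -
  have "(\<Prod>j\<in>UNIV. \<Sum>n\<le>M. f j n) = (\<Sum>g\<in>PiE UNIV (\<lambda>_. {..M}). \<Prod>j\<in>UNIV. f j (g j))"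
    by (rule prod_sum_PiE) auto
  also have "\<dots> = (\<Sum>n\<in>box_upto M. \<Prod>j\<in>UNIV. f j (n $ j))"
    by (rule sum.reindex_bij_witness[of _ "vec_nth" vec_lambda]) (auto simp: box_upto_def)
  finally show ?thesis .
qed

lemma norm_prod_diff_le:
  fixes a b :: "'d::finite \<Rightarrow> complex"
  assumes K: "K \<ge> 1" "\<And>j. norm (a j) \<le> K" "\<And>j. norm (b j) \<le> K"
  shows "norm ((\<Prod>j\<in>UNIV. a j) - (\<Prod>j\<in>UNIV. b j)) \<le> K ^ CARD('d) * (\<Sum>j\<in>UNIV. norm (a j - b j))"
proof -
  have "norm ((\<Prod>j\<in>UNIV. a j / of_real K) - (\<Prod>j\<in>UNIV. b j / of_real K)) \<le> (\<Sum>j\<in>UNIV. norm (a j / of_real K - b j / of_real K))"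
    by (rule norm_prod_diff) (use K in \<open>auto simp: norm_divide\<close>)
  also have "\<dots> \<le> (\<Sum>j\<in>UNIV. norm (a j - b j))"
  proof (rule sum_mono)
    fix j
    have "norm (a j - b j) * 1 \<le> norm (a j - b j) * K" using K(1) by (intro mult_left_mono) auto
    then show "norm (a j / of_real K - b j / of_real K) \<le> norm (a j - b j)"
      using K(1) by (simp add: norm_divide divide_le_eq flip: diff_divide_distrib)
  qed
  also have "(\<Prod>j\<in>UNIV. a j / of_real K) - (\<Prod>j\<in>UNIV. b j / of_real K) = ((\<Prod>j\<in>UNIV. a j) - (\<Prod>j\<in>UNIV. b j)) / of_real K ^ CARD('d)"
    by (simp add: prod_dividef diff_divide_distrib)
  finally show ?thesis using K by (simp add: norm_divide norm_power field_simps)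
qed

lemma deriv_family_partial: "deriv_family (\<lambda>m t. \<Sum>n\<le>M. expcoeff z n * hfun_deriv m n t)"
  unfolding deriv_family_def
  by (intro allI has_vector_derivative_sum has_vector_derivative_mult_right hfun_deriv_has_derivative)

text \<open>
  The partial sums over boxes of the expansion of \<open>genprod z\<close> into Hermite functions are products of
  one-dimensional partial sums. They converge in every Schwartz seminorm, because each factor does and all factors
  are bounded, and \<open>u\<close> is continuous.
\<close>

theorem functional_genprod_expansion:
  fixes u :: "'d::finite functional"
  assumes u: "u \<in> tempered_distributions"
  shows "(\<lambda>M. \<Sum>n\<in>box_upto M. hcoeff u n * zpow z n) \<longlonglongrightarrow> u (genprod z)"
proof -
  define c where "c = (\<lambda>n::nat^'d. zpow z n / (\<Prod>j\<in>UNIV. fact (n $ j)))"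
  define gs where "gs = (\<lambda>M t. \<Sum>n\<in>box_upto M. c n * hprod n t)"
  define P where "P = (\<lambda>M (j::'d) m t. \<Sum>n\<le>M. expcoeff (z j) n * hfun_deriv m n t)"
  have gsP: "gs M = (\<lambda>t. \<Prod>j\<in>UNIV. P M j 0 (t $ j))" for M
    unfolding gs_def P_def c_def hprod_alt prod_sum_box by (simp add: prod.distrib prod_dividef)
  have sc: "gs M \<in> schwartz_space" and ugs: "u (gs M) = (\<Sum>n\<in>box_upto M. c n * u (hprod n))" for M
    using tempered_sum[where g = hprod and c = c, OF u finite_box_upto[of M] hprod_schwartz] by (auto simp: gs_def)
  have dP: "deriv_family (P M j)" for M j unfolding P_def by (rule deriv_family_partial)
  have dG: "deriv_family (\<lambda>m. gen_deriv m (z j))" for j using rapid_gen by (simp add: rapid_family_def)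
  have "(\<lambda>M. schwartz_seminorm k is (\<lambda>t. gs M t - genprod z t)) \<longlonglongrightarrow> 0" for k "is"
  proof -
    have "\<forall>j. \<exists>Q\<ge>0. \<forall>M t. (1 + \<bar>t\<bar>) ^ k * norm (gen_deriv (count_list is j) (z j) t - P M j (count_list is j) t) \<le> Q * (1/2) ^ M"
      unfolding P_def using gen_deriv_tail_bound by metis
    then obtain Q where Q: "\<And>j. Q j \<ge> 0" "\<And>j M t. (1 + \<bar>t\<bar>) ^ k * norm (gen_deriv (count_list is j) (z j) t - P M j (count_list is j) t) \<le> Q j * (1/2) ^ M"
      by metis
    have "\<forall>j. \<exists>B. \<forall>t. (1 + \<bar>t\<bar>) ^ k * norm (gen_deriv (count_list is j) (z j) t) \<le> B"
      using rapid_gen by (auto simp: rapid_family_def)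
    then obtain B where B: "\<And>j t. (1 + \<bar>t\<bar>) ^ k * norm (gen_deriv (count_list is j) (z j) t) \<le> B j" by metis
    have B0: "B j \<ge> 0" for j using B[of 0 j] by (auto intro: order_trans[OF norm_ge_zero])
    define K where "K = 1 + (\<Sum>j\<in>UNIV. B j + Q j)"
    have jK: "B j + Q j \<le> K" for j
      unfolding K_def using member_le_sum[of j UNIV "\<lambda>j. B j + Q j"] B0 Q(1) by (smt (verit) finite UNIV_I)
    have K1: "K \<ge> 1" unfolding K_def using B0 Q(1) by (simp add: sum_nonneg)
    \<comment> \<open>The weight (1 + |t|) ^ k is distributed over the factors before the difference of the two products is taken.\<close>
    have le: "schwartz_seminorm k is (\<lambda>t. gs M t - genprod z t) \<le> K ^ CARD('d) * (\<Sum>j\<in>UNIV. Q j * (1/2) ^ M)" for M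
    proof (rule seminorm_le)
      fix t :: "real^'d"
      define w where "w = (\<lambda>j. (1 + \<bar>t $ j\<bar>) ^ k)"
      define a where "a = (\<lambda>j. of_real (w j) * P M j (count_list is j) (t $ j))"
      define b where "b = (\<lambda>j. of_real (w j) * gen_deriv (count_list is j) (z j) (t $ j))"
      have w: "w j \<ge> 0" for j by (simp add: w_def)
      have diff: "norm (a j - b j) \<le> Q j * (1/2) ^ M" for j
      proof -
        have "a j - b j = of_real (w j) * (P M j (count_list is j) (t $ j) - gen_deriv (count_list is j) (z j) (t $ j))"
          by (simp add: a_def b_def algebra_simps)
        then have "norm (a j - b j) = w j * norm (gen_deriv (count_list is j) (z j) (t $ j) - P M j (count_list is j) (t $ j))"
          by (simp only: norm_mult norm_of_real abs_of_nonneg[OF w] norm_minus_commute)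
        then show ?thesis using Q(2)[of "t $ j" j M] by (simp only: w_def)
      qed
      have nb: "norm (b j) \<le> B j" for j
      proof -
        have "norm (b j) = w j * norm (gen_deriv (count_list is j) (z j) (t $ j))"
          by (simp only: b_def norm_mult norm_of_real abs_of_nonneg[OF w])
        then show ?thesis using B[of "t $ j" j] by (simp only: w_def)
      qed
      have na: "norm (a j) \<le> B j + Q j" for j
      proof -
        have "Q j * (1/2) ^ M \<le> Q j * 1" using Q(1) by (intro mult_left_mono power_le_one) auto
        then show ?thesis using nb[of j] diff[of j] norm_triangle_sub[of "a j" "b j"] by linarith
      qed
      have "iter_deriv is (\<lambda>t. gs M t - genprod z t) = (\<lambda>t. iter_deriv is (gs M) t - iter_deriv is (genprod z) t)"
        using iter_deriv_linear[of "gs M" "genprod z" "is" 1 "-1"] sc[of M] genprod_schwartz[of z] by (simp add: schwartz_space_def)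
      then have "iter_deriv is (\<lambda>t. gs M t - genprod z t) t = (\<Prod>j\<in>UNIV. P M j (count_list is j) (t $ j)) - (\<Prod>j\<in>UNIV. gen_deriv (count_list is j) (z j) (t $ j))"
        unfolding gsP genprod_alt iter_deriv_prod[OF dP] iter_deriv_prod[OF dG] by simp
      then have "norm t ^ k * norm (iter_deriv is (\<lambda>t. gs M t - genprod z t) t) \<le>
         (\<Prod>j\<in>UNIV. w j) * norm ((\<Prod>j\<in>UNIV. P M j (count_list is j) (t $ j)) - (\<Prod>j\<in>UNIV. gen_deriv (count_list is j) (z j) (t $ j)))"
        unfolding w_def by (simp add: mult_right_mono norm_power_le_prod)
      also have "\<dots> = norm (of_real (\<Prod>j\<in>UNIV. w j) * ((\<Prod>j\<in>UNIV. P M j (count_list is j) (t $ j)) - (\<Prod>j\<in>UNIV. gen_deriv (count_list is j) (z j) (t $ j))))"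
      proof -
        have "0 \<le> (\<Prod>j\<in>UNIV. w j)" using w by (intro prod_nonneg) auto
        then show ?thesis by (simp only: norm_mult norm_of_real abs_of_nonneg)
      qed
      also have "\<dots> = norm ((\<Prod>j\<in>UNIV. a j) - (\<Prod>j\<in>UNIV. b j))"
        unfolding a_def b_def by (simp add: prod.distrib right_diff_distrib)
      also have "\<dots> \<le> K ^ CARD('d) * (\<Sum>j\<in>UNIV. norm (a j - b j))"
      proof (rule norm_prod_diff_le[OF K1])
        show "norm (a j) \<le> K" for j using na[of j] jK[of j] by linarith
        show "norm (b j) \<le> K" for j using nb[of j] jK[of j] Q(1)[of j] by linarith
      qed
      also have "\<dots> \<le> K ^ CARD('d) * (\<Sum>j\<in>UNIV. Q j * (1/2) ^ M)"
        by (intro mult_left_mono sum_mono diff) (use K1 in auto)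
      finally show "norm t ^ k * norm (iter_deriv is (\<lambda>t. gs M t - genprod z t) t) \<le> K ^ CARD('d) * (\<Sum>j\<in>UNIV. Q j * (1/2) ^ M)" .
    qed
    have "(\<lambda>M. K ^ CARD('d) * (\<Sum>j\<in>UNIV. Q j * (1/2) ^ M)) \<longlonglongrightarrow> K ^ CARD('d) * (\<Sum>j\<in>(UNIV::'d set). Q j * 0)"
      by (intro tendsto_intros LIMSEQ_power_zero) auto
    then have l: "(\<lambda>M. K ^ CARD('d) * (\<Sum>j\<in>UNIV. Q j * (1/2) ^ M)) \<longlonglongrightarrow> 0" by simp
    have "0 \<le> schwartz_seminorm k is (\<lambda>t. gs M t - genprod z t)" for M
      using seminorm_nonneg[OF schwartz_space_linear[OF sc[of M] genprod_schwartz[of z], of 1 "-1"]] by simp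
    then show ?thesis by (intro tendsto_sandwich[OF _ _ tendsto_const l]) (auto simp: le)
  qed
  from tempered_tendsto[OF u genprod_schwartz sc this]
  show ?thesis unfolding ugs c_def hcoeff_def by (simp add: mult.commute)
qed

text \<open>
  For every \<open>R\<close>, each Schwartz seminorm of \<open>hprod n\<close> is of the order of the product of the
  \<open>fact n\<^sub>j / R ^ n\<^sub>j\<close>, and finitely many seminorms control \<open>u\<close>.
\<close>

theorem hcoeff_bound:
  fixes u :: "'d::finite functional"
  assumes u: "u \<in> tempered_distributions" and R: "R \<ge> 1"
  obtains C where "C \<ge> 0" "\<And>n. norm (hcoeff u n) \<le> C * (\<Prod>j\<in>UNIV. (1 / R) ^ (n $ j))"
proof -
  obtain C m where C: "C \<ge> 0" "\<And>g. g \<in> schwartz_space \<Longrightarrow> norm (u g) \<le> C * (\<Sum>k\<le>m. \<Sum>is | length is \<le> m. schwartz_seminorm k is g)"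
    using tempered_bound[OF u] by blast
  have "\<forall>k m. \<exists>Q\<ge>0. \<forall>n t. (1 + \<bar>t\<bar>) ^ k * norm (hfun_deriv m n t) \<le> Q * fact n / R ^ n"
    using hfun_deriv_bounded[OF R] by metis
  then obtain Q where Q: "\<And>k m. Q k m \<ge> 0" "\<And>k m n t. (1 + \<bar>t\<bar>) ^ k * norm (hfun_deriv m n t) \<le> Q k m * fact n / R ^ n" by metis
  define W where "W = (\<lambda>n::nat^'d. \<Prod>j\<in>UNIV. fact (n $ j) / R ^ (n $ j) :: real)"
  have sn: "schwartz_seminorm k is (hprod n) \<le> (\<Prod>j\<in>(UNIV::'d set). Q k (count_list is j)) * W n" for k "is" and n :: "nat^'d"
  proof (rule seminorm_le)
    fix x :: "real^'d"
    have "norm x ^ k * norm (iter_deriv is (hprod n) x) \<le> (\<Prod>j\<in>UNIV. Q k (count_list is j) * fact (n $ j) / R ^ (n $ j))"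
      unfolding hprod_alt
      using iter_deriv_prod[of "\<lambda>j m. hfun_deriv m (n $ j)" "is"] rapid_hfun
      by (simp add: rapid_family_def) (rule order_trans[OF norm_prod_weighted], intro prod_mono conjI Q mult_nonneg_nonneg; simp)
    then show "norm x ^ k * norm (iter_deriv is (hprod n) x) \<le> (\<Prod>j\<in>(UNIV::'d set). Q k (count_list is j)) * W n"
      by (simp add: W_def prod.distrib prod_dividef)
  qed
  define S where "S = (\<Sum>k\<le>m. \<Sum>is | length is \<le> m. \<Prod>j\<in>(UNIV::'d set). Q k (count_list is j))"
  show thesis
  proof (rule that[of "C * S"])
    show "C * S \<ge> 0" unfolding S_def by (intro mult_nonneg_nonneg C sum_nonneg prod_nonneg ballI Q)
    fix n :: "nat^'d"
    have "norm (u (hprod n)) \<le> C * (\<Sum>k\<le>m. \<Sum>is | length is \<le> m. schwartz_seminorm k is (hprod n))"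
      by (rule C(2)[OF hprod_schwartz])
    also have "\<dots> \<le> C * (\<Sum>k\<le>m. \<Sum>is | length is \<le> m. (\<Prod>j\<in>(UNIV::'d set). Q k (count_list is j)) * W n)"
      by (intro mult_left_mono sum_mono sn C)
    also have "\<dots> = C * S * W n" by (simp add: S_def sum_distrib_right)
    finally have "norm (u (hprod n)) / (\<Prod>j\<in>UNIV. fact (n $ j)) \<le> C * S * W n / (\<Prod>j\<in>UNIV. fact (n $ j))"
      by (intro divide_right_mono prod_nonneg) auto
    also have "\<dots> = C * S * (\<Prod>j\<in>UNIV. (1 / R) ^ (n $ j))"
      unfolding W_def by (simp add: prod_dividef power_divide)
    also have "norm (u (hprod n)) / (\<Prod>j\<in>UNIV. fact (n $ j)) = norm (hcoeff u n)"
      by (simp add: hcoeff_def norm_divide flip: prod_norm)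
    finally show "norm (hcoeff u n) \<le> C * S * (\<Prod>j\<in>UNIV. (1 / R) ^ (n $ j))" .
  qed
qed

section \<open>Rotations of phase space\<close>

type_synonym 'd phase = "(real^'d) \<times> (real^'d)"

text \<open>
  With this sign of the imaginary part the short-time Fourier transform is holomorphic in the coordinates,
  up to its weight and a phase.
\<close>

definition zcoord :: "'d::finite phase \<Rightarrow> 'd \<Rightarrow> complex" where
  "zcoord Z j = Complex (fst Z $ j) (- (snd Z $ j))"

definition gweight :: "'d::finite phase \<Rightarrow> real" where
  "gweight Z = exp (- pi / 2 * ((norm (fst Z))\<^sup>2 + (norm (snd Z))\<^sup>2))"

definition shear1 :: "'d::finite \<Rightarrow> real \<Rightarrow> 'd phase \<Rightarrow> 'd phase" where
  "shear1 k a Z = (fst Z + axis k (a * snd Z $ k), snd Z)"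

definition shear2 :: "'d::finite \<Rightarrow> real \<Rightarrow> 'd phase \<Rightarrow> 'd phase" where
  "shear2 k a Z = (fst Z, snd Z + axis k (a * fst Z $ k))"

definition rot :: "'d::finite \<Rightarrow> real \<Rightarrow> 'd phase \<Rightarrow> 'd phase" where
  "rot k \<theta> Z = (fst Z + axis k ((cos \<theta> - 1) * fst Z $ k + sin \<theta> * snd Z $ k),
               snd Z + axis k ((cos \<theta> - 1) * snd Z $ k - sin \<theta> * fst Z $ k))"

lemma continuous_axis [continuous_intros]:
  "continuous_on S f \<Longrightarrow> continuous_on S (\<lambda>x. axis k (f x) :: real^'d::finite)"
  unfolding axis_def
proof (intro continuous_on_vec_lambda)
  fix i assume "continuous_on S f"
  then show "continuous_on S (\<lambda>x. if i = k then f x else 0)" by (cases "i = k") auto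
qed

lemma continuous_rot: "continuous_on UNIV (\<lambda>(\<theta>, Z). rot k \<theta> Z)"
  unfolding rot_def case_prod_beta by (intro continuous_intros)

lemma measurable_rot: "(\<lambda>p. rot k (fst p) (snd p)) \<in> borel_measurable (borel \<Otimes>\<^sub>M borel)"
  unfolding borel_prod using continuous_rot[of k] by (intro borel_measurable_continuous_onI) (simp add: case_prod_beta)

lemma measurable_rot' [measurable]: "rot k \<theta> \<in> borel_measurable borel"
  unfolding rot_def by (intro borel_measurable_continuous_onI continuous_intros)

lemma measurable_shear [measurable]: "shear1 k a \<in> borel_measurable borel" "shear2 k a \<in> borel_measurable borel"
  unfolding shear1_def shear2_def by (intro borel_measurable_continuous_onI continuous_intros)+

lemma nn_integral_translate:
  fixes f :: "'a::euclidean_space \<Rightarrow> ennreal"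
  assumes [measurable]: "f \<in> borel_measurable borel"
  shows "(\<integral>\<^sup>+x. f (x + c) \<partial>lborel) = (\<integral>\<^sup>+x. f x \<partial>lborel)"
proof -
  have "(\<integral>\<^sup>+x. f x \<partial>lborel) = (\<integral>\<^sup>+x. f x \<partial>distr lborel borel ((+) c))" by (simp add: lborel_distr_plus)
  also have "\<dots> = (\<integral>\<^sup>+x. f (c + x) \<partial>lborel)" by (subst nn_integral_distr) auto
  finally show ?thesis by (simp add: add.commute)
qed

lemma nn_integral_shear:
  fixes G :: "'d::finite phase \<Rightarrow> ennreal"
  assumes [measurable]: "G \<in> borel_measurable borel"
  shows "(\<integral>\<^sup>+Z. G (shear1 k a Z) \<partial>lborel) = (\<integral>\<^sup>+Z. G Z \<partial>lborel)"
    and "(\<integral>\<^sup>+Z. G (shear2 k a Z) \<partial>lborel) = (\<integral>\<^sup>+Z. G Z \<partial>lborel)"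
proof -
  have [measurable]: "G \<in> borel_measurable (borel \<Otimes>\<^sub>M borel)" by (simp add: borel_prod)
  have m: "H \<in> borel_measurable (lborel \<Otimes>\<^sub>M lborel)" if "H \<in> borel_measurable borel" for H :: "'d phase \<Rightarrow> ennreal"
    using that by (simp add: lborel_prod)
  have "(\<integral>\<^sup>+Z. G (shear1 k a Z) \<partial>lborel) = (\<integral>\<^sup>+Z. G (shear1 k a Z) \<partial>(lborel \<Otimes>\<^sub>M lborel))" by (simp add: lborel_prod)
  also have "\<dots> = (\<integral>\<^sup>+w. (\<integral>\<^sup>+x. G (shear1 k a (x, w)) \<partial>lborel) \<partial>lborel)"
    by (subst lborel_pair.nn_integral_snd[symmetric]) (auto intro!: m)
  also have "\<dots> = (\<integral>\<^sup>+w. (\<integral>\<^sup>+x. G (x, w) \<partial>lborel) \<partial>lborel)"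
    unfolding shear1_def fst_conv snd_conv by (intro nn_integral_cong nn_integral_translate) measurable
  also have "\<dots> = (\<integral>\<^sup>+Z. G Z \<partial>(lborel \<Otimes>\<^sub>M lborel))"
    by (subst lborel_pair.nn_integral_snd[symmetric]) (auto intro!: m)
  finally show "(\<integral>\<^sup>+Z. G (shear1 k a Z) \<partial>lborel) = (\<integral>\<^sup>+Z. G Z \<partial>lborel)" by (simp add: lborel_prod)
  have "(\<integral>\<^sup>+Z. G (shear2 k a Z) \<partial>lborel) = (\<integral>\<^sup>+Z. G (shear2 k a Z) \<partial>(lborel \<Otimes>\<^sub>M lborel))" by (simp add: lborel_prod)
  also have "\<dots> = (\<integral>\<^sup>+x. (\<integral>\<^sup>+w. G (shear2 k a (x, w)) \<partial>lborel) \<partial>lborel)"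
    by (subst lborel.nn_integral_fst[symmetric]) (auto intro!: m)
  also have "\<dots> = (\<integral>\<^sup>+x. (\<integral>\<^sup>+w. G (x, w) \<partial>lborel) \<partial>lborel)"
    unfolding shear2_def fst_conv snd_conv by (intro nn_integral_cong nn_integral_translate) measurable
  also have "\<dots> = (\<integral>\<^sup>+Z. G Z \<partial>(lborel \<Otimes>\<^sub>M lborel))"
    by (subst lborel.nn_integral_fst[symmetric]) (auto intro!: m)
  finally show "(\<integral>\<^sup>+Z. G (shear2 k a Z) \<partial>lborel) = (\<integral>\<^sup>+Z. G Z \<partial>lborel)" by (simp add: lborel_prod)
qed

text \<open>
  Three shears make a rotation, the outer ones by \<open>tan (\<theta> / 2)\<close>. A shear preserves Lebesgue measure
  because it is a translation on each line, so a rotation does too.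
\<close>

lemma rot_eq_shears:
  assumes "cos \<theta> \<noteq> -1"
  shows "rot k \<theta> Z = shear1 k (sin \<theta> / (1 + cos \<theta>)) (shear2 k (- sin \<theta>) (shear1 k (sin \<theta> / (1 + cos \<theta>)) Z))"
proof -
  have c: "1 + cos \<theta> \<noteq> 0" using assms by (metis add.commute add_eq_0_iff)
  define \<alpha> where "\<alpha> = sin \<theta> / (1 + cos \<theta>)"
  have a1: "\<alpha> * (1 + cos \<theta>) = sin \<theta>" using c by (simp add: \<alpha>_def)
  have "sin \<theta> * sin \<theta> = (1 - cos \<theta>) * (1 + cos \<theta>)"
    using sin_squared_eq[of \<theta>] by (simp add: power2_eq_square algebra_simps)
  then have a2: "\<alpha> * sin \<theta> = 1 - cos \<theta>" using c by (simp add: \<alpha>_def)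
  obtain x w where Z: "Z = (x, w)" by (cases Z)
  have e1: "(cos \<theta> - 1) * x $ k + sin \<theta> * w $ k = \<alpha> * w $ k + \<alpha> * (w $ k - sin \<theta> * (x $ k + \<alpha> * w $ k))"
  proof -
    have "\<alpha> * w $ k + \<alpha> * (w $ k - sin \<theta> * (x $ k + \<alpha> * w $ k)) = (2 * \<alpha> - \<alpha> * (\<alpha> * sin \<theta>)) * w $ k - (\<alpha> * sin \<theta>) * x $ k"
      by (simp add: algebra_simps)
    also have "2 * \<alpha> - \<alpha> * (\<alpha> * sin \<theta>) = \<alpha> * (1 + cos \<theta>)" unfolding a2 by (simp add: algebra_simps)
    finally show ?thesis unfolding a1 a2 by (simp add: algebra_simps)
  qed
  have e2: "(cos \<theta> - 1) * w $ k - sin \<theta> * x $ k = - sin \<theta> * (x $ k + \<alpha> * w $ k)"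
  proof -
    have "- sin \<theta> * (x $ k + \<alpha> * w $ k) = - sin \<theta> * x $ k - (\<alpha> * sin \<theta>) * w $ k" by (simp add: algebra_simps)
    then show ?thesis unfolding a2 by (simp add: algebra_simps)
  qed
  show ?thesis unfolding rot_def shear1_def shear2_def Z \<alpha>_def[symmetric] fst_conv snd_conv e1 e2
    by (simp add: vec_eq_iff axis_def)
qed

lemma rot_add: "rot k \<theta> (rot k \<theta>' Z) = rot k (\<theta> + \<theta>') Z"
  unfolding rot_def by (simp add: vec_eq_iff axis_def sin_add cos_add algebra_simps)

lemma nn_integral_rot:
  fixes G :: "'d::finite phase \<Rightarrow> ennreal"
  assumes [measurable]: "G \<in> borel_measurable borel"
  shows "(\<integral>\<^sup>+Z. G (rot k \<theta> Z) \<partial>lborel) = (\<integral>\<^sup>+Z. G Z \<partial>lborel)"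
proof -
  have *: "(\<integral>\<^sup>+Z. G (rot k \<theta> Z) \<partial>lborel) = (\<integral>\<^sup>+Z. G Z \<partial>lborel)"
    if "cos \<theta> \<noteq> -1" and G: "G \<in> borel_measurable borel" for G :: "'d phase \<Rightarrow> ennreal" and \<theta>
  proof -
    let ?s = "\<lambda>Z. shear1 k (sin \<theta> / (1 + cos \<theta>)) Z"
    note [measurable] = G
    have "(\<integral>\<^sup>+Z. G (rot k \<theta> Z) \<partial>lborel) = (\<integral>\<^sup>+Z. G (?s (shear2 k (- sin \<theta>) (?s Z))) \<partial>lborel)"
      unfolding rot_eq_shears[OF that(1)] ..
    also have "\<dots> = (\<integral>\<^sup>+Z. G (?s (shear2 k (- sin \<theta>) Z)) \<partial>lborel)"
      by (rule nn_integral_shear(1)[of "\<lambda>Z. G (?s (shear2 k (- sin \<theta>) Z))"]) measurable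
    also have "\<dots> = (\<integral>\<^sup>+Z. G (?s Z) \<partial>lborel)"
      by (rule nn_integral_shear(2)[of "\<lambda>Z. G (?s Z)"]) measurable
    also have "\<dots> = (\<integral>\<^sup>+Z. G Z \<partial>lborel)" by (rule nn_integral_shear(1)) measurable
    finally show ?thesis .
  qed
  show ?thesis
  proof (cases "cos \<theta> = -1")
    case False then show ?thesis by (intro *) measurable
  next
    case True
    \<comment> \<open>A half turn is no product of such shears, but it is the square of a quarter turn.\<close>
    then have "cos (\<theta>/2) \<noteq> -1" using cos_double_cos[of "\<theta>/2"] by auto
    have "(\<integral>\<^sup>+Z. G (rot k \<theta> Z) \<partial>lborel) = (\<integral>\<^sup>+Z. G (rot k (\<theta>/2) (rot k (\<theta>/2) Z)) \<partial>lborel)"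
      by (simp add: rot_add)
    also have "\<dots> = (\<integral>\<^sup>+Z. G (rot k (\<theta>/2) Z) \<partial>lborel)"
      by (rule *[of _ "\<lambda>Z. G (rot k (\<theta>/2) Z)"]) (use \<open>cos (\<theta>/2) \<noteq> -1\<close> in measurable)
    also have "\<dots> = (\<integral>\<^sup>+Z. G Z \<partial>lborel)" by (rule *) (use \<open>cos (\<theta>/2) \<noteq> -1\<close> in measurable)
    finally show ?thesis .
  qed
qed

lemma nn_integral_rot_average:
  fixes G :: "'d::finite phase \<Rightarrow> ennreal"
  assumes [measurable]: "G \<in> borel_measurable borel"
  shows "(\<integral>\<^sup>+Z. (\<integral>\<^sup>+\<theta>. G (rot k \<theta> Z) * indicator {0..2*pi} \<theta> \<partial>lborel) \<partial>lborel) = ennreal (2 * pi) * (\<integral>\<^sup>+Z. G Z \<partial>lborel)"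
proof -
  have m: "(\<lambda>(Z, \<theta>). G (rot k \<theta> Z) * indicator {0..2*pi} \<theta>) \<in> borel_measurable (lborel \<Otimes>\<^sub>M (lborel :: real measure))"
  proof -
    have "(\<lambda>p. rot k (snd p) (fst p)) \<in> borel_measurable (lborel \<Otimes>\<^sub>M (lborel :: real measure))"
      using measurable_compose[OF measurable_pair_swap' measurable_rot[of k]] by (simp add: case_prod_beta)
    from measurable_compose[OF this, of G borel] show ?thesis by (simp add: case_prod_beta)
  qed
  have "(\<integral>\<^sup>+Z. (\<integral>\<^sup>+\<theta>. G (rot k \<theta> Z) * indicator {0..2*pi} \<theta> \<partial>lborel) \<partial>lborel) =
      (\<integral>\<^sup>+\<theta>. (\<integral>\<^sup>+Z. G (rot k \<theta> Z) * indicator {0..2*pi} \<theta> \<partial>lborel) \<partial>lborel)"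
    using lborel_pair.Fubini'[OF m] by simp
  also have "\<dots> = (\<integral>\<^sup>+\<theta>. (\<integral>\<^sup>+Z. G Z \<partial>lborel) * indicator {0..2*pi} \<theta> \<partial>lborel)"
  proof (rule nn_integral_cong)
    fix \<theta> :: real
    have "(\<integral>\<^sup>+Z. G (rot k \<theta> Z) * indicator {0..2*pi} \<theta> \<partial>lborel) = (\<integral>\<^sup>+Z. G (rot k \<theta> Z) \<partial>lborel) * indicator {0..2*pi} \<theta>"
      by (rule nn_integral_multc) measurable
    then show "(\<integral>\<^sup>+Z. G (rot k \<theta> Z) * indicator {0..2*pi} \<theta> \<partial>lborel) = (\<integral>\<^sup>+Z. G Z \<partial>lborel) * indicator {0..2*pi} \<theta>"
      by (simp add: nn_integral_rot)
  qed
  also have "\<dots> = (\<integral>\<^sup>+Z. G Z \<partial>lborel) * ennreal (2 * pi)" by (subst nn_integral_cmult_indicator) auto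
  finally show ?thesis by (simp add: mult.commute)
qed

lemma zcoord_rot: "zcoord (rot k \<theta> Z) j = (if j = k then cis \<theta> * zcoord Z j else zcoord Z j)"
  by (auto simp: zcoord_def rot_def axis_def complex_eq_iff algebra_simps)

lemma gweight_alt: "gweight Z = exp (- pi / 2 * (\<Sum>j\<in>UNIV. (norm (zcoord Z j))\<^sup>2))"
  unfolding gweight_def zcoord_def cmod_power2 norm_vec_def L2_set_def
  by (simp add: sum.distrib sum_nonneg)

lemma gweight_rot: "gweight (rot k \<theta> Z) = gweight Z"
  unfolding gweight_alt zcoord_rot by (intro arg_cong[of _ _ exp] arg_cong2[of _ _ _ _ "(*)"] refl sum.cong) (auto simp: norm_mult)

lemma continuous_zcoord [continuous_intros]: "continuous_on S (\<lambda>Z. zcoord Z j)"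
  unfolding zcoord_def Complex_eq by (intro continuous_intros)

lemma measurable_gweight [measurable]: "gweight \<in> borel_measurable borel"
  unfolding gweight_def by (intro borel_measurable_continuous_onI continuous_intros) auto

section \<open>Entire power series along rotations\<close>

definition entire_coeffs :: "(nat^'d::finite \<Rightarrow> complex) \<Rightarrow> bool" where
  "entire_coeffs a \<longleftrightarrow> (\<forall>r\<ge>0. (\<lambda>n. norm (a n) * (\<Prod>j\<in>UNIV. r ^ (n $ j))) summable_on UNIV)"

definition pseries :: "(nat^'d::finite \<Rightarrow> complex) \<Rightarrow> 'd phase \<Rightarrow> complex" where
  "pseries a Z = infsum (\<lambda>n. a n * zpow (zcoord Z) n) UNIV"

lemma entire_abs_summable:
  assumes "entire_coeffs a"
  shows "(\<lambda>n. norm (a n * zpow (zcoord Z) n)) summable_on UNIV"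
proof -
  define r where "r = (\<Sum>j\<in>UNIV. norm (zcoord Z j))"
  have r: "norm (zcoord Z j) \<le> r" for j unfolding r_def by (rule member_le_sum) auto
  have "r \<ge> 0" unfolding r_def by (rule sum_nonneg) auto
  then have s: "(\<lambda>n. norm (a n) * (\<Prod>j\<in>UNIV. r ^ (n $ j))) summable_on UNIV" using assms by (simp add: entire_coeffs_def)
  show ?thesis
  proof (rule summable_on_comparison_test[OF s])
    fix n :: "nat^'a"
    have "(\<Prod>j\<in>UNIV. norm (zcoord Z j) ^ (n $ j)) \<le> (\<Prod>j\<in>UNIV. r ^ (n $ j))"
      by (intro prod_mono conjI power_mono r) auto
    then show "norm (a n * zpow (zcoord Z) n) \<le> norm (a n) * (\<Prod>j\<in>UNIV. r ^ (n $ j))"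
      by (simp add: norm_mult norm_power mult_left_mono flip: prod_norm)
  qed auto
qed

lemma entire_summable:
  assumes "entire_coeffs a" shows "(\<lambda>n. a n * zpow (zcoord Z) n) summable_on A"
  using abs_summable_summable[OF entire_abs_summable[OF assms]] summable_on_subset_banach by blast

lemma entire_coeffs_comparison:
  assumes "entire_coeffs a" "\<And>n. norm (b n) \<le> norm (a n)" shows "entire_coeffs b"
  unfolding entire_coeffs_def
proof (intro allI impI)
  fix r :: real assume r: "r \<ge> 0"
  then have s: "(\<lambda>n. norm (a n) * (\<Prod>j\<in>UNIV. r ^ (n $ j))) summable_on UNIV" using assms by (simp add: entire_coeffs_def)
  show "(\<lambda>n. norm (b n) * (\<Prod>j\<in>UNIV. r ^ (n $ j))) summable_on UNIV"
    by (rule summable_on_comparison_test[OF s]) (use assms(2) r in \<open>auto intro!: mult_right_mono mult_nonneg_nonneg prod_nonneg\<close>)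
qed

lemma box_upto_exhausts: "filterlim box_upto (finite_subsets_at_top (UNIV :: (nat^'d::finite) set)) sequentially"
  unfolding filterlim_finite_subsets_at_top
proof (intro allI impI)
  fix X :: "(nat^'d) set" assume X: "finite X \<and> X \<subseteq> UNIV"
  define K where "K = (\<Sum>n\<in>X. \<Sum>j\<in>UNIV. n $ j)"
  have "n $ j \<le> K" if "n \<in> X" for n :: "nat^'d" and j
  proof -
    have "n $ j \<le> (\<Sum>j\<in>UNIV. n $ j)" by (rule member_le_sum) auto
    also have "\<dots> \<le> K" unfolding K_def using X that by (intro member_le_sum) auto
    finally show ?thesis .
  qed
  then have "X \<subseteq> box_upto M" if "M \<ge> K" for M using that by (auto simp: box_upto_def intro: order_trans)
  then show "\<forall>\<^sub>F M in sequentially. finite (box_upto M) \<and> X \<subseteq> box_upto M \<and> box_upto M \<subseteq> UNIV"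
    by (intro eventually_mono[OF eventually_ge_at_top[of K]]) (auto simp: finite_box_upto)
qed

lemma pseries_limit:
  assumes "entire_coeffs a"
  shows "(\<lambda>M. \<Sum>n\<in>box_upto M. a n * zpow (zcoord Z) n) \<longlonglongrightarrow> pseries a Z"
proof -
  have "((\<lambda>n. a n * zpow (zcoord Z) n) has_sum pseries a Z) UNIV"
    unfolding pseries_def by (rule has_sum_infsum[OF entire_summable[OF assms]])
  then show ?thesis unfolding has_sum_def by (rule filterlim_compose[OF _ box_upto_exhausts])
qed

lemma measurable_pseries [measurable]:
  assumes "entire_coeffs a" shows "pseries a \<in> borel_measurable borel"
proof (rule borel_measurable_LIMSEQ_metric[OF _ pseries_limit[OF assms]])
  show "(\<lambda>Z. \<Sum>n\<in>box_upto M. a n * zpow (zcoord Z) n) \<in> borel_measurable borel" for M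
    by (intro borel_measurable_continuous_onI continuous_intros)
qed

definition lowpart :: "'d::finite \<Rightarrow> nat \<Rightarrow> (nat^'d \<Rightarrow> complex) \<Rightarrow> nat^'d \<Rightarrow> complex" where
  "lowpart k N a n = (if n $ k \<le> N then a n else 0)"

lemma entire_lowpart: "entire_coeffs a \<Longrightarrow> entire_coeffs (lowpart k N a)"
  by (erule entire_coeffs_comparison) (auto simp: lowpart_def)

text \<open>
  The terms of the series with \<open>k\<close>-th exponent \<open>m\<close>. Along the orbit \<open>rot k \<theta> Z\<close> the whole series is the
  one-variable series in \<open>cis \<theta>\<close> with these coefficients (\<open>pseries_rot\<close>).
\<close>

definition slice :: "'d::finite \<Rightarrow> (nat^'d \<Rightarrow> complex) \<Rightarrow> 'd phase \<Rightarrow> nat \<Rightarrow> complex" where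
  "slice k a Z m = infsum (\<lambda>n. a n * zpow (zcoord Z) n) {n. n $ k = m}"

lemma slice_infsum:
  fixes g :: "nat^'d::finite \<Rightarrow> 'b::banach"
  assumes "(\<lambda>n. norm (g n)) summable_on UNIV"
  shows "(\<lambda>m. infsum g {n. n $ k = m}) sums infsum g UNIV"
proof -
  have gs: "g summable_on UNIV" by (rule abs_summable_summable[OF assms])
  have bij: "bij_betw snd (Sigma (UNIV::nat set) (\<lambda>m. {n :: nat^'d. n $ k = m})) UNIV"
    by (rule bij_betwI[of _ _ _ "\<lambda>n. (n $ k, n)"]) auto
  have s: "(\<lambda>p. g (snd p)) summable_on (Sigma (UNIV::nat set) (\<lambda>m. {n :: nat^'d. n $ k = m}))"
    using summable_on_reindex_bij_betw[OF bij, of g] gs by simp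
  have hs: "((\<lambda>p. g (snd p)) has_sum infsum g UNIV) (Sigma (UNIV::nat set) (\<lambda>m. {n :: nat^'d. n $ k = m}))"
    using has_sum_infsum[OF s] infsum_reindex_bij_betw[OF bij, of g] by simp
  have "((\<lambda>m. infsum g {n. n $ k = m}) has_sum infsum g UNIV) UNIV"
    by (rule has_sum_SigmaD[OF hs]) (auto intro!: has_sum_infsum summable_on_subset_banach[OF gs])
  then show ?thesis by (rule has_sum_imp_sums)
qed

lemma slice_summable:
  assumes "entire_coeffs a"
  shows "summable (\<lambda>m. norm (slice k a Z m))"
proof (rule summable_comparison_test[OF _ sums_summable[OF slice_infsum[where k=k]]])
  show "(\<lambda>n. norm (norm (a n * zpow (zcoord Z) n))) summable_on UNIV" using entire_abs_summable[OF assms] by simp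
  have "norm (slice k a Z m) \<le> infsum (\<lambda>n. norm (a n * zpow (zcoord Z) n)) {n. n $ k = m}" for m
    unfolding slice_def
    by (rule norm_infsum_bound) (rule summable_on_subset_banach[OF entire_abs_summable[OF assms]], simp)
  then show "\<exists>N. \<forall>m\<ge>N. norm (norm (slice k a Z m)) \<le> infsum (\<lambda>n. norm (a n * zpow (zcoord Z) n)) {n. n $ k = m}"
    by auto
qed

lemma zpow_rot: "zpow (zcoord (rot k \<theta> Z)) n = cis \<theta> ^ (n $ k) * zpow (zcoord Z) n"
proof -
  have "zpow (zcoord (rot k \<theta> Z)) n = (\<Prod>j\<in>UNIV. (if j = k then cis \<theta> ^ (n $ k) else 1) * zcoord Z j ^ (n $ j))"
    unfolding zcoord_rot by (intro prod.cong) (auto simp: power_mult_distrib)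
  then show ?thesis by (simp add: prod.distrib)
qed

lemma pseries_rot:
  assumes a: "entire_coeffs a"
  shows "(\<lambda>m. slice k a Z m * cis \<theta> ^ m) sums pseries a (rot k \<theta> Z)"
proof -
  have "(\<lambda>m. infsum (\<lambda>n. a n * zpow (zcoord (rot k \<theta> Z)) n) {n. n $ k = m}) sums pseries a (rot k \<theta> Z)"
    unfolding pseries_def by (rule slice_infsum[OF entire_abs_summable[OF a]])
  moreover have "infsum (\<lambda>n. a n * zpow (zcoord (rot k \<theta> Z)) n) {n. n $ k = m} = slice k a Z m * cis \<theta> ^ m" for m
  proof -
    have "infsum (\<lambda>n. a n * zpow (zcoord (rot k \<theta> Z)) n) {n. n $ k = m} = infsum (\<lambda>n. (a n * zpow (zcoord Z) n) * cis \<theta> ^ m) {n. n $ k = m}"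
      by (rule infsum_cong) (simp add: zpow_rot)
    then show ?thesis unfolding slice_def by (simp add: infsum_cmult_left' )
  qed
  ultimately show ?thesis by simp
qed

lemma slice_lowpart: "slice k (lowpart k N a) Z m = (if m \<le> N then slice k a Z m else 0)"
  unfolding slice_def by (auto simp: lowpart_def intro!: infsum_cong infsum_0)

lemma pseries_lowpart_rot:
  assumes a: "entire_coeffs a"
  shows "pseries (lowpart k N a) (rot k \<theta> Z) = (\<Sum>m\<le>N. slice k a Z m * cis \<theta> ^ m)"
proof -
  have "(\<lambda>m. (if m \<le> N then slice k a Z m else 0) * cis \<theta> ^ m) sums pseries (lowpart k N a) (rot k \<theta> Z)"
    using pseries_rot[OF entire_lowpart[OF a, of k N], of k Z \<theta>] by (simp add: slice_lowpart)
  moreover have "(\<lambda>m. (if m \<le> N then slice k a Z m else 0) * cis \<theta> ^ m) sums (\<Sum>m\<le>N. (if m \<le> N then slice k a Z m else 0) * cis \<theta> ^ m)"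
    by (rule sums_finite) auto
  ultimately show ?thesis using sums_unique2 by fastforce
qed

section \<open>Truncation in weighted spaces of entire functions\<close>

text \<open>
  By \<open>stft_eq_pseries\<close>, the \<open>p\<close>-th power of the modulation norm of a distribution with coefficients \<open>a\<close>.
\<close>

definition pnorm :: "real \<Rightarrow> (nat^'d::finite \<Rightarrow> complex) \<Rightarrow> ennreal" where
  "pnorm p a = (\<integral>\<^sup>+Z. ennreal ((norm (pseries a Z) * gweight Z) powr p) \<partial>lborel)"

abbreviation circ_mean :: "'d::finite \<Rightarrow> ('d phase \<Rightarrow> ennreal) \<Rightarrow> 'd phase \<Rightarrow> ennreal" where
  "circ_mean k G Z \<equiv> (\<integral>\<^sup>+\<theta>. G (rot k \<theta> Z) * indicator {0..2*pi} \<theta> \<partial>lborel)"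

lemma gweight_pos: "gweight Z > 0" by (simp add: gweight_def)

lemma measurable_circ_mean:
  fixes G :: "'d::finite phase \<Rightarrow> ennreal"
  assumes [measurable]: "G \<in> borel_measurable borel"
  shows "circ_mean k G \<in> borel_measurable lborel"
proof -
  have "(\<lambda>p. rot k (snd p) (fst p)) \<in> borel_measurable (lborel \<Otimes>\<^sub>M (lborel :: real measure))"
    using measurable_compose[OF measurable_pair_swap' measurable_rot[of k]] by (simp add: case_prod_beta)
  from measurable_compose[OF this, of G borel]
  have "(\<lambda>(Z, \<theta>). G (rot k \<theta> Z) * indicator {0..2*pi} \<theta>) \<in> borel_measurable (lborel \<Otimes>\<^sub>M (lborel :: real measure))"
    by (simp add: case_prod_beta)
  from lborel.borel_measurable_nn_integral[OF this] show ?thesis by simp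
qed

lemma continuous_circle_series:
  assumes "summable (\<lambda>n. norm (c n))"
  shows "continuous_on UNIV (\<lambda>\<theta>. \<Sum>m. c m * cis \<theta> ^ m)"
proof (rule uniform_limit_theorem)
  show "uniform_limit UNIV (\<lambda>n \<theta>. \<Sum>m<n. c m * cis \<theta> ^ m) (\<lambda>\<theta>. \<Sum>m. c m * cis \<theta> ^ m) sequentially"
    by (rule Weierstrass_m_test[OF _ assms]) (simp add: norm_mult norm_power)
qed (auto intro!: always_eventually continuous_intros)

lemma nn_integral_circle_powr:
  assumes "continuous_on UNIV f" "p > 0" "w \<ge> 0"
  shows "(\<integral>\<^sup>+\<theta>. ennreal ((norm (f \<theta> :: complex) * w) powr p) * indicator {0..2*pi} \<theta> \<partial>lborel)
    = ennreal (w powr p * integral {0..2*pi} (\<lambda>\<theta>. norm (f \<theta>) powr p))"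
proof -
  have "((\<lambda>\<theta>. norm (f \<theta>) powr p) has_integral integral {0..2*pi} (\<lambda>\<theta>. norm (f \<theta>) powr p)) {0..2*pi}"
    using assms by (intro integrable_integral integrable_continuous_real continuous_intros) (auto intro: continuous_on_subset)
  from has_integral_mult_right[OF this, of "w powr p"]
  have "((\<lambda>\<theta>. (norm (f \<theta>) * w) powr p) has_integral w powr p * integral {0..2*pi} (\<lambda>\<theta>. norm (f \<theta>) powr p)) {0..2*pi}"
    using assms by (simp add: powr_mult mult.commute)
  from nn_integral_has_integral_lebesgue'[OF _ this] show ?thesis by simp
qed

lemma circ_mean_pseries:
  assumes a: "entire_coeffs a" and p: "p > 0"
  shows "circ_mean k (\<lambda>Z. ennreal ((norm (pseries a Z) * gweight Z) powr p)) Z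
     = ennreal (gweight Z powr p * integral {0..2*pi} (\<lambda>\<theta>. norm (\<Sum>m. slice k a Z m * cis \<theta> ^ m) powr p))"
  unfolding gweight_rot sums_unique[OF pseries_rot[OF a]]
  by (rule nn_integral_circle_powr[OF continuous_circle_series[OF slice_summable[OF a]] p less_imp_le[OF gweight_pos]])

text \<open>
  On an orbit the weight is constant and truncation of the \<open>k\<close>-th exponent truncates a one-variable power
  series.
\<close>

lemma circ_mean_lowpart:
  assumes a: "entire_coeffs a" and p: "p > 0" and C: "riesz_bound p C" "C \<ge> 0"
  shows "circ_mean k (\<lambda>Z. ennreal ((norm (pseries (lowpart k N a) Z) * gweight Z) powr p)) Z
     \<le> ennreal C * circ_mean k (\<lambda>Z. ennreal ((norm (pseries a Z) * gweight Z) powr p)) Z"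
proof -
  have "circ_mean k (\<lambda>Z. ennreal ((norm (pseries (lowpart k N a) Z) * gweight Z) powr p)) Z
    = ennreal (gweight Z powr p * integral {0..2*pi} (\<lambda>\<theta>. norm (\<Sum>m\<le>N. slice k a Z m * cis \<theta> ^ m) powr p))"
    unfolding gweight_rot pseries_lowpart_rot[OF a]
    by (rule nn_integral_circle_powr[OF _ p less_imp_le[OF gweight_pos]]) (intro continuous_intros)
  also have "\<dots> \<le> ennreal (gweight Z powr p * (C * integral {0..2*pi} (\<lambda>\<theta>. norm (\<Sum>m. slice k a Z m * cis \<theta> ^ m) powr p)))"
    by (intro ennreal_leI mult_left_mono truncation_bound_circle[OF C(1) p slice_summable[OF a]]) auto
  also have "\<dots> = ennreal C * circ_mean k (\<lambda>Z. ennreal ((norm (pseries a Z) * gweight Z) powr p)) Z"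
    unfolding circ_mean_pseries[OF a p] using C by (subst ennreal_mult'[symmetric]) (simp_all add: mult_ac)
  finally show ?thesis .
qed

lemma measurable_pdensity [measurable]:
  "entire_coeffs a \<Longrightarrow> (\<lambda>Z. ennreal ((norm (pseries a Z) * gweight Z) powr p)) \<in> borel_measurable borel"
  by measurable

lemma pnorm_circ_mean:
  assumes "entire_coeffs a"
  shows "(\<integral>\<^sup>+Z. circ_mean k (\<lambda>Z. ennreal ((norm (pseries a Z) * gweight Z) powr p)) Z \<partial>lborel) = ennreal (2 * pi) * pnorm p a"
  unfolding pnorm_def by (rule nn_integral_rot_average) (rule measurable_pdensity[OF assms])

lemma pnorm_lowpart:
  assumes a: "entire_coeffs a" and p: "p > 0" and C: "riesz_bound p C" "C \<ge> 0"
  shows "pnorm p (lowpart k N a) \<le> ennreal C * pnorm p a"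
proof -
  have "ennreal (2 * pi) * pnorm p (lowpart k N a) = (\<integral>\<^sup>+Z. circ_mean k (\<lambda>Z. ennreal ((norm (pseries (lowpart k N a) Z) * gweight Z) powr p)) Z \<partial>lborel)"
    by (rule pnorm_circ_mean[OF entire_lowpart[OF a], symmetric])
  also have "\<dots> \<le> (\<integral>\<^sup>+Z. ennreal C * circ_mean k (\<lambda>Z. ennreal ((norm (pseries a Z) * gweight Z) powr p)) Z \<partial>lborel)"
    by (intro nn_integral_mono circ_mean_lowpart[OF a p C])
  also have "\<dots> = ennreal C * (ennreal (2 * pi) * pnorm p a)"
    using measurable_circ_mean[OF measurable_pdensity[OF a], of k p]
    by (subst nn_integral_cmult) (simp_all add: pnorm_circ_mean[OF a])
  also have "\<dots> = ennreal (2 * pi) * (ennreal C * pnorm p a)" by (simp add: mult_ac)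
  finally show ?thesis by (simp add: ennreal_mult_le_mult_iff)
qed

lemma pseries_add:
  assumes "entire_coeffs a" "entire_coeffs b"
  shows "pseries (\<lambda>n. a n + b n) Z = pseries a Z + pseries b Z"
  unfolding pseries_def distrib_right by (rule infsum_add) (rule entire_summable assms)+

lemma powr_norm_add:
  fixes x y :: complex
  assumes "p > 0" "w \<ge> 0"
  shows "ennreal ((norm (x + y) * w) powr p) \<le> ennreal (2 powr p) * (ennreal ((norm x * w) powr p) + ennreal ((norm y * w) powr p))"
proof -
  have "norm (x + y) * w \<le> (norm x + norm y) * w" by (intro mult_right_mono norm_triangle_ineq assms)
  also have "\<dots> = norm x * w + norm y * w" by (simp add: distrib_right)
  finally have "(norm (x + y) * w) powr p \<le> (norm x * w + norm y * w) powr p"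
    using assms by (intro powr_mono2) auto
  also have "\<dots> \<le> 2 powr p * ((norm x * w) powr p + (norm y * w) powr p)"
    using assms by (intro powr_add_le_max) auto
  finally show ?thesis by (simp flip: ennreal_plus ennreal_mult')
qed

lemma pnorm_add:
  assumes a: "entire_coeffs a" "entire_coeffs b" and p: "p > 0"
  shows "pnorm p (\<lambda>n. a n + b n) \<le> ennreal (2 powr p) * (pnorm p a + pnorm p b)"
proof -
  have "pnorm p (\<lambda>n. a n + b n) \<le> (\<integral>\<^sup>+Z. ennreal (2 powr p) * (ennreal ((norm (pseries a Z) * gweight Z) powr p) + ennreal ((norm (pseries b Z) * gweight Z) powr p)) \<partial>lborel)"
    unfolding pnorm_def pseries_add[OF a] by (intro nn_integral_mono powr_norm_add p less_imp_le[OF gweight_pos])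
  also have "\<dots> = ennreal (2 powr p) * (pnorm p a + pnorm p b)"
    unfolding pnorm_def using a measurable_pdensity[of a p] measurable_pdensity[of b p]
    by (subst nn_integral_cmult, simp, subst nn_integral_add) simp_all
  finally show ?thesis .
qed

definition highpart :: "'d::finite \<Rightarrow> nat \<Rightarrow> (nat^'d \<Rightarrow> complex) \<Rightarrow> nat^'d \<Rightarrow> complex" where
  "highpart k N a n = (if n $ k \<le> N then 0 else a n)"

lemma entire_highpart: "entire_coeffs a \<Longrightarrow> entire_coeffs (highpart k N a)"
  by (erule entire_coeffs_comparison) (auto simp: highpart_def)

lemma pseries_highpart:
  assumes a: "entire_coeffs a"
  shows "pseries (highpart k N a) Z = pseries a Z + - pseries (lowpart k N a) Z"
proof -
  have "a = (\<lambda>n. highpart k N a n + lowpart k N a n)" by (auto simp: highpart_def lowpart_def)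
  then have "pseries a Z = pseries (highpart k N a) Z + pseries (lowpart k N a) Z"
    using pseries_add[OF entire_highpart[OF a, of k N] entire_lowpart[OF a, of k N], of Z] by simp
  then show ?thesis by simp
qed

lemma slice_highpart: "slice k (highpart k N a) Z m = (if m \<le> N then 0 else slice k a Z m)"
  unfolding slice_def by (auto simp: highpart_def intro!: infsum_cong infsum_0)

text \<open>
  On an orbit the remainder is bounded by the tail of an absolutely convergent series.
\<close>

lemma circ_mean_highpart_tendsto:
  assumes a: "entire_coeffs a" and p: "p > 0"
  shows "(\<lambda>N. circ_mean k (\<lambda>Z. ennreal ((norm (pseries (highpart k N a) Z) * gweight Z) powr p)) Z) \<longlonglongrightarrow> 0"
proof -
  let ?c = "\<lambda>m. norm (slice k a Z m)"
  have sm: "summable ?c" by (rule slice_summable[OF a])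
  define T where "T = (\<lambda>N. \<Sum>m. ?c (m + Suc N))"
  have T0: "T \<longlonglongrightarrow> 0" unfolding T_def
    using LIMSEQ_Suc[OF suminf_exist_split2[OF sm]] by simp
  have Tpos: "T N \<ge> 0" for N unfolding T_def by (rule suminf_nonneg[OF summable_ignore_initial_segment[OF sm]]) simp
  have b: "norm (pseries (highpart k N a) (rot k \<theta> Z)) \<le> T N" for N \<theta>
  proof -
    let ?d = "\<lambda>m. slice k (highpart k N a) Z m * cis \<theta> ^ m"
    have nd: "norm (?d m) = (if m \<le> N then 0 else ?c m)" for m by (simp add: slice_highpart norm_mult norm_power)
    have sd: "summable (\<lambda>m. norm (?d m))" unfolding nd
      by (rule summable_comparison_test[OF _ sm]) auto
    have "norm (pseries (highpart k N a) (rot k \<theta> Z)) = norm (\<Sum>m. ?d m)"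
      by (simp only: sums_unique[OF pseries_rot[OF entire_highpart[OF a]]])
    also have "\<dots> \<le> (\<Sum>m. norm (?d m))" by (rule summable_norm[OF sd])
    also have "\<dots> = (\<Sum>m. norm (?d (m + Suc N))) + (\<Sum>m<Suc N. norm (?d m))" by (rule suminf_split_initial_segment[OF sd])
    also have "\<dots> = T N" unfolding nd T_def by simp
    finally show ?thesis .
  qed
  define w where "w = gweight Z"
  have w: "w \<ge> 0" by (simp add: w_def less_imp_le gweight_pos)
  have "circ_mean k (\<lambda>Z. ennreal ((norm (pseries (highpart k N a) Z) * gweight Z) powr p)) Z \<le> ennreal (2 * pi * (T N * w) powr p)" for N
  proof -
    have "circ_mean k (\<lambda>Z. ennreal ((norm (pseries (highpart k N a) Z) * gweight Z) powr p)) Z \<le>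
       (\<integral>\<^sup>+\<theta>. ennreal ((T N * w) powr p) * indicator {0..2*pi} \<theta> \<partial>lborel)"
      unfolding gweight_rot w_def[symmetric]
      using p w by (intro nn_integral_mono mult_right_mono ennreal_leI powr_mono2 b) auto
    also have "\<dots> = ennreal (2 * pi * (T N * w) powr p)"
    proof -
      have "ennreal ((T N * w) powr p) * ennreal (2 * pi) = ennreal ((T N * w) powr p * (2 * pi))"
        by (rule ennreal_mult'[symmetric]) simp
      then show ?thesis by (subst nn_integral_cmult_indicator) (simp_all add: mult.commute)
    qed
    finally show ?thesis .
  qed
  note le = this
  have "(\<lambda>N. T N * w) \<longlonglongrightarrow> 0" by (rule tendsto_mult_left_zero[OF T0])
  then have "(\<lambda>N. (T N * w) powr p) \<longlonglongrightarrow> 0 powr p"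
    by (rule tendsto_powr'[OF _ tendsto_const]) (use p w Tpos in auto)
  from tendsto_mult[OF tendsto_const this, of "2 * pi"]
  have "(\<lambda>N. 2 * pi * (T N * w) powr p) \<longlonglongrightarrow> 0" by simp
  from tendsto_ennrealI[OF this]
  have l: "(\<lambda>N. ennreal (2 * pi * (T N * w) powr p)) \<longlonglongrightarrow> 0" by simp
  show ?thesis
    by (rule tendsto_sandwich[OF _ _ tendsto_const l]) (use le in \<open>simp_all add: always_eventually\<close>)
qed

text \<open>
  Dominated convergence over phase space, for the circle means: these tend to 0 pointwise, and
  \<open>circ_mean_lowpart\<close> supplies an integrable bound that is independent of \<open>N\<close>.
\<close>

lemma pnorm_highpart_tendsto:
  assumes a: "entire_coeffs a" and p: "p > 0" and C: "riesz_bound p C" "C \<ge> 0" and fin: "pnorm p a < \<infinity>"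
  shows "(\<lambda>N. pnorm p (highpart k N a)) \<longlonglongrightarrow> 0"
proof -
  let ?h = "\<lambda>a. circ_mean k (\<lambda>Z. ennreal ((norm (pseries a Z) * gweight Z) powr p))"
  have bound: "?h (highpart k N a) Z \<le> ennreal (2 powr p) * (1 + ennreal C) * ?h a Z" for N Z
  proof -
    have mm: "(\<lambda>\<theta>. ennreal ((norm (pseries b (rot k \<theta> Z)) * gweight (rot k \<theta> Z)) powr p)) \<in> borel_measurable lborel"
      if "entire_coeffs b" for b
    proof -
      have "(\<lambda>\<theta>. rot k \<theta> Z) \<in> borel_measurable borel"
        unfolding rot_def by (intro borel_measurable_continuous_onI continuous_intros)
      from measurable_compose[OF this measurable_pdensity[OF that]] show ?thesis by simp
    qed
    have "?h (highpart k N a) Z \<le> (\<integral>\<^sup>+\<theta>. ennreal (2 powr p) * (ennreal ((norm (pseries a (rot k \<theta> Z)) * gweight (rot k \<theta> Z)) powr p) * indicator {0..2*pi} \<theta>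
        + ennreal ((norm (pseries (lowpart k N a) (rot k \<theta> Z)) * gweight (rot k \<theta> Z)) powr p) * indicator {0..2*pi} \<theta>) \<partial>lborel)"
    proof (rule nn_integral_mono)
      fix \<theta>
      have "ennreal ((norm (pseries (highpart k N a) (rot k \<theta> Z)) * gweight (rot k \<theta> Z)) powr p)
        \<le> ennreal (2 powr p) * (ennreal ((norm (pseries a (rot k \<theta> Z)) * gweight (rot k \<theta> Z)) powr p)
          + ennreal ((norm (pseries (lowpart k N a) (rot k \<theta> Z)) * gweight (rot k \<theta> Z)) powr p))"
        unfolding pseries_highpart[OF a]
        using powr_norm_add[OF p less_imp_le[OF gweight_pos[of "rot k \<theta> Z"]], of "pseries a (rot k \<theta> Z)" "- pseries (lowpart k N a) (rot k \<theta> Z)"]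
        by simp
      then show "ennreal ((norm (pseries (highpart k N a) (rot k \<theta> Z)) * gweight (rot k \<theta> Z)) powr p) * indicator {0..2*pi} \<theta>
        \<le> ennreal (2 powr p) * (ennreal ((norm (pseries a (rot k \<theta> Z)) * gweight (rot k \<theta> Z)) powr p) * indicator {0..2*pi} \<theta>
        + ennreal ((norm (pseries (lowpart k N a) (rot k \<theta> Z)) * gweight (rot k \<theta> Z)) powr p) * indicator {0..2*pi} \<theta>)"
        by (simp split: split_indicator)
    qed
    also have "\<dots> = ennreal (2 powr p) * (?h a Z + ?h (lowpart k N a) Z)"
      using mm[OF a] mm[OF entire_lowpart[OF a, of k N]]
      by (subst nn_integral_cmult, simp, subst nn_integral_add) simp_all
    also have "\<dots> \<le> ennreal (2 powr p) * (?h a Z + ennreal C * ?h a Z)"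
      by (intro mult_left_mono add_left_mono circ_mean_lowpart[OF a p C]) auto
    finally show ?thesis by (simp add: algebra_simps)
  qed
  have "(\<lambda>N. \<integral>\<^sup>+Z. ?h (highpart k N a) Z \<partial>lborel) \<longlonglongrightarrow> (\<integral>\<^sup>+Z. 0 \<partial>(lborel :: 'a phase measure))"
  proof (rule nn_integral_dominated_convergence[where w = "\<lambda>Z. ennreal (2 powr p) * (1 + ennreal C) * ?h a Z"])
    show "?h (highpart k N a) \<in> borel_measurable lborel" for N
      by (intro measurable_circ_mean measurable_pdensity entire_highpart a)
    show "(\<lambda>Z. ennreal (2 powr p) * (1 + ennreal C) * ?h a Z) \<in> borel_measurable lborel"
      by (intro borel_measurable_times_ennreal borel_measurable_const measurable_circ_mean measurable_pdensity a)
    have "(\<integral>\<^sup>+Z. ennreal (2 powr p) * (1 + ennreal C) * ?h a Z \<partial>lborel) = ennreal (2 powr p) * (1 + ennreal C) * (ennreal (2*pi) * pnorm p a)"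
      using measurable_circ_mean[OF measurable_pdensity[OF a], of k p]
      by (subst nn_integral_cmult) (simp_all add: pnorm_circ_mean[OF a])
    moreover have "ennreal (2 powr p) * (1 + ennreal C) * (ennreal (2*pi) * pnorm p a) \<noteq> \<top>"
      using fin by (auto simp: ennreal_mult_eq_top_iff)
    ultimately show "(\<integral>\<^sup>+Z. ennreal (2 powr p) * (1 + ennreal C) * ?h a Z \<partial>lborel) < \<infinity>"
      by (simp only: less_top infinity_ennreal_def)
  qed (use bound circ_mean_highpart_tendsto[OF a p] in auto)
  then have "(\<lambda>N. ennreal (2 * pi) * pnorm p (highpart k N a)) \<longlonglongrightarrow> 0"
    by (simp add: pnorm_circ_mean[OF entire_highpart[OF a]])
  then have "(\<lambda>N. ennreal (1 / (2*pi)) * (ennreal (2 * pi) * pnorm p (highpart k N a))) \<longlonglongrightarrow> ennreal (1 / (2*pi)) * 0"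
    by (intro ennreal_tendsto_cmult) auto
  moreover have "ennreal (1 / (2*pi)) * (ennreal (2 * pi) * x) = x" for x
  proof -
    have "ennreal (1 / (2*pi)) * ennreal (2 * pi) = 1" by (subst ennreal_mult'[symmetric]) auto
    then show ?thesis by (simp only: mult.assoc[symmetric] mult_1_left)
  qed
  ultimately show ?thesis by simp
qed

definition lowset :: "'d::finite set \<Rightarrow> nat \<Rightarrow> (nat^'d \<Rightarrow> complex) \<Rightarrow> nat^'d \<Rightarrow> complex" where
  "lowset J N a n = (if \<forall>j\<in>J. n $ j \<le> N then a n else 0)"

lemma entire_lowset: "entire_coeffs a \<Longrightarrow> entire_coeffs (lowset J N a)"
  by (erule entire_coeffs_comparison) (auto simp: lowset_def)

lemma lowset_insert: "lowset (insert k J) N a = lowpart k N (lowset J N a)"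
  by (auto simp: lowset_def lowpart_def)

lemma pnorm_lowset:
  fixes a :: "nat^'d::finite \<Rightarrow> complex"
  assumes a: "entire_coeffs a" and p: "p > 0" and C: "riesz_bound p C" "C \<ge> 0"
  shows "pnorm p (lowset J N a) \<le> ennreal C ^ card J * pnorm p a"
proof -
  have "finite J" by simp
  then show ?thesis
  proof (induction J)
    case empty then show ?case by (simp add: lowset_def [abs_def])
  next
    case (insert k J)
    have "pnorm p (lowset (insert k J) N a) \<le> ennreal C * pnorm p (lowset J N a)"
      unfolding lowset_insert by (rule pnorm_lowpart[OF entire_lowset[OF a] p C])
    also have "\<dots> \<le> ennreal C * (ennreal C ^ card J * pnorm p a)" by (intro mult_left_mono insert.IH) auto
    finally show ?case using insert by (simp add: mult.assoc)
  qed
qed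

lemma entire_remainder:
  "entire_coeffs a \<Longrightarrow> entire_coeffs (\<lambda>n. a n - lowset J N a n)"
  by (erule entire_coeffs_comparison) (auto simp: lowset_def)

text \<open>
  The coordinates in \<open>J\<close> are treated one at a time: the remainder for \<open>insert k J\<close> is the high part of \<open>a\<close> in the
  \<open>k\<close>-th exponent plus the low part of the remainder for \<open>J\<close>, and taking low parts is bounded.
\<close>

lemma pnorm_remainder_tendsto:
  fixes a :: "nat^'d::finite \<Rightarrow> complex"
  assumes a: "entire_coeffs a" and p: "p > 0" and C: "riesz_bound p C" "C \<ge> 0" and fin: "pnorm p a < \<infinity>"
  shows "(\<lambda>N. pnorm p (\<lambda>n. a n - lowset J N a n)) \<longlonglongrightarrow> 0"
proof -
  have "finite J" by simp
  then show ?thesis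
  proof (induction J)
    case empty
    have "pnorm p (\<lambda>n::nat^'d. 0) = 0" using p by (simp add: pnorm_def pseries_def)
    then show ?case by (simp add: lowset_def)
  next
    case (insert k J)
    let ?r = "\<lambda>N n. a n - lowset J N a n"
    have "(\<lambda>N. ennreal (2 powr p) * (pnorm p (highpart k N a) + ennreal C * pnorm p (?r N))) \<longlonglongrightarrow> ennreal (2 powr p) * (0 + ennreal C * 0)"
      by (intro ennreal_tendsto_cmult tendsto_add insert.IH pnorm_highpart_tendsto[OF a p C fin]) auto
    then have l: "(\<lambda>N. ennreal (2 powr p) * (pnorm p (highpart k N a) + ennreal C * pnorm p (?r N))) \<longlonglongrightarrow> 0" by simp
    have "pnorm p (\<lambda>n. a n - lowset (insert k J) N a n) \<le> ennreal (2 powr p) * (pnorm p (highpart k N a) + ennreal C * pnorm p (?r N))" for N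
    proof -
      have e: "(\<lambda>n. a n - lowset (insert k J) N a n) = (\<lambda>n. highpart k N a n + lowpart k N (?r N) n)"
        by (auto simp: lowset_def highpart_def lowpart_def fun_eq_iff)
      have "pnorm p (\<lambda>n. a n - lowset (insert k J) N a n) \<le> ennreal (2 powr p) * (pnorm p (highpart k N a) + pnorm p (lowpart k N (?r N)))"
        unfolding e by (intro pnorm_add entire_highpart entire_lowpart entire_remainder a p)
      also have "\<dots> \<le> ennreal (2 powr p) * (pnorm p (highpart k N a) + ennreal C * pnorm p (?r N))"
        by (intro mult_left_mono add_left_mono pnorm_lowpart[OF entire_remainder[OF a] p C]) auto
      finally show ?thesis .
    qed
    then show ?case by (intro tendsto_sandwich[OF _ _ tendsto_const l]) auto
  qed
qed

section \<open>Integrals over products\<close>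

lemma Basis_vec_real: "(Basis :: (real^'d::finite) set) = range (\<lambda>j. axis j 1)"
  by (auto simp: Basis_vec_def)

lemma inj_axis: "inj (\<lambda>j. axis j (1::real) :: real^'d::finite)"
  by (auto simp: inj_def axis_eq_axis)

lemma prod_Basis_vec: "(\<Prod>b\<in>(Basis :: (real^'d::finite) set). v \<bullet> b) = (\<Prod>j\<in>UNIV. v $ j)"
  unfolding Basis_vec_real by (subst prod.reindex[OF inj_axis]) (simp add: inner_axis)

lemma measurable_vec_lambda:
  assumes "\<And>j. (\<lambda>x. f x j) \<in> borel_measurable M"
  shows "(\<lambda>x. (\<chi> j. f x j) :: real^'d::finite) \<in> borel_measurable M"
  unfolding borel_measurable_euclidean_space[of "\<lambda>x. (\<chi> j. f x j) :: real^'d"] Basis_vec_real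
  using assms by (auto simp: inner_axis)

lemma lborel_vec_eq_PiM:
  "(lborel :: (real^'d::finite) measure) = distr (PiM UNIV (\<lambda>_. lborel)) borel (\<lambda>f. \<chi> j. f j)"
proof (rule lborel_eqI)
  interpret product_sigma_finite "\<lambda>_ :: 'd. lborel :: real measure" ..
  have m: "(\<lambda>f. (\<chi> j. f j) :: real^'d) \<in> PiM UNIV (\<lambda>_. lborel) \<rightarrow>\<^sub>M borel"
    by (rule measurable_vec_lambda) measurable
  fix l u :: "real^'d" assume le: "\<And>b. b \<in> Basis \<Longrightarrow> l \<bullet> b \<le> u \<bullet> b"
  then have le': "l $ j \<le> u $ j" for j by (metis Basis_vec_real inner_axis' inner_real_def mult_1 rangeI inner_commute)
  have "(\<lambda>f. (\<chi> j. f j) :: real^'d) -` box l u \<inter> space (PiM UNIV (\<lambda>_. lborel)) = PiE UNIV (\<lambda>j. {l $ j <..< u $ j})"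
    by (auto simp: space_PiM mem_box_cart PiE_def Pi_iff)
  then have "emeasure (distr (PiM UNIV (\<lambda>_. lborel)) borel (\<lambda>f. \<chi> j. f j)) (box l u) = emeasure (PiM UNIV (\<lambda>_. lborel)) (PiE UNIV (\<lambda>j. {l $ j <..< u $ j}))"
    by (subst emeasure_distr[OF m]) auto
  also have "\<dots> = (\<Prod>j\<in>UNIV. ennreal (u $ j - l $ j))"
    by (subst emeasure_PiM) (auto simp: le')
  also have "\<dots> = ennreal (\<Prod>b\<in>Basis. (u - l) \<bullet> b)"
    unfolding prod_Basis_vec using le' by (subst prod_ennreal) auto
  finally show "emeasure (distr (PiM UNIV (\<lambda>_. lborel)) borel (\<lambda>f. \<chi> j. f j)) (box l u) = ennreal (\<Prod>b\<in>Basis. (u - l) \<bullet> b)" .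
qed simp

lemma measurable_pair_component:
  fixes h :: "real \<times> real \<Rightarrow> real"
  assumes "h \<in> borel_measurable borel"
  shows "(\<lambda>x. h (x j)) \<in> borel_measurable (PiM UNIV (\<lambda>_. lborel))"
  using measurable_compose[OF measurable_component_singleton[of j UNIV "\<lambda>_. lborel"], of h borel] assms by simp

text \<open>
  Phase space is regrouped into the planes of the pairs \<open>(x\<^sub>j, \<omega>\<^sub>j)\<close>; the kernels of coherent states
  factorise along these planes.
\<close>

lemma lborel_phase_eq_PiM:
  "(lborel :: ('d::finite) phase measure) = distr (PiM UNIV (\<lambda>_. lborel)) borel (\<lambda>f. (\<chi> j. fst (f j), \<chi> j. snd (f j)))"
proof (rule lborel_eqI)
  interpret product_sigma_finite "\<lambda>_ :: 'd. lborel :: (real \<times> real) measure" ..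
  let ?h = "\<lambda>f. (\<chi> j. fst (f j), \<chi> j. snd (f j)) :: 'd phase"
  have m: "?h \<in> PiM UNIV (\<lambda>_. lborel) \<rightarrow>\<^sub>M borel"
    unfolding borel_prod[symmetric]
    by (intro measurable_Pair measurable_vec_lambda measurable_pair_component borel_measurable_continuous_onI continuous_intros)
  fix l u :: "'d phase" assume le: "\<And>b. b \<in> Basis \<Longrightarrow> l \<bullet> b \<le> u \<bullet> b"
  have le1: "fst l $ j \<le> fst u $ j" for j
    using le[of "(axis j 1, 0)"] by (auto simp: Basis_prod_def Basis_vec_real inner_axis inner_prod_def)
  have le2: "snd l $ j \<le> snd u $ j" for j
    using le[of "(0, axis j 1)"] by (auto simp: Basis_prod_def Basis_vec_real inner_axis inner_prod_def)
  have "?h -` box l u \<inter> space (PiM UNIV (\<lambda>_. lborel)) = PiE UNIV (\<lambda>j. box (fst l $ j, snd l $ j) (fst u $ j, snd u $ j))"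
    by (auto simp: space_PiM mem_box_cart PiE_def box_prod mem_box prod_eq_iff mem_Times_iff Pi_iff Basis_prod_def Basis_vec_real inner_axis inner_prod_def ball_Un)
  then have "emeasure (distr (PiM UNIV (\<lambda>_. lborel)) borel ?h) (box l u) = emeasure (PiM UNIV (\<lambda>_. lborel)) (PiE UNIV (\<lambda>j. box (fst l $ j, snd l $ j) (fst u $ j, snd u $ j)))"
    by (subst emeasure_distr[OF m]) auto
  also have "\<dots> = (\<Prod>j\<in>UNIV. emeasure lborel (box (fst l $ j, snd l $ j) (fst u $ j, snd u $ j)))"
    by (subst emeasure_PiM) auto
  also have "\<dots> = (\<Prod>j\<in>UNIV. ennreal ((fst u $ j - fst l $ j) * (snd u $ j - snd l $ j)))"
  proof (rule prod.cong[OF refl])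
    fix j
    have "(1, 0) \<noteq> (0::real, 1::real)" by simp
    then show "emeasure lborel (box (fst l $ j, snd l $ j) (fst u $ j, snd u $ j)) = ennreal ((fst u $ j - fst l $ j) * (snd u $ j - snd l $ j))"
      using le1[of j] le2[of j] by (subst emeasure_lborel_box) (auto simp: Basis_prod_def)
  qed
  also have "\<dots> = ennreal (\<Prod>j\<in>UNIV. (fst u $ j - fst l $ j) * (snd u $ j - snd l $ j))"
    using le1 le2 by (subst prod_ennreal) auto
  also have "(\<Prod>j\<in>UNIV. (fst u $ j - fst l $ j) * (snd u $ j - snd l $ j)) = (\<Prod>b\<in>Basis. (u - l) \<bullet> b)"
  proof -
    have "(\<Prod>b\<in>Basis. (u - l) \<bullet> b) = (\<Prod>b\<in>(\<lambda>x. (x, 0)) ` Basis. (u - l) \<bullet> b) * (\<Prod>b\<in>(\<lambda>x. (0, x)) ` Basis. (u - l) \<bullet> b)"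
      unfolding Basis_prod_def by (rule prod.union_disjoint) auto
    also have "(\<Prod>b\<in>(\<lambda>x. (x, 0)) ` Basis. (u - l) \<bullet> b) = (\<Prod>b\<in>Basis. (fst u - fst l) \<bullet> b)"
      by (subst prod.reindex) (auto simp: inj_on_def inner_prod_def)
    also have "(\<Prod>b\<in>(\<lambda>x. (0, x)) ` Basis. (u - l) \<bullet> b) = (\<Prod>b\<in>Basis. (snd u - snd l) \<bullet> b)"
      by (subst prod.reindex) (auto simp: inj_on_def inner_prod_def)
    finally show ?thesis unfolding prod_Basis_vec by (simp add: prod.distrib)
  qed
  finally show "emeasure (distr (PiM UNIV (\<lambda>_. lborel)) borel ?h) (box l u) = ennreal (\<Prod>b\<in>Basis. (u - l) \<bullet> b)" .
qed simp

lemma integral_prod_vec: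
  fixes g :: "'d::finite \<Rightarrow> real \<Rightarrow> complex"
  assumes g: "\<And>j. integrable lborel (g j)"
  shows "(LINT t|lborel. (\<Prod>j\<in>UNIV. g j (t $ j))) = (\<Prod>j\<in>UNIV. (LINT t|lborel. g j t))" (is ?A)
    and "integrable lborel (\<lambda>t::real^'d. \<Prod>j\<in>UNIV. g j (t $ j))" (is ?B)
proof -
  interpret product_sigma_finite "\<lambda>_ :: 'd. lborel :: real measure" ..
  have m: "(\<lambda>f. (\<chi> j. f j) :: real^'d) \<in> PiM UNIV (\<lambda>_. lborel) \<rightarrow>\<^sub>M borel"
    by (rule measurable_vec_lambda) measurable
  have [measurable]: "g j \<in> borel_measurable borel" for j using g[of j] by (simp add: borel_measurable_integrable[of lborel, simplified])
  have m2: "(\<lambda>t::real^'d. \<Prod>j\<in>UNIV. g j (t $ j)) \<in> borel_measurable borel" by measurable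
  show ?A
    by (subst lborel_vec_eq_PiM, subst integral_distr[OF m m2]) (simp add: product_integral_prod g)
  show ?B
    by (subst lborel_vec_eq_PiM, subst integrable_distr_eq[OF m m2]) (simp add: product_integrable_prod g)
qed

lemma nn_integral_prod_phase:
  fixes g :: "'d::finite \<Rightarrow> real \<times> real \<Rightarrow> ennreal"
  assumes g[measurable]: "\<And>j. g j \<in> borel_measurable borel"
  shows "(\<integral>\<^sup>+Z. (\<Prod>j\<in>UNIV. g j (fst Z $ j, snd Z $ j)) \<partial>(lborel :: 'd phase measure)) = (\<Prod>j\<in>UNIV. (\<integral>\<^sup>+x. g j x \<partial>lborel))"
proof -
  interpret product_sigma_finite "\<lambda>_ :: 'd. lborel :: (real \<times> real) measure" ..
  let ?h = "\<lambda>f. (\<chi> j. fst (f j), \<chi> j. snd (f j)) :: 'd phase"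
  have m: "?h \<in> PiM UNIV (\<lambda>_. lborel) \<rightarrow>\<^sub>M borel"
    unfolding borel_prod[symmetric]
    by (intro measurable_Pair measurable_vec_lambda measurable_pair_component borel_measurable_continuous_onI continuous_intros)
  have m3: "(\<lambda>Z::'d phase. (fst Z $ j, snd Z $ j)) \<in> borel_measurable borel" for j
    by (intro borel_measurable_continuous_onI continuous_intros)
  have m2: "(\<lambda>Z::'d phase. \<Prod>j\<in>UNIV. g j (fst Z $ j, snd Z $ j)) \<in> borel_measurable borel"
    by (intro borel_measurable_prod_ennreal measurable_compose[OF m3 g])
  show ?thesis
    by (subst lborel_phase_eq_PiM, subst nn_integral_distr[OF m]) (use m2 g in \<open>simp_all add: product_nn_integral_prod\<close>)
qed

section \<open>The short-time Fourier transform as a weighted power series\<close>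

definition gphase :: "'d::finite phase \<Rightarrow> complex" where
  "gphase Z = exp (- \<i> * of_real pi * of_real (fst Z \<bullet> snd Z))"

lemma norm_gphase: "norm (gphase Z) = 1" by (simp add: gphase_def)

lemma cnj_coherent_1d:
  "cnj (exp (2 * of_real pi * \<i> * of_real (w * t)) * of_real (2 powr (1/4) * exp (- pi * (t - x)\<^sup>2)))
   = exp (- \<i> * of_real pi * of_real (x * w)) * of_real (exp (- pi / 2 * (x\<^sup>2 + w\<^sup>2))) * gen (Complex x (- w)) t"
proof -
  have "cnj (exp (2 * of_real pi * \<i> * of_real (w * t))) = exp (- 2 * of_real pi * \<i> * of_real (w * t))"
    by (simp add: exp_cnj)
  then have "cnj (exp (2 * of_real pi * \<i> * of_real (w * t)) * of_real (2 powr (1/4) * exp (- pi * (t - x)\<^sup>2)))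
     = of_real (2 powr (1/4)) * (exp (- 2 * of_real pi * \<i> * of_real (w * t)) * exp (of_real (- pi * (t - x)\<^sup>2)))"
    unfolding exp_of_real by (simp only: complex_cnj_mult complex_cnj_complex_of_real of_real_mult mult_ac)
  also have "\<dots> = of_real (2 powr (1/4)) * exp (- 2 * of_real pi * \<i> * of_real (w * t) + of_real (- pi * (t - x)\<^sup>2))"
    by (simp only: exp_add)
  also have "- 2 * of_real pi * \<i> * of_real (w * t) + of_real (- pi * (t - x)\<^sup>2) =
     - \<i> * of_real pi * of_real (x * w) + of_real (- pi / 2 * (x\<^sup>2 + w\<^sup>2))
     + (2 * of_real pi * of_real t * Complex x (- w) - of_real (pi * t\<^sup>2) - of_real pi * (Complex x (- w))\<^sup>2 / 2)"
    unfolding Complex_eq by (simp add: power2_eq_square field_simps)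
  finally show ?thesis unfolding exp_add gen_def exp_of_real[symmetric] by (simp only: mult_ac)
qed

lemma gauss_window_prod: "gauss_window t = (\<Prod>j\<in>UNIV. complex_of_real (2 powr (1/4) * exp (- pi * (t $ j)\<^sup>2)))"
  for t :: "real^'d::finite"
proof -
  have "(norm t)\<^sup>2 = (\<Sum>j\<in>UNIV. (t $ j)\<^sup>2)" unfolding norm_vec_def L2_set_def by (simp add: sum_nonneg)
  then have "exp (- pi * (norm t)\<^sup>2) = (\<Prod>j\<in>UNIV. exp (- pi * (t $ j)\<^sup>2))"
    by (simp add: sum_distrib_left exp_sum sum_negf[symmetric])
  moreover have "(2::real) powr (real CARD('d) / 4) = (\<Prod>j\<in>(UNIV::'d set). 2 powr (1/4))"
    by (simp add: powr_power)
  ultimately show ?thesis unfolding gauss_window_def by (simp add: prod.distrib flip: of_real_prod)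
qed

text \<open>
  Completing the square in each coordinate: the shifted window is the generating function up to a scalar.
\<close>

lemma cnj_tf_shift:
  fixes Z :: "'d::finite phase"
  shows "cnj (tf_shift Z gauss_window t) = (gphase Z * of_real (gweight Z)) * genprod (zcoord Z) t"
proof -
  have "exp (2 * complex_of_real pi * \<i> * complex_of_real (snd Z \<bullet> t)) = (\<Prod>j\<in>UNIV. exp (2 * complex_of_real pi * \<i> * complex_of_real (snd Z $ j * t $ j)))"
    by (simp only: inner_vec_def inner_real_def of_real_sum sum_distrib_left exp_sum[OF finite])
  then have "cnj (tf_shift Z gauss_window t) = (\<Prod>j\<in>UNIV. cnj (exp (2 * of_real pi * \<i> * of_real (snd Z $ j * t $ j)) * of_real (2 powr (1/4) * exp (- pi * (t $ j - fst Z $ j)\<^sup>2))))"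
    unfolding tf_shift_def gauss_window_prod by (simp only: prod.distrib cnj_prod complex_cnj_mult vector_minus_component)
  also have "\<dots> = (\<Prod>j\<in>UNIV. exp (- \<i> * of_real pi * of_real (fst Z $ j * snd Z $ j)) * of_real (exp (- pi / 2 * ((fst Z $ j)\<^sup>2 + (snd Z $ j)\<^sup>2))) * gen (zcoord Z j) (t $ j))"
    unfolding cnj_coherent_1d zcoord_def ..
  also have "\<dots> = (\<Prod>j\<in>UNIV. exp (- \<i> * of_real pi * of_real (fst Z $ j * snd Z $ j))) * of_real (\<Prod>j\<in>UNIV. exp (- pi / 2 * ((fst Z $ j)\<^sup>2 + (snd Z $ j)\<^sup>2))) * genprod (zcoord Z) t"
    by (simp only: prod.distrib of_real_prod genprod_def)
  also have "(\<Prod>j\<in>UNIV. exp (- \<i> * of_real pi * of_real (fst Z $ j * snd Z $ j))) = gphase Z"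
  proof -
    have "- \<i> * of_real pi * of_real (fst Z \<bullet> snd Z) = (\<Sum>j\<in>UNIV. - \<i> * complex_of_real pi * of_real (fst Z $ j * snd Z $ j))"
      by (simp only: inner_vec_def inner_real_def of_real_sum sum_distrib_left)
    then show ?thesis unfolding gphase_def by (simp only: exp_sum[OF finite])
  qed
  also have "(\<Prod>j\<in>UNIV. exp (- pi / 2 * ((fst Z $ j)\<^sup>2 + (snd Z $ j)\<^sup>2))) = gweight Z"
    unfolding gweight_alt sum_distrib_left exp_sum[OF finite] zcoord_def cmod_power2 by simp
  finally show ?thesis .
qed

lemma entire_hcoeff:
  assumes u: "u \<in> tempered_distributions"
  shows "entire_coeffs (hcoeff u)"
  unfolding entire_coeffs_def
proof (intro allI impI)
  fix r :: real assume r: "r \<ge> 0"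
  \<comment> \<open>Any R with r / R at most 1/2 gives a convergent geometric majorant.\<close>
  define R where "R = 2 * r + 1"
  have "R \<ge> 1" using r by (simp add: R_def)
  then obtain C where C: "C \<ge> 0" "\<And>n. norm (hcoeff u n) \<le> C * (\<Prod>j\<in>UNIV. (1 / R) ^ (n $ j))"
    using hcoeff_bound[OF u] by blast
  define q where "q = r / R"
  have "r \<le> 1/2 * R" by (simp add: R_def)
  then have q: "0 \<le> q" "q \<le> 1/2" using r \<open>R \<ge> 1\<close> by (simp_all add: q_def pos_divide_le_eq)
  have le: "norm (hcoeff u n) * (\<Prod>j\<in>UNIV. r ^ (n $ j)) \<le> C * (\<Prod>j\<in>UNIV. q ^ (n $ j))" for n
  proof -
    have "norm (hcoeff u n) * (\<Prod>j\<in>UNIV. r ^ (n $ j)) \<le> C * (\<Prod>j\<in>UNIV. (1 / R) ^ (n $ j)) * (\<Prod>j\<in>UNIV. r ^ (n $ j))"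
      using r by (intro mult_right_mono C prod_nonneg) auto
    also have "\<dots> = C * (\<Prod>j\<in>UNIV. (1 / R) ^ (n $ j) * r ^ (n $ j))" by (simp only: prod.distrib mult.assoc)
    also have "(\<lambda>j. (1 / R) ^ (n $ j) * r ^ (n $ j)) = (\<lambda>j. q ^ (n $ j))"
      by (simp add: q_def fun_eq_iff power_divide)
    finally show ?thesis .
  qed
  show "(\<lambda>n. norm (hcoeff u n) * (\<Prod>j\<in>UNIV. r ^ (n $ j))) summable_on UNIV"
  proof (rule nonneg_bounded_partial_sums_imp_summable_on[where C = "C * 2 ^ CARD('a)"])
    show "\<forall>\<^sub>F F in finite_subsets_at_top UNIV. (\<Sum>n\<in>F. norm (hcoeff u n) * (\<Prod>j\<in>UNIV. r ^ (n $ j))) \<le> C * 2 ^ CARD('a)"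
    proof (rule eventually_finite_subsets_at_top_weakI)
      fix F :: "(nat^'a) set" assume F: "finite F" "F \<subseteq> UNIV"
      have "\<forall>\<^sub>F M in sequentially. F \<subseteq> box_upto M"
        using box_upto_exhausts[where 'd='a] F unfolding filterlim_finite_subsets_at_top
        by (auto elim!: allE[of _ F] eventually_mono)
      then obtain M where M: "F \<subseteq> box_upto M" unfolding eventually_sequentially by blast
      have "(\<Sum>n\<in>F. norm (hcoeff u n) * (\<Prod>j\<in>UNIV. r ^ (n $ j))) \<le> (\<Sum>n\<in>F. C * (\<Prod>j\<in>UNIV. q ^ (n $ j)))"
        by (intro sum_mono le)
      also have "\<dots> \<le> (\<Sum>n\<in>(box_upto M :: (nat^'a) set). C * (\<Prod>j\<in>UNIV. q ^ (n $ j)))"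
        by (rule sum_mono2[OF finite_box_upto M]) (use q C in \<open>auto intro!: mult_nonneg_nonneg prod_nonneg\<close>)
      also have "\<dots> = C * (\<Prod>j\<in>(UNIV::'a set). \<Sum>n\<le>M. q ^ n)"
        unfolding prod_sum_box by (simp add: sum_distrib_left)
      also have "\<dots> \<le> C * (\<Prod>j\<in>(UNIV::'a set). 2)"
      proof (intro mult_left_mono prod_mono conjI C)
        have "(\<Sum>n\<le>M. q ^ n) \<le> (\<Sum>n\<le>M. (1/2) ^ n)" by (intro sum_mono power_mono q)
        also have "\<dots> \<le> (\<Sum>n. (1/2) ^ n)" by (intro sum_le_suminf summable_geometric) auto
        also have "\<dots> = 2" by (subst suminf_geometric) auto
        finally show "(\<Sum>n\<le>M. q ^ n) \<le> 2" .
      qed (use q in \<open>auto intro: sum_nonneg\<close>)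
      finally show "(\<Sum>n\<in>F. norm (hcoeff u n) * (\<Prod>j\<in>UNIV. r ^ (n $ j))) \<le> C * 2 ^ CARD('a)" by simp
    qed
  qed (use r in \<open>auto intro!: prod_nonneg mult_nonneg_nonneg\<close>)
qed

abbreviation stft :: "'d::finite functional \<Rightarrow> 'd phase \<Rightarrow> complex" where
  "stft f Z \<equiv> pairing f (tf_shift Z gauss_window)"

lemma tempered_scale:
  assumes u: "u \<in> tempered_distributions" and g: "g \<in> schwartz_space"
  shows "u (\<lambda>t. c * g t) = c * u g"
  using tempered_linear[OF u g g, of c 0] by simp

theorem stft_eq_pseries:
  assumes u: "u \<in> tempered_distributions"
  shows "stft u Z = gphase Z * of_real (gweight Z) * pseries (hcoeff u) Z"
proof -
  have "u (genprod (zcoord Z)) = pseries (hcoeff u) Z"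
    by (rule LIMSEQ_unique[OF functional_genprod_expansion[OF u] pseries_limit[OF entire_hcoeff[OF u]]])
  then show ?thesis unfolding pairing_def cnj_tf_shift tempered_scale[OF u genprod_schwartz] by (simp only:)
qed

lemma hermite_eq_hprod: "hermite n t = hprod n t / of_real (\<Prod>j\<in>UNIV. sqrt (pi ^ (n $ j) * fact (n $ j)))"
  unfolding hermite_def hermite1_eq_hfun hprod_def by (simp only: prod_dividef of_real_divide of_real_prod)

lemma integral_hprod_genprod:
  "(LINT t|lborel. hprod n t * genprod z t) = (\<Prod>j\<in>UNIV. (of_real pi * z j) ^ (n $ j))"
  "integrable lborel (\<lambda>t. hprod n t * genprod z t)"
  unfolding hprod_def genprod_def prod.distrib[symmetric]
  using integral_prod_vec[of "\<lambda>j t. of_real (hfun (n $ j) t) * gen (z j) t"] integrable_hfun_gen integral_hfun_gen by auto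

lemma schwartz_scale: "g \<in> schwartz_space \<Longrightarrow> (\<lambda>t. c * g t) \<in> schwartz_space"
  using schwartz_space_linear[of g g c 0] by simp

lemma pairing_hermite:
  assumes u: "u \<in> tempered_distributions"
  shows "pairing u (hermite n) = u (hprod n) / of_real (\<Prod>j\<in>UNIV. sqrt (pi ^ (n $ j) * fact (n $ j)))"
proof -
  have "(\<lambda>t. cnj (hermite n t)) = (\<lambda>t. (1 / of_real (\<Prod>j\<in>UNIV. sqrt (pi ^ (n $ j) * fact (n $ j)))) * hprod n t)"
    unfolding hermite_eq_hprod by (simp add: hprod_def fun_eq_iff)
  then show ?thesis unfolding pairing_def by (simp only: tempered_scale[OF u hprod_schwartz]) simp
qed

lemma infsum_finite_support:
  assumes "finite S" "\<And>n. n \<notin> S \<Longrightarrow> g n = 0"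
  shows "infsum g UNIV = sum g S"
  by (subst infsum_cong_neutral[of S UNIV g g]) (use assms in auto)

lemma pseries_box: "pseries (lowset UNIV N a) Z = (\<Sum>n\<in>box_upto N. a n * zpow (zcoord Z) n)"
proof -
  have "pseries (lowset UNIV N a) Z = (\<Sum>n\<in>box_upto N. lowset UNIV N a n * zpow (zcoord Z) n)"
    unfolding pseries_def by (rule infsum_finite_support[OF finite_box_upto]) (auto simp: lowset_def box_upto_def)
  also have "\<dots> = (\<Sum>n\<in>box_upto N. a n * zpow (zcoord Z) n)"
    by (rule sum.cong) (auto simp: lowset_def box_upto_def)
  finally show ?thesis .
qed

text \<open>
  Pairing a Hermite function with a coherent state gives a monomial (\<open>integral_hfun_gen\<close>), and the
  normalisation of the Hermite functions cancels the powers of \<open>\<pi>\<close> in it. So the partial sum gives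
  the same coefficients as \<open>stft_eq_pseries\<close>, cut off at \<open>N\<close>.
\<close>

theorem stft_hermite_partial:
  assumes u: "u \<in> tempered_distributions"
  shows "stft (hermite_partial N u) Z = gphase Z * of_real (gweight Z) * pseries (lowset UNIV N (hcoeff u)) Z"
proof -
  let ?S = "\<lambda>n. of_real (\<Prod>j\<in>UNIV. sqrt (pi ^ (n $ j) * fact (n $ j))) :: complex"
  have box: "{n :: nat^'a. \<forall>j. n $ j \<le> N} = box_upto N" by (simp add: box_upto_def)
  have reorder: "a / x * (h / x) * (c * g) = c * (a / (x * x)) * (h * g)" for a x h c g :: complex
    by simp
  have cancel: "c * (a / (P * F)) * (P * x) = c * (a / F * x)" if "P \<noteq> 0" for c a P F x :: complex
    using that by simp
  have s: "(\<lambda>t. cnj (tf_shift Z gauss_window t)) \<in> schwartz_space"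
    unfolding cnj_tf_shift by (rule schwartz_scale[OF genprod_schwartz])
  have "stft (hermite_partial N u) Z = (LINT t|lborel. hermite_sum N u t * ((gphase Z * of_real (gweight Z)) * genprod (zcoord Z) t))"
    unfolding hermite_partial_def pairing_def distribution_of_def using s by (simp add: cnj_tf_shift)
  also have "\<dots> = (LINT t|lborel. (\<Sum>n\<in>box_upto N. (gphase Z * of_real (gweight Z) * (u (hprod n) / (?S n * ?S n))) * (hprod n t * genprod (zcoord Z) t)))"
    unfolding hermite_sum_def box sum_distrib_right pairing_hermite[OF u] hermite_eq_hprod
    by (intro Bochner_Integration.integral_cong sum.cong refl) (rule reorder)
  also have "\<dots> = (\<Sum>n\<in>box_upto N. (gphase Z * of_real (gweight Z) * (u (hprod n) / (?S n * ?S n))) * (\<Prod>j\<in>UNIV. (of_real pi * zcoord Z j) ^ (n $ j)))"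
    by (subst Bochner_Integration.integral_sum, rule integrable_mult_right, rule integral_hprod_genprod(2))
      (simp only: integral_mult_right_zero integral_hprod_genprod(1))
  also have "\<dots> = (\<Sum>n\<in>box_upto N. (gphase Z * of_real (gweight Z)) * (hcoeff u n * zpow (zcoord Z) n))"
  proof (rule sum.cong[OF refl])
    fix n :: "nat^'a"
    have "?S n * ?S n = of_real (\<Prod>j\<in>UNIV. pi ^ (n $ j) * fact (n $ j))"
      unfolding of_real_mult[symmetric] prod.distrib[symmetric] by simp
    also have "\<dots> = (\<Prod>j\<in>UNIV. of_real pi ^ (n $ j)) * (\<Prod>j\<in>UNIV. fact (n $ j))" by (simp add: prod.distrib)
    finally have S: "?S n * ?S n = (\<Prod>j\<in>UNIV. of_real pi ^ (n $ j)) * (\<Prod>j\<in>UNIV. fact (n $ j))" .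
    have z: "(\<Prod>j\<in>UNIV. (of_real pi * zcoord Z j) ^ (n $ j)) = (\<Prod>j\<in>UNIV. of_real pi ^ (n $ j)) * zpow (zcoord Z) n"
      by (simp add: power_mult_distrib prod.distrib)
    have "(\<Prod>j\<in>UNIV. of_real pi ^ (n $ j)) \<noteq> (0::complex)" by simp
    then show "(gphase Z * of_real (gweight Z) * (u (hprod n) / (?S n * ?S n))) * (\<Prod>j\<in>UNIV. (of_real pi * zcoord Z j) ^ (n $ j))
       = (gphase Z * of_real (gweight Z)) * (hcoeff u n * zpow (zcoord Z) n)"
      unfolding S z hcoeff_def by (rule cancel)
  qed
  also have "\<dots> = gphase Z * of_real (gweight Z) * pseries (lowset UNIV N (hcoeff u)) Z"
    unfolding pseries_box sum_distrib_left ..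
  finally show ?thesis .
qed

section \<open>Boundedness and convergence for \<open>1 < p < \<infinity>\<close>\<close>

definition ennroot :: "real \<Rightarrow> ennreal \<Rightarrow> ennreal" where
  "ennroot q I = (if I = \<infinity> then \<infinity> else ennreal (enn2real I powr (1 / q)))"

lemma mod_norm_finite:
  "p \<noteq> \<infinity> \<Longrightarrow> mod_norm p f = ennroot (enn2real p) (\<integral>\<^sup>+Z. ennreal (norm (stft f Z) powr enn2real p) \<partial>lborel)"
  by (simp add: mod_norm_def ennroot_def Let_def)

lemma ennroot_mult_mono:
  assumes "I \<le> ennreal K * J" "K \<ge> 1" "q > 0"
  shows "ennroot q I \<le> ennreal (K powr (1 / q)) * ennroot q J"
proof (cases "J = \<infinity>")
  case True
  then show ?thesis using assms by (simp add: ennroot_def ennreal_mult_top)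
next
  case False
  then have KJ: "ennreal K * J < \<infinity>" by (simp add: ennreal_mult_less_top less_top)
  then have I: "I \<noteq> \<infinity>" using assms(1) by auto
  have "enn2real I \<le> enn2real (ennreal K * J)" by (rule enn2real_mono[OF assms(1)]) (use KJ in simp)
  also have "\<dots> = K * enn2real J" using assms by (simp add: enn2real_mult)
  finally have "enn2real I powr (1 / q) \<le> (K * enn2real J) powr (1 / q)"
    using assms by (intro powr_mono2) auto
  then show ?thesis using False I assms by (simp add: ennroot_def powr_mult flip: ennreal_mult')
qed

lemma ennroot_tendsto_0:
  assumes "I \<longlonglongrightarrow> 0" "q > 0"
  shows "(\<lambda>N. ennroot q (I N)) \<longlonglongrightarrow> 0"
proof -
  have ev: "\<forall>\<^sub>F N in sequentially. I N < 1" by (rule order_tendstoD(2)[OF assms(1)]) simp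
  have "(\<lambda>N. enn2real (I N)) \<longlonglongrightarrow> enn2real 0" by (rule tendsto_enn2real) (use assms in auto)
  then have "(\<lambda>N. enn2real (I N)) \<longlonglongrightarrow> 0" by simp
  then have "(\<lambda>N. enn2real (I N) powr (1 / q)) \<longlonglongrightarrow> 0 powr (1 / q)"
    by (rule tendsto_powr'[OF _ tendsto_const]) (use assms in auto)
  from tendsto_ennrealI[OF this]
  have "(\<lambda>N. ennreal (enn2real (I N) powr (1 / q))) \<longlonglongrightarrow> 0" by simp
  then show ?thesis
    by (rule Lim_transform_eventually) (use ev in \<open>auto elim!: eventually_mono simp: ennroot_def\<close>)
qed

lemma stft_power_integral:
  assumes u: "u \<in> tempered_distributions"
  shows "(\<integral>\<^sup>+Z. ennreal (norm (stft u Z) powr q) \<partial>lborel) = pnorm q (hcoeff u)"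
  unfolding pnorm_def stft_eq_pseries[OF u]
  by (simp add: norm_mult norm_gphase less_imp_le[OF gweight_pos] mult.commute)

lemma stft_partial_power_integral:
  assumes u: "u \<in> tempered_distributions"
  shows "(\<integral>\<^sup>+Z. ennreal (norm (stft (hermite_partial N u) Z) powr q) \<partial>lborel) = pnorm q (lowset UNIV N (hcoeff u))"
  unfolding pnorm_def stft_hermite_partial[OF u]
  by (simp add: norm_mult norm_gphase less_imp_le[OF gweight_pos] mult.commute)

lemma pairing_diff: "pairing (\<lambda>g. u g - v g) h = pairing u h - pairing v h"
  by (simp add: pairing_def)

lemma stft_remainder_power_integral:
  assumes u: "u \<in> tempered_distributions"
  shows "(\<integral>\<^sup>+Z. ennreal (norm (stft (\<lambda>g. hermite_partial N u g - u g) Z) powr q) \<partial>lborel)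
     = pnorm q (\<lambda>n. hcoeff u n - lowset UNIV N (hcoeff u) n)"
proof -
  note e = entire_hcoeff[OF u]
  have split: "pseries (hcoeff u) Z = pseries (\<lambda>n. hcoeff u n - lowset UNIV N (hcoeff u) n) Z + pseries (lowset UNIV N (hcoeff u)) Z" for Z
    using pseries_add[OF entire_remainder[OF e, of UNIV N] entire_lowset[OF e, of UNIV N], of Z] by simp
  have "stft (\<lambda>g. hermite_partial N u g - u g) Z = - (gphase Z * of_real (gweight Z) * pseries (\<lambda>n. hcoeff u n - lowset UNIV N (hcoeff u) n) Z)" for Z
    unfolding pairing_diff stft_eq_pseries[OF u] stft_hermite_partial[OF u] split by (simp add: algebra_simps)
  then show ?thesis unfolding pnorm_def
    by (simp add: norm_mult norm_gphase less_imp_le[OF gweight_pos] mult.commute)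
qed

context
  fixes p :: ennreal
  assumes p: "1 < p" "p < \<infinity>"
begin

lemma exponent_gt_1: "enn2real p > 1"
proof -
  obtain r where r: "p = ennreal r" "r \<ge> 0" using p(2) by (cases p) auto
  with p(1) have "ennreal 1 < ennreal r" by simp
  then have "1 < r" by (simp only: ennreal_less_iff)
  then show ?thesis using r by simp
qed

lemma hermite_partial_bounded:
  obtains C :: real where
    "\<And>N f. f \<in> (mod_space p :: 'd::finite functional set) \<Longrightarrow> mod_norm p (hermite_partial N f) \<le> ennreal C * mod_norm p f"
proof -
  define q where "q = enn2real p"
  have q: "q > 1" using exponent_gt_1 by (simp add: q_def)
  obtain C where C: "riesz_bound q C" "C \<ge> 0" using riesz_bound_exists[OF q] by blast
  define K where "K = max C 1 ^ CARD('d)"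
  have K: "K \<ge> 1" by (simp add: K_def)
  show thesis
  proof (rule that[of "K powr (1 / q)"])
    fix N and f :: "'d functional" assume "f \<in> mod_space p"
    then have f: "f \<in> tempered_distributions" by (simp add: mod_space_def)
    have "pnorm q (lowset UNIV N (hcoeff f)) \<le> ennreal C ^ CARD('d) * pnorm q (hcoeff f)"
      using pnorm_lowset[OF entire_hcoeff[OF f], of q C UNIV N] q C by simp
    also have "\<dots> \<le> ennreal K * pnorm q (hcoeff f)"
      unfolding K_def using C by (intro mult_right_mono) (auto simp: ennreal_power intro!: ennreal_leI power_mono)
    finally have "ennroot q (pnorm q (lowset UNIV N (hcoeff f))) \<le> ennreal (K powr (1 / q)) * ennroot q (pnorm q (hcoeff f))"
      by (rule ennroot_mult_mono[OF _ K]) (use q in simp)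
    then show "mod_norm p (hermite_partial N f) \<le> ennreal (K powr (1 / q)) * mod_norm p f"
      using p by (simp add: mod_norm_finite stft_power_integral[OF f] stft_partial_power_integral[OF f] q_def)
  qed
qed

lemma hermite_partial_converges:
  fixes f :: "'d::finite functional"
  assumes f: "f \<in> mod_space p"
  shows "converges_in_mod p (\<lambda>N. hermite_partial N f) f"
proof -
  define q where "q = enn2real p"
  have q: "q > 1" "q > 0" using exponent_gt_1 by (simp_all add: q_def)
  obtain C where C: "riesz_bound q C" "C \<ge> 0" using riesz_bound_exists[OF q(1)] by blast
  have t: "f \<in> tempered_distributions" and "mod_norm p f < \<infinity>" using f by (simp_all add: mod_space_def)
  then have "pnorm q (hcoeff f) < \<infinity>" using p
    by (auto simp: mod_norm_finite stft_power_integral[OF t] q_def ennroot_def less_top split: if_splits)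
  from pnorm_remainder_tendsto[OF entire_hcoeff[OF t] q(2) C this, of UNIV]
  have "(\<lambda>N. ennroot q (pnorm q (\<lambda>n. hcoeff f n - lowset UNIV N (hcoeff f) n))) \<longlonglongrightarrow> 0"
    by (rule ennroot_tendsto_0) (rule q(2))
  then show ?thesis unfolding converges_in_mod_def using p
    by (simp add: mod_norm_finite stft_remainder_power_integral[OF t] q_def)
qed

end

section \<open>A logarithmic lower bound for truncated exponential series\<close>

lemma has_integral_sawtooth:
  assumes "k > 0"
  shows "((\<lambda>\<theta>. of_real (pi - \<theta>) * cnj (cis \<theta>) ^ k) has_integral (- 2 * pi * \<i> / of_nat k)) {0..2*pi}"
proof -
  define c1 c2 where "c1 = \<i> / of_nat k" and "c2 = 1 / (of_nat k)\<^sup>2 + (0::complex)"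
  define F where "F = (\<lambda>\<theta>. exp (- \<i> * of_nat k * \<theta>) * ((of_real pi - \<theta>) * c1 - c2))"
  have k: "of_nat k \<noteq> (0::complex)" using assms by simp
  have cs: "- \<i> * of_nat k * c1 = 1" "\<i> * of_nat k * c2 = c1"
    using k by (simp_all add: c1_def c2_def power2_eq_square)
  have "(F has_field_derivative (of_real pi - z) * exp (- \<i> * of_nat k * z)) (at z)" for z
  proof -
    have "(F has_field_derivative exp (- \<i> * of_nat k * z) * ((of_real pi - z) * (- \<i> * of_nat k * c1) + \<i> * of_nat k * c2 - c1)) (at z)"
      unfolding F_def by (auto intro!: derivative_eq_intros simp: algebra_simps)
    then show ?thesis unfolding cs by (simp add: mult.commute)
  qed
  from has_vector_derivative_real_field[OF this]
  have d: "((\<lambda>t. F (of_real t)) has_vector_derivative (of_real pi - of_real t) * exp (- \<i> * of_nat k * of_real t)) (at t within {0..2*pi})" for t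
    by (simp add: o_def)
  have "((\<lambda>t. (of_real pi - of_real t) * exp (- \<i> * of_nat k * of_real t)) has_integral (F (of_real (2*pi)) - F (of_real 0))) {0..2*pi}"
    by (rule fundamental_theorem_of_calculus) (use d in auto)
  moreover have ck: "exp (- \<i> * of_nat k * of_real t) = cnj (cis t) ^ k" for t
  proof -
    have "cnj (cis t) = exp (- \<i> * of_real t)" by (simp add: complex_eq_iff Re_exp Im_exp)
    then show ?thesis by (simp only: exp_of_nat_mult[symmetric]) (simp add: mult_ac)
  qed
  moreover have "F (of_real (2*pi)) - F (of_real 0) = - 2 * pi * \<i> / of_nat k"
  proof -
    have "exp (- \<i> * of_nat k * of_real (2*pi)) = 1" unfolding ck by simp
    then have "F (of_real (2*pi)) - F (of_real 0) = - 2 * pi * c1" unfolding F_def by (simp add: algebra_simps)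
    then show ?thesis by (simp add: c1_def)
  qed
  ultimately show ?thesis by simp
qed

text \<open>
  Hardy's inequality, read from the top coefficient downwards: the polynomial, with its frequencies
  shifted down by \<open>N + 1\<close>, is integrated against the sawtooth \<open>\<pi> - \<theta>\<close>, whose Fourier coefficients are
  \<open>1 / k\<close> up to a factor of constant modulus and which is bounded by \<open>\<pi>\<close>.
\<close>

lemma hardy_inequality_nonneg:
  fixes a :: "nat \<Rightarrow> real"
  shows "2 * (\<Sum>n\<le>N. a n / (N + 1 - n)) \<le> integral {0..2*pi} (\<lambda>\<theta>. norm (\<Sum>n\<le>N. of_real (a n) * cis \<theta> ^ n))"
proof -
  let ?q = "\<lambda>\<theta>. \<Sum>n\<le>N. of_real (a n) * cis \<theta> ^ n :: complex"
  have cc: "cnj (cis \<theta>) ^ m * cis \<theta> ^ m = 1" for \<theta> m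
    by (metis cis_mult_cnj mult.commute power_mult_distrib power_one)
  have e: "of_real (pi - \<theta>) * (cnj (cis \<theta>) ^ (N+1) * ?q \<theta>) = (\<Sum>n\<le>N. of_real (a n) * (of_real (pi - \<theta>) * cnj (cis \<theta>) ^ (N + 1 - n)))" for \<theta>
    unfolding sum_distrib_left
  proof (rule sum.cong[OF refl])
    fix n assume "n \<in> {..N}"
    then have "cnj (cis \<theta>) ^ (N+1) = cnj (cis \<theta>) ^ (N + 1 - n) * cnj (cis \<theta>) ^ n" by (simp flip: power_add)
    then show "of_real (pi - \<theta>) * (cnj (cis \<theta>) ^ (N+1) * (of_real (a n) * cis \<theta> ^ n)) = of_real (a n) * (of_real (pi - \<theta>) * cnj (cis \<theta>) ^ (N + 1 - n))"
    proof -
      assume h: "cnj (cis \<theta>) ^ (N+1) = cnj (cis \<theta>) ^ (N + 1 - n) * cnj (cis \<theta>) ^ n"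
      have "cnj (cis \<theta>) ^ (N+1) * (of_real (a n) * cis \<theta> ^ n) = of_real (a n) * (cnj (cis \<theta>) ^ (N + 1 - n) * (cnj (cis \<theta>) ^ n * cis \<theta> ^ n))"
        unfolding h by (simp only: mult_ac)
      then show ?thesis unfolding cc by (simp only: mult_1_right mult.left_commute)
    qed
  qed
  have hi: "((\<lambda>\<theta>. of_real (pi - \<theta>) * (cnj (cis \<theta>) ^ (N+1) * ?q \<theta>)) has_integral (\<Sum>n\<le>N. of_real (a n) * (- 2 * pi * \<i> / of_nat (N + 1 - n)))) {0..2*pi}"
    unfolding e by (intro has_integral_sum has_integral_mult_right has_integral_sawtooth) auto
  have "(\<Sum>n\<le>N. of_real (a n) * (- 2 * pi * \<i> / of_nat (N + 1 - n))) = - 2 * pi * \<i> * of_real (\<Sum>n\<le>N. a n / (N + 1 - n))"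
    by (simp add: sum_distrib_left mult_ac of_nat_diff)
  moreover have "norm (- 2 * pi * \<i> * complex_of_real S) = 2 * pi * \<bar>S\<bar>" for S by (simp add: norm_mult)
  ultimately have "norm (\<Sum>n\<le>N. of_real (a n) * (- 2 * pi * \<i> / of_nat (N + 1 - n))) = 2 * pi * \<bar>\<Sum>n\<le>N. a n / (N + 1 - n)\<bar>"
    by (simp only:)
  moreover have "norm (\<Sum>n\<le>N. of_real (a n) * (- 2 * pi * \<i> / of_nat (N + 1 - n))) \<le> integral {0..2*pi} (\<lambda>\<theta>. pi * norm (?q \<theta>))"
    unfolding integral_unique[OF hi, symmetric]
  proof (rule integral_norm_bound_integral)
    show "norm (of_real (pi - \<theta>) * (cnj (cis \<theta>) ^ (N+1) * ?q \<theta>)) \<le> pi * norm (?q \<theta>)" if "\<theta> \<in> {0..2*pi}" for \<theta>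
    proof -
      have "\<bar>pi - \<theta>\<bar> * norm (?q \<theta>) \<le> pi * norm (?q \<theta>)" using that by (intro mult_right_mono) auto
      then show ?thesis by (simp only: norm_mult norm_power complex_mod_cnj norm_cis power_one mult_1_left norm_of_real)
    qed
    show "(\<lambda>\<theta>. pi * norm (?q \<theta>)) integrable_on {0..2*pi}" by (intro integrable_continuous_real continuous_intros)
  qed (rule has_integral_integrable[OF hi])
  ultimately have "2 * pi * \<bar>\<Sum>n\<le>N. a n / (N + 1 - n)\<bar> \<le> pi * integral {0..2*pi} (\<lambda>\<theta>. norm (?q \<theta>))" by simp
  then have "pi * (2 * \<bar>\<Sum>n\<le>N. a n / (N + 1 - n)\<bar>) \<le> pi * integral {0..2*pi} (\<lambda>\<theta>. norm (?q \<theta>))"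
    by (simp only: mult.assoc mult.left_commute[of 2 pi])
  then have "2 * \<bar>\<Sum>n\<le>N. a n / (N + 1 - n)\<bar> \<le> integral {0..2*pi} (\<lambda>\<theta>. norm (?q \<theta>))"
    by (rule mult_left_le_imp_le) (rule pi_gt_zero)
  then show ?thesis by linarith
qed

lemma integral_periodic_shift:
  fixes f :: "real \<Rightarrow> real"
  assumes c: "continuous_on UNIV f" and per: "\<And>x. f (x + 2*pi) = f x" and a: "0 \<le> a" "a \<le> 2*pi"
  shows "integral {0..2*pi} (\<lambda>x. f (a + x)) = integral {0..2*pi} f"
proof -
  have io: "f integrable_on {x..y}" for x y by (intro integrable_continuous_real continuous_on_subset[OF c]) auto
  have "integral {0..2*pi} (\<lambda>x. f (a + x)) = integral {a..2*pi + a} f"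
    using integral_shift_Icc_real[of 0 "2*pi" f a] by (simp add: o_def)
  also have "\<dots> = integral {a..2*pi} f + integral {2*pi..2*pi + a} f"
    using Henstock_Kurzweil_Integration.integral_combine[where a=a and c="2*pi" and b="2*pi + a" and f=f] a io by simp
  also have "integral {2*pi..2*pi + a} f = integral {0..a} (\<lambda>x. f (2*pi + x))"
    using integral_shift_Icc_real[of 0 a f "2*pi"] by (simp add: o_def add.commute)
  also have "\<dots> = integral {0..a} f" using per by (simp add: add.commute)
  also have "integral {a..2*pi} f + integral {0..a} f = integral {0..2*pi} f"
    using Henstock_Kurzweil_Integration.integral_combine[where a=0 and c=a and b="2*pi" and f=f] a io by (simp add: add.commute)
  finally show ?thesis .
qed

text \<open>
  Stirling's upper bound with a crude constant, by comparing \<open>ln (1 + 1 / n)\<close> with \<open>2 / (2 * n + 1)\<close>.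
\<close>

lemma ln_fact_upper:
  assumes "n \<ge> 1"
  shows "ln (fact n) \<le> 1 + (real n + 1/2) * ln (real n) - real n"
  using assms
proof (induction n rule: dec_induct)
  case (step n)
  have n: "real n > 0" using step by simp
  have h: "2 / (2 * real n + 1) \<le> ln (real (Suc n)) - ln (real n)"
    using ln_inverse_approx_ge[of "real n" "real (Suc n)"] n by (simp add: algebra_simps)
  have "(real n + 1/2) * (2 / (2 * real n + 1)) \<le> (real n + 1/2) * (ln (real (Suc n)) - ln (real n))"
    by (intro mult_left_mono h) auto
  moreover have "(real n + 1/2) * (2 / (2 * real n + 1)) = 1" using n by (simp add: field_simps)
  ultimately have a: "1 \<le> (real n + 1/2) * (ln (real (Suc n)) - ln (real n))" by linarith
  have "ln (fact (Suc n)) = ln (real (Suc n)) + ln (fact n :: real)" by (simp add: ln_mult)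
  also have "\<dots> \<le> ln (real (Suc n)) + (1 + (real n + 1/2) * ln (real n) - real n)" using step by simp
  also have "\<dots> \<le> 1 + (real (Suc n) + 1/2) * ln (real (Suc n)) - real (Suc n)" using a by (simp add: algebra_simps)
  finally show ?case .
qed simp

text \<open>
  A one-sided local limit estimate: Poisson weights of mean \<open>l\<close> are at least of the order of \<open>1 / sqrt n\<close> as long as
  \<open>l - n\<close> is of the order of \<open>sqrt l\<close>.
\<close>

lemma poisson_lower_bound:
  fixes l :: real
  assumes n: "n \<ge> 1" and l: "l \<ge> real n"
  shows "exp (- (l - n)\<^sup>2 / l - 1) / sqrt n \<le> exp (- l) * l ^ n / fact n"
proof -
  have npos: "real n > 0" "l > 0" using n l by auto
  have "ln (real n / l) \<le> real n / l - 1" using npos by (intro ln_le_minus_one) auto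
  then have "real n * (ln l - ln n) \<ge> real n * (1 - real n / l)" using npos by (intro mult_left_mono) (auto simp: ln_div)
  moreover have "real n * (1 - real n / l) = (l - n) - (l - n)\<^sup>2 / l" using npos by (simp add: field_simps power2_eq_square)
  ultimately have a: "real n * ln l - real n * ln n \<ge> (l - n) - (l - n)\<^sup>2 / l" by (simp add: algebra_simps)
  have "ln (exp (- (l - n)\<^sup>2 / l - 1) / sqrt n) = - (l - n)\<^sup>2 / l - 1 - ln n / 2"
    using npos by (simp add: ln_div ln_sqrt)
  also have "\<dots> \<le> - l + n * ln l - ln (fact n)"
    using a ln_fact_upper[OF n] by (simp add: algebra_simps)
  also have "\<dots> = ln (exp (- l) * l ^ n / fact n)" using npos by (simp add: ln_div ln_mult ln_realpow)
  finally show ?thesis using npos by (subst (asm) ln_le_cancel_iff) auto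
qed

text \<open>
  In one coordinate, the modulus at \<open>z\<close> of the short-time Fourier transform of the partial sum of the
  coherent state at \<open>w\<close>; see \<open>norm_stft_partial_coh\<close>.
\<close>

definition ker1 :: "nat \<Rightarrow> complex \<Rightarrow> complex \<Rightarrow> real" where
  "ker1 N w z = exp (- pi / 2 * ((norm w)\<^sup>2 + (norm z)\<^sup>2)) * norm (\<Sum>n\<le>N. (of_real pi * w * z) ^ n / fact n)"

lemma ker1_commute: "ker1 N w z = ker1 N z w"
proof -
  have "of_real pi * w * z = of_real pi * z * w" by simp
  then show ?thesis unfolding ker1_def by (simp only: add.commute[of "(norm w)\<^sup>2"])
qed

lemma ker1_nonneg: "ker1 N w z \<ge> 0" by (simp add: ker1_def)

text \<open>
  The argument of \<open>z\<close> merely shifts the angle of integration.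
\<close>

lemma ker1_rotation_integral:
  assumes N: "N \<ge> 1" and r: "norm z = r"
  shows "integral {0..2*pi} (\<lambda>\<theta>. ker1 N (of_real \<rho>) (cis \<theta> * z)) =
    integral {0..2*pi} (\<lambda>\<theta>. exp (- pi / 2 * (\<rho>\<^sup>2 + r\<^sup>2)) * norm (\<Sum>n\<le>N. of_real ((pi * \<rho> * r) ^ n / fact n) * cis \<theta> ^ n))"
proof -
  define f where "f = (\<lambda>\<theta>. exp (- pi / 2 * (\<rho>\<^sup>2 + r\<^sup>2)) * norm (\<Sum>n\<le>N. of_real ((pi * \<rho> * r) ^ n / fact n) * cis \<theta> ^ n))"
  define a where "a = Arg2pi z"
  have "0 \<le> a" "a < 2*pi" unfolding a_def by (rule Arg2pi_ge_0 Arg2pi_lt_2pi)+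
  moreover have "z = of_real r * cis a"
    unfolding a_def cis_conv_exp r[symmetric] by (rule Arg2pi_eq)
  ultimately have a: "0 \<le> a" "a < 2*pi" "z = of_real r * cis a" .
  have kf: "ker1 N (of_real \<rho>) (cis \<theta> * z) = f (a + \<theta>)" for \<theta>
  proof -
    have e1: "of_real pi * of_real \<rho> * (cis \<theta> * z) = of_real (pi * \<rho> * r) * cis (a + \<theta>)"
      unfolding a(3) cis_mult[symmetric] of_real_mult by (simp only: mult.assoc mult.left_commute mult.commute)
    have e2: "(of_real pi * of_real \<rho> * (cis \<theta> * z)) ^ n / fact n = of_real ((pi * \<rho> * r) ^ n / fact n) * cis (a + \<theta>) ^ n" for n
      unfolding e1 power_mult_distrib[of "of_real _"] of_real_divide of_real_power of_real_fact by (simp only: times_divide_eq_left)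
    have e3: "norm (cis \<theta> * z) = r" by (simp add: norm_mult r)
    show ?thesis unfolding ker1_def f_def e2 e3 by simp
  qed
  have cf: "continuous_on UNIV f" unfolding f_def by (intro continuous_intros)
  have per: "f (x + 2*pi) = f x" for x
  proof -
    have "cis (x + 2*pi) = cis x" unfolding cis_mult[symmetric] by simp
    then show ?thesis by (simp only: f_def)
  qed
  have "integral {0..2*pi} (\<lambda>\<theta>. f (a + \<theta>)) = integral {0..2*pi} f"
    by (rule integral_periodic_shift[OF cf per]) (use a in auto)
  then show ?thesis unfolding kf by (simp only: f_def)
qed

definition c0 :: real where "c0 = exp (- 10)"

text \<open>
  On the circle through \<open>z\<close> the kernel is the modulus of a polynomial in \<open>cis \<theta>\<close> whose coefficients are, up to
  a bounded factor, the Poisson weights of mean \<open>l = \<pi> * \<rho> * \<bar>z\<bar>\<close>, cut off at \<open>N\<close>. The choice of \<open>\<rho>\<close> puts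
  \<open>l\<close> between \<open>N\<close> and \<open>N + 2 * sqrt N\<close>, so the top \<open>sqrt N / 2\<close> coefficients are at least \<open>c0 / sqrt N\<close>.
  Hardy's inequality weights them by \<open>1, 1/2, 1/3, \<dots>\<close>, which sums to the logarithm.
\<close>

lemma ker1_circle_lower_bound:
  assumes N: "N \<ge> 1" and \<rho>: "\<rho> = sqrt (N / pi)" and z: "\<rho> \<le> norm z" "norm z \<le> \<rho> + 1"
  shows "c0 / (3 * sqrt N) * ln (2 * N) \<le> integral {0..2*pi} (\<lambda>\<theta>. ker1 N (of_real \<rho>) (cis \<theta> * z))"
proof -
  define r where "r = norm z"
  define l where "l = pi * \<rho> * r"
  define m where "m = nat \<lfloor>sqrt N / 2\<rfloor>"
  define p where "p = (\<lambda>n. exp (- pi / 2 * (\<rho>\<^sup>2 + r\<^sup>2)) * (l ^ n / fact n))"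
  have N0: "real N \<ge> 1" using N by simp
  have rho: "\<rho> > 0" "pi * \<rho>\<^sup>2 = N" "pi * \<rho> = sqrt pi * sqrt N" using N0
    by (auto simp: \<rho> real_sqrt_divide real_div_sqrt field_simps)
  have sqpi: "sqrt pi \<le> 2" using pi_less_4 by (intro real_le_lsqrt) auto
  have sN: "sqrt N \<ge> 1" using N0 by simp
  have lN: "real N \<le> l"
  proof -
    have "pi * \<rho> * \<rho> \<le> pi * \<rho> * r" using z rho by (intro mult_left_mono) (auto simp: r_def)
    moreover have "pi * \<rho> * \<rho> = N" using rho(2) by (simp add: power2_eq_square mult.assoc)
    ultimately show ?thesis unfolding l_def by linarith
  qed
  have lN2: "l - N \<le> 2 * sqrt N"
  proof -
    have "l - N = pi * \<rho> * (r - \<rho>)" using rho(2) by (simp add: l_def algebra_simps power2_eq_square)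
    also have "\<dots> \<le> pi * \<rho> * 1" using z rho by (intro mult_left_mono) (auto simp: r_def)
    also have "\<dots> \<le> 2 * sqrt N" using sqpi rho(3) by (simp add: mult_right_mono)
    finally show ?thesis .
  qed
  have mle: "real m \<le> sqrt N / 2" unfolding m_def by (rule of_nat_floor) simp
  have "sqrt N / 2 \<le> N / 2" using sN N0 by (simp add: real_le_lsqrt power2_eq_square)
  then have mN: "real m \<le> N / 2" using mle by linarith
  have p_lower: "c0 / sqrt N \<le> p (N - k)" if "k \<le> m" for k
  proof -
    define n where "n = N - k"
    have k: "real k \<le> sqrt N / 2" "real k \<le> N / 2" using that mle mN by linarith+
    then have "k < N" using N0 by linarith
    then have n: "n \<ge> 1" "real n = real N - real k" "real n \<le> N" by (auto simp: n_def)
    have nl: "real n \<le> l" using n lN by linarith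
    \<comment> \<open>At most 2 * sqrt N from l - N and sqrt N / 2 from k; squared, this gives the exponent 25/4 + 1 < 8.\<close>
    have "l - n \<le> 5/2 * sqrt N" using lN2 k n by linarith
    moreover have "0 \<le> l - n" using nl by simp
    ultimately have "(l - n)\<^sup>2 \<le> (5/2 * sqrt N)\<^sup>2" by (intro power_mono)
    also have "\<dots> = 25/4 * N" by (simp add: power_mult_distrib power2_eq_square)
    also have "\<dots> \<le> 25/4 * l" using lN by simp
    finally have "(l - n)\<^sup>2 / l \<le> 25/4" using lN N0 by (simp add: pos_divide_le_eq)
    then have e1: "exp (- 8) \<le> exp (- (l - n)\<^sup>2 / l - 1)"
      unfolding exp_le_cancel_iff minus_divide_left[symmetric] by linarith
    have "exp (- 8) / sqrt N \<le> exp (- (l - n)\<^sup>2 / l - 1) / sqrt n"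
      using n e1 by (intro frac_le) auto
    also have "\<dots> \<le> exp (- l) * l ^ n / fact n" by (rule poisson_lower_bound[OF n(1) nl])
    finally have A: "exp (- 8) / sqrt N \<le> exp (- l) * l ^ n / fact n" .
    \<comment> \<open>The Gaussian prefactor is at least exp (- 2) times the factor exp (- l) of the Poisson weights.\<close>
    have "- pi / 2 * (\<rho>\<^sup>2 + r\<^sup>2) = - l - pi / 2 * (r - \<rho>)\<^sup>2" by (simp add: l_def power2_eq_square algebra_simps)
    moreover have "pi / 2 * (r - \<rho>)\<^sup>2 \<le> 2 * 1"
    proof (rule mult_mono)
      show "pi / 2 \<le> 2" using pi_less_4 by simp
      show "(r - \<rho>)\<^sup>2 \<le> 1" using z by (intro power_le_one) (auto simp: r_def)
    qed auto
    ultimately have "- 2 - l \<le> - pi / 2 * (\<rho>\<^sup>2 + r\<^sup>2)" by linarith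
    then have "exp (- 2) * exp (- l) \<le> exp (- pi / 2 * (\<rho>\<^sup>2 + r\<^sup>2))" by (simp only: mult_exp_exp exp_le_cancel_iff)
    then have "exp (- 2) * exp (- l) * (l ^ n / fact n) \<le> p n"
      unfolding p_def using lN N0 by (intro mult_right_mono) auto
    moreover have "exp (- 2) * (exp (- 8) / sqrt N) \<le> exp (- 2) * (exp (- l) * l ^ n / fact n)" using A by (intro mult_left_mono) auto
    moreover have "exp (- 2) * (exp (- 8) / sqrt N) = c0 / sqrt N" by (simp add: c0_def mult_exp_exp)
    moreover have "exp (- 2) * (exp (- l) * l ^ n / fact n) = exp (- 2) * exp (- l) * (l ^ n / fact n)" by simp
    ultimately have "c0 / sqrt N \<le> p n" by linarith
    then show ?thesis unfolding n_def .
  qed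
  have p_nonneg: "p n \<ge> 0" for n using lN N0 by (simp add: p_def)
  \<comment> \<open>The number m of coefficients used is of the order of sqrt N, whose logarithm is comparable to that of N.
    The sixth power is a crude choice for which 2 * N is bounded by (sqrt N / 2 + 1) ^ 6 for every N.\<close>
  have log: "ln (2 * N) / 6 \<le> harm (m + 1)"
  proof -
    define s where "s = sqrt N / 2"
    have s: "s \<ge> 1/2" "real N = 4 * s\<^sup>2" using sN by (auto simp: s_def power_divide)
    have "2 * real N \<le> (s + 1) ^ 6"
    proof -
      have "(s + 1) ^ 6 = 15 * s\<^sup>2 + (1 + 6 * s + 20 * s ^ 3 + 15 * s ^ 4 + 6 * s ^ 5 + s ^ 6)"
        by (simp add: eval_nat_numeral algebra_simps)
      moreover have "0 \<le> 1 + 6 * s + 20 * s ^ 3 + 15 * s ^ 4 + 6 * s ^ 5 + s ^ 6" using s by simp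
      moreover have "8 * s\<^sup>2 \<le> 15 * s\<^sup>2" by simp
      ultimately show ?thesis using s by linarith
    qed
    then have "ln (2 * real N) \<le> ln ((s + 1) ^ 6)" using N0 s by (subst ln_le_cancel_iff) auto
    also have "\<dots> = 6 * ln (s + 1)" using s by (simp add: ln_realpow)
    also have "ln (s + 1) \<le> ln (real (m + 1) + 1)"
    proof (subst ln_le_cancel_iff)
      have "s < real m + 1" unfolding m_def s_def[symmetric] using s by linarith
      then show "s + 1 \<le> real (m + 1) + 1" by simp
    qed (use s in auto)
    also have "\<dots> \<le> harm (m + 1)" by (rule ln_le_harm)
    finally show ?thesis by simp
  qed
  have "c0 / sqrt N * (ln (2 * N) / 6) \<le> c0 / sqrt N * harm (m + 1)"
    using log by (intro mult_left_mono) (auto simp: c0_def)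
  also have "\<dots> = (\<Sum>k\<le>m. c0 / sqrt N / (k + 1))"
    unfolding harm_def sum_distrib_left
    by (rule sum.reindex_bij_witness[of _ "\<lambda>k. k + 1" "\<lambda>k. k - 1"]) (auto simp: field_simps)
  also have "\<dots> \<le> (\<Sum>k\<le>m. p (N - k) / (k + 1))" by (intro sum_mono divide_right_mono p_lower) auto
  also have "\<dots> = (\<Sum>n\<in>(\<lambda>k. N - k) ` {..m}. p n / (N + 1 - n))"
  proof -
    have "m \<le> N" using mN by linarith
    then show ?thesis by (subst sum.reindex) (auto simp: inj_on_def of_nat_diff intro!: sum.cong)
  qed
  also have "\<dots> \<le> (\<Sum>n\<le>N. p n / (N + 1 - n))"
    by (rule sum_mono2) (use p_nonneg in \<open>auto intro!: divide_nonneg_nonneg\<close>)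
  finally have "c0 / (3 * sqrt N) * ln (2 * N) \<le> 2 * (\<Sum>n\<le>N. p n / (N + 1 - n))" by (simp add: field_simps)
  also have "\<dots> \<le> integral {0..2*pi} (\<lambda>\<theta>. norm (\<Sum>n\<le>N. of_real (p n) * cis \<theta> ^ n))"
    by (rule hardy_inequality_nonneg)
  also have "\<dots> = integral {0..2*pi} (\<lambda>\<theta>. ker1 N (of_real \<rho>) (cis \<theta> * z))"
  proof -
    have "norm (\<Sum>n\<le>N. of_real (p n) * cis \<theta> ^ n) = exp (- pi / 2 * (\<rho>\<^sup>2 + r\<^sup>2)) * norm (\<Sum>n\<le>N. of_real ((pi * \<rho> * r) ^ n / fact n) * cis \<theta> ^ n)" for \<theta>
    proof -
      have "(\<Sum>n\<le>N. of_real (p n) * cis \<theta> ^ n) = of_real (exp (- pi / 2 * (\<rho>\<^sup>2 + r\<^sup>2))) * (\<Sum>n\<le>N. of_real ((pi * \<rho> * r) ^ n / fact n) * cis \<theta> ^ n)"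
        unfolding p_def l_def sum_distrib_left of_real_mult by (simp only: mult.assoc)
      then show ?thesis by (simp only: norm_mult norm_of_real abs_exp_cancel)
    qed
    then show ?thesis using ker1_rotation_integral[OF N r_def[symmetric]] by simp
  qed
  finally show ?thesis by (simp only: of_nat_mult of_nat_numeral)
qed

section \<open>Coherent states as distributions\<close>

text \<open>
  The conjugate of the shifted window depends holomorphically on \<open>zcoord W\<close>, up to weight and phase, so
  its coefficients are monomials in these coordinates (\<open>hcoeff_coh\<close>).
\<close>

definition cohfun :: "'d::finite phase \<Rightarrow> real^'d \<Rightarrow> complex" where
  "cohfun W t = cnj (tf_shift W gauss_window t)"

definition coh :: "'d::finite phase \<Rightarrow> 'd functional" where
  "coh W = distribution_of (cohfun W)"

lemma cohfun_eq: "cohfun W t = (gphase W * of_real (gweight W)) * genprod (zcoord W) t"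
  unfolding cohfun_def by (rule cnj_tf_shift)

lemma schwartz_continuous: "g \<in> schwartz_space \<Longrightarrow> continuous_on UNIV g"
proof -
  assume "g \<in> schwartz_space"
  then have "iter_deriv [] g differentiable (at x)" for x unfolding schwartz_space_def smooth_def by blast
  then show ?thesis by (simp add: differentiable_imp_continuous_within continuous_at_imp_continuous_on)
qed

lemma schwartz_measurable: "g \<in> schwartz_space \<Longrightarrow> g \<in> borel_measurable borel"
  by (intro borel_measurable_continuous_onI schwartz_continuous)

lemma schwartz_sup: "g \<in> schwartz_space \<Longrightarrow> norm (g x) \<le> schwartz_seminorm 0 [] g"
  using seminorm_upper[of g x 0 "[]"] by simp

lemma seminorm_le_sum:
  assumes "g \<in> schwartz_space"
  shows "schwartz_seminorm 0 [] g \<le> (\<Sum>k\<le>0. \<Sum>is | length is \<le> 0. schwartz_seminorm k is g)"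
proof -
  have "{is :: 'a list. length is \<le> 0} = {[]}" by auto
  then show ?thesis by simp
qed

lemma integrable_mult_schwartz:
  assumes F: "integrable lborel F" and g: "g \<in> schwartz_space"
  shows "integrable lborel (\<lambda>t. F t * g t)"
proof (rule Bochner_Integration.integrable_bound[of _ "\<lambda>t. schwartz_seminorm 0 [] g * norm (F t)"])
  show "integrable lborel (\<lambda>t. schwartz_seminorm 0 [] g * norm (F t))" using F by simp
  show "(\<lambda>t. F t * g t) \<in> borel_measurable lborel"
    using F schwartz_measurable[OF g] by (intro borel_measurable_times) auto
  show "AE t in lborel. norm (F t * g t) \<le> norm (schwartz_seminorm 0 [] g * norm (F t))"
  proof (rule AE_I2)
    fix t
    have "norm (F t * g t) = norm (g t) * norm (F t)" by (simp add: norm_mult)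
    also have "\<dots> \<le> schwartz_seminorm 0 [] g * norm (F t)" by (intro mult_right_mono schwartz_sup[OF g]) auto
    finally show "norm (F t * g t) \<le> norm (schwartz_seminorm 0 [] g * norm (F t))"
      by (simp add: abs_mult abs_of_nonneg[OF seminorm_nonneg[OF g]])
  qed
qed

lemma distribution_of_bound:
  assumes F: "integrable lborel F" and g: "g \<in> schwartz_space"
  shows "norm (distribution_of F g) \<le> (LINT t|lborel. norm (F t)) * schwartz_seminorm 0 [] g"
proof -
  have "norm (LINT t|lborel. F t * g t) \<le> (LINT t|lborel. norm (F t * g t))" by (rule integral_norm_bound)
  also have "\<dots> \<le> (LINT t|lborel. norm (F t) * schwartz_seminorm 0 [] g)"
  proof (rule integral_mono)
    show "integrable lborel (\<lambda>t. norm (F t * g t))" by (rule integrable_norm[OF integrable_mult_schwartz[OF F g]])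
    show "integrable lborel (\<lambda>t. norm (F t) * schwartz_seminorm 0 [] g)" using F by simp
    show "norm (F t * g t) \<le> norm (F t) * schwartz_seminorm 0 [] g" for t
      unfolding norm_mult by (intro mult_left_mono schwartz_sup[OF g]) auto
  qed
  finally show ?thesis using g by (simp add: distribution_of_def)
qed

lemma distribution_of_linear:
  assumes F: "integrable lborel F" and g: "g \<in> schwartz_space" "h \<in> schwartz_space"
  shows "distribution_of F (\<lambda>t. a * g t + b * h t) = a * distribution_of F g + b * distribution_of F h"
proof -
  have "(LINT t|lborel. F t * (a * g t + b * h t)) = (LINT t|lborel. a * (F t * g t) + b * (F t * h t))"
    by (intro Bochner_Integration.integral_cong refl) (simp add: algebra_simps)
  also have "\<dots> = a * (LINT t|lborel. F t * g t) + b * (LINT t|lborel. F t * h t)"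
    using integrable_mult_schwartz[OF F g(1)] integrable_mult_schwartz[OF F g(2)] by simp
  finally show ?thesis using g schwartz_space_linear[OF g] by (simp add: distribution_of_def)
qed

lemma integrable_gen: "integrable lborel (gen z)"
  using schwartz_decay_integrable[OF schwartz_decay_gen[of 0 z]] by (simp add: gen_deriv_0)

lemma integrable_cohfun: "integrable lborel (cohfun W)"
proof -
  have "integrable lborel (genprod (zcoord W))"
    unfolding genprod_def [abs_def] by (rule integral_prod_vec(2)) (rule integrable_gen)
  then show ?thesis unfolding cohfun_eq [abs_def] by (rule integrable_mult_right)
qed

definition gauss_mass :: "'d::finite itself \<Rightarrow> real" where
  "gauss_mass _ = (LINT t|lborel. norm (gauss_window (t :: real^'d)))"

lemma norm_cohfun: "norm (cohfun W t) = norm (gauss_window (t - fst W))"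
  unfolding cohfun_def tf_shift_def by (simp add: norm_mult)

lemma integral_norm_cohfun: "(LINT t|lborel. norm (cohfun W t)) = gauss_mass TYPE('d)" for W :: "'d::finite phase"
proof -
  have m: "(\<lambda>t. norm (gauss_window (t::real^'d))) \<in> borel_measurable borel"
    unfolding gauss_window_def by (intro borel_measurable_continuous_onI continuous_intros)
  have "(LINT t|lborel. norm (gauss_window (t :: real^'d))) = (LINT t|distr lborel borel ((+) (- fst W)). norm (gauss_window t))"
    by (simp add: lborel_distr_plus)
  also have "\<dots> = (LINT t|lborel. norm (gauss_window (- fst W + t)))"
    by (rule integral_distr[OF _ m]) simp
  finally show ?thesis unfolding norm_cohfun gauss_mass_def by simp
qed

lemma coh_bound:
  fixes W :: "'d::finite phase"
  assumes "g \<in> schwartz_space" shows "norm (coh W g) \<le> gauss_mass TYPE('d) * schwartz_seminorm 0 [] g"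
  using distribution_of_bound[OF integrable_cohfun assms, of W] unfolding integral_norm_cohfun coh_def .

lemma coh_outside: "g \<notin> schwartz_space \<Longrightarrow> coh W g = 0" by (simp add: coh_def distribution_of_def)

lemma gauss_mass_nonneg: "gauss_mass TYPE('d::finite) \<ge> 0" by (simp add: gauss_mass_def)

lemma tempered_of_sup_bound:
  fixes u :: "'d::finite functional"
  assumes lin: "\<And>a b g h. g \<in> schwartz_space \<Longrightarrow> h \<in> schwartz_space \<Longrightarrow> u (\<lambda>t. a * g t + b * h t) = a * u g + b * u h"
    and bd: "\<And>g. g \<in> schwartz_space \<Longrightarrow> norm (u g) \<le> C * schwartz_seminorm 0 [] g" and C: "C \<ge> 0"
    and out: "\<And>g. g \<notin> schwartz_space \<Longrightarrow> u g = 0"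
  shows "u \<in> tempered_distributions"
proof -
  have "norm (u g) \<le> C * (\<Sum>k\<le>0. \<Sum>is | length is \<le> 0. schwartz_seminorm k is g)" if "g \<in> schwartz_space" for g
    using order_trans[OF bd[OF that] mult_left_mono[OF seminorm_le_sum[OF that] C]] .
  then show ?thesis unfolding tempered_distributions_def mem_Collect_eq using lin out by blast
qed

lemma coh_tempered: "coh W \<in> tempered_distributions"
  by (rule tempered_of_sup_bound[OF _ coh_bound gauss_mass_nonneg coh_outside])
    (simp add: coh_def distribution_of_linear[OF integrable_cohfun])

lemma coh_apply: "g \<in> schwartz_space \<Longrightarrow> coh W g = (LINT t|lborel. cohfun W t * g t)"
  by (simp add: coh_def distribution_of_def)

lemma hcoeff_coh: "hcoeff (coh W) n = gphase W * of_real (gweight W) * (\<Prod>j\<in>UNIV. (of_real pi * zcoord W j) ^ (n $ j) / fact (n $ j))"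
proof -
  have "coh W (hprod n) = (LINT t|lborel. (gphase W * of_real (gweight W)) * (hprod n t * genprod (zcoord W) t))"
    unfolding coh_apply[OF hprod_schwartz] cohfun_eq by (intro Bochner_Integration.integral_cong refl) simp
  also have "\<dots> = (gphase W * of_real (gweight W)) * (\<Prod>j\<in>UNIV. (of_real pi * zcoord W j) ^ (n $ j))"
    by (simp only: integral_mult_right_zero integral_hprod_genprod(1))
  finally show ?thesis unfolding hcoeff_def by (simp only: prod_dividef times_divide_eq_right)
qed

definition gker :: "complex \<Rightarrow> complex \<Rightarrow> real" where
  "gker w z = exp (- pi / 2 * ((norm w)\<^sup>2 + (norm z)\<^sup>2)) * norm (exp (of_real pi * w * z))"

lemma gweight_mult: "gweight W * gweight Z = (\<Prod>j\<in>UNIV. exp (- pi / 2 * ((norm (zcoord W j))\<^sup>2 + (norm (zcoord Z j))\<^sup>2)))"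
proof -
  have "- pi / 2 * (\<Sum>j\<in>UNIV. (norm (zcoord W j))\<^sup>2) + - pi / 2 * (\<Sum>j\<in>UNIV. (norm (zcoord Z j))\<^sup>2)
    = (\<Sum>j\<in>UNIV. - pi / 2 * ((norm (zcoord W j))\<^sup>2 + (norm (zcoord Z j))\<^sup>2))"
    by (simp only: sum_distrib_left sum.distrib distrib_left)
  then show ?thesis unfolding gweight_alt mult_exp_exp by (simp only: exp_sum[OF finite])
qed

lemma norm_stft_coh: "norm (stft (coh W) Z) = (\<Prod>j\<in>UNIV. gker (zcoord W j) (zcoord Z j))"
proof -
  have i: "integrable lborel (\<lambda>t. gen w t * gen z t)" for w z
    using schwartz_decay_integrable[OF schwartz_decay_mult[OF schwartz_decay_gen[of 0 w] schwartz_decay_gen[of 0 z]]]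
    by (simp add: gen_deriv_0)
  have "stft (coh W) Z = coh W (\<lambda>t. (gphase Z * of_real (gweight Z)) * genprod (zcoord Z) t)"
    unfolding pairing_def cnj_tf_shift ..
  also have "\<dots> = (LINT t|lborel. cohfun W t * ((gphase Z * of_real (gweight Z)) * genprod (zcoord Z) t))"
    by (rule coh_apply[OF schwartz_scale[OF genprod_schwartz]])
  also have "\<dots> = (LINT t|lborel. (gphase W * of_real (gweight W) * (gphase Z * of_real (gweight Z))) * (\<Prod>j\<in>UNIV. gen (zcoord W j) (t $ j) * gen (zcoord Z j) (t $ j)))"
    unfolding cohfun_eq genprod_def by (intro Bochner_Integration.integral_cong refl) (simp only: prod.distrib mult_ac)
  also have "\<dots> = (gphase W * of_real (gweight W) * (gphase Z * of_real (gweight Z))) * (\<Prod>j\<in>UNIV. exp (of_real pi * zcoord W j * zcoord Z j))"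
    by (simp only: integral_mult_right_zero integral_prod_vec(1)[OF i] complex_gaussian_integral)
  finally have "norm (stft (coh W) Z) = gweight W * gweight Z * (\<Prod>j\<in>UNIV. norm (exp (of_real pi * zcoord W j * zcoord Z j)))"
    by (simp only: norm_mult norm_gphase norm_of_real abs_of_pos[OF gweight_pos] mult_1_left prod_norm)
  then show ?thesis unfolding gweight_mult gker_def by (simp only: prod.distrib)
qed

text \<open>
  A box truncation of a product of exponential series is the product of the truncated series.
\<close>

lemma norm_stft_partial_coh:
  "norm (stft (hermite_partial N (coh W)) Z) = (\<Prod>j\<in>UNIV. ker1 N (zcoord W j) (zcoord Z j))"
proof -
  have "pseries (lowset UNIV N (hcoeff (coh W))) Z =
      (\<Sum>n\<in>box_upto N. gphase W * of_real (gweight W) * (\<Prod>j\<in>UNIV. (of_real pi * zcoord W j * zcoord Z j) ^ (n $ j) / fact (n $ j)))"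
    unfolding pseries_box hcoeff_coh mult.assoc prod.distrib[symmetric]
    by (simp add: power_mult_distrib mult_ac)
  also have "\<dots> = gphase W * of_real (gweight W) * (\<Prod>j\<in>UNIV. \<Sum>n\<le>N. (of_real pi * zcoord W j * zcoord Z j) ^ n / fact n)"
    unfolding prod_sum_box sum_distrib_left ..
  finally have p: "pseries (lowset UNIV N (hcoeff (coh W))) Z = gphase W * of_real (gweight W) * (\<Prod>j\<in>UNIV. \<Sum>n\<le>N. (of_real pi * zcoord W j * zcoord Z j) ^ n / fact n)" .
  have "norm (stft (hermite_partial N (coh W)) Z) = gweight W * gweight Z * (\<Prod>j\<in>UNIV. norm (\<Sum>n\<le>N. (of_real pi * zcoord W j * zcoord Z j) ^ n / fact n))"
    unfolding stft_hermite_partial[OF coh_tempered] p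
    by (simp only: norm_mult norm_gphase norm_of_real abs_of_pos[OF gweight_pos] mult_1_left prod_norm mult_ac)
  then show ?thesis unfolding gweight_mult ker1_def by (simp only: prod.distrib)
qed

section \<open>Norms of coherent states and of their partial sums\<close>

lemma ennroot_1: "ennroot 1 I = I"
  by (cases I) (auto simp: ennroot_def)

lemma mod_norm_1: "mod_norm 1 f = (\<integral>\<^sup>+Z. ennreal (norm (stft f Z)) \<partial>lborel)"
  using mod_norm_finite[of 1 f] by (simp add: ennroot_1)

definition gmass2 :: ennreal where
  "gmass2 = (\<integral>\<^sup>+x. ennreal (exp (- pi / 2 * ((fst x)\<^sup>2 + (snd x)\<^sup>2))) \<partial>(lborel :: (real \<times> real) measure))"

lemma gmass2_eq: "gmass2 = ennreal 2"
proof -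
  have g: "(\<integral>\<^sup>+t. ennreal (exp (- pi * t\<^sup>2 / 2)) \<partial>lborel) = ennreal (sqrt 2)"
  proof -
    have "exp (- pi * t\<^sup>2 / 2) = sqrt 2 * normal_density 0 (1 / sqrt pi) t" for t
      by (simp add: normal_density_def power_divide real_sqrt_divide field_simps)
    then have "(\<integral>\<^sup>+t. ennreal (exp (- pi * t\<^sup>2 / 2)) \<partial>lborel) = (\<integral>\<^sup>+t. ennreal (sqrt 2) * ennreal (normal_density 0 (1 / sqrt pi) t) \<partial>lborel)"
      by (simp add: ennreal_mult')
    also have "\<dots> = ennreal (sqrt 2) * (\<integral>\<^sup>+t. ennreal (normal_density 0 (1 / sqrt pi) t) \<partial>lborel)"
      by (rule nn_integral_cmult) auto
    also have "(\<integral>\<^sup>+t. ennreal (normal_density 0 (1 / sqrt pi) t) \<partial>lborel) = 1"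
      by (subst nn_integral_eq_integral) auto
    finally show ?thesis by simp
  qed
  have "gmass2 = (\<integral>\<^sup>+x. ennreal (exp (- pi / 2 * ((fst x)\<^sup>2 + (snd x)\<^sup>2))) \<partial>((lborel :: real measure) \<Otimes>\<^sub>M (lborel :: real measure)))"
    by (simp add: gmass2_def lborel_prod)
  also have "\<dots> = (\<integral>\<^sup>+x. (\<integral>\<^sup>+w. ennreal (exp (- pi * x\<^sup>2 / 2)) * ennreal (exp (- pi * w\<^sup>2 / 2)) \<partial>lborel) \<partial>lborel)"
    by (subst lborel.nn_integral_fst[symmetric]) (auto simp: ennreal_mult'[symmetric] mult_exp_exp algebra_simps add_divide_distrib intro!: nn_integral_cong)
  also have "\<dots> = (\<integral>\<^sup>+x. ennreal (exp (- pi * x\<^sup>2 / 2)) * ennreal (sqrt 2) \<partial>lborel)"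
    by (subst nn_integral_cmult, simp, simp only: g)
  also have "\<dots> = ennreal (sqrt 2) * ennreal (sqrt 2)"
    by (subst nn_integral_multc, simp, simp only: g)
  finally show ?thesis by (simp flip: ennreal_mult')
qed

lemma gker_eq: "gker w (Complex x (- y)) = exp (- pi / 2 * ((x - Re w)\<^sup>2 + (y - Im w)\<^sup>2))"
  unfolding gker_def norm_exp_eq_Re cmod_power2 mult_exp_exp
  by (rule arg_cong[of _ _ exp]) (simp add: power2_eq_square field_simps)

lemma gker_mass: "(\<integral>\<^sup>+x. ennreal (gker w (Complex (fst x) (- snd x))) \<partial>(lborel :: (real \<times> real) measure)) = ennreal 2"
proof -
  let ?f = "\<lambda>x :: real \<times> real. ennreal (exp (- pi / 2 * ((fst x)\<^sup>2 + (snd x)\<^sup>2)))"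
  have "(\<integral>\<^sup>+x. ennreal (gker w (Complex (fst x) (- snd x))) \<partial>(lborel :: (real \<times> real) measure)) = (\<integral>\<^sup>+x. ?f (x + (- Re w, - Im w)) \<partial>lborel)"
    unfolding gker_eq by simp
  also have "\<dots> = (\<integral>\<^sup>+x. ?f x \<partial>lborel)"
    by (rule nn_integral_translate) (intro measurable_compose[OF _ measurable_ennreal] borel_measurable_continuous_onI continuous_intros)
  finally show ?thesis using gmass2_eq by (simp add: gmass2_def)
qed

lemma mod_norm_coh: "mod_norm 1 (coh (W :: 'd::finite phase)) = ennreal (2 ^ CARD('d))"
proof -
  have "mod_norm 1 (coh W) = (\<integral>\<^sup>+Z. (\<Prod>j\<in>UNIV. ennreal (gker (zcoord W j) (Complex (fst (fst Z $ j, snd Z $ j)) (- snd (fst Z $ j, snd Z $ j))))) \<partial>lborel)"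
    unfolding mod_norm_1 norm_stft_coh by (subst prod_ennreal) (auto simp: gker_def zcoord_def)
  also have "\<dots> = (\<Prod>j\<in>UNIV. \<integral>\<^sup>+x. ennreal (gker (zcoord W j) (Complex (fst x) (- snd x))) \<partial>lborel)"
    by (rule nn_integral_prod_phase) (unfold gker_eq, intro measurable_compose[OF _ measurable_ennreal] borel_measurable_continuous_onI continuous_intros)
  also have "\<dots> = ennreal (2 ^ CARD('d))" unfolding gker_mass prod_constant by (rule ennreal_power) simp
  finally show ?thesis .
qed

lemma continuous_ker1_right: "continuous_on UNIV (\<lambda>x :: real \<times> real. ker1 N w (Complex (fst x) (- snd x)))"
  unfolding ker1_def Complex_eq by (intro continuous_intros) auto

lemma mod_norm_partial_coh:
  "mod_norm 1 (hermite_partial N (coh W)) = (\<Prod>j\<in>UNIV. \<integral>\<^sup>+x. ennreal (ker1 N (zcoord W j) (Complex (fst x) (- snd x))) \<partial>lborel)"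
proof -
  have "mod_norm 1 (hermite_partial N (coh W)) = (\<integral>\<^sup>+Z. (\<Prod>j\<in>UNIV. ennreal (ker1 N (zcoord W j) (Complex (fst (fst Z $ j, snd Z $ j)) (- snd (fst Z $ j, snd Z $ j))))) \<partial>lborel)"
    unfolding mod_norm_1 norm_stft_partial_coh by (subst prod_ennreal) (auto simp: ker1_nonneg zcoord_def)
  also have "\<dots> = (\<Prod>j\<in>UNIV. \<integral>\<^sup>+x. ennreal (ker1 N (zcoord W j) (Complex (fst x) (- snd x))) \<partial>lborel)"
    by (rule nn_integral_prod_phase) (intro measurable_compose[OF _ measurable_ennreal] borel_measurable_continuous_onI continuous_ker1_right)
  finally show ?thesis .
qed

text \<open>
  The circle bound is integrated over the annulus \<open>\<rho> \<le> \<bar>z\<bar> \<le> \<rho> + 1\<close>, whose area is at least \<open>2 * \<pi> * \<rho>\<close>;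
  this is of the order of \<open>sqrt N\<close> and compensates the factor \<open>1 / sqrt N\<close> of the circle bound.
\<close>

lemma ker1_mass_lower:
  assumes N: "N \<ge> 1"
  shows "ennreal (c0 / 6 * ln (2 * real N)) \<le> (\<integral>\<^sup>+x. ennreal (ker1 N (of_real (sqrt (N / pi))) (Complex (fst x) (- snd x))) \<partial>(lborel :: (real \<times> real) measure))"
proof -
  define \<rho> where "\<rho> = sqrt (N / pi)"
  have N0: "real N \<ge> 1" using N by simp
  define L where "L = c0 / (3 * sqrt N) * ln (2 * real N)"
  have L: "L \<ge> 0" using N0 by (auto simp: L_def c0_def)
  have rho: "\<rho> > 0" using N0 by (simp add: \<rho>_def)
  \<comment> \<open>The plane is taken as the phase space of dimension one, so that the invariance under rot applies.\<close>
  define G where "G = (\<lambda>Z :: 1 phase. ennreal (ker1 N (of_real \<rho>) (zcoord Z 1)))"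
  have Gm: "G \<in> borel_measurable borel" unfolding G_def ker1_def
    by (intro measurable_compose[OF _ measurable_ennreal] borel_measurable_continuous_onI continuous_intros) auto
  define A where "A = cball (0 :: 1 phase) (\<rho> + 1) - ball 0 \<rho>"
  have Am: "A \<in> sets lborel" by (simp add: A_def)
  have nz: "norm Z = norm (zcoord Z 1)" for Z :: "1 phase"
    unfolding norm_prod_def norm_vec_def zcoord_def by (simp add: cmod_def)
  have "ennreal L * indicator A Z \<le> circ_mean 1 G Z" for Z
  proof (cases "Z \<in> A")
    case True
    then have z: "\<rho> \<le> norm (zcoord Z 1)" "norm (zcoord Z 1) \<le> \<rho> + 1" by (auto simp: A_def nz[symmetric])
    have c: "continuous_on {0..2*pi} (\<lambda>\<theta>. ker1 N (of_real \<rho>) (cis \<theta> * zcoord Z 1))"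
      unfolding ker1_def by (intro continuous_intros) auto
    have "ennreal L \<le> ennreal (integral {0..2*pi} (\<lambda>\<theta>. ker1 N (of_real \<rho>) (cis \<theta> * zcoord Z 1)))"
      unfolding L_def by (rule ennreal_leI) (rule ker1_circle_lower_bound[OF N \<rho>_def z])
    also have "\<dots> = circ_mean 1 G Z" unfolding G_def zcoord_rot
      using nn_integral_has_integral_lebesgue'[OF _ integrable_integral[OF integrable_continuous_real[OF c]]] by (simp add: ker1_nonneg)
    finally show ?thesis using True by simp
  qed simp
  then have "(\<integral>\<^sup>+Z. ennreal L * indicator A Z \<partial>lborel) \<le> (\<integral>\<^sup>+Z. circ_mean 1 G Z \<partial>lborel)"
    by (intro nn_integral_mono)
  then have "ennreal L * emeasure lborel A \<le> ennreal (2*pi) * (\<integral>\<^sup>+Z. G Z \<partial>lborel)"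
    unfolding nn_integral_rot_average[OF Gm] using Am by (simp add: nn_integral_cmult_indicator)
  moreover have "ennreal (2*pi*\<rho>) \<le> emeasure lborel A"
  proof -
    have D: "DIM(1 phase) = 2" by simp
    have "emeasure lborel A = emeasure lborel (cball (0 :: 1 phase) (\<rho> + 1)) - emeasure lborel (ball (0 :: 1 phase) \<rho>)"
      unfolding A_def by (rule emeasure_Diff) (use rho in \<open>auto simp: emeasure_ball\<close>)
    also have "\<dots> = ennreal (pi * (\<rho> + 1)\<^sup>2) - ennreal (pi * \<rho>\<^sup>2)"
      using rho by (simp add: emeasure_ball emeasure_cball unit_ball_vol_2 power2_eq_square)
    also have "\<dots> = ennreal (pi * (\<rho> + 1)\<^sup>2 - pi * \<rho>\<^sup>2)" by (rule ennreal_minus) simp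
    finally show ?thesis by (simp add: power2_eq_square algebra_simps ennreal_leI)
  qed
  ultimately have "ennreal L * ennreal (2*pi*\<rho>) \<le> ennreal (2*pi) * (\<integral>\<^sup>+Z. G Z \<partial>lborel)"
    using mult_left_mono[of "ennreal (2*pi*\<rho>)" "emeasure lborel A" "ennreal L"] by (simp add: order_trans)
  moreover have "ennreal L * ennreal (2*pi*\<rho>) = ennreal (2*pi) * ennreal (L * \<rho>)"
    using L rho by (simp add: mult_ac flip: ennreal_mult')
  ultimately have "ennreal (L * \<rho>) \<le> (\<integral>\<^sup>+Z. G Z \<partial>lborel)"
    by (simp add: ennreal_mult_le_mult_iff)
  moreover have "c0 / 6 * ln (2 * real N) \<le> L * \<rho>"
  proof -
    have "sqrt pi \<le> 2" using pi_less_4 by (intro real_le_lsqrt) auto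
    then have "c0 * ln (2 * real N) / 6 \<le> c0 * ln (2 * real N) / (3 * sqrt pi)"
      using N0 by (intro divide_left_mono) (auto simp: c0_def)
    moreover have "L * \<rho> = c0 * ln (2 * real N) / (3 * sqrt pi)"
      using N0 unfolding L_def \<rho>_def real_sqrt_divide by simp
    ultimately show ?thesis by simp
  qed
  moreover have "(\<integral>\<^sup>+Z. G Z \<partial>lborel) = (\<integral>\<^sup>+x. ennreal (ker1 N (of_real \<rho>) (Complex (fst x) (- snd x))) \<partial>lborel)"
  proof -
    have "(\<integral>\<^sup>+Z. (\<Prod>j\<in>(UNIV :: 1 set). ennreal (ker1 N (of_real \<rho>) (Complex (fst (fst Z $ j, snd Z $ j)) (- snd (fst Z $ j, snd Z $ j))))) \<partial>lborel)
      = (\<Prod>j\<in>(UNIV :: 1 set). \<integral>\<^sup>+x. ennreal (ker1 N (of_real \<rho>) (Complex (fst x) (- snd x))) \<partial>lborel)"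
      by (rule nn_integral_prod_phase) (intro measurable_compose[OF _ measurable_ennreal] borel_measurable_continuous_onI continuous_ker1_right)
    then show ?thesis by (simp add: G_def zcoord_def)
  qed
  ultimately show ?thesis unfolding \<rho>_def by (metis ennreal_leI order_trans)
qed

lemma ennreal_power_mono: "a \<le> b \<Longrightarrow> a ^ n \<le> b ^ n" for a b :: ennreal
  by (induction n) (auto intro: mult_mono)

definition witness :: "nat \<Rightarrow> 'd::finite phase" where
  "witness N = (\<chi> j. sqrt (N / pi), 0)"

lemma mod_norm_partial_witness:
  assumes "N \<ge> 1"
  shows "ennreal ((c0 / 6 * ln (2 * real N)) ^ CARD('d)) \<le> mod_norm 1 (hermite_partial N (coh (witness N :: 'd::finite phase)))"
proof -
  have z: "zcoord (witness N :: 'd phase) j = of_real (sqrt (N / pi))" for j by (simp add: witness_def zcoord_def complex_eq_iff)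
  have "c0 / 6 * ln (2 * real N) \<ge> 0" using assms by (auto simp: c0_def)
  then have "ennreal ((c0 / 6 * ln (2 * real N)) ^ CARD('d)) = (\<Prod>j\<in>(UNIV::'d set). ennreal (c0 / 6 * ln (2 * real N)))"
    by (simp add: ennreal_power)
  also have "\<dots> \<le> mod_norm 1 (hermite_partial N (coh (witness N :: 'd phase)))"
    unfolding mod_norm_partial_coh z prod_constant by (intro ennreal_power_mono ker1_mass_lower[OF assms])
  finally show ?thesis .
qed

section \<open>The lower bound on \<open>M\<^sup>1\<close>\<close>

lemma tempered_scaled:
  assumes u: "u \<in> tempered_distributions"
  shows "(\<lambda>g. c * u g) \<in> tempered_distributions"
proof -
  obtain C m where C: "C \<ge> 0" "\<And>g. g \<in> schwartz_space \<Longrightarrow> norm (u g) \<le> C * (\<Sum>k\<le>m. \<Sum>is | length is \<le> m. schwartz_seminorm k is g)"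
    using tempered_bound[OF u] by blast
  have "norm (c * u g) \<le> (norm c * C) * (\<Sum>k\<le>m. \<Sum>is | length is \<le> m. schwartz_seminorm k is g)" if "g \<in> schwartz_space" for g
    unfolding norm_mult mult.assoc by (intro mult_left_mono C that) auto
  moreover have "c * u g = 0" if "g \<notin> schwartz_space" for g using u that by (simp add: tempered_distributions_def)
  moreover have "c * u (\<lambda>t. a * g t + b * h t) = a * (c * u g) + b * (c * u h)"
    if "g \<in> schwartz_space" "h \<in> schwartz_space" for a b g h
    using tempered_linear[OF u that, of a b] by (simp add: algebra_simps)
  ultimately show ?thesis unfolding tempered_distributions_def mem_Collect_eq by blast
qed

lemma hermite_partial_scaled:
  "hermite_partial N (\<lambda>g. c * u g) = (\<lambda>g. c * hermite_partial N u g)"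
proof
  fix g :: "real^'a \<Rightarrow> complex"
  have "hermite_sum N (\<lambda>g. c * u g) t = c * hermite_sum N u t" for t
    by (simp add: hermite_sum_def pairing_def sum_distrib_left mult.assoc)
  then show "hermite_partial N (\<lambda>g. c * u g) g = c * hermite_partial N u g"
    by (simp add: hermite_partial_def distribution_of_def mult.assoc)
qed

lemma mod_norm_scaled:
  assumes [measurable]: "(\<lambda>Z. ennreal (norm (stft u Z))) \<in> borel_measurable borel"
  shows "mod_norm 1 (\<lambda>g. c * u g) = ennreal (norm c) * mod_norm 1 u"
proof -
  have "mod_norm 1 (\<lambda>g. c * u g) = (\<integral>\<^sup>+Z. ennreal (norm c) * ennreal (norm (stft u Z)) \<partial>lborel)"
    unfolding mod_norm_1 pairing_def by (simp add: norm_mult ennreal_mult')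
  also have "\<dots> = ennreal (norm c) * mod_norm 1 u" unfolding mod_norm_1 by (rule nn_integral_cmult) measurable
  finally show ?thesis .
qed

lemma measurable_stft:
  assumes "u \<in> tempered_distributions"
  shows "(\<lambda>Z. stft u Z) \<in> borel_measurable borel" "(\<lambda>Z. stft (hermite_partial N u) Z) \<in> borel_measurable borel"
proof -
  have g: "gphase \<in> borel_measurable borel"
    unfolding gphase_def [abs_def] by (intro borel_measurable_continuous_onI continuous_intros)
  note e = entire_hcoeff[OF assms]
  note [measurable] = g measurable_pseries[OF e] measurable_pseries[OF entire_lowset[OF e, of UNIV N]]
  show "(\<lambda>Z. stft u Z) \<in> borel_measurable borel" unfolding stft_eq_pseries[OF assms] by measurable
  show "(\<lambda>Z. stft (hermite_partial N u) Z) \<in> borel_measurable borel" unfolding stft_hermite_partial[OF assms] by measurable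
qed

lemma measurable_norm_stft:
  assumes "u \<in> tempered_distributions"
  shows "(\<lambda>Z. ennreal (norm (stft u Z))) \<in> borel_measurable borel"
    "(\<lambda>Z. ennreal (norm (stft (hermite_partial N u) Z))) \<in> borel_measurable borel"
  using measurable_stft(1)[OF assms] measurable_stft(2)[OF assms, of N] by measurable

lemma coh_in_mod_space: "coh W \<in> mod_space 1"
  unfolding mod_space_def using coh_tempered[of W] mod_norm_coh[of W] by simp

text \<open>
  The coherent state of \<open>mod_norm_partial_witness\<close>, divided by its norm \<open>2 ^ CARD('d)\<close>.
\<close>

lemma opnorm_lower:
  assumes "N \<ge> 1"
  shows "ennreal ((c0 / 12) ^ CARD('d) * (ln (2 * real N)) ^ CARD('d)) \<le> mod_opnorm 1 (hermite_partial N :: 'd::finite functional \<Rightarrow> 'd functional)"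
proof -
  let ?u = "coh (witness N :: 'd phase)"
  define c where "c = complex_of_real (1 / 2 ^ CARD('d))"
  have nc: "norm c = 1 / 2 ^ CARD('d)" unfolding c_def norm_of_real by simp
  define f where "f = (\<lambda>g. c * ?u g)"
  have t: "f \<in> tempered_distributions" unfolding f_def by (rule tempered_scaled[OF coh_tempered])
  have "mod_norm 1 f = ennreal (norm c) * ennreal (2 ^ CARD('d))"
    unfolding f_def mod_norm_scaled[OF measurable_norm_stft(1)[OF coh_tempered]] mod_norm_coh ..
  also have "\<dots> = 1" unfolding nc by (subst ennreal_mult'[symmetric]) auto
  finally have n: "mod_norm 1 f = 1" .
  have "ennreal ((c0 / 12) ^ CARD('d) * (ln (2 * real N)) ^ CARD('d)) = ennreal (norm c) * ennreal ((c0 / 6 * ln (2 * real N)) ^ CARD('d))"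
  proof -
    have "(c0 / 12) ^ CARD('d) * (ln (2 * real N)) ^ CARD('d) = (1/2) ^ CARD('d) * (c0 / 6 * ln (2 * real N)) ^ CARD('d)"
      unfolding power_mult_distrib[symmetric] by simp
    then show ?thesis unfolding nc by (subst ennreal_mult'[symmetric]) (auto simp: power_divide)
  qed
  also have "\<dots> \<le> ennreal (norm c) * mod_norm 1 (hermite_partial N ?u)"
    by (intro mult_left_mono mod_norm_partial_witness assms) auto
  also have "\<dots> = mod_norm 1 (hermite_partial N f)"
    unfolding f_def hermite_partial_scaled mod_norm_scaled[OF measurable_norm_stft(2)[OF coh_tempered]] ..
  also have "\<dots> \<le> mod_opnorm 1 (hermite_partial N :: 'd functional \<Rightarrow> 'd functional)"
    unfolding mod_opnorm_def by (rule SUP_upper) (use t n in \<open>simp add: mod_space_def\<close>)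
  finally show ?thesis .
qed

lemma witness_norm_unbounded:
  "\<exists>N\<ge>n. N \<ge> 1 \<and> ennreal B \<le> mod_norm 1 (hermite_partial N (coh (witness N :: 'd::finite phase)))"
proof -
  define b where "b = max B 1"
  define x where "x = 6 * b / c0"
  obtain N :: nat where N: "exp x \<le> real N" using real_arch_simple by blast
  define M where "M = max (max n 1) N"
  have M: "M \<ge> n" "M \<ge> 1" "real M \<ge> exp x" using N by (auto simp: M_def)
  have "exp x \<le> 2 * real M" using M by simp
  then have "x \<le> ln (2 * real M)" using M by (subst ln_ge_iff) auto
  then have "c0 / 6 * x \<le> c0 / 6 * ln (2 * real M)" by (intro mult_left_mono) (auto simp: c0_def)
  then have le: "b \<le> c0 / 6 * ln (2 * real M)" by (simp add: x_def c0_def)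
  have "b ^ 1 \<le> b ^ CARD('d)" by (intro power_increasing) (auto simp: b_def Suc_le_eq)
  also have "\<dots> \<le> (c0 / 6 * ln (2 * real M)) ^ CARD('d)" by (intro power_mono le) (auto simp: b_def)
  finally have "B \<le> (c0 / 6 * ln (2 * real M)) ^ CARD('d)" by (simp add: b_def)
  then have "ennreal B \<le> ennreal ((c0 / 6 * ln (2 * real M)) ^ CARD('d))" by (rule ennreal_leI)
  also have "\<dots> \<le> mod_norm 1 (hermite_partial M (coh (witness M :: 'd phase)))" by (rule mod_norm_partial_witness[OF M(2)])
  finally show ?thesis using M by blast
qed

lemma unbounded_p1:
  assumes C: "\<forall>N\<ge>1. \<forall>f \<in> (mod_space 1 :: 'd::finite functional set). mod_norm 1 (hermite_partial N f) \<le> ennreal C * mod_norm 1 f"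
  shows False
proof -
  obtain N where N: "N \<ge> 1" "ennreal (\<bar>C\<bar> * 2 ^ CARD('d) + 1) \<le> mod_norm 1 (hermite_partial N (coh (witness N :: 'd phase)))"
    using witness_norm_unbounded by blast
  note N(2)
  also have "mod_norm 1 (hermite_partial N (coh (witness N :: 'd phase))) \<le> ennreal C * mod_norm 1 (coh (witness N :: 'd phase))" using C N(1) coh_in_mod_space by blast
  also have "\<dots> \<le> ennreal (\<bar>C\<bar> * 2 ^ CARD('d))" unfolding mod_norm_coh
    by (subst ennreal_mult''[symmetric]) (auto intro!: ennreal_leI mult_right_mono)
  finally show False by (subst (asm) ennreal_le_iff) auto
qed

section \<open>Superpositions of coherent states\<close>

text \<open>
  A weak integral. It is used with Lebesgue measure on phase space for the case \<open>p = \<infinity>\<close>, and with counting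
  measure for a series of coherent states.
\<close>

definition superpose :: "'a measure \<Rightarrow> ('a \<Rightarrow> complex) \<Rightarrow> ('a \<Rightarrow> 'd::finite phase) \<Rightarrow> 'd functional" where
  "superpose M s w g = (if g \<in> schwartz_space then LINT x|M. s x * coh (w x) g else 0)"

lemma measurable_coh:
  fixes g :: "real^'d::finite \<Rightarrow> complex"
  assumes g: "g \<in> schwartz_space"
  shows "(\<lambda>W. coh W g) \<in> borel_measurable borel"
proof -
  have c1: "continuous_on UNIV (\<lambda>p :: 'd phase \<times> (real^'d). cohfun (fst p) (snd p))"
    unfolding cohfun_def tf_shift_def gauss_window_def by (intro continuous_intros)
  have c2: "continuous_on UNIV (\<lambda>p :: 'd phase \<times> (real^'d). g (snd p))"
    by (rule continuous_on_compose2[OF schwartz_continuous[OF g]]) (auto intro: continuous_intros)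
  have "continuous_on UNIV (\<lambda>p :: 'd phase \<times> (real^'d). cohfun (fst p) (snd p) * g (snd p))"
    by (intro continuous_on_mult c1 c2)
  then have "(\<lambda>p :: 'd phase \<times> (real^'d). cohfun (fst p) (snd p) * g (snd p)) \<in> borel_measurable (borel \<Otimes>\<^sub>M borel)"
    unfolding borel_prod by (rule borel_measurable_continuous_onI)
  then have "(\<lambda>(W, t). cohfun W t * g t) \<in> borel_measurable (borel \<Otimes>\<^sub>M lborel)"
    by (simp add: case_prod_beta cong: measurable_cong_sets sets_pair_measure_cong)
  from lborel.borel_measurable_lebesgue_integral[OF this] show ?thesis unfolding coh_apply[OF g] .
qed

context
  fixes M :: "'a measure" and s :: "'a \<Rightarrow> complex" and w :: "'a \<Rightarrow> 'd::finite phase"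
  assumes s: "integrable M s" and w: "w \<in> measurable M borel"
begin

lemma integrable_superpose:
  assumes g: "g \<in> schwartz_space"
  shows "integrable M (\<lambda>x. s x * coh (w x) g)"
proof (rule Bochner_Integration.integrable_bound[of _ "\<lambda>x. (gauss_mass TYPE('d) * schwartz_seminorm 0 [] g) * norm (s x)"])
  show "integrable M (\<lambda>x. (gauss_mass TYPE('d) * schwartz_seminorm 0 [] g) * norm (s x))" using s by simp
  show "(\<lambda>x. s x * coh (w x) g) \<in> borel_measurable M"
    using s measurable_compose[OF w measurable_coh[OF g]] by (intro borel_measurable_times) auto
  show "AE x in M. norm (s x * coh (w x) g) \<le> norm ((gauss_mass TYPE('d) * schwartz_seminorm 0 [] g) * norm (s x))"
  proof (rule AE_I2)
    fix x
    have "norm (s x * coh (w x) g) = norm (coh (w x) g) * norm (s x)" by (simp add: norm_mult)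
    also have "\<dots> \<le> (gauss_mass TYPE('d) * schwartz_seminorm 0 [] g) * norm (s x)"
      by (intro mult_right_mono coh_bound[OF g]) auto
    finally show "norm (s x * coh (w x) g) \<le> norm ((gauss_mass TYPE('d) * schwartz_seminorm 0 [] g) * norm (s x))"
      by (simp add: order_trans[OF _ abs_ge_self])
  qed
qed

lemma superpose_tempered: "superpose M s w \<in> tempered_distributions"
proof (rule tempered_of_sup_bound[where C = "gauss_mass TYPE('d) * (LINT x|M. norm (s x))"])
  show "superpose M s w (\<lambda>t. a * g t + b * h t) = a * superpose M s w g + b * superpose M s w h"
    if gh: "g \<in> schwartz_space" "h \<in> schwartz_space" for a b g h
  proof -
    have "superpose M s w (\<lambda>t. a * g t + b * h t) = (LINT x|M. a * (s x * coh (w x) g) + b * (s x * coh (w x) h))"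
      unfolding superpose_def using schwartz_space_linear[OF gh, of a b]
      by (simp add: tempered_linear[OF coh_tempered gh] algebra_simps)
    also have "\<dots> = a * superpose M s w g + b * superpose M s w h"
      using integrable_superpose[OF gh(1)] integrable_superpose[OF gh(2)] gh by (simp add: superpose_def)
    finally show ?thesis .
  qed
  show "norm (superpose M s w g) \<le> gauss_mass TYPE('d) * (LINT x|M. norm (s x)) * schwartz_seminorm 0 [] g"
    if g: "g \<in> schwartz_space" for g
  proof -
    have "norm (LINT x|M. s x * coh (w x) g) \<le> (LINT x|M. norm (s x * coh (w x) g))" by (rule integral_norm_bound)
    also have "\<dots> \<le> (LINT x|M. norm (s x) * (gauss_mass TYPE('d) * schwartz_seminorm 0 [] g))"
    proof (rule integral_mono)
      show "integrable M (\<lambda>x. norm (s x * coh (w x) g))" by (rule integrable_norm[OF integrable_superpose[OF g]])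
      show "integrable M (\<lambda>x. norm (s x) * (gauss_mass TYPE('d) * schwartz_seminorm 0 [] g))" using s by simp
      show "norm (s x * coh (w x) g) \<le> norm (s x) * (gauss_mass TYPE('d) * schwartz_seminorm 0 [] g)" for x
        unfolding norm_mult by (intro mult_left_mono coh_bound[OF g]) auto
    qed
    also have "\<dots> = gauss_mass TYPE('d) * (LINT x|M. norm (s x)) * schwartz_seminorm 0 [] g" by simp
    finally show ?thesis using g by (simp add: superpose_def)
  qed
qed (auto simp: superpose_def gauss_mass_nonneg)

lemma stft_superpose: "stft (superpose M s w) Z = (LINT x|M. s x * stft (coh (w x)) Z)"
proof -
  have "(\<lambda>t. cnj (tf_shift Z gauss_window t)) \<in> schwartz_space"
    unfolding cnj_tf_shift by (rule schwartz_scale[OF genprod_schwartz])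
  then show ?thesis unfolding pairing_def superpose_def by simp
qed

lemma integrable_superpose_stft: "integrable M (\<lambda>x. s x * stft (coh (w x)) Z)"
proof -
  have "(\<lambda>t. cnj (tf_shift Z gauss_window t)) \<in> schwartz_space"
    unfolding cnj_tf_shift by (rule schwartz_scale[OF genprod_schwartz])
  then show ?thesis unfolding pairing_def by (rule integrable_superpose)
qed

lemma hcoeff_superpose:
  "hcoeff (superpose M s w) n = (LINT x|M. s x * hcoeff (coh (w x)) n)"
  "integrable M (\<lambda>x. s x * hcoeff (coh (w x)) n)"
  using integrable_superpose[OF hprod_schwartz[of n]] hprod_schwartz[of n]
  unfolding hcoeff_def superpose_def by simp_all

lemma stft_partial_superpose:
  "stft (hermite_partial N (superpose M s w)) Z = (LINT x|M. s x * stft (hermite_partial N (coh (w x))) Z)"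
  "integrable M (\<lambda>x. s x * stft (hermite_partial N (coh (w x))) Z)"
proof -
  let ?c = "gphase Z * of_real (gweight Z)"
  have e: "s x * stft (hermite_partial N (coh (w x))) Z = ?c * (\<Sum>n\<in>box_upto N. zpow (zcoord Z) n * (s x * hcoeff (coh (w x)) n))" for x
    unfolding stft_hermite_partial[OF coh_tempered] pseries_box sum_distrib_left
    by (intro sum.cong refl) (simp only: mult_ac)
  have i: "integrable M (\<lambda>x. \<Sum>n\<in>box_upto N. zpow (zcoord Z) n * (s x * hcoeff (coh (w x)) n))"
    by (intro Bochner_Integration.integrable_sum integrable_mult_right hcoeff_superpose(2))
  show "integrable M (\<lambda>x. s x * stft (hermite_partial N (coh (w x))) Z)"
    unfolding e by (rule integrable_mult_right[OF i])
  have "(LINT x|M. s x * stft (hermite_partial N (coh (w x))) Z) = ?c * (\<Sum>n\<in>box_upto N. zpow (zcoord Z) n * hcoeff (superpose M s w) n)"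
    unfolding e hcoeff_superpose(1) integral_mult_right_zero
    by (subst Bochner_Integration.integral_sum, rule integrable_mult_right, rule hcoeff_superpose(2)) (simp only: integral_mult_right_zero)
  then show "stft (hermite_partial N (superpose M s w)) Z = (LINT x|M. s x * stft (hermite_partial N (coh (w x))) Z)"
    unfolding stft_hermite_partial[OF superpose_tempered] pseries_box by (simp only: mult.commute)
qed

end

section \<open>Unboundedness on \<open>M\<^sup>\<infinity>\<close>\<close>

lemma norm_stft_coh_commute: "norm (stft (coh W) Z) = norm (stft (coh Z) W)"
  unfolding norm_stft_coh by (rule prod.cong) (auto simp: gker_def add.commute mult.commute mult.left_commute)

lemma norm_stft_partial_coh_commute: "norm (stft (hermite_partial N (coh W)) Z) = norm (stft (hermite_partial N (coh Z)) W)"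
  unfolding norm_stft_partial_coh by (rule prod.cong) (auto simp: ker1_commute)

lemma measurable_partial_coh_center: "(\<lambda>Z. stft (hermite_partial N (coh Z)) W) \<in> borel_measurable borel"
proof -
  have "(\<lambda>Z. gphase W * of_real (gweight W) * (\<Sum>n\<in>box_upto N. hcoeff (coh Z) n * zpow (zcoord W) n)) \<in> borel_measurable borel"
    unfolding hcoeff_def
    by (intro borel_measurable_times borel_measurable_const borel_measurable_sum borel_measurable_divide measurable_coh hprod_schwartz)
  then show ?thesis unfolding stft_hermite_partial[OF coh_tempered] pseries_box .
qed

lemma mod_norm_top: "mod_norm \<infinity> f = (SUP Z. ennreal (norm (stft f Z)))"
  by (simp add: mod_norm_def)

text \<open>
  Let \<open>k Z\<close> be the short-time Fourier transform at \<open>W\<close> of the partial sum of the coherent state at \<open>Z\<close>. By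
  symmetry, the integral of \<open>\<bar>k Z\<bar>\<close> is the \<open>M\<^sup>1\<close> norm of the partial sum of the coherent state at \<open>W\<close>. Superposing coherent states with the
  conjugate signs of \<open>k\<close> as coefficients gives an element whose \<open>M\<^sup>\<infinity>\<close> norm is at most the \<open>M\<^sup>1\<close> norm \<open>2 ^ CARD('d)\<close>
  of a coherent state, and whose partial sum attains this integral at \<open>W\<close>. A bound on \<open>M\<^sup>\<infinity>\<close> would thus bound the
  \<open>M\<^sup>1\<close> norms of partial sums of coherent states, against \<open>witness_norm_unbounded\<close>.
\<close>

lemma unbounded_pinf:
  assumes C: "\<forall>N\<ge>1. \<forall>f \<in> (mod_space \<infinity> :: 'd::finite functional set). mod_norm \<infinity> (hermite_partial N f) \<le> ennreal C * mod_norm \<infinity> f"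
  shows False
proof -
  define K where "K = \<bar>C\<bar> * 2 ^ CARD('d)"
  have main: "mod_norm 1 (hermite_partial N (coh W)) \<le> ennreal K" if N: "N \<ge> 1" for N and W :: "'d phase"
  proof -
    define k where "k = (\<lambda>Z. stft (hermite_partial N (coh Z)) W)"
    have km: "k \<in> borel_measurable borel" unfolding k_def by (rule measurable_partial_coh_center)
    have ball: "(\<integral>\<^sup>+Z. ennreal (norm (k Z)) * indicator (ball 0 (real R)) Z \<partial>lborel) \<le> ennreal K" for R :: nat
    proof -
      \<comment> \<open>The restriction to a ball makes the coefficients integrable; R tends to infinity at the end.\<close>
      define s where "s = (\<lambda>Z. indicator (ball 0 (real R)) Z * cnj (sgn (k Z)) :: complex)"
      have sm: "s \<in> borel_measurable lborel"
      proof -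
        have "(\<lambda>Z. k Z /\<^sub>R norm (k Z)) \<in> borel_measurable borel" using km by measurable
        then have "(\<lambda>Z. cnj (k Z /\<^sub>R norm (k Z))) \<in> borel_measurable borel"
          by (rule measurable_compose[OF _ borel_measurable_continuous_onI]) (intro continuous_intros)
        then have "(\<lambda>Z. indicator (ball 0 (real R)) Z * cnj (k Z /\<^sub>R norm (k Z))) \<in> borel_measurable borel"
          by (intro borel_measurable_times borel_measurable_indicator) auto
        then show ?thesis by (simp add: s_def sgn_div_norm)
      qed
      have sle: "norm (s Z) \<le> indicator (ball 0 (real R)) Z" for Z
        unfolding s_def norm_mult by (auto simp: norm_sgn split: split_indicator)
      have si: "integrable lborel s"
      proof (rule Bochner_Integration.integrable_bound[OF _ sm])
        show "integrable lborel (indicator (ball 0 (real R)) :: 'd phase \<Rightarrow> real)"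
          by (rule integrable_real_indicator) (use emeasure_lborel_ball_finite in auto)
      qed (use sle in auto)
      let ?f = "superpose lborel s (\<lambda>Z. Z)"
      have wm: "(\<lambda>Z. Z) \<in> measurable (lborel :: 'd phase measure) borel" by simp
      have t: "?f \<in> tempered_distributions" by (rule superpose_tempered[OF si wm])
      have "ennreal (norm (stft ?f Z)) \<le> ennreal (2 ^ CARD('d))" for Z
      proof -
        have "ennreal (norm (stft ?f Z)) \<le> (\<integral>\<^sup>+Y. ennreal (norm (s Y * stft (coh Y) Z)) \<partial>lborel)"
          unfolding stft_superpose[OF si wm] by (rule integral_norm_bound_ennreal[OF integrable_superpose_stft[OF si wm]])
        also have "\<dots> \<le> (\<integral>\<^sup>+Y. ennreal (norm (stft (coh Z) Y)) \<partial>lborel)"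
        proof (intro nn_integral_mono ennreal_leI)
          fix Y
          have "norm (s Y) \<le> 1" using sle[of Y] by (auto intro: order_trans simp: indicator_le_1)
          then show "norm (s Y * stft (coh Y) Z) \<le> norm (stft (coh Z) Y)"
            unfolding norm_mult norm_stft_coh_commute[of Y Z] by (intro mult_left_le_one_le) auto
        qed
        also have "\<dots> = ennreal (2 ^ CARD('d))" using mod_norm_coh[of Z] by (simp only: mod_norm_1)
        finally show ?thesis .
      qed
      then have fn: "mod_norm \<infinity> ?f \<le> ennreal (2 ^ CARD('d))" unfolding mod_norm_top by (intro SUP_least)
      then have "?f \<in> mod_space \<infinity>" using t unfolding mod_space_def by (auto intro: le_less_trans)
      then have "mod_norm \<infinity> (hermite_partial N ?f) \<le> ennreal C * mod_norm \<infinity> ?f" using C N by blast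
      also have "\<dots> \<le> ennreal \<bar>C\<bar> * ennreal (2 ^ CARD('d))" by (intro mult_mono fn ennreal_leI) auto
      also have "\<dots> = ennreal K" unfolding K_def by (rule ennreal_mult'[symmetric]) simp
      finally have up: "mod_norm \<infinity> (hermite_partial N ?f) \<le> ennreal K" .
      have sk: "s Z * k Z = of_real (norm (k Z) * indicator (ball 0 (real R)) Z)" for Z
      proof -
        have "cnj (sgn x) * x = of_real (norm x)" for x :: complex
        proof (cases "x = 0")
          case False
          have "cnj x * x = (of_real (norm x))\<^sup>2" by (metis complex_norm_square mult.commute of_real_power)
          then show ?thesis using False by (simp add: sgn_div_norm scaleR_conv_of_real power2_eq_square field_simps)
        qed simp
        then show ?thesis unfolding s_def by (simp split: split_indicator)
      qed
      have int: "integrable lborel (\<lambda>Z. s Z * k Z)" unfolding k_def by (rule stft_partial_superpose(2)[OF si wm])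
      then have "integrable lborel (\<lambda>Z. norm (s Z * k Z))" by (rule integrable_norm)
      then have intr: "integrable lborel (\<lambda>Z. norm (k Z) * indicator (ball 0 (real R)) Z)"
      proof -
        have "norm (s Z * k Z) = norm (k Z) * indicator (ball 0 (real R)) Z" for Z
          unfolding sk norm_of_real by (simp split: split_indicator)
        then show ?thesis using \<open>integrable lborel (\<lambda>Z. norm (s Z * k Z))\<close> by (simp only:)
      qed
      have "stft (hermite_partial N ?f) W = (LINT Z|lborel. s Z * k Z)"
        unfolding k_def by (rule stft_partial_superpose(1)[OF si wm])
      also have "\<dots> = of_real (LINT Z|lborel. norm (k Z) * indicator (ball 0 (real R)) Z)"
        unfolding sk by (rule integral_complex_of_real)
      finally have v: "norm (stft (hermite_partial N ?f) W) = (LINT Z|lborel. norm (k Z) * indicator (ball 0 (real R)) Z)"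
        by (simp add: integral_nonneg)
      have "(\<integral>\<^sup>+Z. ennreal (norm (k Z)) * indicator (ball 0 (real R)) Z \<partial>lborel) = (\<integral>\<^sup>+Z. ennreal (norm (k Z) * indicator (ball 0 (real R)) Z) \<partial>lborel)"
        by (intro nn_integral_cong) (simp split: split_indicator)
      also have "\<dots> = ennreal (LINT Z|lborel. norm (k Z) * indicator (ball 0 (real R)) Z)"
        by (rule nn_integral_eq_integral[OF intr]) simp
      also have "\<dots> = ennreal (norm (stft (hermite_partial N ?f) W))" unfolding v ..
      also have "\<dots> \<le> mod_norm \<infinity> (hermite_partial N ?f)" unfolding mod_norm_top by (rule SUP_upper) simp
      finally show ?thesis using up by (rule order_trans)
    qed
    have "(\<integral>\<^sup>+Z. ennreal (norm (k Z)) \<partial>lborel) = (\<integral>\<^sup>+Z. (SUP R::nat. ennreal (norm (k Z)) * indicator (ball 0 (real R)) Z) \<partial>lborel)"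
    proof (intro nn_integral_cong antisym)
      fix Z :: "'d phase"
      obtain R :: nat where "norm Z < real R" using reals_Archimedean2 by blast
      then have "ennreal (norm (k Z)) = ennreal (norm (k Z)) * indicator (ball 0 (real R)) Z" by simp
      also have "\<dots> \<le> (SUP R::nat. ennreal (norm (k Z)) * indicator (ball 0 (real R)) Z)" by (rule SUP_upper) simp
      finally show "ennreal (norm (k Z)) \<le> (SUP R::nat. ennreal (norm (k Z)) * indicator (ball 0 (real R)) Z)" .
    qed (auto intro!: SUP_least split: split_indicator)
    also have "\<dots> = (SUP R::nat. \<integral>\<^sup>+Z. ennreal (norm (k Z)) * indicator (ball 0 (real R)) Z \<partial>lborel)"
    proof (rule nn_integral_monotone_convergence_SUP)
      show "incseq (\<lambda>(R::nat) Z. ennreal (norm (k Z)) * indicator (ball 0 (real R)) Z)"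
        by (auto simp: incseq_def le_fun_def split: split_indicator)
      show "(\<lambda>Z. ennreal (norm (k Z)) * indicator (ball 0 (real R)) Z) \<in> borel_measurable lborel" for R :: nat
      proof -
        have b: "ball (0::'d phase) (real R) \<in> sets lborel" by simp
        note b[measurable] km[measurable]
        show ?thesis by measurable
      qed
    qed
    also have "\<dots> \<le> ennreal K" by (intro SUP_least ball)
    finally show ?thesis unfolding mod_norm_1 k_def norm_stft_partial_coh_commute[of N _ W] .
  qed
  obtain N where N: "N \<ge> 1" "ennreal (K + 1) \<le> mod_norm 1 (hermite_partial N (coh (witness N :: 'd phase)))"
    using witness_norm_unbounded by blast
  have "ennreal (K + 1) \<le> ennreal K" using N(2) main[OF N(1), of "witness N"] by (rule order_trans)
  moreover have "K \<ge> 0" by (simp add: K_def)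
  ultimately show False by (subst (asm) ennreal_le_iff) auto
qed

section \<open>A gliding hump in \<open>M\<^sup>1\<close>\<close>

lemma wide_gaussian_mass:
  "(\<integral>\<^sup>+x. ennreal (exp (- pi / 4 * ((fst x)\<^sup>2 + (snd x)\<^sup>2))) \<partial>(lborel :: (real \<times> real) measure)) = ennreal 4"
proof -
  have g: "(\<integral>\<^sup>+t. ennreal (exp (- pi * t\<^sup>2 / 4)) \<partial>lborel) = ennreal 2"
  proof -
    have "exp (- pi * t\<^sup>2 / 4) = 2 * normal_density 0 (sqrt (2 / pi)) t" for t
      by (simp add: normal_density_def field_simps)
    then have "(\<integral>\<^sup>+t. ennreal (exp (- pi * t\<^sup>2 / 4)) \<partial>lborel) = (\<integral>\<^sup>+t. ennreal 2 * ennreal (normal_density 0 (sqrt (2 / pi)) t) \<partial>lborel)"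
      by (simp only: ennreal_mult'[OF zero_le_numeral])
    also have "\<dots> = ennreal 2 * (\<integral>\<^sup>+t. ennreal (normal_density 0 (sqrt (2 / pi)) t) \<partial>lborel)"
      by (rule nn_integral_cmult) auto
    also have "(\<integral>\<^sup>+t. ennreal (normal_density 0 (sqrt (2 / pi)) t) \<partial>lborel) = 1"
      by (subst nn_integral_eq_integral) auto
    finally show ?thesis by simp
  qed
  have "(\<integral>\<^sup>+x. ennreal (exp (- pi / 4 * ((fst x)\<^sup>2 + (snd x)\<^sup>2))) \<partial>(lborel :: (real \<times> real) measure))
    = (\<integral>\<^sup>+x. ennreal (exp (- pi / 4 * ((fst x)\<^sup>2 + (snd x)\<^sup>2))) \<partial>((lborel :: real measure) \<Otimes>\<^sub>M (lborel :: real measure)))"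
    by (simp add: lborel_prod)
  also have "\<dots> = (\<integral>\<^sup>+x. (\<integral>\<^sup>+w. ennreal (exp (- pi * x\<^sup>2 / 4)) * ennreal (exp (- pi * w\<^sup>2 / 4)) \<partial>lborel) \<partial>lborel)"
    by (subst lborel.nn_integral_fst[symmetric]) (auto simp: ennreal_mult'[symmetric] mult_exp_exp algebra_simps add_divide_distrib intro!: nn_integral_cong)
  also have "\<dots> = (\<integral>\<^sup>+x. ennreal (exp (- pi * x\<^sup>2 / 4)) * ennreal 2 \<partial>lborel)"
    by (subst nn_integral_cmult, simp, simp only: g)
  also have "\<dots> = ennreal 2 * ennreal 2"
    by (subst nn_integral_multc, simp, simp only: g)
  also have "\<dots> = ennreal 4" by (subst ennreal_mult'[symmetric]) auto
  finally show ?thesis .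
qed

lemma power_le_fact_exp: "y \<ge> 0 \<Longrightarrow> y ^ n \<le> fact n * exp (y :: real)"
proof -
  assume y: "y \<ge> 0"
  have "(\<Sum>i\<in>{n}. y ^ i /\<^sub>R fact i) \<le> (\<Sum>i. y ^ i /\<^sub>R fact i)"
    by (rule sum_le_suminf[OF sums_summable[OF exp_converges]]) (use y in auto)
  then show ?thesis using sums_unique[OF exp_converges[of y]] by (simp add: field_simps)
qed

text \<open>
  A bound whose constant may depend badly on \<open>N\<close> but not on \<open>w\<close>: each factor \<open>\<bar>w\<bar> ^ n\<close> is absorbed by the Gaussian in \<open>w\<close>,
  and each \<open>\<bar>z\<bar> ^ n\<close> by half of the Gaussian in \<open>z\<close>.
\<close>

lemma ker1_le: "ker1 N w z \<le> (\<Sum>n\<le>N. fact n * exp 2) * exp (- pi / 4 * (norm z)\<^sup>2)"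
proof -
  define x y where "x = sqrt pi * norm w" and "y = sqrt pi * norm z"
  have xy: "x \<ge> 0" "y \<ge> 0" "x\<^sup>2 = pi * (norm w)\<^sup>2" "y\<^sup>2 = pi * (norm z)\<^sup>2" "pi * norm w * norm z = x * y"
    by (auto simp: x_def y_def power_mult_distrib)
  have E: "- pi / 2 * ((norm w)\<^sup>2 + (norm z)\<^sup>2) = - x\<^sup>2 / 2 + - y\<^sup>2 / 2" unfolding xy by (simp add: algebra_simps)
  have "norm (\<Sum>n\<le>N. (of_real pi * w * z) ^ n / fact n) \<le> (\<Sum>n\<le>N. (x * y) ^ n / fact n)"
    by (rule order_trans[OF norm_sum]) (simp add: norm_divide norm_power norm_mult xy(5))
  then have "ker1 N w z \<le> exp (- x\<^sup>2 / 2 + - y\<^sup>2 / 2) * (\<Sum>n\<le>N. (x * y) ^ n / fact n)"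
    unfolding ker1_def E by (intro mult_left_mono) auto
  also have "\<dots> = (\<Sum>n\<le>N. (exp (- x\<^sup>2 / 2) * (x ^ n / fact n)) * (exp (- y\<^sup>2 / 2) * y ^ n))"
    unfolding exp_add sum_distrib_left by (intro sum.cong refl) (simp add: power_mult_distrib)
  also have "\<dots> \<le> (\<Sum>n\<le>N. exp 1 * (fact n * exp 1 * exp (- y\<^sup>2 / 4)))"
  proof (rule sum_mono, rule mult_mono)
    fix n
    have "x ^ n / fact n \<le> exp x" using power_le_fact_exp[OF xy(1), of n] by (simp add: field_simps)
    then have "exp (- x\<^sup>2 / 2) * (x ^ n / fact n) \<le> exp (- x\<^sup>2 / 2) * exp x" by (intro mult_left_mono) auto
    also have "\<dots> \<le> exp 1" unfolding mult_exp_exp exp_le_cancel_iff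
      using zero_le_power2[of "x - 1"] by (simp add: power2_eq_square algebra_simps)
    finally show "exp (- x\<^sup>2 / 2) * (x ^ n / fact n) \<le> exp 1" .
    have "exp (- y\<^sup>2 / 2) * y ^ n \<le> exp (- y\<^sup>2 / 2) * (fact n * exp y)"
      by (intro mult_left_mono power_le_fact_exp xy) auto
    also have "\<dots> = fact n * exp (- y\<^sup>2 / 2 + y)" by (simp only: exp_add mult_ac)
    also have "\<dots> \<le> fact n * exp (1 + - y\<^sup>2 / 4)"
      using zero_le_power2[of "y - 2"] by (intro mult_left_mono) (auto simp: power2_eq_square algebra_simps)
    also have "\<dots> = fact n * exp 1 * exp (- y\<^sup>2 / 4)" by (simp only: exp_add mult.assoc)
    finally show "exp (- y\<^sup>2 / 2) * y ^ n \<le> fact n * exp 1 * exp (- y\<^sup>2 / 4)" .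
  qed (use xy in auto)
  also have "\<dots> = (\<Sum>n\<le>N. fact n * exp 2) * exp (- y\<^sup>2 / 4)"
  proof -
    have "exp 1 * exp 1 = exp (2 :: real)" by (simp add: mult_exp_exp)
    then have "exp 1 * (fact n * exp 1 * exp (- y\<^sup>2 / 4)) = fact n * exp 2 * exp (- y\<^sup>2 / 4)" for n by (simp add: mult_ac)
    then show ?thesis by (simp only: sum_distrib_right)
  qed
  finally show ?thesis unfolding xy by simp
qed

lemma partial_coh_uniform_bound:
  "\<exists>L\<ge>0. \<forall>W :: 'd::finite phase. mod_norm 1 (hermite_partial N (coh W)) \<le> ennreal L"
proof -
  define S where "S = (\<Sum>n\<le>N. fact n * exp 2 :: real)"
  have S: "S \<ge> 0" unfolding S_def by (intro sum_nonneg) auto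
  have b: "(\<integral>\<^sup>+x. ennreal (ker1 N w (Complex (fst x) (- snd x))) \<partial>(lborel :: (real \<times> real) measure)) \<le> ennreal (S * 4)" for w
  proof -
    have "(\<integral>\<^sup>+x. ennreal (ker1 N w (Complex (fst x) (- snd x))) \<partial>(lborel :: (real \<times> real) measure))
      \<le> (\<integral>\<^sup>+x. ennreal S * ennreal (exp (- pi / 4 * ((fst x)\<^sup>2 + (snd x)\<^sup>2))) \<partial>(lborel :: (real \<times> real) measure))"
    proof (rule nn_integral_mono)
      fix x :: "real \<times> real"
      have "ker1 N w (Complex (fst x) (- snd x)) \<le> S * exp (- pi / 4 * ((fst x)\<^sup>2 + (snd x)\<^sup>2))"
        using ker1_le[of N w "Complex (fst x) (- snd x)"] unfolding S_def cmod_power2 by simp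
      then show "ennreal (ker1 N w (Complex (fst x) (- snd x))) \<le> ennreal S * ennreal (exp (- pi / 4 * ((fst x)\<^sup>2 + (snd x)\<^sup>2)))"
        unfolding ennreal_mult'[OF S, symmetric] by (rule ennreal_leI)
    qed
    also have "\<dots> = ennreal S * ennreal 4"
      unfolding wide_gaussian_mass[symmetric]
    proof (rule nn_integral_cmult)
      have "(\<lambda>x::real \<times> real. exp (- pi / 4 * ((fst x)\<^sup>2 + (snd x)\<^sup>2))) \<in> borel_measurable borel"
        by (intro borel_measurable_continuous_onI continuous_intros)
      then show "(\<lambda>x::real \<times> real. ennreal (exp (- pi / 4 * ((fst x)\<^sup>2 + (snd x)\<^sup>2)))) \<in> borel_measurable lborel"
        using measurable_compose[OF _ measurable_ennreal] by simp
    qed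
    finally show ?thesis using S by (simp add: ennreal_mult')
  qed
  show ?thesis
  proof (intro exI[of _ "(S * 4) ^ CARD('d)"] conjI allI)
    fix W :: "'d phase"
    have "mod_norm 1 (hermite_partial N (coh W)) \<le> (\<Prod>j\<in>(UNIV :: 'd set). ennreal (S * 4))"
    proof -
      have "(\<Prod>j\<in>J. \<integral>\<^sup>+x. ennreal (ker1 N (zcoord W j) (Complex (fst x) (- snd x))) \<partial>lborel) \<le> (\<Prod>j\<in>J. ennreal (S * 4))" if "finite J" for J
        using that by (induction J) (auto intro!: mult_mono b)
      then show ?thesis unfolding mod_norm_partial_coh by simp
    qed
    then show "mod_norm 1 (hermite_partial N (coh W)) \<le> ennreal ((S * 4) ^ CARD('d))"
      using S by (simp only: prod_constant ennreal_power[OF mult_nonneg_nonneg[OF S zero_le_numeral]])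
  qed (use S in simp)
qed

text \<open>
  The bookkeeping of the gliding hump. In the application \<open>\<alpha> N\<close> is the norm of the \<open>N\<close>-th partial sum of
  the coherent state at \<open>witness N\<close>, \<open>L N\<close> bounds the \<open>N\<close>-th partial sums of all coherent states, and
  \<open>U (N i)\<close> bounds all partial sums of the \<open>i\<close>-th chosen state. First the coefficient \<open>b k\<close> is made small enough
  that the \<open>k\<close>-th term cannot disturb the humps chosen before; then \<open>N k\<close> is chosen large enough that
  the \<open>k\<close>-th hump dominates everything chosen before.
\<close>

lemma gliding_hump_sequence:
  fixes \<alpha> L U :: "nat \<Rightarrow> real"
  assumes unb: "\<And>n B. \<exists>N\<ge>n. \<alpha> N \<ge> B" and L: "\<And>N. L N \<ge> 0"
  obtains N :: "nat \<Rightarrow> nat" and b :: "nat \<Rightarrow> real"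
  where "strict_mono N" "\<And>k. 0 < b k" "\<And>k. b k \<le> (1/2) ^ Suc k"
    "\<And>k j. k < j \<Longrightarrow> b j * L (N k) \<le> (1/2) ^ Suc j"
    "\<And>k. real k + 1 + (\<Sum>i<k. b i * U (N i)) \<le> b k * \<alpha> (N k)"
proof -
  \<comment> \<open>The state of the recursion consists of N k and of the sums over i < k of L (N i) and of b i * U (N i).\<close>
  define bb where "bb = (\<lambda>k (SL::real). (1/2::real) ^ Suc k / (1 + SL))"
  define P where "P = (\<lambda>k (s :: nat \<times> real \<times> real). case s of (N, SL, SU) \<Rightarrow>
     SL \<ge> 0 \<and> real k + 1 + SU \<le> bb k SL * \<alpha> N \<and> (k = 0 \<longrightarrow> SU = 0))"
  define Q where "Q = (\<lambda>k (s :: nat \<times> real \<times> real) s'. case s of (N, SL, SU) \<Rightarrow> case s' of (N', SL', SU') \<Rightarrow>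
     N < N' \<and> SL' = SL + L N \<and> SU' = SU + bb k SL * U N)"
  have pick: "\<exists>N>n. real k + 1 + SU \<le> bb k SL * \<alpha> N" if "SL \<ge> 0" for n k SL SU
  proof -
    have pos: "bb k SL > 0" using that by (simp add: bb_def)
    obtain N where "N \<ge> Suc n" "\<alpha> N \<ge> (real k + 1 + SU) / bb k SL" using unb by blast
    then show ?thesis using pos by (intro exI[of _ N]) (auto simp: pos_divide_le_eq mult.commute)
  qed
  have "\<exists>f. \<forall>n. P n (f n) \<and> Q n (f n) (f (Suc n))"
  proof (rule dependent_nat_choice)
    obtain N where "real 0 + 1 + 0 \<le> bb 0 0 * \<alpha> N" using pick[of 0 0 0 0] by auto
    then show "\<exists>x. P 0 x" by (intro exI[of _ "(N, 0, 0)"]) (simp add: P_def)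
    fix s n assume "P n s"
    obtain N SL SU where s: "s = (N, SL, SU)" by (cases s)
    have SL: "SL \<ge> 0" using \<open>P n s\<close> by (simp add: P_def s)
    then have SL': "SL + L N \<ge> 0" using L by simp
    obtain N' where "N' > N" "real (Suc n) + 1 + (SU + bb n SL * U N) \<le> bb (Suc n) (SL + L N) * \<alpha> N'" using pick[OF SL'] by blast
    then show "\<exists>y. P (Suc n) y \<and> Q n s y"
      using SL' by (intro exI[of _ "(N', SL + L N, SU + bb n SL * U N)"]) (simp add: P_def Q_def s)
  qed
  then obtain f where f: "\<And>n. P n (f n)" "\<And>n. Q n (f n) (f (Suc n))" by blast
  define N where "N = (\<lambda>k. fst (f k))"
  define SL where "SL = (\<lambda>k. fst (snd (f k)))"
  define SU where "SU = (\<lambda>k. snd (snd (f k)))"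
  have ff: "f k = (N k, SL k, SU k)" for k by (simp add: N_def SL_def SU_def)
  have SL0: "SL k \<ge> 0" and main: "real k + 1 + SU k \<le> bb k (SL k) * \<alpha> (N k)" and SU0: "SU 0 = 0" for k
    using f(1)[of k] f(1)[of 0] unfolding P_def ff by auto
  have Nlt: "N k < N (Suc k)" and SLs: "SL (Suc k) = SL k + L (N k)" and SUs: "SU (Suc k) = SU k + bb k (SL k) * U (N k)" for k
    using f(2)[of k] unfolding Q_def ff by auto
  have mono: "SL i \<le> SL j" if "i \<le> j" for i j
    by (rule lift_Suc_mono_le[OF _ that]) (use SLs L in simp)
  have SU: "SU k = (\<Sum>i<k. bb i (SL i) * U (N i))" for k by (induction k) (auto simp: SU0 SUs)
  show thesis
  proof (rule that[of N "\<lambda>k. bb k (SL k)"])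
    show "strict_mono N" using Nlt by (simp add: strict_mono_Suc_iff)
    show "0 < bb k (SL k)" for k using SL0[of k] by (simp add: bb_def)
    show "bb k (SL k) \<le> (1/2) ^ Suc k" for k
      using SL0[of k] unfolding bb_def by (subst pos_divide_le_eq) auto
    show "bb j (SL j) * L (N k) \<le> (1/2) ^ Suc j" if "k < j" for k j
    proof -
      have "L (N k) \<le> SL (Suc k)" using SLs[of k] SL0[of k] by simp
      also have "\<dots> \<le> SL j" using that by (intro mono) simp
      finally have "L (N k) \<le> 1 + SL j" by simp
      then have "(1/2) ^ Suc j * (L (N k) / (1 + SL j)) \<le> (1/2) ^ Suc j * 1"
        using SL0[of j] by (intro mult_left_mono) (auto simp: divide_le_eq)
      then show ?thesis by (simp add: bb_def)
    qed
    show "real k + 1 + (\<Sum>i<k. bb i (SL i) * U (N i)) \<le> bb k (SL k) * \<alpha> (N k)" for k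
      using main[of k] unfolding SU .
  qed
qed

lemma mod_norm_1_superpose_le:
  fixes W :: "nat \<Rightarrow> 'd::finite phase"
  assumes s: "summable (\<lambda>k. norm (s k))"
  shows "mod_norm 1 (superpose (count_space UNIV) s W) \<le> (\<Sum>k. ennreal (norm (s k)) * mod_norm 1 (coh (W k)))" (is ?A)
    and "mod_norm 1 (hermite_partial N (superpose (count_space UNIV) s W)) \<le> (\<Sum>k. ennreal (norm (s k)) * mod_norm 1 (hermite_partial N (coh (W k))))" (is ?B)
proof -
  have si: "integrable (count_space UNIV) s" using s by (simp add: integrable_count_space_nat_iff)
  have w: "W \<in> measurable (count_space UNIV) borel" by simp
  have aux: "(\<integral>\<^sup>+Z. ennreal (norm (LINT k|count_space UNIV. s k * h k Z)) \<partial>lborel) \<le> (\<Sum>k. ennreal (norm (s k)) * (\<integral>\<^sup>+Z. ennreal (norm (h k Z)) \<partial>lborel))"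
    if hm: "\<And>k. (\<lambda>Z. ennreal (norm (h k Z))) \<in> borel_measurable borel"
      and hi: "\<And>Z. integrable (count_space UNIV) (\<lambda>k. s k * h k Z)" for h :: "nat \<Rightarrow> 'd phase \<Rightarrow> complex"
  proof -
    have hm': "(\<lambda>Z. ennreal (norm (h k Z))) \<in> borel_measurable lborel" for k using hm by simp
    have "ennreal (norm (LINT k|count_space UNIV. s k * h k Z)) \<le> (\<Sum>k. ennreal (norm (s k)) * ennreal (norm (h k Z)))" for Z
      using integral_norm_bound_ennreal[OF hi[of Z]] by (simp add: nn_integral_count_space_nat norm_mult ennreal_mult')
    then have "(\<integral>\<^sup>+Z. ennreal (norm (LINT k|count_space UNIV. s k * h k Z)) \<partial>lborel) \<le> (\<integral>\<^sup>+Z. (\<Sum>k. ennreal (norm (s k)) * ennreal (norm (h k Z))) \<partial>lborel)"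
      by (intro nn_integral_mono)
    also have "\<dots> = (\<Sum>k. \<integral>\<^sup>+Z. ennreal (norm (s k)) * ennreal (norm (h k Z)) \<partial>lborel)"
      by (intro nn_integral_suminf borel_measurable_times_ennreal borel_measurable_const hm')
    also have "\<dots> = (\<Sum>k. ennreal (norm (s k)) * (\<integral>\<^sup>+Z. ennreal (norm (h k Z)) \<partial>lborel))"
      by (intro suminf_cong nn_integral_cmult hm')
    finally show ?thesis .
  qed
  show ?A unfolding mod_norm_1 stft_superpose[OF si w]
    by (intro aux measurable_norm_stft coh_tempered integrable_superpose_stft[OF si w])
  show ?B unfolding mod_norm_1 stft_partial_superpose(1)[OF si w]
    by (intro aux measurable_norm_stft coh_tempered stft_partial_superpose(2)[OF si w])
qed

text \<open>
  The \<open>k\<close>-th term is the difference of the full series and the series without it.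
\<close>

lemma superpose_peak:
  fixes W :: "nat \<Rightarrow> 'd::finite phase"
  assumes s: "summable (\<lambda>k. norm (s k))"
  shows "ennreal (norm (s k)) * mod_norm 1 (hermite_partial N (coh (W k)))
    \<le> mod_norm 1 (hermite_partial N (superpose (count_space UNIV) s W))
       + mod_norm 1 (hermite_partial N (superpose (count_space UNIV) (s(k := 0)) W))"
proof -
  have s': "summable (\<lambda>j. norm ((s(k := 0)) j))" by (rule summable_comparison_test[OF _ s]) auto
  have si: "integrable (count_space UNIV) s" "integrable (count_space UNIV) (s(k := 0))"
    using s s' by (simp_all add: integrable_count_space_nat_iff)
  have w: "W \<in> measurable (count_space UNIV) borel" by simp
  let ?h = "\<lambda>j Z. stft (hermite_partial N (coh (W j))) Z"
  let ?f = "superpose (count_space UNIV) s W" and ?f' = "superpose (count_space UNIV) (s(k := 0)) W"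
  have eq: "s k * ?h k Z = stft (hermite_partial N ?f) Z - stft (hermite_partial N ?f') Z" for Z
  proof -
    have "(\<lambda>j. s j * ?h j Z) sums stft (hermite_partial N ?f) Z"
      unfolding stft_partial_superpose(1)[OF si(1) w] by (rule sums_integral_count_space_nat[OF stft_partial_superpose(2)[OF si(1) w]])
    moreover have "(\<lambda>j. (s(k := 0)) j * ?h j Z) sums stft (hermite_partial N ?f') Z"
      unfolding stft_partial_superpose(1)[OF si(2) w] by (rule sums_integral_count_space_nat[OF stft_partial_superpose(2)[OF si(2) w]])
    ultimately have "(\<lambda>j. s j * ?h j Z - (s(k := 0)) j * ?h j Z) sums (stft (hermite_partial N ?f) Z - stft (hermite_partial N ?f') Z)"
      by (rule sums_diff)
    moreover have "(\<lambda>j. s j * ?h j Z - (s(k := 0)) j * ?h j Z) = (\<lambda>j. if j = k then s k * ?h k Z else 0)" by auto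
    ultimately show ?thesis using sums_unique2[OF sums_single[of k "\<lambda>_. s k * ?h k Z"]] by simp
  qed
  have "ennreal (norm (s k)) * mod_norm 1 (hermite_partial N (coh (W k))) = (\<integral>\<^sup>+Z. ennreal (norm (s k)) * ennreal (norm (?h k Z)) \<partial>lborel)"
    unfolding mod_norm_1 by (rule nn_integral_cmult[symmetric]) (use measurable_norm_stft(2)[OF coh_tempered[of "W k"], of N] in simp)
  also have "\<dots> = (\<integral>\<^sup>+Z. ennreal (norm (stft (hermite_partial N ?f) Z - stft (hermite_partial N ?f') Z)) \<partial>lborel)"
    unfolding eq[symmetric] norm_mult by (simp add: ennreal_mult')
  also have "\<dots> \<le> (\<integral>\<^sup>+Z. ennreal (norm (stft (hermite_partial N ?f) Z)) + ennreal (norm (stft (hermite_partial N ?f') Z)) \<partial>lborel)"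
    by (intro nn_integral_mono) (simp add: norm_triangle_ineq4 flip: ennreal_plus)
  also have "\<dots> = mod_norm 1 (hermite_partial N ?f) + mod_norm 1 (hermite_partial N ?f')"
    unfolding mod_norm_1
    using measurable_norm_stft(2)[OF superpose_tempered[OF si(1) w], of N] measurable_norm_stft(2)[OF superpose_tempered[OF si(2) w], of N]
    by (intro nn_integral_add) simp_all
  finally show ?thesis .
qed

lemma mod_norm_1_triangle:
  assumes u: "u \<in> tempered_distributions"
  shows "mod_norm 1 (hermite_partial N u) \<le> mod_norm 1 (\<lambda>g. hermite_partial N u g - u g) + mod_norm 1 u"
proof -
  have "(\<lambda>Z. stft (hermite_partial N u) Z - stft u Z) \<in> borel_measurable borel"
    by (intro borel_measurable_diff measurable_stft u)
  then have m: "(\<lambda>Z. ennreal (norm (stft (hermite_partial N u) Z - stft u Z))) \<in> borel_measurable lborel"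
    by (intro measurable_compose[OF _ measurable_ennreal] borel_measurable_norm) simp
  have m2: "(\<lambda>Z. ennreal (norm (stft u Z))) \<in> borel_measurable lborel" using measurable_norm_stft(1)[OF u] by simp
  have "mod_norm 1 (hermite_partial N u) \<le> (\<integral>\<^sup>+Z. ennreal (norm (stft (hermite_partial N u) Z - stft u Z)) + ennreal (norm (stft u Z)) \<partial>lborel)"
    unfolding mod_norm_1
  proof (rule nn_integral_mono)
    fix Z
    have "norm (stft (hermite_partial N u) Z) \<le> norm (stft (hermite_partial N u) Z - stft u Z) + norm (stft u Z)"
      using norm_triangle_sub[of "stft (hermite_partial N u) Z" "stft u Z"] by simp
    then show "ennreal (norm (stft (hermite_partial N u) Z)) \<le> ennreal (norm (stft (hermite_partial N u) Z - stft u Z)) + ennreal (norm (stft u Z))"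
      by (simp flip: ennreal_plus)
  qed
  also have "\<dots> = mod_norm 1 (\<lambda>g. hermite_partial N u g - u g) + mod_norm 1 u"
    unfolding mod_norm_1 pairing_diff by (rule nn_integral_add[OF m m2])
  finally show ?thesis .
qed

lemma converges_eventually_bounded:
  assumes u: "u \<in> tempered_distributions" and c: "converges_in_mod 1 (\<lambda>N. hermite_partial N u) u"
  shows "\<exists>N0. \<forall>N\<ge>N0. mod_norm 1 (hermite_partial N u) \<le> 1 + mod_norm 1 u"
proof -
  have "(\<lambda>N. mod_norm 1 (\<lambda>g. hermite_partial N u g - u g)) \<longlonglongrightarrow> 0" using c by (simp add: converges_in_mod_def)
  from order_tendstoD(2)[OF this, of 1] obtain N0 where N0: "\<And>N. N \<ge> N0 \<Longrightarrow> mod_norm 1 (\<lambda>g. hermite_partial N u g - u g) < 1"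
    unfolding eventually_sequentially by auto
  have "mod_norm 1 (hermite_partial N u) \<le> 1 + mod_norm 1 u" if "N \<ge> N0" for N
    by (rule order_trans[OF mod_norm_1_triangle[OF u]]) (intro add_right_mono less_imp_le N0 that)
  then show ?thesis by blast
qed

text \<open>
  Suppose that the partial sums of every element of \<open>M\<^sup>1\<close> converge. Then the partial sums of every single coherent state are bounded,
  so the coefficients of \<open>gliding_hump_sequence\<close> exist. The series of coherent states with these
  coefficients lies in \<open>M\<^sup>1\<close>, but its \<open>N k\<close>-th partial sum has norm at least \<open>k\<close>.
\<close>

lemma exists_divergent:
  "\<exists>f \<in> (mod_space 1 :: 'd::finite functional set). \<not> converges_in_mod 1 (\<lambda>N. hermite_partial N f) f"
proof (rule ccontr)
  assume "\<not> ?thesis"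
  then have conv: "converges_in_mod 1 (\<lambda>N. hermite_partial N f) f" if "f \<in> mod_space 1" for f :: "'d functional"
    using that by blast
  let ?w = "\<lambda>N. coh (witness N :: 'd phase)"
  obtain L where L: "\<And>N. L N \<ge> 0" "\<And>N (W :: 'd phase). mod_norm 1 (hermite_partial N (coh W)) \<le> ennreal (L N)"
    using partial_coh_uniform_bound[where 'd='d] by metis
  have "\<exists>U. \<forall>M. mod_norm 1 (hermite_partial M (?w N)) \<le> ennreal U" for N
  proof -
    obtain N0 where N0: "\<And>M. M \<ge> N0 \<Longrightarrow> mod_norm 1 (hermite_partial M (?w N)) \<le> 1 + mod_norm 1 (?w N)"
      using converges_eventually_bounded[OF coh_tempered conv[OF coh_in_mod_space]] by blast
    define U where "U = 1 + 2 ^ CARD('d) + (\<Sum>M<N0. L M)"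
    have sL: "(\<Sum>M<N0. L M) \<ge> 0" by (intro sum_nonneg L)
    have "mod_norm 1 (hermite_partial M (?w N)) \<le> ennreal U" for M
    proof (cases "M \<ge> N0")
      case True
      have "mod_norm 1 (hermite_partial M (?w N)) \<le> 1 + ennreal (2 ^ CARD('d))" using N0[OF True] unfolding mod_norm_coh .
      also have "\<dots> = ennreal (1 + 2 ^ CARD('d))" by (subst ennreal_plus) auto
      also have "\<dots> \<le> ennreal U" using sL by (intro ennreal_leI) (simp add: U_def)
      finally show ?thesis .
    next
      case False
      have "L M \<le> (\<Sum>M<N0. L M)" using False by (intro member_le_sum L) auto
      then have "L M \<le> U" unfolding U_def by (smt (verit) zero_le_power)
      then show ?thesis using L(2)[of M "witness N"] by (meson ennreal_leI order_trans)
    qed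
    then show ?thesis by blast
  qed
  then obtain U where U: "\<And>N M. mod_norm 1 (hermite_partial M (?w N)) \<le> ennreal (U N)" by metis
  define \<alpha> where "\<alpha> = (\<lambda>N. enn2real (mod_norm 1 (hermite_partial N (?w N))))"
  have \<alpha>: "mod_norm 1 (hermite_partial N (?w N)) = ennreal (\<alpha> N)" for N
    unfolding \<alpha>_def using L(2)[of N "witness N"] by (intro ennreal_enn2real[symmetric]) (auto intro: le_less_trans)
  have unb: "\<exists>N\<ge>n. \<alpha> N \<ge> B" for n B
  proof -
    obtain N where N: "N \<ge> n" "ennreal (max B 0) \<le> mod_norm 1 (hermite_partial N (?w N))"
      using witness_norm_unbounded[of n "max B 0", where 'd='d] by blast
    have "\<alpha> N \<ge> 0" by (simp add: \<alpha>_def)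
    then have "max B 0 \<le> \<alpha> N" using N(2) unfolding \<alpha> by (subst (asm) ennreal_le_iff) auto
    then show ?thesis using N(1) by (intro exI[of _ N]) simp
  qed
  obtain N b where Nb: "strict_mono N" "\<And>k. 0 < b k" "\<And>k. b k \<le> (1/2) ^ Suc k"
    "\<And>k j. k < j \<Longrightarrow> b j * L (N k) \<le> (1/2) ^ Suc j"
    "\<And>k. real k + 1 + (\<Sum>i<k. b i * max (U (N i)) 0) \<le> b k * \<alpha> (N k)"
    using gliding_hump_sequence[of \<alpha> L "\<lambda>N. max (U N) 0", OF unb L(1)] by blast
  define s where "s = (\<lambda>k. complex_of_real (b k))"
  define W where "W = (\<lambda>k. witness (N k) :: 'd phase)"
  have ns: "norm (s k) = b k" for k using Nb(2)[of k] by (simp add: s_def)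
  have half: "(\<lambda>k. (1/2::real) ^ Suc k) sums 1" using power_half_series .
  have sm: "summable (\<lambda>k. norm (s k))" unfolding ns
  proof (rule summable_comparison_test'[OF sums_summable[OF half]])
    show "norm (b n) \<le> (1/2) ^ Suc n" if "n \<ge> 0" for n using Nb(2)[of n] Nb(3)[of n] by simp
  qed
  have si: "integrable (count_space UNIV) s" using sm by (simp add: integrable_count_space_nat_iff)
  have w: "W \<in> measurable (count_space UNIV) borel" by simp
  define f where "f = superpose (count_space UNIV) s W"
  have t: "f \<in> tempered_distributions" unfolding f_def by (rule superpose_tempered[OF si w])
  have "mod_norm 1 f \<le> (\<Sum>k. ennreal (norm (s k)) * mod_norm 1 (coh (W k)))"
    unfolding f_def by (rule mod_norm_1_superpose_le(1)[OF sm])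
  also have "\<dots> = (\<Sum>k. ennreal (norm (s k) * 2 ^ CARD('d)))" unfolding mod_norm_coh by (simp add: ennreal_mult')
  also have "\<dots> = ennreal (\<Sum>k. norm (s k) * 2 ^ CARD('d))"
    by (rule suminf_ennreal2) (auto intro: summable_mult2 sm)
  finally have fb: "mod_norm 1 f \<le> ennreal (\<Sum>k. norm (s k) * 2 ^ CARD('d))" .
  define F where "F = (\<Sum>k. norm (s k) * 2 ^ CARD('d))"
  have F0: "F \<ge> 0" unfolding F_def by (rule suminf_nonneg) (auto intro: summable_mult2 sm)
  have fm: "f \<in> mod_space 1" using t fb by (auto simp: mod_space_def intro: le_less_trans)
  have peak: "ennreal (real k) \<le> mod_norm 1 (hermite_partial (N k) f)" for k
  proof -
    \<comment> \<open>Bounds for the terms other than the k-th: earlier humps through U, later ones through the geometric decay.\<close>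
    define r where "r = (\<lambda>j. if j < k then b j * max (U (N j)) 0 else if j = k then 0 else (1/2) ^ Suc j)"
    define S where "S = (\<Sum>i<k. b i * max (U (N i)) 0)"
    have S0: "S \<ge> 0" unfolding S_def using Nb(2) by (intro sum_nonneg mult_nonneg_nonneg) (auto intro: less_imp_le)
    have r0: "r j \<ge> 0" for j using Nb(2)[of j] by (auto simp: r_def less_imp_le)
    define q where "q = (\<lambda>j. if j \<in> {..<k} then b j * max (U (N j)) 0 else 0)"
    have qs: "q sums S" unfolding q_def S_def by (rule sums_If_finite_set) simp
    have rs: "summable r" and rS: "suminf r \<le> S + 1"
    proof -
      have qh: "(\<lambda>j. q j + (1/2) ^ Suc j) sums (S + 1)" by (intro sums_add qs half)
      have le: "r j \<le> q j + (1/2) ^ Suc j" for j by (simp add: r_def q_def)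
      show "summable r" by (rule summable_comparison_test[OF _ sums_summable[OF qh]]) (use le r0 in auto)
      then show "suminf r \<le> S + 1"
        using suminf_le[of r, OF le _ sums_summable[OF qh]] unfolding sums_unique[OF qh, symmetric] by blast
    qed
    have s's: "summable (\<lambda>j. norm ((s(k := 0)) j))" by (rule summable_comparison_test[OF _ sm]) auto
    have "mod_norm 1 (hermite_partial (N k) (superpose (count_space UNIV) (s(k := 0)) W))
       \<le> (\<Sum>j. ennreal (norm ((s(k := 0)) j)) * mod_norm 1 (hermite_partial (N k) (coh (W j))))"
      by (rule mod_norm_1_superpose_le(2)[OF s's])
    also have "\<dots> \<le> (\<Sum>j. ennreal (r j))"
    proof (rule suminf_le)
      fix j
      consider "j < k" | "j = k" | "k < j" by linarith
      then show "ennreal (norm ((s(k := 0)) j)) * mod_norm 1 (hermite_partial (N k) (coh (W j))) \<le> ennreal (r j)"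
      proof cases
        case 1
        have "mod_norm 1 (hermite_partial (N k) (coh (W j))) \<le> ennreal (max (U (N j)) 0)"
          using U[of "N k" "N j"] unfolding W_def by (rule order_trans) (simp add: ennreal_leI)
        then have "ennreal (b j) * mod_norm 1 (hermite_partial (N k) (coh (W j))) \<le> ennreal (b j) * ennreal (max (U (N j)) 0)"
          by (rule mult_left_mono) simp
        also have "\<dots> = ennreal (r j)" using 1 by (subst ennreal_mult''[symmetric]) (auto simp: r_def)
        finally show ?thesis using 1 ns[of j] by simp
      next
        case 2 then show ?thesis by simp
      next
        case 3
        have "ennreal (b j) * mod_norm 1 (hermite_partial (N k) (coh (W j))) \<le> ennreal (b j) * ennreal (L (N k))"
          by (intro mult_left_mono L) auto
        also have "\<dots> = ennreal (b j * L (N k))" by (rule ennreal_mult''[symmetric]) (rule L)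
        also have "\<dots> \<le> ennreal (r j)" using Nb(4)[OF 3] 3 by (intro ennreal_leI) (auto simp: r_def)
        finally show ?thesis using 3 ns[of j] by simp
      qed
    qed auto
    also have "\<dots> = ennreal (suminf r)" by (rule suminf_ennreal2[OF r0 rs])
    also have "\<dots> \<le> ennreal (S + 1)" by (rule ennreal_leI[OF rS])
    finally have rest: "mod_norm 1 (hermite_partial (N k) (superpose (count_space UNIV) (s(k := 0)) W)) \<le> ennreal (S + 1)" .
    have "ennreal (b k * \<alpha> (N k)) = ennreal (norm (s k)) * mod_norm 1 (hermite_partial (N k) (coh (W k)))"
      unfolding ns W_def \<alpha> using Nb(2)[of k] by (intro ennreal_mult') simp
    also have "\<dots> \<le> mod_norm 1 (hermite_partial (N k) f) + ennreal (S + 1)"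
      unfolding f_def by (rule order_trans[OF superpose_peak[OF sm]]) (intro add_left_mono rest)
    finally have "ennreal (b k * \<alpha> (N k)) \<le> mod_norm 1 (hermite_partial (N k) f) + ennreal (S + 1)" .
    moreover have "ennreal (real k + (S + 1)) \<le> ennreal (b k * \<alpha> (N k))" using Nb(5)[of k] by (intro ennreal_leI) (simp add: S_def)
    ultimately have le: "ennreal (real k + (S + 1)) \<le> mod_norm 1 (hermite_partial (N k) f) + ennreal (S + 1)"
      by (rule order_trans[rotated])
    then show ?thesis
    proof (cases "mod_norm 1 (hermite_partial (N k) f)")
      case (real x)
      then have "mod_norm 1 (hermite_partial (N k) f) + ennreal (S + 1) = ennreal (x + (S + 1))"
        using ennreal_plus[of x "S + 1"] S0 by simp
      then have "ennreal (real k + (S + 1)) \<le> ennreal (x + (S + 1))" using le by (simp only:)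
      then have "real k \<le> x" using real S0 by (subst (asm) ennreal_le_iff) auto
      then show ?thesis using real by (simp add: ennreal_leI)
    qed simp
  qed
  obtain N0 where N0: "\<And>M. M \<ge> N0 \<Longrightarrow> mod_norm 1 (hermite_partial M f) \<le> 1 + mod_norm 1 f"
    using converges_eventually_bounded[OF t conv[OF fm]] by blast
  obtain k :: nat where k: "real k > 1 + F" "k \<ge> N0"
  proof -
    obtain k1 :: nat where "real k1 > 1 + F" using reals_Archimedean2 by blast
    then show thesis by (intro that[of "max k1 N0"]) auto
  qed
  have "N k \<ge> N0" using strict_mono_imp_increasing[OF Nb(1), of k] k(2) by linarith
  then have "ennreal (real k) \<le> 1 + mod_norm 1 f" using peak[of k] N0 by (meson order_trans)
  also have "\<dots> \<le> 1 + ennreal F" using fb unfolding F_def by (rule add_left_mono)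
  also have "\<dots> = ennreal (1 + F)" using F0 by (subst ennreal_plus) auto
  finally have "real k \<le> 1 + F" using F0 by (subst (asm) ennreal_le_iff) auto
  then show False using k by simp
qed

section \<open>Boundedness, lower bound, convergence and divergence\<close>

theorem corollary3p1:
  shows "(\<forall>p::ennreal. 1 \<le> p \<longrightarrow>
           ((\<exists>C::real. \<forall>N\<ge>1. \<forall>f \<in> (mod_space p :: 'd::finite functional set).
               mod_norm p (hermite_partial N f) \<le> ennreal C * mod_norm p f)
            \<longleftrightarrow> 1 < p \<and> p < \<infinity>))
       \<and> (\<exists>c::real. \<exists>\<kappa>::real. c > 1 \<and> \<kappa> > 0 \<and>
            (\<forall>N\<ge>1. ennreal (\<kappa> * (ln (c * real N)) ^ CARD('d))
               \<le> mod_opnorm 1 (hermite_partial N :: 'd functional \<Rightarrow> 'd functional)))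
       \<and> (\<forall>p::ennreal. 1 < p \<and> p < \<infinity> \<longrightarrow>
            (\<forall>f \<in> (mod_space p :: 'd functional set).
               converges_in_mod p (\<lambda>N. hermite_partial N f) f))
       \<and> (\<exists>f \<in> (mod_space 1 :: 'd functional set).
            \<not> converges_in_mod 1 (\<lambda>N. hermite_partial N f) f)"
proof (intro conjI allI impI)
  fix p :: ennreal assume p: "1 \<le> p"
  show "(\<exists>C::real. \<forall>N\<ge>1. \<forall>f \<in> (mod_space p :: 'd functional set).
               mod_norm p (hermite_partial N f) \<le> ennreal C * mod_norm p f) \<longleftrightarrow> 1 < p \<and> p < \<infinity>"
  proof
    assume "\<exists>C::real. \<forall>N\<ge>1. \<forall>f \<in> (mod_space p :: 'd functional set).
               mod_norm p (hermite_partial N f) \<le> ennreal C * mod_norm p f"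
    then obtain C :: real where C: "\<forall>N\<ge>1. \<forall>f \<in> (mod_space p :: 'd functional set).
               mod_norm p (hermite_partial N f) \<le> ennreal C * mod_norm p f" by blast
    have "p \<noteq> 1" using unbounded_p1[where 'd='d, of C] C by auto
    then have "1 < p" using p by (simp add: order.strict_iff_order)
    moreover have "p \<noteq> \<infinity>" using unbounded_pinf[where 'd='d, of C] C by auto
    ultimately show "1 < p \<and> p < \<infinity>" by (simp add: less_top)
  next
    assume "1 < p \<and> p < \<infinity>"
    then show "\<exists>C::real. \<forall>N\<ge>1. \<forall>f \<in> (mod_space p :: 'd functional set).
               mod_norm p (hermite_partial N f) \<le> ennreal C * mod_norm p f"
      using hermite_partial_bounded[of p, where 'd='d] by metis
  qed
next
  show "\<exists>c::real. \<exists>\<kappa>::real. c > 1 \<and> \<kappa> > 0 \<and>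
            (\<forall>N\<ge>1. ennreal (\<kappa> * (ln (c * real N)) ^ CARD('d))
               \<le> mod_opnorm 1 (hermite_partial N :: 'd functional \<Rightarrow> 'd functional))"
    by (rule exI[of _ 2], rule exI[of _ "(c0 / 12) ^ CARD('d)"]) (auto simp: c0_def intro!: opnorm_lower[unfolded c0_def])
next
  fix p :: ennreal assume "1 < p \<and> p < \<infinity>"
  then show "\<forall>f \<in> (mod_space p :: 'd functional set). converges_in_mod p (\<lambda>N. hermite_partial N f) f"
    using hermite_partial_converges by blast
next
  show "\<exists>f \<in> (mod_space 1 :: 'd functional set). \<not> converges_in_mod 1 (\<lambda>N. hermite_partial N f) f"
    by (rule exists_divergent)
qed

end
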